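(* Let $(L,A)$ be a Lie pair over a smooth manifold $M$. The Kapranov Leibniz$_\infty[1]$ algebra structure $\{\lambda_k\}_{k\ge1}$ on the graded vector space $\Gamma(\wedge^\bullet A^\vee\otimes L/A)$ is unique up to isomorphism in the category of Leibniz$_\infty[1]$ $\Gamma(\wedge^\bullet A^\vee)$-algebras. That is, for any two choices $(j,\nabla)$ and $(j',\nabla')$ of a splitting $L/A\to L$ and of an $L$-connection on $L/A$ extending the Bott $A$-module structure, the resulting Leibniz$_\infty[1]$ $\Gamma(\wedge^\bullet A^\vee)$-algebras are isomorphic.
   Context: A Lie pair $(L,A)$ consists of a Lie algebroid $L$ over $M$ (anchor $\rho$) and a Lie subalgebroid $A\subset L$ over the same $M$. Put $B=L/A$, $\mathrm{pr}_B:L\to B$. The Bott $A$-module structure is the flat $A$-connection $\nabla_a(\mathrm{pr}_B\,l)=\mathrm{pr}_B[a,l]$ on $B$. The cdga is $\Omega_A^\bullet=(\Gamma(\wedge^\bullet A^\vee),d_A)$, $d_A$ the Chevalley–Eilenberg differential; sections of $B$ have degree $0$. Kapranov structure. Choose a bundle map $j:B\to L$ with $\mathrm{pr}_B j=\mathrm{id}_B$; it gives $L\cong A\oplus B$ and a projection $\mathrm{pr}_A:L\to A$. Choose an $L$-connection $\nabla$ on $B$ with $\nabla_a$ equal to the Bott connection for $a\in\Gamma(A)$. The Atiyah cocycle is $\alpha_B^\nabla(a,b)e=\nabla_a\nabla_{j(b)}e-\nabla_{j(b)}\nabla_ae-\nabla_{[a,j(b)]}e$. Let $\lambda_1$ be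 the Chevalley–Eilenberg differential of the Bott representation. Let $R_2:B\otimes B\to A^\vee\otimes B$, $R_2(b_1,b_2)=\alpha_B^\nabla(-,b_1)b_2$, and, for $n\ge2$, $$R_{n+1}(b_0\otimes\cdots\otimes b_n)=R_n(\nabla_{j(b_0)}(b_1\otimes\cdots\otimes b_n))-\nabla_{j(b_0)}R_n(b_1\otimes\cdots\otimes b_n),$$ where $\nabla_{j(b)}$ acts by the Leibniz rule on tensor products and on $\Gamma(A^\vee)$ by $\langle\nabla_{j(b)}\xi,a\rangle=\rho(j(b))\langle\xi,a\rangle-\langle\xi,\mathrm{pr}_A[j(b),a]\rangle$. For $k\ge2$, $\lambda_k(\xi_1\otimes b_1,\dots,\xi_k\otimes b_k)=(-1)^{|\xi_1|+\cdots+|\xi_k|}\xi_1\wedge\cdots\wedge\xi_k\wedge R_k(b_1,\dots,b_k)$. Leibniz$_\infty[1]$ algebra: a graded vector space $V$ with degree $1$ multilinear maps $\lambda_k:V^{\otimes k}\to V$, $k\ge1$, such that for all $n\ge1$, $$\sum_{i+j=n+1}\sum_{k=j}^{n}\sum_{\sigma\in \mathrm{sh}(k-j,j-1)}\epsilon(\sigma)(-1)^{|v_{\sigma(1)}|+\cdots+|v_{\sigma(k-j)}|}\lambda_i\big(v_{\sigma(1)},\dots,v_{\sigma(k-j)},\lambda_j(v_{\sigma(k-j+1)},\dots,v_{\sigma(k-1)},v_k),v_{k+1},\dots,v_n\big)=0,$$ with $\mathrm{sh}(p,q)$ the $(p,q)$-shuffles and $\epsilon$ Koszul signs. A morphism $(V,\lambda_\bullet)\to(V',\lambda'_\bullet)$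 is a sequence of degree $0$ multilinear maps $f_k:V^{\otimes k}\to V'$ with, for all $n\ge1$, $$\sum_{k+p\le n-1}\sum_{\sigma\in\mathrm{sh}(k,p)}\epsilon(\sigma)(-1)^{|b_{\sigma(1)}|+\cdots+|b_{\sigma(k)}|}f_{n-p}\big(b_{\sigma(1)},\dots,b_{\sigma(k)},\lambda_{p+1}(b_{\sigma(k+1)},\dots,b_{\sigma(k+p)},b_{k+p+1}),b_{k+p+2},\dots,b_n\big)$$ $$=\sum_{q\ge1}\ \sum_{I^1,\dots,I^q}\epsilon(I^1,\dots,I^q)\,\lambda'_q\big(f_{|I^1|}(b_{I^1}),\dots,f_{|I^q|}(b_{I^q})\big),$$ the last sum over partitions of $\{1,\dots,n\}$ into non-empty disjoint subsets with $\max I^1<\cdots<\max I^q$, $b_I$ listing the $b_i$, $i\in I$, in increasing order. Over a cdga $\mathscr{A}$ (here $\mathscr{A}=\Omega_A^\bullet$): a Leibniz$_\infty[1]$ $\mathscr{A}$-algebra is one where $(V,\lambda_1)$ is a dg $\mathscr{A}$-module and all $\lambda_k$, $k\ge2$, are $\mathscr{A}$-multilinear (graded sense); morphisms have all $f_k$ $\mathscr{A}$-multilinear; a morphism is an isomorphism if $f_1$ is an isomorphism of dg $\mathscr{A}$-modules. *)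

theory Defs
  imports "HOL-Analysis.Analysis" "HOL-Library.Function_Algebras" "HOL-Library.Disjoint_Sets"
begin

text \<open>Sections and forms are functions; they form real vector spaces pointwise.\<close>

instantiation "fun" :: (type, real_vector) real_vector
begin

definition scaleR_fun :: "real \<Rightarrow> ('a \<Rightarrow> 'b) \<Rightarrow> 'a \<Rightarrow> 'b"
  where "scaleR_fun c f = (\<lambda>x. c *\<^sub>R f x)"

instance
  by standard (simp_all add: scaleR_fun_def plus_fun_def fun_eq_iff scaleR_add_left scaleR_add_right)

end


section \<open>Smooth manifolds and vector bundles\<close>

text \<open>Real functions on open subsets \<open>W\<close> of \<open>\<real>\<^sup>n\<close>.  Here \<open>\<real>\<^sup>n\<close> is
  \<^const>\<open>Euclidean_space\<close>, i.e. the sequences vanishing from index \<open>n\<close> on, so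
  that \<open>n = 0\<close> is allowed.\<close>

definition partial :: "nat \<Rightarrow> ((nat \<Rightarrow> real) \<Rightarrow> real) \<Rightarrow> (nat \<Rightarrow> real) \<Rightarrow> real"
  where "partial i f x = deriv (\<lambda>t. f (x(i := t))) (x i)"

fun Ck_on :: "nat \<Rightarrow> nat \<Rightarrow> (nat \<Rightarrow> real) set \<Rightarrow> ((nat \<Rightarrow> real) \<Rightarrow> real) \<Rightarrow> bool" where
  "Ck_on n 0 W f \<longleftrightarrow> continuous_map (subtopology (Euclidean_space n) W) euclideanreal f"
| "Ck_on n (Suc k) W f \<longleftrightarrow>
     continuous_map (subtopology (Euclidean_space n) W) euclideanreal f \<and>
     (\<forall>i<n. (\<forall>x\<in>W. (\<lambda>t. f (x(i := t))) differentiable (at (x i))) \<and> Ck_on n k W (partial i f))"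

definition smooth_on :: "nat \<Rightarrow> (nat \<Rightarrow> real) set \<Rightarrow> ((nat \<Rightarrow> real) \<Rightarrow> real) \<Rightarrow> bool"
  where "smooth_on n W f \<longleftrightarrow> (\<forall>k. Ck_on n k W f)"

record 'm manifold =
  mdim :: nat
  charts :: "('m set \<times> ('m \<Rightarrow> nat \<Rightarrow> real)) set"

text \<open>The points of the manifold are the elements of the type \<open>'m\<close>, whose topology is Hausdorff
  and second countable by the sort constraint.\<close>

definition smooth_manifold :: "('m::{t2_space,second_countable_topology}) manifold \<Rightarrow> bool" where
  "smooth_manifold M \<longleftrightarrow>
     (\<forall>(U, \<phi>)\<in>charts M. open U \<and> openin (Euclidean_space (mdim M)) (\<phi> ` U) \<and>
        homeomorphic_map (top_of_set U) (subtopology (Euclidean_space (mdim M)) (\<phi> ` U)) \<phi>) \<and>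
     (\<Union>(U, \<phi>)\<in>charts M. U) = UNIV \<and>
     (\<forall>(U, \<phi>)\<in>charts M. \<forall>(V, \<psi>)\<in>charts M. \<forall>i<mdim M.
        smooth_on (mdim M) (\<phi> ` (U \<inter> V)) (\<lambda>y. \<psi> (inv_into U \<phi> y) i))"

definition smooth_fun_on :: "'m manifold \<Rightarrow> 'm set \<Rightarrow> ('m \<Rightarrow> real) \<Rightarrow> bool" where
  "smooth_fun_on M W f \<longleftrightarrow>
     (\<forall>(U, \<phi>)\<in>charts M. smooth_on (mdim M) (\<phi> ` (U \<inter> W)) (\<lambda>y. f (inv_into U \<phi> y)))"

definition Cinf :: "'m manifold \<Rightarrow> ('m \<Rightarrow> real) set"
  where "Cinf M = {f. smooth_fun_on M UNIV f}"

text \<open>A vector bundle is given by its fibres, which are linear subspaces of an ambient real vector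
  space, and by an atlas of local trivialisations.  A trivialisation over \<open>U\<close> is recorded as the
  corresponding frame \<open>e 0, ..., e (r - 1)\<close> over \<open>U\<close>; the transition matrices between
  frames are required to be smooth.\<close>

record ('m, 'v) vbundle =
  vrank :: nat
  fib :: "'m \<Rightarrow> 'v set"
  frames :: "('m set \<times> (nat \<Rightarrow> 'm \<Rightarrow> 'v)) set"

definition smooth_section_on ::
  "'m manifold \<Rightarrow> ('m, 'v::real_vector, 'z) vbundle_scheme \<Rightarrow> 'm set \<Rightarrow> ('m \<Rightarrow> 'v) \<Rightarrow> bool" where
  "smooth_section_on M E W s \<longleftrightarrow> (\<forall>x\<in>W. s x \<in> fib E x) \<and>
     (\<forall>(U, e)\<in>frames E. \<exists>g. (\<forall>i<vrank E. smooth_fun_on M (U \<inter> W) (g i)) \<and>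
        (\<forall>x\<in>U \<inter> W. s x = (\<Sum>i<vrank E. g i x *\<^sub>R e i x)))"

definition smooth_frame ::
  "('m::topological_space) manifold \<Rightarrow> ('m, 'v::real_vector, 'z) vbundle_scheme \<Rightarrow> 'm set
     \<Rightarrow> (nat \<Rightarrow> 'm \<Rightarrow> 'v) \<Rightarrow> bool" where
  "smooth_frame M E U e \<longleftrightarrow> open U \<and>
     (\<forall>x\<in>U. inj_on (\<lambda>i. e i x) {..<vrank E} \<and> independent ((\<lambda>i. e i x) ` {..<vrank E}) \<and>
        span ((\<lambda>i. e i x) ` {..<vrank E}) = fib E x) \<and>
     (\<forall>i<vrank E. smooth_section_on M E U (e i))"

definition vector_bundle ::
  "('m::topological_space) manifold \<Rightarrow> ('m, 'v::real_vector, 'z) vbundle_scheme \<Rightarrow> bool" where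
  "vector_bundle M E \<longleftrightarrow>
     (\<forall>(U, e)\<in>frames E. smooth_frame M E U e) \<and> (\<Union>(U, e)\<in>frames E. U) = UNIV"

definition sections ::
  "'m manifold \<Rightarrow> ('m, 'v::real_vector, 'z) vbundle_scheme \<Rightarrow> ('m \<Rightarrow> 'v) set"
  where "sections M E = {s. smooth_section_on M E UNIV s}"

definition bundle_map ::
  "'m manifold \<Rightarrow> ('m, 'v::real_vector, 'z) vbundle_scheme \<Rightarrow> ('m, 'w::real_vector, 'y) vbundle_scheme
     \<Rightarrow> ('m \<Rightarrow> 'v \<Rightarrow> 'w) \<Rightarrow> bool" where
  "bundle_map M E F h \<longleftrightarrow>
     (\<forall>x. \<forall>v\<in>fib E x. h x v \<in> fib F x) \<and>
     (\<forall>x. \<forall>v\<in>fib E x. \<forall>w\<in>fib E x. \<forall>c. h x (c *\<^sub>R v + w) = c *\<^sub>R h x v + h x w) \<and>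
     (\<forall>(U, e)\<in>frames E. \<forall>i<vrank E. smooth_section_on M F U (\<lambda>x. h x (e i x)))"

text \<open>Subbundles of \<open>E\<close>, via local frames of \<open>E\<close> adapted to the subbundle.\<close>

definition subbundle ::
  "('m::topological_space) manifold \<Rightarrow> ('m, 'v::real_vector, 'z) vbundle_scheme
     \<Rightarrow> ('m \<Rightarrow> 'v set) \<Rightarrow> bool" where
  "subbundle M E A \<longleftrightarrow> (\<exists>k\<le>vrank E. \<forall>x. \<exists>U e. x \<in> U \<and> smooth_frame M E U e \<and>
     (\<forall>y\<in>U. A y = span ((\<lambda>i. e i y) ` {..<k})))"

definition smul :: "('m \<Rightarrow> real) \<Rightarrow> ('m \<Rightarrow> 'v::real_vector) \<Rightarrow> 'm \<Rightarrow> 'v"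
  where "smul f s = (\<lambda>x. f x *\<^sub>R s x)"

definition tangent_vector :: "'m manifold \<Rightarrow> 'm \<Rightarrow> (('m \<Rightarrow> real) \<Rightarrow> real) \<Rightarrow> bool" where
  "tangent_vector M x D \<longleftrightarrow>
     (\<forall>f\<in>Cinf M. \<forall>g\<in>Cinf M. \<forall>c. D (\<lambda>y. c * f y + g y) = c * D f + D g) \<and>
     (\<forall>f\<in>Cinf M. \<forall>g\<in>Cinf M. D (\<lambda>y. f y * g y) = f x * D g + g x * D f)"


section \<open>Lie algebroids and Lie pairs\<close>

text \<open>The anchor sends \<open>v\<close> in the fibre over \<open>x\<close> to a tangent vector at \<open>x\<close>, i.e. to a
  derivation \<open>Cinf M \<Rightarrow> \<real>\<close> at \<open>x\<close>.\<close>

record ('m, 'v) algebroid = "('m, 'v) vbundle" +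
  anchor :: "'m \<Rightarrow> 'v \<Rightarrow> ('m \<Rightarrow> real) \<Rightarrow> real"
  bracket :: "('m \<Rightarrow> 'v) \<Rightarrow> ('m \<Rightarrow> 'v) \<Rightarrow> ('m \<Rightarrow> 'v)"

definition anchor_der ::
  "('m, 'v, 'z) algebroid_scheme \<Rightarrow> ('m \<Rightarrow> 'v) \<Rightarrow> ('m \<Rightarrow> real) \<Rightarrow> ('m \<Rightarrow> real)"
  where "anchor_der L X f = (\<lambda>x. anchor L x (X x) f)"

definition lie_algebroid ::
  "('m::topological_space) manifold \<Rightarrow> ('m, 'v::real_vector, 'z) algebroid_scheme \<Rightarrow> bool" where
  "lie_algebroid M L \<longleftrightarrow>
     vector_bundle M L \<and>
     (\<forall>x. \<forall>v\<in>fib L x. tangent_vector M x (anchor L x v)) \<and>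
     (\<forall>x. \<forall>v\<in>fib L x. \<forall>w\<in>fib L x. \<forall>c. \<forall>f\<in>Cinf M.
        anchor L x (c *\<^sub>R v + w) f = c * anchor L x v f + anchor L x w f) \<and>
     (\<forall>(U, e)\<in>frames L. \<forall>i<vrank L. \<forall>f\<in>Cinf M. smooth_fun_on M U (anchor_der L (e i) f)) \<and>
     (\<forall>X\<in>sections M L. \<forall>Y\<in>sections M L.
        bracket L X Y \<in> sections M L \<and>
        bracket L X Y = - bracket L Y X \<and>
        (\<forall>Z\<in>sections M L. \<forall>c. bracket L (c *\<^sub>R X + Y) Z = c *\<^sub>R bracket L X Z + bracket L Y Z) \<and>
        (\<forall>Z\<in>sections M L.
           bracket L X (bracket L Y Z) + bracket L Y (bracket L Z X) + bracket L Z (bracket L X Y) = 0) \<and>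
        (\<forall>f\<in>Cinf M. bracket L X (smul f Y) = smul f (bracket L X Y) + smul (anchor_der L X f) Y) \<and>
        (\<forall>f\<in>Cinf M. anchor_der L (bracket L X Y) f =
           anchor_der L X (anchor_der L Y f) - anchor_der L Y (anchor_der L X f)))"

text \<open>The quotient bundle \<open>L/A\<close> is represented by a vector bundle \<open>quot_B P\<close> with a fibrewise
  surjective bundle map \<open>pr_B P\<close> out of \<open>L\<close> whose kernel is \<open>A\<close>; this determines it up
  to a unique isomorphism.\<close>

record ('m, 'v, 'w) lie_pair_data =
  base_mfd :: "'m manifold"
  alg_L :: "('m, 'v) algebroid"
  sub_A :: "'m \<Rightarrow> 'v set"
  quot_B :: "('m, 'w) vbundle"
  pr_B :: "'m \<Rightarrow> 'v \<Rightarrow> 'w"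

definition secL :: "('m, 'v::real_vector, 'w) lie_pair_data \<Rightarrow> ('m \<Rightarrow> 'v) set"
  where "secL P = sections (base_mfd P) (alg_L P)"

definition secA :: "('m, 'v::real_vector, 'w) lie_pair_data \<Rightarrow> ('m \<Rightarrow> 'v) set"
  where "secA P = {s \<in> secL P. \<forall>x. s x \<in> sub_A P x}"

definition secB :: "('m, 'v, 'w::real_vector) lie_pair_data \<Rightarrow> ('m \<Rightarrow> 'w) set"
  where "secB P = sections (base_mfd P) (quot_B P)"

definition lie_pair ::
  "('m::{t2_space,second_countable_topology}, 'v::real_vector, 'w::real_vector) lie_pair_data \<Rightarrow> bool" where
  "lie_pair P \<longleftrightarrow>
     smooth_manifold (base_mfd P) \<and>
     lie_algebroid (base_mfd P) (alg_L P) \<and>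
     subbundle (base_mfd P) (alg_L P) (sub_A P) \<and>
     (\<forall>a\<in>secA P. \<forall>a'\<in>secA P. bracket (alg_L P) a a' \<in> secA P) \<and>
     vector_bundle (base_mfd P) (quot_B P) \<and>
     bundle_map (base_mfd P) (alg_L P) (quot_B P) (pr_B P) \<and>
     (\<forall>x. pr_B P x ` fib (alg_L P) x = fib (quot_B P) x) \<and>
     (\<forall>x. {v \<in> fib (alg_L P) x. pr_B P x v = 0} = sub_A P x)"

definition on_sections :: "('m \<Rightarrow> 'v \<Rightarrow> 'w) \<Rightarrow> ('m \<Rightarrow> 'v) \<Rightarrow> ('m \<Rightarrow> 'w)"
  where "on_sections h s = (\<lambda>x. h x (s x))"

text \<open>The Bott connection, \<open>a \<mapsto> (pr\<^sub>B l \<mapsto> pr\<^sub>B [a, l])\<close>; the choice of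
  the lift \<open>l\<close> is irrelevant since \<open>[a, -]\<close> preserves sections of \<open>A\<close>.\<close>

definition bott :: "('m, 'v::real_vector, 'w::real_vector) lie_pair_data
    \<Rightarrow> ('m \<Rightarrow> 'v) \<Rightarrow> ('m \<Rightarrow> 'w) \<Rightarrow> ('m \<Rightarrow> 'w)" where
  "bott P a b = on_sections (pr_B P)
     (bracket (alg_L P) a (SOME l. l \<in> secL P \<and> on_sections (pr_B P) l = b))"

definition splitting :: "('m, 'v::real_vector, 'w::real_vector) lie_pair_data
    \<Rightarrow> ('m \<Rightarrow> 'w \<Rightarrow> 'v) \<Rightarrow> bool" where
  "splitting P j \<longleftrightarrow> bundle_map (base_mfd P) (quot_B P) (alg_L P) j \<and>
     (\<forall>x. \<forall>b\<in>fib (quot_B P) x. pr_B P x (j x b) = b)"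

definition connection :: "('m, 'v::real_vector, 'w::real_vector) lie_pair_data
    \<Rightarrow> (('m \<Rightarrow> 'v) \<Rightarrow> ('m \<Rightarrow> 'w) \<Rightarrow> ('m \<Rightarrow> 'w)) \<Rightarrow> bool" where
  "connection P nabla \<longleftrightarrow>
     (\<forall>l\<in>secL P. \<forall>b\<in>secB P. nabla l b \<in> secB P \<and>
        (\<forall>l'\<in>secL P. \<forall>f\<in>Cinf (base_mfd P). nabla (smul f l + l') b = smul f (nabla l b) + nabla l' b) \<and>
        (\<forall>b'\<in>secB P. \<forall>c. nabla l (c *\<^sub>R b + b') = c *\<^sub>R nabla l b + nabla l b') \<and>
        (\<forall>f\<in>Cinf (base_mfd P). nabla l (smul f b) = smul f (nabla l b) + smul (anchor_der (alg_L P) l f) b))"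

definition extends_bott :: "('m, 'v::real_vector, 'w::real_vector) lie_pair_data
    \<Rightarrow> (('m \<Rightarrow> 'v) \<Rightarrow> ('m \<Rightarrow> 'w) \<Rightarrow> ('m \<Rightarrow> 'w)) \<Rightarrow> bool" where
  "extends_bott P nabla \<longleftrightarrow> (\<forall>a\<in>secA P. \<forall>b\<in>secB P. nabla a b = bott P a b)"


section \<open>Forms\<close>

text \<open>For \<open>G = \<Gamma>(A)\<close> and \<open>S = \<Gamma>(E)\<close>, the space \<open>\<Gamma>(\<wedge>\<^sup>p A\<^sup>\<or> \<otimes> E)\<close>
  consists of the alternating \<open>Cinf M\<close>-multilinear maps \<open>\<Gamma>(A) \<times> \<cdots> \<times> \<Gamma>(A) \<rightarrow>
  \<Gamma>(E)\<close> in \<open>p\<close> arguments.  The arguments are given as a list, and forms are extended by zero to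
  all other lists, so that forms of different degrees live in the same vector space.\<close>

type_synonym ('m, 'v, 'e) form = "('m \<Rightarrow> 'v) list \<Rightarrow> 'm \<Rightarrow> 'e"

definition alt_forms :: "('m \<Rightarrow> real) set \<Rightarrow> ('m \<Rightarrow> 'v::real_vector) set \<Rightarrow> ('m \<Rightarrow> 'e::real_vector) set
    \<Rightarrow> nat \<Rightarrow> ('m, 'v, 'e) form set" where
  "alt_forms C G S p = {w.
     (\<forall>as. \<not> (length as = p \<and> set as \<subseteq> G) \<longrightarrow> w as = 0) \<and>
     (\<forall>as. length as = p \<and> set as \<subseteq> G \<longrightarrow>
        w as \<in> S \<and>
        (\<forall>i<p. \<forall>a\<in>G. \<forall>f\<in>C. w (as[i := smul f (as ! i) + a]) = smul f (w as) + w (as[i := a])) \<and>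
        (\<forall>i<p. \<forall>k<p. i \<noteq> k \<and> as ! i = as ! k \<longrightarrow> w as = 0))}"

definition scalar_forms :: "('m, 'v::real_vector, 'w) lie_pair_data \<Rightarrow> nat \<Rightarrow> ('m, 'v, real) form set"
  where "scalar_forms P p = alt_forms (Cinf (base_mfd P)) (secA P) (Cinf (base_mfd P)) p"

definition B_forms ::
  "('m, 'v::real_vector, 'w::real_vector) lie_pair_data \<Rightarrow> nat \<Rightarrow> ('m, 'v, 'w) form set"
  where "B_forms P p = alt_forms (Cinf (base_mfd P)) (secA P) (secB P) p"

text \<open>A shuffle of the arguments \<open>as\<close> is given by the set \<open>I\<close> of positions that come first;
  its sign counts the inversions.\<close>

definition shuffle_sign :: "nat set \<Rightarrow> real"
  where "shuffle_sign I = (-1) ^ card {(i, k). i \<in> I \<and> k \<notin> I \<and> k < i}"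

text \<open>For a \<open>Cinf M\<close>-linear map \<open>\<Phi>\<close> from \<open>\<Gamma>(E)\<close> to forms, \<open>wedge_insert w \<Phi>\<close> is the
  \<open>Cinf M\<close>-linear extension of \<open>\<xi> \<otimes> b \<mapsto> \<xi> \<and> \<Phi> b\<close> to all
  \<open>E\<close>-valued forms \<open>w\<close>; see \<open>wedge_insert_tensor\<close> below.  Summands in which the
  number of arguments of \<open>w\<close> is not its degree vanish.\<close>

definition wedge_insert ::
  "('m, 'v, 'e) form \<Rightarrow> (('m \<Rightarrow> 'e) \<Rightarrow> ('m, 'v, 'f::real_vector) form) \<Rightarrow> ('m, 'v, 'f) form" where
  "wedge_insert w \<Phi> = (\<lambda>as. \<Sum>I\<in>Pow {..<length as}.
     shuffle_sign I *\<^sub>R \<Phi> (w (nths as I)) (nths as (- I)))"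

definition wedge :: "('m, 'v, real) form \<Rightarrow> ('m, 'v, 'e::real_vector) form \<Rightarrow> ('m, 'v, 'e) form"
  where "wedge \<xi> w = wedge_insert \<xi> (\<lambda>f as. smul f (w as))"

definition tensor :: "('m, 'v, real) form \<Rightarrow> ('m \<Rightarrow> 'e::real_vector) \<Rightarrow> ('m, 'v, 'e) form"
  where "tensor \<xi> b = (\<lambda>as. smul (\<xi> as) b)"

text \<open>The multilinear extension of
  \<open>(\<xi>\<^sub>1 \<otimes> b\<^sub>1, ..., \<xi>\<^sub>k \<otimes> b\<^sub>k) \<mapsto> \<xi>\<^sub>1 \<and> ... \<and> \<xi>\<^sub>k \<and> R [b\<^sub>1, ..., b\<^sub>k]\<close>;
  see \<open>insert_forms_tensor\<close> below.\<close>

fun insert_forms ::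
  "('m, 'v, 'e) form list \<Rightarrow> (('m \<Rightarrow> 'e) list \<Rightarrow> ('m, 'v, 'f::real_vector) form) \<Rightarrow> ('m, 'v, 'f) form" where
  "insert_forms [] R = R []"
| "insert_forms (w # ws) R = wedge_insert w (\<lambda>b. insert_forms ws (\<lambda>bs. R (b # bs)))"

text \<open>Multiplication by \<open>(-1)\<^sup>p\<close> on forms of degree \<open>p\<close>.\<close>

definition parity_twist :: "('m, 'v, 'e::real_vector) form \<Rightarrow> ('m, 'v, 'e) form"
  where "parity_twist w = (\<lambda>as. (-1) ^ length as *\<^sub>R w as)"

text \<open>The Chevalley--Eilenberg differential with coefficients in a representation \<open>D\<close>.\<close>

definition ce_diff :: "(('m \<Rightarrow> 'v) \<Rightarrow> ('m \<Rightarrow> 'v) \<Rightarrow> ('m \<Rightarrow> 'v)) \<Rightarrow> ('m \<Rightarrow> 'v) set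
    \<Rightarrow> (('m \<Rightarrow> 'v) \<Rightarrow> ('m \<Rightarrow> 'e) \<Rightarrow> ('m \<Rightarrow> 'e)) \<Rightarrow> ('m, 'v, 'e::real_vector) form \<Rightarrow> ('m, 'v, 'e) form" where
  "ce_diff br G D w = (\<lambda>as. if set as \<subseteq> G then
       (\<Sum>i<length as. (-1) ^ i *\<^sub>R D (as ! i) (w (nths as (- {i})))) +
       (\<Sum>k<length as. \<Sum>i<k. (-1) ^ (i + k) *\<^sub>R w (br (as ! i) (as ! k) # nths as (- {i, k})))
     else 0)"


section \<open>The Kapranov structure\<close>

definition prA :: "('m, 'v::real_vector, 'w) lie_pair_data \<Rightarrow> ('m \<Rightarrow> 'w \<Rightarrow> 'v) \<Rightarrow> ('m \<Rightarrow> 'v) \<Rightarrow> ('m \<Rightarrow> 'v)"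
  where "prA P j l = l - on_sections j (on_sections (pr_B P) l)"

definition atiyah :: "('m, 'v, 'w::real_vector) lie_pair_data \<Rightarrow> ('m \<Rightarrow> 'w \<Rightarrow> 'v)
    \<Rightarrow> (('m \<Rightarrow> 'v) \<Rightarrow> ('m \<Rightarrow> 'w) \<Rightarrow> ('m \<Rightarrow> 'w)) \<Rightarrow> ('m \<Rightarrow> 'v) \<Rightarrow> ('m \<Rightarrow> 'w) \<Rightarrow> ('m \<Rightarrow> 'w) \<Rightarrow> ('m \<Rightarrow> 'w)" where
  "atiyah P j nabla a b e =
     nabla a (nabla (on_sections j b) e) - nabla (on_sections j b) (nabla a e)
       - nabla (bracket (alg_L P) a (on_sections j b)) e"

definition one_form ::
  "('m, 'v::real_vector, 'w) lie_pair_data \<Rightarrow> (('m \<Rightarrow> 'v) \<Rightarrow> ('m \<Rightarrow> 'w::zero)) \<Rightarrow> ('m, 'v, 'w) form" where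
  "one_form P F = (\<lambda>as. case as of [a] \<Rightarrow> (if a \<in> secA P then F a else 0) | _ \<Rightarrow> 0)"

text \<open>The operator \<open>\<nabla>\<^bsub>j b\<^esub>\<close> on \<open>\<Gamma>(A\<^sup>\<or> \<otimes> B)\<close>: the Leibniz rule applied to
  \<open>\<xi> \<otimes> e\<close> and evaluated at \<open>a\<close>, with
  \<open>\<langle>\<nabla>\<^bsub>j b\<^esub> \<xi>, a\<rangle> = \<rho>(j b)\<langle>\<xi>, a\<rangle> - \<langle>\<xi>, pr\<^sub>A [j b, a]\<rangle>\<close>, gives
  \<open>\<nabla>\<^bsub>j b\<^esub> (\<xi>(a) e) - \<xi>(pr\<^sub>A [j b, a]) e\<close>.\<close>

definition nabla_one_form :: "('m, 'v::real_vector, 'w::real_vector) lie_pair_data \<Rightarrow> ('m \<Rightarrow> 'w \<Rightarrow> 'v)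
    \<Rightarrow> (('m \<Rightarrow> 'v) \<Rightarrow> ('m \<Rightarrow> 'w) \<Rightarrow> ('m \<Rightarrow> 'w)) \<Rightarrow> ('m \<Rightarrow> 'w) \<Rightarrow> ('m, 'v, 'w) form \<Rightarrow> ('m, 'v, 'w) form" where
  "nabla_one_form P j nabla b \<eta> = one_form P (\<lambda>a.
     nabla (on_sections j b) (\<eta> [a]) - \<eta> [prA P j (bracket (alg_L P) (on_sections j b) a)])"

text \<open>The argument list of \<open>kap_R P j nabla k\<close> has length \<open>k\<close>.  Since \<open>\<nabla>\<close> acts on
  \<open>b\<^sub>1 \<otimes> ... \<otimes> b\<^sub>n\<close> by the Leibniz rule, the first term of the recursion is a sum
  over the tensor factors.\<close>

fun kap_R :: "('m, 'v::real_vector, 'w::real_vector) lie_pair_data \<Rightarrow> ('m \<Rightarrow> 'w \<Rightarrow> 'v)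
    \<Rightarrow> (('m \<Rightarrow> 'v) \<Rightarrow> ('m \<Rightarrow> 'w) \<Rightarrow> ('m \<Rightarrow> 'w)) \<Rightarrow> nat \<Rightarrow> ('m \<Rightarrow> 'w) list \<Rightarrow> ('m, 'v, 'w) form" where
  "kap_R P j nabla 0 bs = 0"
| "kap_R P j nabla (Suc 0) bs = 0"
| "kap_R P j nabla (Suc (Suc 0)) bs = one_form P (\<lambda>a. atiyah P j nabla a (bs ! 0) (bs ! 1))"
| "kap_R P j nabla (Suc (Suc (Suc n))) bs =
     (\<Sum>i<n + 2. kap_R P j nabla (Suc (Suc n)) ((tl bs)[i := nabla (on_sections j (hd bs)) (tl bs ! i)]))
       - nabla_one_form P j nabla (hd bs) (kap_R P j nabla (Suc (Suc n)) (tl bs))"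

definition kapranov :: "('m, 'v::real_vector, 'w::real_vector) lie_pair_data \<Rightarrow> ('m \<Rightarrow> 'w \<Rightarrow> 'v)
    \<Rightarrow> (('m \<Rightarrow> 'v) \<Rightarrow> ('m \<Rightarrow> 'w) \<Rightarrow> ('m \<Rightarrow> 'w)) \<Rightarrow> ('m, 'v, 'w) form list \<Rightarrow> ('m, 'v, 'w) form" where
  "kapranov P j nabla ws =
     (if length ws = 1 then ce_diff (bracket (alg_L P)) (secA P) (bott P) (hd ws)
      else insert_forms (map parity_twist ws) (kap_R P j nabla (length ws)))"

lemma smul_scaleR: "smul f (c *\<^sub>R s) = c *\<^sub>R smul f s"
  by (simp add: smul_def scaleR_fun_def mult.commute)

lemma smul_sum: "smul f (\<Sum>i\<in>I. s i) = (\<Sum>i\<in>I. smul f (s i))"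
  by (induction I rule: infinite_finite_induct)
     (simp_all add: smul_def fun_eq_iff scaleR_add_right)

lemma smul_left_commute: "smul f (smul g s) = smul g (smul f s)"
  by (simp add: smul_def mult.commute)

lemma wedge_insert_tensor:
  assumes "\<And>as. \<Phi> (smul (\<xi> as) b) = (\<lambda>cs. smul (\<xi> as) (\<Phi> b cs))"
  shows "wedge_insert (tensor \<xi> b) \<Phi> = wedge \<xi> (\<Phi> b)"
  by (simp add: wedge_insert_def wedge_def tensor_def assms)

lemma parity_twist_tensor: "parity_twist (tensor \<xi> b) = tensor (parity_twist \<xi>) b"
  by (simp add: parity_twist_def tensor_def smul_def scaleR_fun_def fun_eq_iff)

text \<open>The operations \<open>\<lambda>\<^sub>k\<close> on decomposable elements, for \<open>\<Phi> = R\<^sub>k\<close>.\<close>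

lemma insert_forms_tensor:
  fixes xs :: "(('m, 'v, real) form \<times> ('m \<Rightarrow> 'e::real_vector)) list"
    and \<Phi> :: "('m \<Rightarrow> 'e) list \<Rightarrow> ('m, 'v, 'f::real_vector) form"
  assumes "\<And>bs i f. \<lbrakk>length bs = length xs; i < length bs; f \<in> F\<rbrakk>
      \<Longrightarrow> \<Phi> (bs[i := smul f (bs ! i)]) = (\<lambda>cs. smul f (\<Phi> bs cs))"
    and "\<And>\<xi> b as. (\<xi>, b) \<in> set xs \<Longrightarrow> \<xi> as \<in> F"
  shows "insert_forms (map (\<lambda>(\<xi>, b). tensor \<xi> b) xs) \<Phi> = foldr wedge (map fst xs) (\<Phi> (map snd xs))"
  using assms
proof (induction xs arbitrary: \<Phi>)
  case (Cons x xs)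
  obtain \<xi> b where x: "x = (\<xi>, b)" by fastforce
  have IH: "insert_forms (map (\<lambda>(\<xi>, b). tensor \<xi> b) xs) (\<lambda>bs. \<Phi> (c # bs))
      = foldr wedge (map fst xs) (\<Phi> (c # map snd xs))" for c
  proof (rule Cons.IH)
    fix bs :: "('m \<Rightarrow> 'e) list" and i f assume *: "length bs = length xs" "i < length bs" "f \<in> F"
    show "\<Phi> (c # bs[i := smul f (bs ! i)]) = (\<lambda>cs. smul f (\<Phi> (c # bs) cs))"
      using Cons.prems(1)[of "c # bs" "Suc i" f] * by simp
  qed (use Cons.prems(2) in auto)
  have lin: "foldr wedge zs (\<lambda>cs. smul f (w cs)) = (\<lambda>cs. smul f (foldr wedge zs w cs))"
    for zs f and w :: "('m, 'v, 'f) form"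
  proof (induction zs)
    case (Cons z zs)
    have "wedge z (\<lambda>cs. smul f (u cs)) = (\<lambda>cs. smul f (wedge z u cs))" for u :: "('m, 'v, 'f) form"
      by (simp add: wedge_def wedge_insert_def smul_sum smul_scaleR smul_left_commute[of f])
    then show ?case using Cons by simp
  qed simp
  have "wedge_insert (tensor \<xi> b) (\<lambda>c. foldr wedge (map fst xs) (\<Phi> (c # map snd xs)))
      = wedge \<xi> (foldr wedge (map fst xs) (\<Phi> (b # map snd xs)))"
  proof (rule wedge_insert_tensor)
    fix as
    have "\<Phi> (smul (\<xi> as) b # map snd xs) = (\<lambda>cs. smul (\<xi> as) (\<Phi> (b # map snd xs) cs))"
      using Cons.prems(1)[of "b # map snd xs" 0 "\<xi> as"] Cons.prems(2)[of \<xi> b as] x by simp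
    then show "foldr wedge (map fst xs) (\<Phi> (smul (\<xi> as) b # map snd xs))
        = (\<lambda>cs. smul (\<xi> as) (foldr wedge (map fst xs) (\<Phi> (b # map snd xs)) cs))"
      by (simp add: lin)
  qed
  then show ?case by (simp add: x IH)
qed simp


section \<open>Leibniz infinity[1] algebras over a cdga\<close>

text \<open>Gradings are by natural numbers, which covers all objects considered here.  Multilinear maps
  \<open>V\<^sup>\<otimes>\<^sup>k \<rightarrow> W\<close> for all \<open>k\<close> are given as one function on lists, \<open>k\<close> being the length of
  the list, and are determined by their values on homogeneous elements.  Signs refer to a list
  \<open>ds\<close> of degrees of the arguments.\<close>

record 'a dga =
  dga_car :: "nat \<Rightarrow> 'a set"
  dga_mul :: "'a \<Rightarrow> 'a \<Rightarrow> 'a"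
  dga_one :: 'a
  dga_diff :: "'a \<Rightarrow> 'a"

record ('a, 'v) gmodule =
  gcar :: "nat \<Rightarrow> 'v set"
  gact :: "'a \<Rightarrow> 'v \<Rightarrow> 'v"

definition homogeneous :: "(nat \<Rightarrow> 'v set) \<Rightarrow> nat list \<Rightarrow> 'v list \<Rightarrow> bool"
  where "homogeneous V ds vs \<longleftrightarrow> list_all2 (\<lambda>d v. v \<in> V d) ds vs"

definition graded_multilinear ::
  "(nat \<Rightarrow> 'v::real_vector set) \<Rightarrow> (nat \<Rightarrow> 'w::real_vector set) \<Rightarrow> nat \<Rightarrow> nat \<Rightarrow> ('v list \<Rightarrow> 'w) \<Rightarrow> bool" where
  "graded_multilinear V W e k m \<longleftrightarrow>
     (\<forall>ds vs. length vs = k \<and> homogeneous V ds vs \<longrightarrow>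
        m vs \<in> W (sum_list ds + e) \<and>
        (\<forall>i<k. \<forall>u\<in>V (ds ! i). \<forall>c. m (vs[i := c *\<^sub>R (vs ! i) + u]) = c *\<^sub>R m vs + m (vs[i := u])))"

definition multilinear_over ::
  "('a, 'z) dga_scheme \<Rightarrow> ('a, 'v) gmodule \<Rightarrow> ('a, 'w::real_vector) gmodule \<Rightarrow> nat \<Rightarrow> nat
     \<Rightarrow> ('v list \<Rightarrow> 'w) \<Rightarrow> bool" where
  "multilinear_over A V W e k m \<longleftrightarrow>
     (\<forall>ds vs. length vs = k \<and> homogeneous (gcar V) ds vs \<longrightarrow>
        (\<forall>i<k. \<forall>p. \<forall>a\<in>dga_car A p.
           m (vs[i := gact V a (vs ! i)]) = (-1) ^ (p * (e + sum_list (take i ds))) *\<^sub>R gact W a (m vs)))"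

definition dg_module ::
  "('a::real_vector, 'z) dga_scheme \<Rightarrow> ('a, 'v::real_vector) gmodule \<Rightarrow> ('v \<Rightarrow> 'v) \<Rightarrow> bool" where
  "dg_module A V d \<longleftrightarrow>
     (\<forall>q. subspace (gcar V q)) \<and>
     (\<forall>p q. \<forall>a\<in>dga_car A p. \<forall>v\<in>gcar V q.
        gact V a v \<in> gcar V (p + q) \<and>
        (\<forall>a'\<in>dga_car A p. \<forall>c. gact V (c *\<^sub>R a + a') v = c *\<^sub>R gact V a v + gact V a' v) \<and>
        (\<forall>v'\<in>gcar V q. \<forall>c. gact V a (c *\<^sub>R v + v') = c *\<^sub>R gact V a v + gact V a v') \<and>
        (\<forall>p'. \<forall>a'\<in>dga_car A p'. gact V (dga_mul A a' a) v = gact V a' (gact V a v)) \<and>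
        d (gact V a v) = gact V (dga_diff A a) v + (-1) ^ p *\<^sub>R gact V a (d v)) \<and>
     (\<forall>q. \<forall>v\<in>gcar V q. gact V (dga_one A) v = v \<and> d v \<in> gcar V (q + 1) \<and> d (d v) = 0 \<and>
        (\<forall>v'\<in>gcar V q. \<forall>c. d (c *\<^sub>R v + v') = c *\<^sub>R d v + d v'))"

text \<open>Permutations are written in one-line notation, as lists of (zero-based) indices.\<close>

definition shuffle_lists :: "nat \<Rightarrow> nat \<Rightarrow> nat list set" where
  "shuffle_lists p q =
     {\<sigma>. distinct \<sigma> \<and> set \<sigma> = {..<p + q} \<and> sorted (take p \<sigma>) \<and> sorted (drop p \<sigma>)}"

definition koszul :: "nat list \<Rightarrow> nat list \<Rightarrow> real" where
  "koszul ds \<sigma> = (\<Prod>k<length \<sigma>. \<Prod>i<k.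
     if \<sigma> ! i > \<sigma> ! k then (-1) ^ (ds ! (\<sigma> ! i) * ds ! (\<sigma> ! k)) else 1)"

abbreviation pick :: "'a list \<Rightarrow> nat list \<Rightarrow> 'a list"
  where "pick xs is \<equiv> map ((!) xs) is"

definition leibniz_inf :: "(nat \<Rightarrow> 'v::real_vector set) \<Rightarrow> ('v list \<Rightarrow> 'v) \<Rightarrow> bool" where
  "leibniz_inf V lam \<longleftrightarrow>
     (\<forall>d. subspace (V d)) \<and>
     (\<forall>k\<ge>1. graded_multilinear V V 1 k lam) \<and>
     (\<forall>n\<ge>1. \<forall>ds vs. length vs = n \<and> homogeneous V ds vs \<longrightarrow>
        (\<Sum>j=1..n. \<Sum>k=j..n. \<Sum>\<sigma>\<in>shuffle_lists (k - j) (j - 1).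
           (koszul ds \<sigma> * (-1) ^ sum_list (pick ds (take (k - j) \<sigma>))) *\<^sub>R
           lam (pick vs (take (k - j) \<sigma>) @
                [lam (pick vs (drop (k - j) \<sigma>) @ [vs ! (k - 1)])] @ drop k vs)) = 0)"

definition leibniz_inf_over ::
  "('a::real_vector, 'z) dga_scheme \<Rightarrow> ('a, 'v::real_vector) gmodule \<Rightarrow> ('v list \<Rightarrow> 'v) \<Rightarrow> bool" where
  "leibniz_inf_over A V lam \<longleftrightarrow>
     leibniz_inf (gcar V) lam \<and>
     dg_module A V (\<lambda>v. lam [v]) \<and>
     (\<forall>k\<ge>2. multilinear_over A V V 1 k lam)"

text \<open>Partitions of \<open>{..<n}\<close> into non-empty disjoint subsets, listed by increasing maximum.\<close>

definition max_ordered_partitions :: "nat \<Rightarrow> nat set list set" where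
  "max_ordered_partitions n = {Is. partition_on {..<n} (set Is) \<and> sorted_wrt (<) (map Max Is)}"

definition leibniz_inf_morphism ::
  "('a::real_vector, 'z) dga_scheme \<Rightarrow> ('a, 'v::real_vector) gmodule \<Rightarrow> ('v list \<Rightarrow> 'v)
     \<Rightarrow> ('a, 'w::real_vector) gmodule \<Rightarrow> ('w list \<Rightarrow> 'w) \<Rightarrow> ('v list \<Rightarrow> 'w) \<Rightarrow> bool" where
  "leibniz_inf_morphism A V lam W lam' f \<longleftrightarrow>
     (\<forall>k\<ge>1. graded_multilinear (gcar V) (gcar W) 0 k f \<and> multilinear_over A V W 0 k f) \<and>
     (\<forall>n\<ge>1. \<forall>ds bs. length bs = n \<and> homogeneous (gcar V) ds bs \<longrightarrow>
        (\<Sum>k<n. \<Sum>p<n - k. \<Sum>\<sigma>\<in>shuffle_lists k p.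
           (koszul ds \<sigma> * (-1) ^ sum_list (pick ds (take k \<sigma>))) *\<^sub>R
           f (pick bs (take k \<sigma>) @
              [lam (pick bs (drop k \<sigma>) @ [bs ! (k + p)])] @ drop (k + p + 1) bs)) =
        (\<Sum>Is\<in>max_ordered_partitions n.
           koszul ds (concat (map sorted_list_of_set Is)) *\<^sub>R lam' (map (\<lambda>I. f (nths bs I)) Is)))"

text \<open>For a morphism \<open>f\<close> the component \<open>f\<^sub>1\<close> is already a map of dg modules, so it is
  an isomorphism of dg modules iff it is bijective in each degree.\<close>

definition leibniz_inf_isomorphic ::
  "('a::real_vector, 'z) dga_scheme \<Rightarrow> ('a, 'v::real_vector) gmodule \<Rightarrow> ('v list \<Rightarrow> 'v)
     \<Rightarrow> ('a, 'w::real_vector) gmodule \<Rightarrow> ('w list \<Rightarrow> 'w) \<Rightarrow> bool" where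
  "leibniz_inf_isomorphic A V lam W lam' \<longleftrightarrow>
     leibniz_inf_over A V lam \<and> leibniz_inf_over A W lam' \<and>
     (\<exists>f. leibniz_inf_morphism A V lam W lam' f \<and>
          (\<forall>d. bij_betw (\<lambda>v. f [v]) (gcar V d) (gcar W d)))"


section \<open>The base cdga and the underlying module of the Kapranov structure\<close>

definition Omega_A :: "('m, 'v::real_vector, 'w) lie_pair_data \<Rightarrow> ('m, 'v, real) form dga" where
  "Omega_A P = \<lparr>
     dga_car = scalar_forms P,
     dga_mul = wedge,
     dga_one = (\<lambda>as. if as = [] then (\<lambda>x. 1) else 0),
     dga_diff = ce_diff (bracket (alg_L P)) (secA P) (anchor_der (alg_L P)) \<rparr>"

definition Omega_A_B :: "('m, 'v::real_vector, 'w::real_vector) lie_pair_data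
    \<Rightarrow> (('m, 'v, real) form, ('m, 'v, 'w) form) gmodule" where
  "Omega_A_B P = \<lparr> gcar = B_forms P, gact = wedge \<rparr>"

end

theory Submission
  imports Defs
begin

text \<open>Both \<open>\<lambda>\<close> and the morphism are determined by their values on sections of \<open>L/A\<close>,
  where the identities become statements about the coderivations \<open>q\<^sub>a\<close> with components
  \<open>\<nabla>\<^sub>a, R\<^sub>2(-)(a), R\<^sub>3(-)(a), \<dots>\<close>. The recursion for \<open>R\<close> says that, with
  \<open>n\<^sub>b = - \<nabla>\<^bsub>j b\<^esub>\<close> and \<open>c(b, a) = pr\<^sub>A [j b, a]\<close>,
  \<open>q\<^sub>a(b, -) + [q\<^sub>a, n\<^sub>b] = n\<^bsub>\<nabla>\<^sub>a b\<^esub> + q\<^bsub>c(b, a)\<^esub>\<close>; by induction on the number of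
  arguments this forces \<open>[q\<^sub>a, q\<^sub>a\<^sub>'] = q\<^bsub>[a, a']\<^esub>\<close>. For a second choice \<open>(j', \<nabla>')\<close> the
  coderivations \<open>m\<^sub>b = n'\<^sub>b + q'\<^bsub>j'b - jb\<^esub>\<close> satisfy the same relation with \<open>q'\<close> and the
  original \<open>c\<close>. The coalgebra morphism defined recursively by
  \<open>F(b, -) = (b + m\<^sub>b) F(-) - F n\<^sub>b\<close> therefore intertwines \<open>q\<^sub>a\<close> with \<open>q'\<^sub>a\<close>, and it is
  \<open>C\<^sup>\<infinity>\<close>-multilinear because \<open>m\<^sub>b\<close> and \<open>n\<^sub>b\<close> have the same symbol \<open>- \<rho>(j b)\<close>. The passage
  to forms is by contraction: an operator on forms commuting with all contractions
  \<open>\<iota>\<^sub>a\<close> vanishes once it vanishes in degree \<open>0\<close>, and \<open>[\<iota>\<^sub>a, \<lambda>]\<close> restricts to \<open>q\<^sub>a\<close>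
  there.\<close>

section \<open>Coderivations on graded tensors\<close>

text \<open>The operations live on the tensor coalgebra in which the last entry of a block is
  distinguished: any of the earlier entries may be moved in front of the block, with Koszul sign.
  Coderivations and morphisms are determined by their components, and commutators of coderivations
  are coderivations again. The choice of m_b has a simple origin. Both n_b and m_b stand for minus
  the action of the same section j b of L. The second choice only knows how j'b acts, through n'_b,
  and how sections of A act, through q'; writing j b = j'b - (j'b - j b) gives m_b. This is why both
  families go with the same c and have the same symbol. The obstacle is that nabla_a and n_b are
  first-order operators. Linearity over functions holds only from two arguments on, has to be
  obtained by cancelling symbols between several terms, and must be carried through the same
  induction that constructs the components. Hence the components cut off at a given number of
  arguments and the explicit ranges of lengths in the statements on linearity.\<close>

definition sg :: "int \<Rightarrow> real"
  where "sg k = (if even k then 1 else - 1)"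

lemma sg_0 [simp]: "sg 0 = 1"
  and sg_1 [simp]: "sg 1 = - 1"
  and sg_m1 [simp]: "sg (- 1) = - 1"
  and sg_minus [simp]: "sg (- k) = sg k"
  and sg_sq [simp]: "sg k * sg k = 1"
  and sg_sq' [simp]: "sg k * (sg k * r) = r"
  and sg_sqsq: "sg (k * k) = sg k"
  by (simp_all add: sg_def)

lemma sg_add: "sg (k + l) = sg k * sg l"
  and sg_diff: "sg (k - l) = sg k * sg l"
  by (simp_all add: sg_def)

lemma sg_norm:
  "sg (k * (l + m)) = sg (k * l) * sg (k * m)"
  "sg ((l + m) * k) = sg (l * k) * sg (m * k)"
  "sg (k * (l - m)) = sg (k * l) * sg (k * m)"
  "sg ((l - m) * k) = sg (l * k) * sg (m * k)"
  by (auto simp: sg_def)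

lemma sg_power: "sg (int n) = (- 1) ^ n"
  by (simp add: sg_def)

text \<open>Elements of a tensor power are lists of pairs (degree, entry); \<open>cod f g e\<close> is \<open>f\<close> composed with the
  coderivation of degree \<open>e\<close> generated by \<open>g\<close>. In the recursion the first entry either is the only argument of
  \<open>g\<close>, stays outside \<open>g\<close>, or is the first of several arguments of \<open>g\<close>.\<close>

fun cod :: "((int \<times> 'a) list \<Rightarrow> 'b::real_vector) \<Rightarrow> ((int \<times> 'a) list \<Rightarrow> 'a) \<Rightarrow> int
    \<Rightarrow> (int \<times> 'a) list \<Rightarrow> 'b" where
  "cod f g e [] = 0"
| "cod f g e (x # X) = f ((e + fst x, g [x]) # X)
     + sg (e * fst x) *\<^sub>R cod (\<lambda>Y. f (x # Y)) g e X
     + cod f (\<lambda>Y. g (x # Y)) (e + fst x) X"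

definition hom :: "(int \<Rightarrow> 'a set) \<Rightarrow> (int \<times> 'a) list \<Rightarrow> bool"
  where "hom V X \<longleftrightarrow> (\<forall>x\<in>set X. snd x \<in> V (fst x))"

abbreviation dg :: "(int \<times> 'a) list \<Rightarrow> int"
  where "dg X \<equiv> sum_list (map fst X)"

text \<open>Degrees are integers because contractions have degree -1. The empty list is excluded
  because the recursion of \<open>cod\<close> never hands an empty list to either of its two
  functions.\<close>

definition maps :: "(int \<Rightarrow> 'a set) \<Rightarrow> ((int \<times> 'a) list \<Rightarrow> 'b) \<Rightarrow> (int \<Rightarrow> 'b set) \<Rightarrow> int \<Rightarrow> bool"
  where "maps V g W e \<longleftrightarrow> (\<forall>X. X \<noteq> [] \<longrightarrow> hom V X \<longrightarrow> g X \<in> W (dg X + e))"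

definition mlin :: "(int \<Rightarrow> 'a::real_vector set) \<Rightarrow> ((int \<times> 'a) list \<Rightarrow> 'b::real_vector) \<Rightarrow> bool" where
  "mlin V f \<longleftrightarrow> (\<forall>X Y d u v c. hom V X \<longrightarrow> hom V Y \<longrightarrow> u \<in> V d \<longrightarrow> v \<in> V d \<longrightarrow>
     f (X @ (d, c *\<^sub>R u + v) # Y) = c *\<^sub>R f (X @ (d, u) # Y) + f (X @ (d, v) # Y))"

definition closedV :: "(int \<Rightarrow> 'a::real_vector set) \<Rightarrow> bool" where
  "closedV V \<longleftrightarrow> (\<forall>d u v c. u \<in> V d \<longrightarrow> v \<in> V d \<longrightarrow> c *\<^sub>R u + v \<in> V d)"

lemma hom_simps [simp]:
  "hom V []" "hom V (x # X) \<longleftrightarrow> snd x \<in> V (fst x) \<and> hom V X"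
  "hom V (X @ Y) \<longleftrightarrow> hom V X \<and> hom V Y"
  by (auto simp: hom_def)

lemma closedV_lin: "\<lbrakk>closedV V; u \<in> V d; v \<in> V d\<rbrakk> \<Longrightarrow> c *\<^sub>R u + v \<in> V d"
  by (auto simp: closedV_def)

lemma closedV_zero: "closedV V \<Longrightarrow> u \<in> V d \<Longrightarrow> 0 \<in> V d"
  using closedV_lin[of V u d u "- 1"] by simp

lemma closedV_scale: "closedV V \<Longrightarrow> u \<in> V d \<Longrightarrow> c *\<^sub>R u \<in> V d"
  using closedV_lin[of V u d 0 c] closedV_zero[of V u d] by simp

lemma closedV_add: "\<lbrakk>closedV V; u \<in> V d; v \<in> V d\<rbrakk> \<Longrightarrow> u + v \<in> V d"
  using closedV_lin[of V u d v 1] by simp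

lemma closedV_diff: "\<lbrakk>closedV V; u \<in> V d; v \<in> V d\<rbrakk> \<Longrightarrow> u - v \<in> V d"
  using closedV_lin[of V v d u "-1"] by simp

lemma mlinD: "mlin V f \<Longrightarrow> hom V X \<Longrightarrow> hom V Y \<Longrightarrow> u \<in> V d \<Longrightarrow> v \<in> V d \<Longrightarrow>
     f (X @ (d, c *\<^sub>R u + v) # Y) = c *\<^sub>R f (X @ (d, u) # Y) + f (X @ (d, v) # Y)"
  by (auto simp: mlin_def)

lemma mlinD0: "mlin V f \<Longrightarrow> hom V Y \<Longrightarrow> u \<in> V d \<Longrightarrow> v \<in> V d \<Longrightarrow>
     f ((d, c *\<^sub>R u + v) # Y) = c *\<^sub>R f ((d, u) # Y) + f ((d, v) # Y)"
  using mlinD[of V f "[]"] by simp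

lemma mlin_zero: "\<lbrakk>mlin V f; hom V X; hom V Y; 0 \<in> V d\<rbrakk> \<Longrightarrow> f (X @ (d, 0) # Y) = 0"
  using mlinD[of V f X Y 0 d 0 1] by simp

lemma mlin_Cons: "mlin V f \<Longrightarrow> snd x \<in> V (fst x) \<Longrightarrow> mlin V (\<lambda>Y. f (x # Y))"
  unfolding mlin_def by (metis append_Cons hom_simps(2))

lemma mlin_lin: "mlin V f \<Longrightarrow> mlin V g \<Longrightarrow> mlin V (\<lambda>X. c *\<^sub>R f X + g X)"
  by (simp add: mlin_def algebra_simps)

lemma mlin_add: "mlin V f \<Longrightarrow> mlin V g \<Longrightarrow> mlin V (\<lambda>X. f X + g X)"
  using mlin_lin[of V f g 1] by simp

lemma mlin_zero_fun: "mlin V (\<lambda>X. 0)"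
  by (simp add: mlin_def)

lemma mlin_scale: "mlin V f \<Longrightarrow> mlin V (\<lambda>X. c *\<^sub>R f X)"
  using mlin_lin[OF _ mlin_zero_fun, of V f c] by simp

lemma mlin_diff: "mlin V f \<Longrightarrow> mlin V g \<Longrightarrow> mlin V (\<lambda>X. f X - g X)"
  using mlin_lin[of V g f "-1"] by simp

lemma mapsD: "\<lbrakk>maps V g W e; X \<noteq> []; hom V X; dg X + e = k\<rbrakk> \<Longrightarrow> g X \<in> W k"
  by (auto simp: maps_def)

lemma maps_Cons: "\<lbrakk>maps V g W e; snd x \<in> V (fst x); k = e + fst x\<rbrakk> \<Longrightarrow> maps V (\<lambda>Y. g (x # Y)) W k"
  unfolding maps_def
proof (intro allI impI)
  fix X assume *: "\<forall>X. X \<noteq> [] \<longrightarrow> hom V X \<longrightarrow> g X \<in> W (dg X + e)"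
    "snd x \<in> V (fst x)" "k = e + fst x" "X \<noteq> []" "hom V X"
  have "dg (x # X) + e = dg X + k" using *(3) by simp
  moreover have "g (x # X) \<in> W (dg (x # X) + e)" using *(1,2,5) by (simp del: list.map)
  ultimately show "g (x # X) \<in> W (dg X + k)" by (simp only:)
qed

lemma maps_lin: "\<lbrakk>closedV W; maps V f W e; maps V g W e\<rbrakk> \<Longrightarrow> maps V (\<lambda>X. c *\<^sub>R f X + g X) W e"
  by (simp add: maps_def closedV_lin)

lemma maps_scale: "closedV W \<Longrightarrow> maps V f W e \<Longrightarrow> maps V (\<lambda>X. c *\<^sub>R f X) W e"
  by (simp add: maps_def closedV_scale)

lemma maps_diff: "\<lbrakk>closedV W; maps V f W e; maps V g W e\<rbrakk> \<Longrightarrow> maps V (\<lambda>X. f X - g X) W e"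
  by (simp add: maps_def closedV_diff)

lemma maps_add: "\<lbrakk>closedV W; maps V f W e; maps V g W e\<rbrakk> \<Longrightarrow> maps V (\<lambda>X. f X + g X) W e"
  by (simp add: maps_def closedV_add)

lemma maps_single: "maps V g V e \<Longrightarrow> snd x \<in> V (fst x) \<Longrightarrow> g [x] \<in> V (e + fst x)"
  unfolding maps_def by (drule spec[of _ "[x]"]) (simp add: add.commute)

lemma cod_lin_f: "cod (\<lambda>Y. c *\<^sub>R f Y + f' Y) g e X = c *\<^sub>R cod f g e X + cod f' g e X"
  by (induction X arbitrary: f f' g e) (simp_all add: algebra_simps)

lemma cod_zero_f [simp]: "cod (\<lambda>Y. 0) g e X = 0"
  by (induction X arbitrary: g e) simp_all

lemma cod_scale_f: "cod (\<lambda>Y. c *\<^sub>R f Y) g e X = c *\<^sub>R cod f g e X"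
  using cod_lin_f[of c f "\<lambda>_. 0"] by simp

lemma cod_add_f: "cod (\<lambda>Y. f Y + f' Y) g e X = cod f g e X + cod f' g e X"
  using cod_lin_f[of 1 f f'] by simp

lemma cod_diff_f: "cod (\<lambda>Y. f Y - f' Y) g e X = cod f g e X - cod f' g e X"
  using cod_lin_f[of "-1" f' f] by simp

text \<open>Replacing a block by its value never lengthens a list, so only lists at most as long as
  \<open>X\<close> and of the right total degree matter. Inductions on the number of arguments use
  this bound to apply their hypothesis under \<open>cod\<close>.\<close>

lemma cod_cong:
  assumes "\<And>Z. \<lbrakk>hom V Z; Z \<noteq> []; length Z \<le> length X; dg Z = dg X + e\<rbrakk> \<Longrightarrow> f Z = f' Z"
    and "\<And>Z. \<lbrakk>hom V Z; Z \<noteq> []; length Z \<le> length X\<rbrakk> \<Longrightarrow> g Z = g' Z"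
    and "maps V g V e" and "hom V X"
  shows "cod f g e X = cod f' g' e X"
  using assms
proof (induction X arbitrary: f f' g g' e)
  case (Cons x X)
  have x: "snd x \<in> V (fst x)" "hom V X" using Cons.prems(4) by simp_all
  have gx: "g [x] = g' [x]" using Cons.prems(2)[of "[x]"] x by simp
  have gV: "g [x] \<in> V (e + fst x)" using maps_single[OF Cons.prems(3)] x by simp
  have 1: "f ((e + fst x, g [x]) # X) = f' ((e + fst x, g [x]) # X)"
    by (rule Cons.prems(1)) (use x gV in auto)
  have 2: "cod (\<lambda>Y. f (x # Y)) g e X = cod (\<lambda>Y. f' (x # Y)) g' e X"
    by (rule Cons.IH) (use Cons.prems x in \<open>auto intro!: Cons.prems(1)\<close>)
  have 3: "cod f (\<lambda>Y. g (x # Y)) (e + fst x) X = cod f' (\<lambda>Y. g' (x # Y)) (e + fst x) X"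
    by (rule Cons.IH) (use Cons.prems x in \<open>auto intro!: Cons.prems(1) Cons.prems(2) maps_Cons\<close>)
  show ?case using 1 2 3 gx by simp
qed simp

lemma cod_vanish:
  assumes "\<And>Z. \<lbrakk>hom V Z; Z \<noteq> []; length Z \<le> length X; dg Z = dg X + e\<rbrakk> \<Longrightarrow> f Z = 0"
    and "maps V g V e" and "hom V X"
  shows "cod f g e X = 0"
proof -
  have "cod f g e X = cod (\<lambda>Y. 0) g e X"
    using assms by (intro cod_cong[of V]) blast+
  then show ?thesis by simp
qed

lemma cod_lin_g:
  assumes "closedV V" "mlin V f" "maps V g V e" "maps V g' V e" "hom V X"
  shows "cod f (\<lambda>Y. c *\<^sub>R g Y + g' Y) e X = c *\<^sub>R cod f g e X + cod f g' e X"
  using assms(2-)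
proof (induction X arbitrary: f g g' e)
  case (Cons x X)
  have x: "snd x \<in> V (fst x)" "hom V X" using Cons.prems by simp_all
  have 1: "f ((e + fst x, c *\<^sub>R g [x] + g' [x]) # X)
      = c *\<^sub>R f ((e + fst x, g [x]) # X) + f ((e + fst x, g' [x]) # X)"
    by (rule mlinD0[OF Cons.prems(1)]) (use x Cons.prems in \<open>auto intro: maps_single\<close>)
  have 2: "cod (\<lambda>Y. f (x # Y)) (\<lambda>Y. c *\<^sub>R g Y + g' Y) e X
      = c *\<^sub>R cod (\<lambda>Y. f (x # Y)) g e X + cod (\<lambda>Y. f (x # Y)) g' e X"
    by (rule Cons.IH) (use x Cons.prems in \<open>auto intro: mlin_Cons\<close>)
  have 3: "cod f (\<lambda>Y. c *\<^sub>R g (x # Y) + g' (x # Y)) (e + fst x) X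
      = c *\<^sub>R cod f (\<lambda>Y. g (x # Y)) (e + fst x) X + cod f (\<lambda>Y. g' (x # Y)) (e + fst x) X"
    by (rule Cons.IH) (use x Cons.prems in \<open>auto intro: maps_Cons\<close>)
  show ?case using 1 2 3 by (simp add: algebra_simps)
qed simp

lemma cod_zero_g:
  assumes "closedV V" "mlin V f" "maps V (\<lambda>Y. 0) V e" "hom V X"
  shows "cod f (\<lambda>Y. 0) e X = 0"
  using cod_lin_g[OF assms(1,2,3,3,4), of 1] by simp

lemma cod_scale_g:
  assumes "closedV V" "mlin V f" "maps V g V e" "hom V X"
  shows "cod f (\<lambda>Y. c *\<^sub>R g Y) e X = c *\<^sub>R cod f g e X"
proof -
  have "maps V (\<lambda>Y. 0) V e"
    using maps_scale[OF assms(1,3), of 0] by simp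
  from cod_lin_g[OF assms(1-3) this assms(4), of c] cod_zero_g[OF assms(1,2) this assms(4)]
  show ?thesis by simp
qed

lemma cod_add_g:
  assumes "closedV V" "mlin V f" "maps V g V e" "maps V g' V e" "hom V X"
  shows "cod f (\<lambda>Y. g Y + g' Y) e X = cod f g e X + cod f g' e X"
  using cod_lin_g[OF assms, of 1] by simp

lemma cod_diff_g:
  assumes "closedV V" "mlin V f" "maps V g V e" "maps V g' V e" "hom V X"
  shows "cod f (\<lambda>Y. g Y - g' Y) e X = cod f g e X - cod f g' e X"
  using cod_lin_g[OF assms(1,2,4,3,5), of "-1"] by simp

lemma maps_cod:
  assumes "closedV W" "maps V f W e" "maps V g V e'" "k = e + e'"
  shows "maps V (cod f g e') W k"
proof -
  have "cod f g e' X \<in> W (dg X + (e + e'))" if "X \<noteq> []" "hom V X" for X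
    using that assms(2,3)
  proof (induction X arbitrary: f g e e')
    case (Cons x X)
    have x: "snd x \<in> V (fst x)" "hom V X" using Cons.prems by simp_all
    have 1: "f ((e' + fst x, g [x]) # X) \<in> W (dg (x # X) + (e + e'))"
      by (rule mapsD[OF Cons.prems(3)]) (use x Cons.prems(2) maps_single[OF Cons.prems(4) x(1)] in auto)
    show ?case
    proof (cases "X = []")
      case True then show ?thesis using 1 by simp
    next
      case False
      have 2: "cod (\<lambda>Y. f (x # Y)) g e' X \<in> W (dg X + ((e + fst x) + e'))"
        by (rule Cons.IH) (use x False Cons.prems(3,4) in \<open>auto intro: maps_Cons\<close>)
      have 3: "cod f (\<lambda>Y. g (x # Y)) (e' + fst x) X \<in> W (dg X + (e + (e' + fst x)))"
        by (rule Cons.IH) (use x False Cons.prems(3,4) in \<open>auto intro: maps_Cons\<close>)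
      have "dg X + ((e + fst x) + e') = dg (x # X) + (e + e')" "dg X + (e + (e' + fst x)) = dg (x # X) + (e + e')"
        by simp_all
      with 1 2 3 show ?thesis
        unfolding cod.simps by (metis assms(1) closedV_add closedV_scale)
    qed
  qed simp
  then show ?thesis using assms(4) by (auto simp: maps_def)
qed

lemma mlin_cod:
  assumes "closedV V" "mlin V f" "mlin V g" "maps V g V e"
  shows "mlin V (cod f g e)"
proof -
  have "cod f g e (X @ (d, c *\<^sub>R u + v) # Y) = c *\<^sub>R cod f g e (X @ (d, u) # Y) + cod f g e (X @ (d, v) # Y)"
    if "hom V X" "hom V Y" "u \<in> V d" "v \<in> V d" for X Y d u v c
    using assms(2-) that
  proof (induction X arbitrary: f g e)
    case Nil
    let ?w = "c *\<^sub>R u + v"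
    have w: "?w \<in> V d" using assms(1) Nil by (auto intro: closedV_lin)
    have g1: "g [(d, ?w)] = c *\<^sub>R g [(d, u)] + g [(d, v)]"
      using mlinD0[OF Nil.prems(2), of "[]"] Nil by simp
    have gV: "g [(d, u)] \<in> V (e + d)" "g [(d, v)] \<in> V (e + d)"
      using maps_single[OF Nil.prems(3), of "(d, u)"] maps_single[OF Nil.prems(3), of "(d, v)"] Nil by auto
    have 1: "f ((e + d, g [(d, ?w)]) # Y) = c *\<^sub>R f ((e + d, g [(d, u)]) # Y) + f ((e + d, g [(d, v)]) # Y)"
      unfolding g1 by (rule mlinD0) (use Nil gV in auto)
    have 2: "cod (\<lambda>Z. f ((d, ?w) # Z)) g e Y
        = c *\<^sub>R cod (\<lambda>Z. f ((d, u) # Z)) g e Y + cod (\<lambda>Z. f ((d, v) # Z)) g e Y"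
      unfolding cod_lin_f[symmetric]
      by (rule cod_cong[of V]) (use Nil mlinD0[OF Nil.prems(1)] in auto)
    have "cod f (\<lambda>Z. g ((d, ?w) # Z)) (e + d) Y
        = cod f (\<lambda>Z. c *\<^sub>R g ((d, u) # Z) + g ((d, v) # Z)) (e + d) Y"
      by (rule cod_cong[of V]) (use Nil w mlinD0[OF Nil.prems(2)] in \<open>auto intro!: maps_Cons\<close>)
    also have "\<dots> = c *\<^sub>R cod f (\<lambda>Z. g ((d, u) # Z)) (e + d) Y + cod f (\<lambda>Z. g ((d, v) # Z)) (e + d) Y"
      by (rule cod_lin_g) (use Nil assms(1) in \<open>auto intro: maps_Cons\<close>)
    finally show ?case using 1 2 by (simp add: algebra_simps)
  next
    case (Cons x X)
    have x: "snd x \<in> V (fst x)" "hom V X" using Cons.prems by simp_all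
    have gV: "g [x] \<in> V (e + fst x)" using maps_single[OF Cons.prems(3)] x by simp
    have 1: "f ((e + fst x, g [x]) # X @ (d, c *\<^sub>R u + v) # Y)
       = c *\<^sub>R f ((e + fst x, g [x]) # X @ (d, u) # Y) + f ((e + fst x, g [x]) # X @ (d, v) # Y)"
      using mlinD[OF Cons.prems(1), of "(e + fst x, g [x]) # X" Y u d v c] x gV Cons.prems by simp
    have 2: "cod (\<lambda>Y. f (x # Y)) g e (X @ (d, c *\<^sub>R u + v) # Y)
       = c *\<^sub>R cod (\<lambda>Y. f (x # Y)) g e (X @ (d, u) # Y) + cod (\<lambda>Y. f (x # Y)) g e (X @ (d, v) # Y)"
      by (rule Cons.IH) (use x Cons.prems in \<open>auto intro: mlin_Cons\<close>)
    have 3: "cod f (\<lambda>Y. g (x # Y)) (e + fst x) (X @ (d, c *\<^sub>R u + v) # Y)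
       = c *\<^sub>R cod f (\<lambda>Y. g (x # Y)) (e + fst x) (X @ (d, u) # Y)
          + cod f (\<lambda>Y. g (x # Y)) (e + fst x) (X @ (d, v) # Y)"
      by (rule Cons.IH) (use x Cons.prems in \<open>auto intro: mlin_Cons maps_Cons\<close>)
    show ?case using 1 2 3 by (simp add: algebra_simps)
  qed
  then show ?thesis by (auto simp: mlin_def)
qed

section \<open>Graded commutators of coderivations\<close>

definition com :: "((int \<times> 'a::real_vector) list \<Rightarrow> 'a) \<Rightarrow> int \<Rightarrow> ((int \<times> 'a) list \<Rightarrow> 'a) \<Rightarrow> int
    \<Rightarrow> (int \<times> 'a) list \<Rightarrow> 'a" where
  "com f e g e' = (\<lambda>X. cod f g e' X - sg (e * e') *\<^sub>R cod g f e X)"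

lemma maps_com:
  assumes "closedV V" "maps V f V e" "maps V g V e'" "k = e + e'"
  shows "maps V (com f e g e') V k"
  unfolding com_def using assms
  by (intro maps_diff maps_scale maps_cod) auto

lemma mlin_com:
  assumes "closedV V" "mlin V f" "maps V f V e" "mlin V g" "maps V g V e'"
  shows "mlin V (com f e g e')"
  unfolding com_def using assms
  by (intro mlin_diff mlin_scale mlin_cod) auto

text \<open>Induction on the first entry \<open>x\<close>. Where \<open>x\<close> lies outside both
  blocks, or in a block of several entries of one operator, the induction hypothesis applies. The
  terms in which \<open>g [x]\<close> or \<open>h [x]\<close> stays outside the other block occur in
  both orders and cancel; those in which it opens the other block remain as part of the
  commutator.\<close>

lemma cod_comm:
  assumes V: "closedV V" and "mlin V f" "mlin V g" "maps V g V e" "mlin V h" "maps V h V e'" "hom V X"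
  shows "cod (cod f g e) h e' X - sg (e * e') *\<^sub>R cod (cod f h e') g e X = cod f (com g e h e') (e + e') X"
  using assms(2-)
proof (induction X arbitrary: f g h e e')
  case (Cons x X)
  have x: "snd x \<in> V (fst x)" "hom V X" using Cons.prems by simp_all
  let ?d = "fst x"
  have gx: "g [x] \<in> V (e + ?d)" and hx: "h [x] \<in> V (e' + ?d)"
    using maps_single[OF Cons.prems(3)] maps_single[OF Cons.prems(5)] x by simp_all
  note pr = Cons.prems
  have IH1: "cod (cod (\<lambda>Y. f (x # Y)) g e) h e' X - sg (e * e') *\<^sub>R cod (cod (\<lambda>Y. f (x # Y)) h e') g e X
      = cod (\<lambda>Y. f (x # Y)) (com g e h e') (e + e') X"
    by (rule Cons.IH) (use pr x in \<open>auto intro: mlin_Cons\<close>)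
  have IH2: "cod (cod f g e) (\<lambda>Y. h (x # Y)) (e' + ?d) X
      - sg (e * (e' + ?d)) *\<^sub>R cod (cod f (\<lambda>Y. h (x # Y)) (e' + ?d)) g e X
      = cod f (com g e (\<lambda>Y. h (x # Y)) (e' + ?d)) (e + (e' + ?d)) X"
    by (rule Cons.IH) (use pr x in \<open>auto intro: mlin_Cons maps_Cons\<close>)
  have IH3: "cod (cod f (\<lambda>Y. g (x # Y)) (e + ?d)) h e' X
      - sg ((e + ?d) * e') *\<^sub>R cod (cod f h e') (\<lambda>Y. g (x # Y)) (e + ?d) X
      = cod f (com (\<lambda>Y. g (x # Y)) (e + ?d) h e') ((e + ?d) + e') X"
    by (rule Cons.IH) (use pr x in \<open>auto intro: mlin_Cons maps_Cons\<close>)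
  \<comment> \<open>In \<open>A\<close> and \<open>B\<close> the inner value, which has consumed
    \<open>x\<close>, opens the block of the outer operator. In \<open>C\<close> and
    \<open>D\<close> the entry \<open>x\<close> belongs to the block of \<open>h\<close>,
    respectively of \<open>g\<close>, and a commutator with the other operator is left.\<close>
  define A where "A = (\<lambda>Y. g ((e' + ?d, h [x]) # Y))"
  define B where "B = (\<lambda>Y. h ((e + ?d, g [x]) # Y))"
  define C where "C = com g e (\<lambda>Y. h (x # Y)) (e' + ?d)"
  define D where "D = com (\<lambda>Y. g (x # Y)) (e + ?d) h e'"
  have m: "maps V A V (e + e' + ?d)" "maps V B V (e + e' + ?d)" "maps V C V (e + e' + ?d)" "maps V D V (e + e' + ?d)"
    unfolding A_def B_def C_def D_def using pr x gx hx V
    by (auto intro!: maps_com intro: maps_Cons)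
  have "com g e h e' (x # Y) = sg (e' * ?d) *\<^sub>R D Y + (1 *\<^sub>R C Y + ((- sg (e * e')) *\<^sub>R B Y + A Y))" for Y
    by (simp add: com_def A_def B_def C_def D_def scaleR_add_right scaleR_diff_right sg_norm mult.commute
        mult.left_commute)
  then have "cod f (\<lambda>Y. com g e h e' (x # Y)) (e + e' + ?d) X
     = cod f (\<lambda>Y. sg (e' * ?d) *\<^sub>R D Y + (1 *\<^sub>R C Y + ((- sg (e * e')) *\<^sub>R B Y + A Y))) (e + e' + ?d) X"
    by simp
  also have "\<dots> = sg (e' * ?d) *\<^sub>R cod f D (e + e' + ?d) X + (1 *\<^sub>R cod f C (e + e' + ?d) X
      + ((- sg (e * e')) *\<^sub>R cod f B (e + e' + ?d) X + cod f A (e + e' + ?d) X))"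
    using V pr x m by (simp add: cod_lin_g maps_lin del: scaleR_one scaleR_minus_left)
  finally have R: "cod f (\<lambda>Y. com g e h e' (x # Y)) (e + e' + ?d) X = \<dots>" .
  have e0: "com g e h e' [x] = g [(e' + ?d, h [x])] - sg (e * e') *\<^sub>R h [(e + ?d, g [x])]"
    by (simp add: com_def)
  have f0: "f ((e + e' + ?d, com g e h e' [x]) # X)
     = f ((e + e' + ?d, g [(e' + ?d, h [x])]) # X) - sg (e * e') *\<^sub>R f ((e + e' + ?d, h [(e + ?d, g [x])]) # X)"
  proof -
    have "g [(e' + ?d, h [x])] \<in> V (e + e' + ?d)" "h [(e + ?d, g [x])] \<in> V (e + e' + ?d)"
      using mapsD[OF pr(3), of "[(e' + ?d, h [x])]"] mapsD[OF pr(5), of "[(e + ?d, g [x])]"] gx hx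
      by (simp_all add: algebra_simps)
    then show ?thesis
      using mlinD0[OF pr(1), of X "h [(e + ?d, g [x])]" "e + e' + ?d" "g [(e' + ?d, h [x])]" "- sg (e * e')"] x
      by (simp add: e0)
  qed
  have "cod (cod f g e) h e' (x # X) = cod f g e ((e' + ?d, h [x]) # X)
      + sg (e' * ?d) *\<^sub>R cod (\<lambda>Y. cod f g e (x # Y)) h e' X + cod (cod f g e) (\<lambda>Y. h (x # Y)) (e' + ?d) X"
    by simp
  then have L1: "cod (cod f g e) h e' (x # X) =
      f ((e + (e' + ?d), g [(e' + ?d, h [x])]) # X)
     + sg (e * (e' + ?d)) *\<^sub>R cod (\<lambda>Y. f ((e' + ?d, h [x]) # Y)) g e X
     + cod f A (e + e' + ?d) X
     + sg (e' * ?d) *\<^sub>R (cod (\<lambda>Y. f ((e + ?d, g [x]) # Y)) h e' X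
        + sg (e * ?d) *\<^sub>R cod (cod (\<lambda>Y. f (x # Y)) g e) h e' X
        + cod (cod f (\<lambda>Y. g (x # Y)) (e + ?d)) h e' X)
     + cod (cod f g e) (\<lambda>Y. h (x # Y)) (e' + ?d) X"
    by (simp add: cod_add_f cod_scale_f A_def add.assoc)
  have "cod (cod f h e') g e (x # X) = cod f h e' ((e + ?d, g [x]) # X)
      + sg (e * ?d) *\<^sub>R cod (\<lambda>Y. cod f h e' (x # Y)) g e X + cod (cod f h e') (\<lambda>Y. g (x # Y)) (e + ?d) X"
    by simp
  then have L2: "cod (cod f h e') g e (x # X) =
      f ((e' + (e + ?d), h [(e + ?d, g [x])]) # X)
     + sg (e' * (e + ?d)) *\<^sub>R cod (\<lambda>Y. f ((e + ?d, g [x]) # Y)) h e' X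
     + cod f B (e + e' + ?d) X
     + sg (e * ?d) *\<^sub>R (cod (\<lambda>Y. f ((e' + ?d, h [x]) # Y)) g e X
        + sg (e' * ?d) *\<^sub>R cod (cod (\<lambda>Y. f (x # Y)) h e') g e X
        + cod (cod f (\<lambda>Y. h (x # Y)) (e' + ?d)) g e X)
     + cod (cod f h e') (\<lambda>Y. g (x # Y)) (e + ?d) X"
    by (simp add: cod_add_f cod_scale_f B_def add.assoc add.left_commute)
  have E: "cod f (com g e h e') (e + e') (x # X) =
      f ((e + e' + ?d, g [(e' + ?d, h [x])]) # X) - sg (e * e') *\<^sub>R f ((e + e' + ?d, h [(e + ?d, g [x])]) # X)
      + sg ((e + e') * ?d) *\<^sub>R (cod (cod (\<lambda>Y. f (x # Y)) g e) h e' X - sg (e * e') *\<^sub>R cod (cod (\<lambda>Y. f (x # Y)) h e') g e X)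
      + (sg (e' * ?d) *\<^sub>R (cod (cod f (\<lambda>Y. g (x # Y)) (e + ?d)) h e' X
      - sg ((e + ?d) * e') *\<^sub>R cod (cod f h e') (\<lambda>Y. g (x # Y)) (e + ?d) X)
      + ((cod (cod f g e) (\<lambda>Y. h (x # Y)) (e' + ?d) X
      - sg (e * (e' + ?d)) *\<^sub>R cod (cod f (\<lambda>Y. h (x # Y)) (e' + ?d)) g e X)
      + ((- sg (e * e')) *\<^sub>R cod f B (e + e' + ?d) X + cod f A (e + e' + ?d) X)))"
    unfolding IH1 IH2 IH3 using R f0 by (simp add: C_def D_def algebra_simps)
  show ?case
    unfolding E L1 L2
    by (simp add: scaleR_add_right scaleR_diff_right sg_norm mult.commute mult.left_commute
        add.assoc add.left_commute)
qed simp

lemma com_cong: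
  assumes "\<And>Z. \<lbrakk>hom V Z; Z \<noteq> []; length Z \<le> length X\<rbrakk> \<Longrightarrow> f Z = f' Z"
    and "\<And>Z. \<lbrakk>hom V Z; Z \<noteq> []; length Z \<le> length X\<rbrakk> \<Longrightarrow> g Z = g' Z"
    and "maps V f V e" "maps V g V e'" "hom V X"
  shows "com f e g e' X = com f' e g' e' X"
  unfolding com_def using assms by (auto intro!: arg_cong2[of _ _ _ _ "(-)"] arg_cong[of _ _ "\<lambda>x. _ *\<^sub>R x"] cod_cong[of V])

lemma com_lin_right:
  assumes "closedV V" "maps V g V e'" "maps V g' V e'" "mlin V f" "hom V X"
  shows "com f e (\<lambda>Y. c *\<^sub>R g Y + g' Y) e' X = c *\<^sub>R com f e g e' X + com f e g' e' X"
  unfolding com_def cod_lin_f cod_lin_g[OF assms(1,4,2,3,5)] by (simp add: algebra_simps)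

lemma com_skew: "com g e' f e X = - sg (e * e') *\<^sub>R com f e g e' X"
  by (simp add: com_def algebra_simps)

text \<open>Purely formal once \<open>cod_comm\<close> is known: both sides become sums of iterated
  \<open>cod\<close> terms.\<close>

lemma com_Jacobi:
  assumes V: "closedV V" and f: "mlin V f" "maps V f V e" and g: "mlin V g" "maps V g V e'"
    and h: "mlin V h" "maps V h V e''" and X: "hom V X"
  shows "com f e (com g e' h e'') (e' + e'') X
     = com (com f e g e') (e + e') h e'' X + sg (e * e') *\<^sub>R com g e' (com f e h e'') (e + e'') X"
proof -
  have A: "cod f (com g e' h e'') (e' + e'') X
      = cod (cod f g e') h e'' X - sg (e' * e'') *\<^sub>R cod (cod f h e'') g e' X"
    by (rule cod_comm[symmetric, OF V]) (use assms in auto)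
  have B: "cod g (com f e h e'') (e + e'') X
      = cod (cod g f e) h e'' X - sg (e * e'') *\<^sub>R cod (cod g h e'') f e X"
    by (rule cod_comm[symmetric, OF V]) (use assms in auto)
  have C: "cod h (com f e g e') (e + e') X
      = cod (cod h f e) g e' X - sg (e * e') *\<^sub>R cod (cod h g e') f e X"
    by (rule cod_comm[symmetric, OF V]) (use assms in auto)
  have D: "cod (com g e' h e'') k l X = cod (cod g h e'') k l X - sg (e' * e'') *\<^sub>R cod (cod h g e') k l X"
    "cod (com f e h e'') k l X = cod (cod f h e'') k l X - sg (e * e'') *\<^sub>R cod (cod h f e) k l X"
    "cod (com f e g e') k l X = cod (cod f g e') k l X - sg (e * e') *\<^sub>R cod (cod g f e) k l X"
    for k l unfolding com_def by (simp_all add: cod_diff_f cod_scale_f)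
  show ?thesis
    unfolding com_def[of f e "com g e' h e''"] com_def[of "com f e g e'"] com_def[of g e' "com f e h e''"]
      A B C D
    by (simp add: scaleR_add_right scaleR_diff_right sg_norm mult.commute mult.left_commute)
qed

text \<open>Sums over all splittings into two subsequences such that the last entry belongs to the second one.\<close>

fun unsh :: "((int \<times> 'a) list \<Rightarrow> (int \<times> 'a) list \<Rightarrow> 'b::real_vector) \<Rightarrow> int
    \<Rightarrow> (int \<times> 'a) list \<Rightarrow> 'b" where
  "unsh \<psi> e [] = 0"
| "unsh \<psi> e (x # X) = (if X = [] then \<psi> [] [x]
     else sg (e * fst x) *\<^sub>R unsh (\<lambda>Y Z. \<psi> (x # Y) Z) e X
       + unsh (\<lambda>Y Z. \<psi> Y (x # Z)) (e + fst x) X)"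

lemma unsh_cong:
  assumes "\<And>Y Z. hom V Y \<Longrightarrow> hom V Z \<Longrightarrow> Z \<noteq> [] \<Longrightarrow> length Y + length Z = length X \<Longrightarrow> dg Y + dg Z = dg X
      \<Longrightarrow> \<psi> Y Z = \<psi>' Y Z"
    and "hom V X"
  shows "unsh \<psi> e X = unsh \<psi>' e X"
  using assms
proof (induction X arbitrary: \<psi> \<psi>' e)
  case (Cons x X)
  show ?case
  proof (cases "X = []")
    case True then show ?thesis using Cons.prems by simp
  next
    case False
    have "unsh (\<lambda>Y Z. \<psi> (x # Y) Z) e X = unsh (\<lambda>Y Z. \<psi>' (x # Y) Z) e X"
      by (rule Cons.IH) (use Cons.prems in \<open>auto intro!: Cons.prems(1)\<close>)
    moreover have "unsh (\<lambda>Y Z. \<psi> Y (x # Z)) (e + fst x) X = unsh (\<lambda>Y Z. \<psi>' Y (x # Z)) (e + fst x) X"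
      by (rule Cons.IH) (use Cons.prems in \<open>auto intro!: Cons.prems(1)\<close>)
    ultimately show ?thesis using False by simp
  qed
qed simp

lemma hom_UNIV [simp]: "hom (\<lambda>_. UNIV) X" "maps (\<lambda>_. UNIV) g (\<lambda>_. UNIV) e"
  by (auto simp: hom_def maps_def)

lemma unsh_cong':
  assumes "\<And>Y Z. \<lbrakk>Z \<noteq> []; length Y + length Z = length X; dg Y + dg Z = dg X\<rbrakk> \<Longrightarrow> \<psi> Y Z = \<psi>' Y Z"
  shows "unsh \<psi> e X = unsh \<psi>' e X"
  by (rule unsh_cong[of "\<lambda>_. UNIV"]) (use assms in auto)

lemma cod_cong':
  assumes "\<And>Z. \<lbrakk>Z \<noteq> []; length Z \<le> length X; dg Z = dg X + e\<rbrakk> \<Longrightarrow> f Z = f' Z"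
  shows "cod f g e X = cod f' g e X"
  by (rule cod_cong[of "\<lambda>_. UNIV"]) (use assms in auto)

lemma unsh_lin: "unsh (\<lambda>Y Z. c *\<^sub>R \<psi> Y Z + \<psi>' Y Z) e X = c *\<^sub>R unsh \<psi> e X + unsh \<psi>' e X"
  by (induction X arbitrary: \<psi> \<psi>' e) (simp_all add: algebra_simps)

lemma unsh_zero [simp]: "unsh (\<lambda>Y Z. 0) e X = 0"
  by (induction X arbitrary: e) simp_all

lemma unsh_scale: "unsh (\<lambda>Y Z. c *\<^sub>R \<psi> Y Z) e X = c *\<^sub>R unsh \<psi> e X"
  using unsh_lin[of c \<psi> "\<lambda>_ _. 0"] by simp

lemma unsh_scale2: "unsh (\<lambda>Y Z. (c * d Y Z) *\<^sub>R \<psi> Y Z) e X = c *\<^sub>R unsh (\<lambda>Y Z. d Y Z *\<^sub>R \<psi> Y Z) e X"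
  unfolding unsh_scale[symmetric] by simp

lemma unsh_add: "unsh (\<lambda>Y Z. \<psi> Y Z + \<psi>' Y Z) e X = unsh \<psi> e X + unsh \<psi>' e X"
  using unsh_lin[of 1 \<psi> \<psi>'] by simp

text \<open>The parameter \<open>e\<close> is the degree that entries of the left block have to
  pass; it grows whenever an entry joins the right block. A sign depending only on the degree of the
  left block is therefore absorbed into \<open>e\<close>.\<close>

lemma unsh_shift: "unsh (\<lambda>Y Z. sg (k * dg Y) *\<^sub>R \<psi> Y Z) e X = unsh \<psi> (e + k) X"
proof (induction X arbitrary: \<psi> e)
  case (Cons x X)
  have "unsh (\<lambda>Y Z. sg (k * dg (x # Y)) *\<^sub>R \<psi> (x # Y) Z) e X
      = sg (k * fst x) *\<^sub>R unsh (\<lambda>Y Z. sg (k * dg Y) *\<^sub>R \<psi> (x # Y) Z) e X"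
    by (simp add: unsh_scale[symmetric] sg_norm)
  then show ?case
    using Cons.IH[of "\<lambda>Y Z. \<psi> (x # Y) Z" e] Cons.IH[of "\<lambda>Y Z. \<psi> Y (x # Z)" "e + fst x"]
    by (simp add: sg_norm mult.commute add.commute add.left_commute)
qed simp

text \<open>Coderivations are compatible with the half-unshuffle coproduct.\<close>

lemma cod_unsh:
  "cod (unsh \<psi> e) g k X = unsh (\<lambda>Y Z. sg (e * k) *\<^sub>R cod (\<lambda>A. \<psi> A Z) g k Y
      + sg (k * dg Y) *\<^sub>R cod (\<psi> Y) g k Z) e X"
proof (induction X arbitrary: \<psi> e g k)
  case (Cons x X)
  let ?d = "fst x"
  show ?case
  proof (cases "X = []")
    case True then show ?thesis by simp
  next
    case False
    let ?\<psi>1 = "\<lambda>Y Z. \<psi> (x # Y) Z" and ?\<psi>2 = "\<lambda>Y Z. \<psi> Y (x # Z)" and ?g = "\<lambda>Y. g (x # Y)"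
    have A: "cod (\<lambda>Y. unsh \<psi> e (x # Y)) g k X
        = sg (e * ?d) *\<^sub>R cod (unsh ?\<psi>1 e) g k X + cod (unsh ?\<psi>2 (e + ?d)) g k X"
      unfolding cod_lin_f[symmetric] by (rule cod_cong') simp
    have L: "cod (unsh \<psi> e) g k (x # X) =
       sg (e * (k + ?d)) *\<^sub>R unsh (\<lambda>Y Z. \<psi> ((k + ?d, g [x]) # Y) Z) e X
       + unsh (\<lambda>Y Z. sg (k * dg Y) *\<^sub>R \<psi> Y ((k + ?d, g [x]) # Z)) (e + ?d) X
       + sg (k * ?d) *\<^sub>R (sg (e * ?d) *\<^sub>R unsh (\<lambda>Y Z. sg (e * k) *\<^sub>R cod (\<lambda>A. \<psi> (x # A) Z) g k Y
            + sg (k * dg Y) *\<^sub>R cod (\<psi> (x # Y)) g k Z) e X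
          + unsh (\<lambda>Y Z. sg ((e + ?d) * k) *\<^sub>R cod (\<lambda>A. \<psi> A (x # Z)) g k Y
            + sg (k * dg Y) *\<^sub>R cod (\<lambda>B. \<psi> Y (x # B)) g k Z) (e + ?d) X)
       + unsh (\<lambda>Y Z. sg (e * (k + ?d)) *\<^sub>R cod (\<lambda>A. \<psi> A Z) ?g (k + ?d) Y
            + sg ((k + ?d) * dg Y) *\<^sub>R cod (\<psi> Y) ?g (k + ?d) Z) e X"
      using False A Cons.IH[of ?\<psi>1 e g k] Cons.IH[of ?\<psi>2 "e + ?d" g k] Cons.IH[of \<psi> e ?g "k + ?d"]
      by (simp add: unsh_shift algebra_simps)
    have S: "unsh (\<lambda>Y Z. sg ((k + ?d) * dg Y) *\<^sub>R cod (\<psi> Y) ?g (k + ?d) Z) e X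
        = unsh (\<lambda>Y Z. sg (k * dg Y) *\<^sub>R cod (\<psi> Y) ?g (k + ?d) Z) (e + ?d) X"
      unfolding unsh_shift by (simp add: add.assoc add.left_commute add.commute)
    show ?thesis
      unfolding L using False S
      by (simp add: unsh_add unsh_scale unsh_scale2 sg_norm scaleR_add_right mult.commute mult.left_commute
          add.commute add.left_commute scaleR_left_commute)
  qed
qed simp

text \<open>The only surviving splitting leaves the last entry alone on the right. With e = 0 every
  function on non-empty lists is thus of the form \<open>unsh\<close>, so that the coproduct rules
  apply to arbitrary \<phi>; this is the starting point of \<open>FF_eq_FX\<close>.\<close>

lemma unsh_last:
  "X \<noteq> [] \<Longrightarrow> unsh (\<lambda>A B. if length B = 1 then \<phi> (A @ B) else 0) e X = sg (e * dg (butlast X)) *\<^sub>R \<phi> X"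
proof (induction X arbitrary: \<phi> e)
  case (Cons x X)
  show ?case
  proof (cases "X = []")
    case True then show ?thesis by simp
  next
    case False
    have "unsh (\<lambda>A B. if length (x # B) = 1 then \<phi> (A @ x # B) else 0) (e + fst x) X = unsh (\<lambda>A B. 0) (e + fst x) X"
      by (rule unsh_cong') auto
    then show ?thesis
      using False Cons.IH[of "\<lambda>A. \<phi> (x # A)" e] by (simp add: sg_norm cong: if_cong)
  qed
qed simp

lemma unsh_first: "X \<noteq> [] \<Longrightarrow> unsh (\<lambda>A B. if A = [] then h B else 0) e X = h X"
proof (induction X arbitrary: h e)
  case (Cons x X)
  then show ?case using Cons.IH[of "\<lambda>B. h (x # B)" "e + fst x"] by auto
qed simp

lemma cod_vanish_g:
  assumes "closedV V" "mlin V f" "maps V g V e" "hom V X"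
    and "\<And>Z. \<lbrakk>hom V Z; Z \<noteq> []; length Z \<le> length X\<rbrakk> \<Longrightarrow> g Z = 0"
  shows "cod f g e X = 0"
proof (cases "X = []")
  case False
  have m: "maps V (\<lambda>Y. 0) V e" using maps_scale[OF assms(1,3), of 0] by simp
  have "cod f g e X = cod f (\<lambda>Y. 0) e X"
    by (rule cod_cong[of V]) (use assms in auto)
  then show ?thesis using cod_zero_g[OF assms(1,2) m assms(4)] by simp
qed simp

section \<open>Coderivations with only a unary component\<close>

definition unary :: "((int \<times> 'a) list \<Rightarrow> 'b::zero) \<Rightarrow> bool"
  where "unary g \<longleftrightarrow> (\<forall>X. length X \<noteq> 1 \<longrightarrow> g X = 0)"

lemma cod_unary_zero:
  assumes "closedV V" "mlin V f" "maps V g V e" "unary g" "snd x \<in> V (fst x)" "hom V X" "k = e + fst x"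
  shows "cod f (\<lambda>Y. g (x # Y)) k X = 0"
  by (rule cod_vanish_g[of V]) (use assms in \<open>auto simp: unary_def intro: maps_Cons\<close>)

lemma cod_unary_Cons:
  assumes "closedV V" "mlin V f" "maps V g V e" "unary g" "snd x \<in> V (fst x)" "hom V X"
  shows "cod f g e (x # X) = f ((e + fst x, g [x]) # X) + sg (e * fst x) *\<^sub>R cod (\<lambda>Y. f (x # Y)) g e X"
  using cod_unary_zero[OF assms refl] by simp

text \<open>A unary component acts on one entry at a time, so its coderivation can also be unfolded
  at the last entry. This is the end at which \<open>FX\<close> splits off its blocks.\<close>

lemma cod_unary_append:
  assumes "closedV V" "maps V g V e" "unary g" "mlin V f" "hom V X" "snd z \<in> V (fst z)"
  shows "cod f g e (X @ [z]) = cod (\<lambda>Y. f (Y @ [z])) g e X + sg (e * dg X) *\<^sub>R f (X @ [(e + fst z, g [z])])"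
  using assms(4-)
proof (induction X arbitrary: f)
  case (Cons x X)
  have "mlin V (\<lambda>Y. f (x # Y))" using Cons.prems by (auto intro: mlin_Cons)
  moreover have "mlin V (\<lambda>Y. f (Y @ [z]))" using Cons.prems(1,3)
    unfolding mlin_def by simp
  ultimately show ?case
    using Cons.prems Cons.IH[of "\<lambda>Y. f (x # Y)"] assms
    by (simp add: cod_unary_Cons[of V] sg_norm scaleR_add_right del: cod.simps)
qed simp

lemma cod_of_unary:
  assumes "unary f" "X \<noteq> []"
  shows "cod f g e X = f [(e + dg X, g X)]"
  using assms
proof (induction X arbitrary: g e)
  case (Cons x X)
  show ?case
  proof (cases "X = []")
    case False
    have "cod (\<lambda>Y. f (x # Y)) g e X = cod (\<lambda>Y. 0) g e X"
      by (rule cod_cong') (use Cons.prems in \<open>auto simp: unary_def\<close>)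
    moreover have "f ((e + fst x, g [x]) # X) = 0" using Cons.prems False by (simp add: unary_def)
    ultimately show ?thesis using Cons False by (simp add: add.assoc)
  qed simp
qed simp

lemma cod_mem:
  assumes "subspace T" "\<And>Z. \<lbrakk>hom V Z; Z \<noteq> []; dg Z = dg X + k\<rbrakk> \<Longrightarrow> f Z \<in> T"
    and "maps V g V k" "hom V X"
  shows "cod f g k X \<in> T"
  using assms(2-)
proof (induction X arbitrary: f g k)
  case Nil then show ?case using assms(1) by (simp add: subspace_0)
next
  case (Cons x X)
  have x: "snd x \<in> V (fst x)" "hom V X" using Cons.prems by simp_all
  have "f ((k + fst x, g [x]) # X) \<in> T"
    by (rule Cons.prems(1)) (use x maps_single[OF Cons.prems(2)] in auto)
  moreover have "cod (\<lambda>Y. f (x # Y)) g k X \<in> T"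
    by (rule Cons.IH) (use x Cons.prems in auto)
  moreover have "cod f (\<lambda>Y. g (x # Y)) (k + fst x) X \<in> T"
    by (rule Cons.IH) (use x Cons.prems in \<open>auto intro: maps_Cons\<close>)
  ultimately show ?case using assms(1) by (simp add: subspace_add subspace_scale)
qed

text \<open>The maps in question are total functions, but they are known to be linear only on
  sections, on forms of a fixed degree or on a fibre.\<close>

definition lin_on :: "'a::real_vector set \<Rightarrow> ('a \<Rightarrow> 'b::real_vector) \<Rightarrow> bool" where
  "lin_on T h \<longleftrightarrow> (\<forall>u\<in>T. \<forall>v\<in>T. \<forall>c. h (c *\<^sub>R u + v) = c *\<^sub>R h u + h v)"

lemma lin_on_simps:
  assumes "subspace T" "lin_on T h"
  shows "h 0 = 0" "u \<in> T \<Longrightarrow> h (c *\<^sub>R u) = c *\<^sub>R h u" "u \<in> T \<Longrightarrow> v \<in> T \<Longrightarrow> h (u + v) = h u + h v"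
    "u \<in> T \<Longrightarrow> v \<in> T \<Longrightarrow> h (u - v) = h u - h v"
proof -
  have z: "0 \<in> T" using assms(1) by (rule subspace_0)
  have l: "h (c *\<^sub>R u + v) = c *\<^sub>R h u + h v" if "u \<in> T" "v \<in> T" for u v c
    using assms(2) that by (simp add: lin_on_def)
  show h0: "h 0 = 0" using l[OF z z, of 1] by simp
  show "u \<in> T \<Longrightarrow> h (c *\<^sub>R u) = c *\<^sub>R h u" using l[of u 0 c] z h0 by simp
  show "u \<in> T \<Longrightarrow> v \<in> T \<Longrightarrow> h (u + v) = h u + h v" using l[of u v 1] by simp
  show "u \<in> T \<Longrightarrow> v \<in> T \<Longrightarrow> h (u - v) = h u - h v" using l[of v u "-1"] by simp
qed

lemma lin_onD: "\<lbrakk>lin_on T h; u \<in> T; v \<in> T\<rbrakk> \<Longrightarrow> h (c *\<^sub>R u + v) = c *\<^sub>R h u + h v"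
  by (simp add: lin_on_def)

lemma cod_apply:
  assumes T: "subspace T" "lin_on T h" and "\<And>Z. \<lbrakk>hom V Z; Z \<noteq> []; dg Z = dg X + k\<rbrakk> \<Longrightarrow> f Z \<in> T"
    and "maps V g V k" "hom V X"
  shows "cod (\<lambda>Z. h (f Z)) g k X = h (cod f g k X)"
  using assms(3-)
proof (induction X arbitrary: f g k)
  case Nil then show ?case using lin_on_simps(1)[OF T] by simp
next
  case (Cons x X)
  have x: "snd x \<in> V (fst x)" "hom V X" using Cons.prems by simp_all
  have m1: "f ((k + fst x, g [x]) # X) \<in> T"
    by (rule Cons.prems(1)) (use x maps_single[OF Cons.prems(2)] in auto)
  have m2: "cod (\<lambda>Y. f (x # Y)) g k X \<in> T"
    by (rule cod_mem[of T V]) (use T x Cons.prems in auto)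
  have m3: "cod f (\<lambda>Y. g (x # Y)) (k + fst x) X \<in> T"
    by (rule cod_mem[of T V]) (use T x Cons.prems in \<open>auto intro: maps_Cons\<close>)
  have 1: "cod (\<lambda>Y. h (f (x # Y))) g k X = h (cod (\<lambda>Y. f (x # Y)) g k X)"
    by (rule Cons.IH) (use x Cons.prems in auto)
  have 2: "cod (\<lambda>Y. h (f Y)) (\<lambda>Y. g (x # Y)) (k + fst x) X = h (cod f (\<lambda>Y. g (x # Y)) (k + fst x) X)"
    by (rule Cons.IH) (use x Cons.prems in \<open>auto intro: maps_Cons\<close>)
  show ?case
    using 1 2 m1 m2 m3 T by (simp add: lin_on_simps[OF T] subspace_add subspace_scale)
qed

lemma unsh_mem:
  assumes "subspace T" "\<And>Y Z. hom V Y \<Longrightarrow> hom V Z \<Longrightarrow> Z \<noteq> [] \<Longrightarrow> length Y + length Z = length X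
      \<Longrightarrow> dg Y + dg Z = dg X \<Longrightarrow> \<psi> Y Z \<in> T" and "hom V X"
  shows "unsh \<psi> e X \<in> T"
  using assms(2-)
proof (induction X arbitrary: \<psi> e)
  case Nil then show ?case using assms(1) by (simp add: subspace_0)
next
  case (Cons x X)
  show ?case
  proof (cases "X = []")
    case True then show ?thesis using Cons.prems by simp
  next
    case False
    have "unsh (\<lambda>Y Z. \<psi> (x # Y) Z) e X \<in> T"
      by (rule Cons.IH) (use Cons.prems in auto)
    moreover have "unsh (\<lambda>Y Z. \<psi> Y (x # Z)) (e + fst x) X \<in> T"
      by (rule Cons.IH) (use Cons.prems in auto)
    ultimately show ?thesis using False assms(1) by (simp add: subspace_add subspace_scale)
  qed
qed

lemma unsh_apply: "linear h \<Longrightarrow> unsh (\<lambda>Y Z. h (\<psi> Y Z)) e X = h (unsh \<psi> e X)"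
  by (induction X arbitrary: \<psi> e) (simp_all add: linear_0 linear_add linear_scale)

definition mapv :: "('a \<Rightarrow> 'b) \<Rightarrow> (int \<times> 'a) list \<Rightarrow> (int \<times> 'b) list"
  where "mapv p = map (\<lambda>x. (fst x, p (snd x)))"

lemma mapv_simps [simp]:
  "mapv p [] = []" "mapv p (x # X) = (fst x, p (snd x)) # mapv p X" "mapv p (X @ Y) = mapv p X @ mapv p Y"
  "mapv p X = [] \<longleftrightarrow> X = []" "length (mapv p X) = length X" "dg (mapv p X) = dg X"
  by (simp_all add: mapv_def comp_def)

lemma unsh_mapv: "unsh \<psi> e (mapv p X) = unsh (\<lambda>Y Z. \<psi> (mapv p Y) (mapv p Z)) e X"
  by (induction X arbitrary: \<psi> e) simp_all

text \<open>Applied to the evaluation of forms on no arguments: it carries operators on forms of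
  degree 0 over to operators on sections.\<close>

lemma cod_mapv:
  assumes "linear p'" "\<And>X. X \<noteq> [] \<Longrightarrow> p' (F X) = f (mapv p X)" "\<And>X. X \<noteq> [] \<Longrightarrow> p (G X) = g (mapv p X)"
  shows "p' (cod F G e X) = cod f g e (mapv p X)"
  using assms(2,3)
proof (induction X arbitrary: F f G g e)
  case (Cons x X)
  have "p' (cod (\<lambda>Y. F (x # Y)) G e X) = cod (\<lambda>Y. f ((fst x, p (snd x)) # Y)) g e (mapv p X)"
    by (rule Cons.IH) (simp_all add: Cons.prems)
  moreover have "p' (cod F (\<lambda>Y. G (x # Y)) (e + fst x) X)
      = cod f (\<lambda>Y. g ((fst x, p (snd x)) # Y)) (e + fst x) (mapv p X)"
    by (rule Cons.IH) (simp_all add: Cons.prems)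
  ultimately show ?case
    using assms(1) by (simp add: linear_add linear_scale Cons.prems)
qed (simp add: linear_0 assms(1))

text \<open>\<open>\<phi>\<close> composed with the coalgebra morphism generated by \<open>f\<close>. The first argument of \<open>Fx\<close> is fuel; each step splits off
  the block containing the last entry.\<close>

primrec Fx :: "((int \<times> 'a) list \<Rightarrow> 'a) \<Rightarrow> nat \<Rightarrow> ((int \<times> 'a) list \<Rightarrow> 'b::real_vector)
    \<Rightarrow> (int \<times> 'a) list \<Rightarrow> 'b" where
  "Fx f 0 \<phi> X = \<phi> []"
| "Fx f (Suc n) \<phi> X = (if X = [] then \<phi> []
     else unsh (\<lambda>Y Z. Fx f n (\<lambda>W. \<phi> (W @ [(dg Z, f Z)])) Y) 0 X)"

definition FX :: "((int \<times> 'a) list \<Rightarrow> 'a) \<Rightarrow> ((int \<times> 'a) list \<Rightarrow> 'b::real_vector)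
    \<Rightarrow> (int \<times> 'a) list \<Rightarrow> 'b"
  where "FX f \<phi> X = Fx f (length X) \<phi> X"

lemma Fx_fuel:
  fixes \<phi> :: "(int \<times> 'a) list \<Rightarrow> 'b::real_vector"
  shows "length X \<le> n \<Longrightarrow> Fx f n \<phi> X = FX f \<phi> X"
proof -
  have "length X \<le> n \<Longrightarrow> length X \<le> m \<Longrightarrow> Fx f n \<phi> X = Fx f m \<phi> X" for m
  proof (induction n arbitrary: m \<phi> X)
    case 0 then show ?case by (cases m) simp_all
  next
    case (Suc n)
    show ?case
    proof (cases m)
      case 0 then show ?thesis using Suc by simp
    next
      case (Suc l)
      have "Fx f n \<phi>' Y = Fx f l \<phi>' Y" if "length Y + length Z = length X" "Z \<noteq> []" 
        for Y Z :: "(int \<times> 'a) list" and \<phi>' :: "(int \<times> 'a) list \<Rightarrow> 'b"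
      proof -
        have "length Z > 0" using that by simp
        then show ?thesis using that Suc.prems Suc by (intro Suc.IH) linarith+
      qed
      then show ?thesis using Suc by (auto intro!: unsh_cong')
    qed
  qed
  from this[of "length X"] show "length X \<le> n \<Longrightarrow> Fx f n \<phi> X = FX f \<phi> X" by (simp add: FX_def)
qed

lemma FX_Nil [simp]: "FX f \<phi> [] = \<phi> []"
  by (simp add: FX_def)

lemma FX_step:
  fixes \<phi> :: "(int \<times> 'a) list \<Rightarrow> 'b::real_vector"
  assumes "X \<noteq> []"
  shows "FX f \<phi> X = unsh (\<lambda>Y Z. FX f (\<lambda>W. \<phi> (W @ [(dg Z, f Z)])) Y) 0 X"
proof -
  obtain n where n: "length X = Suc n" using assms by (cases X) auto
  have "Fx f n \<phi>' Y = FX f \<phi>' Y" if "length Y + length Z = length X" "Z \<noteq> []" 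
        for Y Z :: "(int \<times> 'a) list" and \<phi>' :: "(int \<times> 'a) list \<Rightarrow> 'b"
  proof -
    have "length Z > 0" using that by simp
    then show ?thesis using that n by (intro Fx_fuel) linarith
  qed
  then show ?thesis using assms n by (auto simp: FX_def[of f \<phi> X] intro!: unsh_cong')
qed

lemma FX_cong:
  assumes "\<And>Z. \<lbrakk>hom V Z; (Z = [] \<longleftrightarrow> X = []); length Z \<le> length X; dg Z = dg X\<rbrakk> \<Longrightarrow> \<phi> Z = \<phi>' Z"
    and "maps V f V 0" "hom V X"
  shows "FX f \<phi> X = FX f \<phi>' X"
  using assms
proof (induction "length X" arbitrary: X \<phi> \<phi>' rule: less_induct)
  case less
  show ?case
  proof (cases "X = []")
    case True then show ?thesis using less.prems by simp
  next
    case False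
    have "FX f (\<lambda>W. \<phi> (W @ [(dg Z, f Z)])) Y = FX f (\<lambda>W. \<phi>' (W @ [(dg Z, f Z)])) Y"
      if "hom V Y" "hom V Z" "Z \<noteq> []" "length Y + length Z = length X" "dg Y + dg Z = dg X" for Y Z
    proof (rule less.hyps)
      have "length Z > 0" using that by simp
      then show "length Y < length X" using that by linarith
      fix W assume "hom V W" "length W \<le> length Y" "dg W = dg Y"
      moreover have "f Z \<in> V (dg Z)" using less.prems(2) that by (auto simp: maps_def)
      moreover have "Suc (length W) \<le> length X"
        using \<open>length Z > 0\<close> \<open>length W \<le> length Y\<close> that(4) by linarith
      ultimately show "\<phi> (W @ [(dg Z, f Z)]) = \<phi>' (W @ [(dg Z, f Z)])"
        using that False by (intro less.prems(1)) auto
    qed (use less.prems that in auto)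
    then show ?thesis unfolding FX_step[OF False] by (rule unsh_cong[of V]) (use less.prems in auto)
  qed
qed

lemma FX_mem:
  assumes "subspace T" "\<And>Z. \<lbrakk>hom V Z; (Z = [] \<longleftrightarrow> X = []); length Z \<le> length X; dg Z = dg X\<rbrakk> \<Longrightarrow> \<phi> Z \<in> T"
    and "maps V f V 0" "hom V X"
  shows "FX f \<phi> X \<in> T"
  using assms(2-)
proof (induction "length X" arbitrary: X \<phi> rule: less_induct)
  case less
  show ?case
  proof (cases "X = []")
    case True then show ?thesis using less.prems by simp
  next
    case False
    have "FX f (\<lambda>W. \<phi> (W @ [(dg Z, f Z)])) Y \<in> T"
      if "hom V Y" "hom V Z" "Z \<noteq> []" "length Y + length Z = length X" "dg Y + dg Z = dg X" for Y Z
    proof (rule less.hyps)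
      have "length Z > 0" using that by simp
      then show "length Y < length X" using that by linarith
      fix W assume "hom V W" "length W \<le> length Y" "dg W = dg Y"
      moreover have "f Z \<in> V (dg Z)" using less.prems(2) that by (auto simp: maps_def)
      moreover have "Suc (length W) \<le> length X"
        using \<open>length Z > 0\<close> \<open>length W \<le> length Y\<close> that(4) by linarith
      ultimately show "\<phi> (W @ [(dg Z, f Z)]) \<in> T"
        using that False by (intro less.prems(1)) auto
    qed (use less.prems that in auto)
    then show ?thesis unfolding FX_step[OF False]
      by (intro unsh_mem[of T V]) (use less.prems assms(1) in auto)
  qed
qed

lemma FX_lin:
  fixes \<phi> :: "(int \<times> 'a) list \<Rightarrow> 'b::real_vector"
  shows "FX f (\<lambda>Z. c *\<^sub>R \<phi> Z + \<phi>' Z) X = c *\<^sub>R FX f \<phi> X + FX f \<phi>' X"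
proof (induction "length X" arbitrary: X \<phi> \<phi>' rule: less_induct)
  case less
  show ?case
  proof (cases "X = []")
    case False
    have *: "length Y < length X" if "Z \<noteq> []" "length Y + length Z = length X" for Y Z :: "(int \<times> 'a) list"
    proof -
      have "length Z > 0" using that by simp
      then show ?thesis using that by linarith
    qed
    have "unsh (\<lambda>Y Z. FX f (\<lambda>W. c *\<^sub>R \<phi> (W @ [(dg Z, f Z)]) + \<phi>' (W @ [(dg Z, f Z)])) Y) 0 X
      = unsh (\<lambda>Y Z. c *\<^sub>R FX f (\<lambda>W. \<phi> (W @ [(dg Z, f Z)])) Y + FX f (\<lambda>W. \<phi>' (W @ [(dg Z, f Z)])) Y) 0 X"
      by (rule unsh_cong') (use less.hyps less.prems * in auto)
    then show ?thesis using False by (simp add: FX_step unsh_lin)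
  qed simp
qed

lemma FX_zero [simp]: "FX f (\<lambda>Z. 0) X = 0"
  using FX_lin[of f 1 "\<lambda>_. 0" "\<lambda>_. 0" X] by simp

lemma FX_scale: "FX f (\<lambda>Z. c *\<^sub>R \<phi> Z) X = c *\<^sub>R FX f \<phi> X"
  using FX_lin[of f c \<phi> "\<lambda>_. 0"] by simp

lemma FX_add: "FX f (\<lambda>Z. \<phi> Z + \<phi>' Z) X = FX f \<phi> X + FX f \<phi>' X"
  using FX_lin[of f 1 \<phi> \<phi>'] by simp

lemma FX_apply:
  fixes \<phi> :: "(int \<times> 'a) list \<Rightarrow> 'b::real_vector"
  shows "linear h \<Longrightarrow> FX f (\<lambda>Z. h (\<phi> Z)) X = h (FX f \<phi> X)"
proof (induction "length X" arbitrary: X \<phi> rule: less_induct)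
  case less
  show ?case
  proof (cases "X = []")
    case False
    have *: "length Y < length X" if "Z \<noteq> []" "length Y + length Z = length X" for Y Z :: "(int \<times> 'a) list"
    proof -
      have "length Z > 0" using that by simp
      then show ?thesis using that by linarith
    qed
    have "unsh (\<lambda>Y Z. FX f (\<lambda>W. h (\<phi> (W @ [(dg Z, f Z)]))) Y) 0 X
      = unsh (\<lambda>Y Z. h (FX f (\<lambda>W. \<phi> (W @ [(dg Z, f Z)])) Y)) 0 X"
      by (rule unsh_cong') (use less.hyps less.prems * in auto)
    then show ?thesis using False by (simp add: FX_step unsh_apply[OF less.prems])
  qed simp
qed

lemma FX_unary:
  assumes "unary \<phi>" "X \<noteq> []"
  shows "FX f \<phi> X = \<phi> [(dg X, f X)]"
proof -
  have "FX f (\<lambda>W. \<phi> (W @ [(dg Z, f Z)])) Y = (if Y = [] then \<phi> [(dg Z, f Z)] else 0)" for Y Z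
  proof (cases "Y = []")
    case False
    have "FX f (\<lambda>W. \<phi> (W @ [(dg Z, f Z)])) Y = FX f (\<lambda>W. 0) Y"
      by (rule FX_cong[of "\<lambda>_. UNIV"]) (use False assms in \<open>auto simp: unary_def\<close>)
    then show ?thesis using False by simp
  qed simp
  then show ?thesis using assms(2) by (simp add: FX_step unsh_first[where h = "\<lambda>Z. \<phi> [(dg Z, f Z)]"])
qed

text \<open>Keeps track of the entries instead of the degrees: \<open>FX_zv\<close> has to know in
  which block a zero entry ends up.\<close>

lemma unsh_cong_set:
  assumes "\<And>Y Z. \<lbrakk>Z \<noteq> []; length Y + length Z = length X; set Y \<union> set Z = set X\<rbrakk> \<Longrightarrow> \<psi> Y Z = \<psi>' Y Z"
  shows "unsh \<psi> e X = unsh \<psi>' e X"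
  using assms
proof (induction X arbitrary: \<psi> \<psi>' e)
  case (Cons x X)
  show ?case
  proof (cases "X = []")
    case True then show ?thesis using Cons.prems by simp
  next
    case False
    have "unsh (\<lambda>Y Z. \<psi> (x # Y) Z) e X = unsh (\<lambda>Y Z. \<psi>' (x # Y) Z) e X"
      by (rule Cons.IH) (auto intro!: Cons.prems)
    moreover have "unsh (\<lambda>Y Z. \<psi> Y (x # Z)) (e + fst x) X = unsh (\<lambda>Y Z. \<psi>' Y (x # Z)) (e + fst x) X"
      by (rule Cons.IH) (auto intro!: Cons.prems)
    ultimately show ?thesis using False by simp
  qed
qed simp

text \<open>A weak consequence of multilinearity that passes to \<open>FX f \<phi>\<close> directly.
  It is all that the contraction argument asks for, where it disposes of entries of negative degree,
  which are zero.\<close>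

definition zv :: "(int \<Rightarrow> 'a::zero set) \<Rightarrow> ((int \<times> 'a) list \<Rightarrow> 'b::zero) \<Rightarrow> bool"
  where "zv V f \<longleftrightarrow> (\<forall>X. hom V X \<longrightarrow> 0 \<in> snd ` set X \<longrightarrow> f X = 0)"

lemma zvD: "\<lbrakk>zv V f; hom V X; 0 \<in> snd ` set X\<rbrakk> \<Longrightarrow> f X = 0"
  by (simp add: zv_def)

lemma mlin_zv:
  assumes "mlin V f" shows "zv V f"
  unfolding zv_def
proof (intro allI impI)
  fix X assume X: "hom V X" "0 \<in> snd ` set X"
  then obtain x where x: "x \<in> set X" "snd x = 0" by auto
  then obtain A B where AB: "X = A @ x # B" by (meson split_list)
  have "x = (fst x, 0)" using x by (metis prod.collapse)
  then show "f X = 0" using X AB mlin_zero[OF assms, of A B "fst x"] by (metis hom_simps(2,3) snd_conv)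
qed

lemma FX_zv:
  assumes f: "zv V f" "maps V f V 0" and "zv V \<phi>"
  shows "zv V (FX f \<phi>)"
proof -
  have "FX f \<phi> X = 0" if "hom V X" "0 \<in> snd ` set X" for X
    using assms(3) that
  proof (induction "length X" arbitrary: X \<phi> rule: less_induct)
    case less
    then have ne: "X \<noteq> []" by auto
    have "FX f (\<lambda>W. \<phi> (W @ [(dg Z, f Z)])) Y = 0"
      if YZ: "Z \<noteq> []" "length Y + length Z = length X" "set Y \<union> set Z = set X" for Y Z
    proof -
      have h: "hom V Y" "hom V Z" using less.prems(2) YZ(3) unfolding hom_def by auto
      have fZ: "f Z \<in> V (dg Z)" using f(2) h YZ(1) by (auto simp: maps_def)
      have l: "length Y < length X" using YZ(1,2) by (metis length_greater_0_conv less_add_same_cancel1)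
      show ?thesis
      proof (cases "0 \<in> snd ` set Y")
        case True
        show ?thesis
          by (rule less.hyps[OF l _ h(1) True]) (use less.prems(1) fZ in \<open>auto simp: zv_def\<close>)
      next
        case False
        then have "0 \<in> snd ` set Z" using less.prems(3) YZ(3) by (metis UnE image_Un)
        then have "f Z = 0" using f(1) h(2) by (simp add: zvD)
        then have "FX f (\<lambda>W. \<phi> (W @ [(dg Z, f Z)])) Y = FX f (\<lambda>W. 0) Y"
          by (intro FX_cong[of V]) (use f h fZ in \<open>auto intro!: zvD[OF less.prems(1)]\<close>)
        then show ?thesis by simp
      qed
    qed
    then have "unsh (\<lambda>Y Z. FX f (\<lambda>W. \<phi> (W @ [(dg Z, f Z)])) Y) 0 X = unsh (\<lambda>Y Z. 0) 0 X"
      by (intro unsh_cong_set) auto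
    then show ?case using ne by (simp add: FX_step)
  qed
  then show ?thesis by (auto simp: zv_def)
qed

lemma FX_mapv:
  assumes "linear p'" "\<And>X. p' (\<Phi> X) = \<phi> (mapv p X)" and f: "\<And>X. X \<noteq> [] \<Longrightarrow> p (F X) = f (mapv p X)"
  shows "p' (FX F \<Phi> X) = FX f \<phi> (mapv p X)"
  using assms(2)
proof (induction "length X" arbitrary: X \<Phi> \<phi> rule: less_induct)
  case less
  show ?case
  proof (cases "X = []")
    case True then show ?thesis using less.prems[of "[]"] by simp
  next
    case False
    have "FX f (\<lambda>W. \<phi> (W @ [(dg Z, f (mapv p Z))])) (mapv p Y) = p' (FX F (\<lambda>W. \<Phi> (W @ [(dg Z, F Z)])) Y)"
      if YZ: "Z \<noteq> []" "length Y + length Z = length X" for Y Z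
    proof -
      have l: "length Y < length X" using YZ(1,2) by (metis length_greater_0_conv less_add_same_cancel1)
      show ?thesis
        by (rule less.hyps[OF l, symmetric]) (use YZ in \<open>simp add: less.prems f\<close>)
    qed
    then have "unsh (\<lambda>Y Z. FX f (\<lambda>W. \<phi> (W @ [(dg Z, f (mapv p Z))])) (mapv p Y)) 0 X
        = unsh (\<lambda>Y Z. p' (FX F (\<lambda>W. \<Phi> (W @ [(dg Z, F Z)])) Y)) 0 X"
      by (intro unsh_cong')
    then show ?thesis using False by (simp add: FX_step unsh_mapv unsh_apply[OF assms(1)])
  qed
qed

lemma mlin_snoc: "mlin V \<phi> \<Longrightarrow> snd z \<in> V (fst z) \<Longrightarrow> mlin V (\<lambda>W. \<phi> (W @ [z]))"
  unfolding mlin_def by simp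

text \<open>The coalgebra morphism generated by \<open>f\<close> commutes with a derivation as soon
  as its components do. When the last block is split off, \<open>cod_unsh\<close> distributes the
  derivation over the two parts, and \<open>fg\<close> moves it from the value of the block to its
  entries. The application is to contractions.\<close>

lemma FX_cod_unary:
  assumes V: "\<And>d. subspace (V d)" and f: "mlin V f" "maps V f V 0"
    and g: "mlin V g" "maps V g V k" "unary g"
    and fg: "\<And>Z. hom V Z \<Longrightarrow> Z \<noteq> [] \<Longrightarrow> g [(dg Z, f Z)] = cod f g k Z"
    and "mlin V \<phi>" "hom V X"
  shows "FX f (cod \<phi> g k) X = cod (FX f \<phi>) g k X"
  using assms(8,9)
proof (induction "length X" arbitrary: X \<phi> rule: less_induct)
  case less
  have cV: "closedV V" using V unfolding closedV_def by (auto intro: subspace_add subspace_scale)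
  show ?case
  proof (cases "X = []")
    case False
    let ?\<psi> = "\<lambda>Y Z. FX f (\<lambda>W. \<phi> (W @ [(dg Z, f Z)])) Y"
    have "FX f (\<lambda>W. cod \<phi> g k (W @ [(dg Z, f Z)])) Y
        = sg (0 * k) *\<^sub>R cod (\<lambda>A. ?\<psi> A Z) g k Y + sg (k * dg Y) *\<^sub>R cod (?\<psi> Y) g k Z"
      if YZ: "hom V Y" "hom V Z" "Z \<noteq> []" "length Y + length Z = length X" for Y Z
    proof -
      have l: "length Y < length X" using YZ(3,4) by (metis length_greater_0_conv less_add_same_cancel1)
      have fZ: "f Z \<in> V (dg Z)" using f(2) YZ by (auto simp: maps_def)
      let ?z = "(dg Z, f Z)" and ?z' = "(k + dg Z, cod f g k Z)"
      have cZ: "cod f g k Z \<in> V (k + dg Z)"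
        by (rule mapsD[OF maps_cod[OF cV f(2) g(2) refl] YZ(3,2)]) simp
      have "FX f (\<lambda>W. cod \<phi> g k (W @ [?z])) Y
          = FX f (\<lambda>W. cod (\<lambda>W'. \<phi> (W' @ [?z])) g k W + sg (k * dg Y) *\<^sub>R \<phi> (W @ [?z'])) Y"
        by (rule FX_cong[of V])
          (use cod_unary_append[OF cV g(2,3) less.prems(1), of _ ?z] fg[OF YZ(2,3)] f YZ fZ in auto)
      also have "\<dots> = FX f (cod (\<lambda>W'. \<phi> (W' @ [?z])) g k) Y + sg (k * dg Y) *\<^sub>R FX f (\<lambda>W. \<phi> (W @ [?z'])) Y"
        by (simp add: FX_add FX_scale)
      also have "FX f (cod (\<lambda>W'. \<phi> (W' @ [?z])) g k) Y = cod (\<lambda>A. ?\<psi> A Z) g k Y"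
        by (rule less.hyps[OF l mlin_snoc YZ(1)]) (use less.prems fZ in auto)
      also have "FX f (\<lambda>W. \<phi> (W @ [?z'])) Y = cod (?\<psi> Y) g k Z"
      proof -
        \<comment> \<open>The expression is linear in the value placed last, so a \<open>cod\<close>
          acting on the entries of the last block can be pulled through it.\<close>
        let ?H = "\<lambda>u. FX f (\<lambda>W. \<phi> (W @ [(k + dg Z, u)])) Y"
        have H: "lin_on (V (k + dg Z)) ?H"
          unfolding lin_on_def FX_lin[symmetric]
          by (intro ballI allI FX_cong[of V]) (use f YZ less.prems(1) in \<open>auto simp: mlinD\<close>)
        have "cod (?\<psi> Y) g k Z = cod (\<lambda>Z'. ?H (f Z')) g k Z"
          by (rule cod_cong') (simp add: add.commute)
        also have "\<dots> = ?H (cod f g k Z)"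
          by (rule cod_apply[OF V H _ g(2) YZ(2)]) (use f(2) in \<open>auto simp: maps_def add.commute\<close>)
        finally show ?thesis by simp
      qed
      finally show ?thesis by simp
    qed
    then have "unsh (\<lambda>Y Z. FX f (\<lambda>W. cod \<phi> g k (W @ [(dg Z, f Z)])) Y) 0 X
       = cod (unsh ?\<psi> 0) g k X"
      unfolding cod_unsh using less.prems(2) by (intro unsh_cong[of V]) auto
    also have "\<dots> = cod (FX f \<phi>) g k X"
      by (rule cod_cong') (simp add: FX_step)
    finally show ?thesis using False by (simp add: FX_step)
  qed simp
qed

section \<open>The intertwiner given by two families of coderivations\<close>

primrec FFn :: "('a \<Rightarrow> (int \<times> 'a) list \<Rightarrow> 'a) \<Rightarrow> ('a \<Rightarrow> (int \<times> 'a) list \<Rightarrow> 'a) \<Rightarrow> nat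
    \<Rightarrow> ((int \<times> 'a) list \<Rightarrow> 'b::real_vector) \<Rightarrow> (int \<times> 'a) list \<Rightarrow> 'b" where
  "FFn m n 0 \<phi> X = \<phi> []"
| "FFn m n (Suc k) \<phi> X = (case X of [] \<Rightarrow> \<phi> [] | x # Y \<Rightarrow>
     FFn m n k (\<lambda>Z. \<phi> (x # Z) + cod \<phi> (m (snd x)) 0 Z) Y - cod (FFn m n k \<phi>) (n (snd x)) 0 Y)"

text \<open>\<open>FF m n \<phi>\<close> is \<phi> composed with the recursive \<open>F\<close> of
  the overview. What is applied after \<open>F\<close> becomes an operation on \<phi>, what is
  applied before it acts on the list through \<open>cod\<close>. The recursion runs under
  \<open>cod\<close>, on lists that are not sublists of the given one, which is the reason for the
  fuel in \<open>FFn\<close>.\<close>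

definition FF :: "('a \<Rightarrow> (int \<times> 'a) list \<Rightarrow> 'a) \<Rightarrow> ('a \<Rightarrow> (int \<times> 'a) list \<Rightarrow> 'a)
    \<Rightarrow> ((int \<times> 'a) list \<Rightarrow> 'b::real_vector) \<Rightarrow> (int \<times> 'a) list \<Rightarrow> 'b"
  where "FF m n \<phi> X = FFn m n (length X) \<phi> X"

lemma FFn_fuel:
  fixes \<phi> :: "(int \<times> 'a) list \<Rightarrow> 'b::real_vector"
  shows "length X \<le> k \<Longrightarrow> FFn m n k \<phi> X = FF m n \<phi> X"
proof -
  have "length X \<le> k \<Longrightarrow> length X \<le> l \<Longrightarrow> FFn m n k \<phi> X = FFn m n l \<phi> X" for l
  proof (induction k arbitrary: l \<phi> X)
    case 0 then show ?case by (cases l) simp_all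
  next
    case (Suc k)
    show ?case
    proof (cases X)
      case Nil then show ?thesis by (cases l) simp_all
    next
      case (Cons x Y)
      then obtain l' where l: "l = Suc l'" using Suc.prems by (cases l) auto
      have "cod (FFn m n k \<phi>) (n (snd x)) 0 Y = cod (FFn m n l' \<phi>) (n (snd x)) 0 Y"
        by (rule cod_cong', rule Suc.IH) (use Suc.prems l Cons in auto)
      moreover have "FFn m n k \<phi>' Y = FFn m n l' \<phi>' Y" for \<phi>' :: "(int \<times> 'a) list \<Rightarrow> 'b"
        by (rule Suc.IH) (use Suc.prems l Cons in auto)
      ultimately show ?thesis using Cons l by simp
    qed
  qed
  from this[of "length X"] show "length X \<le> k \<Longrightarrow> FFn m n k \<phi> X = FF m n \<phi> X" by (simp add: FF_def)
qed

lemma FF_Nil [simp]: "FF m n \<phi> [] = \<phi> []"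
  by (simp add: FF_def)

lemma FF_Cons: "FF m n \<phi> (x # X)
    = FF m n (\<lambda>Z. \<phi> (x # Z) + cod \<phi> (m (snd x)) 0 Z) X - cod (FF m n \<phi>) (n (snd x)) 0 X"
proof -
  have "cod (FFn m n (length X) \<phi>) (n (snd x)) 0 X = cod (FF m n \<phi>) (n (snd x)) 0 X"
    by (rule cod_cong') (simp add: FFn_fuel)
  then show ?thesis by (simp add: FF_def[of m n \<phi> "x # X"] FFn_fuel)
qed

lemma FF_lin: "FF m n (\<lambda>Z. c *\<^sub>R \<phi> Z + \<phi>' Z) X = c *\<^sub>R FF m n \<phi> X + FF m n \<phi>' X"
proof (induction "length X" arbitrary: X \<phi> \<phi>' rule: less_induct)
  case less
  show ?case
  proof (cases X)
    case (Cons x Y)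
    let ?M = "\<lambda>\<phi> Z. \<phi> (x # Z) + cod \<phi> (m (snd x)) 0 Z"
    have "FF m n (\<lambda>Z. c *\<^sub>R ?M \<phi> Z + ?M \<phi>' Z) Y = c *\<^sub>R FF m n (?M \<phi>) Y + FF m n (?M \<phi>') Y"
      by (rule less.hyps) (simp add: Cons)
    moreover have "?M (\<lambda>Z. c *\<^sub>R \<phi> Z + \<phi>' Z) = (\<lambda>Z. c *\<^sub>R ?M \<phi> Z + ?M \<phi>' Z)"
      unfolding cod_lin_f by (simp add: algebra_simps)
    moreover have "cod (FF m n (\<lambda>Z. c *\<^sub>R \<phi> Z + \<phi>' Z)) (n (snd x)) 0 Y
        = cod (\<lambda>Z. c *\<^sub>R FF m n \<phi> Z + FF m n \<phi>' Z) (n (snd x)) 0 Y"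
      by (rule cod_cong', rule less.hyps) (simp add: Cons)
    ultimately show ?thesis unfolding Cons FF_Cons by (simp only: cod_lin_f) (simp add: algebra_simps)
  qed simp
qed

lemma FF_zero [simp]: "FF m n (\<lambda>Z. 0) X = 0"
  using FF_lin[of m n 1 "\<lambda>_. 0" "\<lambda>_. 0" X] by simp

lemma FF_scale: "FF m n (\<lambda>Z. c *\<^sub>R \<phi> Z) X = c *\<^sub>R FF m n \<phi> X"
  using FF_lin[of m n c \<phi> "\<lambda>_. 0"] by simp

lemma FF_add: "FF m n (\<lambda>Z. \<phi> Z + \<phi>' Z) X = FF m n \<phi> X + FF m n \<phi>' X"
  using FF_lin[of m n 1 \<phi> \<phi>'] by simp

lemma FF_diff: "FF m n (\<lambda>Z. \<phi> Z - \<phi>' Z) X = FF m n \<phi> X - FF m n \<phi>' X"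
  using FF_lin[of m n "-1" \<phi>' \<phi>] by simp

text \<open>The two operations act on different tensor factors.\<close>

lemma FF_cod_swap: "FF m n (\<lambda>A. cod (G A) g e B) A = cod (\<lambda>B. FF m n (\<lambda>A. G A B) A) g e B"
  by (induction B arbitrary: G g e) (simp_all add: FF_add FF_scale)

section \<open>Morphisms generated by two families of coderivations\<close>

text \<open>Sections have degree 0, so over \<open>V0\<close> all Koszul signs are 1.\<close>

definition V0 :: "'a set \<Rightarrow> int \<Rightarrow> 'a set"
  where "V0 S d = (if d = 0 then S else {})"

lemma V0_simps [simp]: "u \<in> V0 S d \<longleftrightarrow> d = 0 \<and> u \<in> S"
  by (simp add: V0_def)

lemma closedV_V0: "subspace S \<Longrightarrow> closedV (V0 S)"
  by (auto simp: closedV_def intro: subspace_add subspace_scale)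

lemma hom_V0_dg: "hom (V0 S) X \<Longrightarrow> dg X = 0"
  by (induction X) auto

lemma maps_V0_UNIV [simp]: "maps (V0 UNIV) g (V0 UNIV) 0"
  by (auto simp: maps_def hom_V0_dg)

lemma maps_V0_iff: "maps (V0 S) g (V0 S) 0 \<longleftrightarrow> (\<forall>X. X \<noteq> [] \<longrightarrow> hom (V0 S) X \<longrightarrow> g X \<in> S)"
  by (auto simp: maps_def hom_V0_dg)

lemma FF_cong:
  assumes "\<And>Z. \<lbrakk>hom V Z; (Z = [] \<longleftrightarrow> X = []); length Z \<le> length X\<rbrakk> \<Longrightarrow> \<phi> Z = \<phi>' Z"
    and mn: "\<And>d b. b \<in> V d \<Longrightarrow> maps V (m b) V 0 \<and> maps V (n b) V 0" and "hom V X"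
  shows "FF m n \<phi> X = FF m n \<phi>' X"
  using assms(1,3)
proof (induction "length X" arbitrary: X \<phi> \<phi>' rule: less_induct)
  case less
  show ?case
  proof (cases X)
    case Nil then show ?thesis using less.prems by simp
  next
    case (Cons x Y)
    have x: "snd x \<in> V (fst x)" "hom V Y" using less.prems(2) Cons by simp_all
    have "FF m n (\<lambda>Z. \<phi> (x # Z) + cod \<phi> (m (snd x)) 0 Z) Y = FF m n (\<lambda>Z. \<phi>' (x # Z) + cod \<phi>' (m (snd x)) 0 Z) Y"
    proof (rule less.hyps)
      fix Z assume Z: "hom V Z" "(Z = []) = (Y = [])" "length Z \<le> length Y"
      have "cod \<phi> (m (snd x)) 0 Z = cod \<phi>' (m (snd x)) 0 Z"
        by (rule cod_cong[of V]) (use Z x mn less.prems(1) Cons in auto)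
      then show "\<phi> (x # Z) + cod \<phi> (m (snd x)) 0 Z = \<phi>' (x # Z) + cod \<phi>' (m (snd x)) 0 Z"
        using less.prems(1)[of "x # Z"] Z x Cons by simp
    qed (use Cons x in auto)
    moreover have "cod (FF m n \<phi>) (n (snd x)) 0 Y = cod (FF m n \<phi>') (n (snd x)) 0 Y"
      by (rule cod_cong[of V], rule less.hyps) (use Cons x mn less.prems(1) in auto)
    ultimately show ?thesis by (simp add: Cons FF_Cons)
  qed
qed

lemma FF_mem:
  assumes T: "subspace T" and "\<And>Z. \<lbrakk>hom V Z; (Z = [] \<longleftrightarrow> X = []); length Z \<le> length X\<rbrakk> \<Longrightarrow> \<phi> Z \<in> T"
    and mn: "\<And>d b. b \<in> V d \<Longrightarrow> maps V (m b) V 0 \<and> maps V (n b) V 0" and "hom V X"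
  shows "FF m n \<phi> X \<in> T"
  using assms(2,4)
proof (induction "length X" arbitrary: X \<phi> rule: less_induct)
  case less
  show ?case
  proof (cases X)
    case Nil then show ?thesis using less.prems by simp
  next
    case (Cons x Y)
    have x: "snd x \<in> V (fst x)" "hom V Y" using less.prems(2) Cons by simp_all
    have l: "length Y < length X" using Cons by simp
    have "FF m n (\<lambda>Z. \<phi> (x # Z) + cod \<phi> (m (snd x)) 0 Z) Y \<in> T"
    proof (rule less.hyps[OF l])
      fix Z assume Z: "hom V Z" "(Z = []) = (Y = [])" "length Z \<le> length Y"
      have "cod \<phi> (m (snd x)) 0 Z = cod (\<lambda>Z. if length Z \<le> length Y then \<phi> Z else 0) (m (snd x)) 0 Z"
        by (rule cod_cong') (use Z in auto)
      also have "\<dots> \<in> T"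
        by (rule cod_mem[of T V]) (use Z x mn less.prems(1) Cons T in \<open>auto simp: subspace_0\<close>)
      finally show "\<phi> (x # Z) + cod \<phi> (m (snd x)) 0 Z \<in> T"
        using less.prems(1)[of "x # Z"] Z x Cons T by (simp add: subspace_add)
    qed (use x in auto)
    moreover have "cod (FF m n \<phi>) (n (snd x)) 0 Y \<in> T"
    proof -
      have "cod (FF m n \<phi>) (n (snd x)) 0 Y
          = cod (\<lambda>Z. if length Z \<le> length Y then FF m n \<phi> Z else 0) (n (snd x)) 0 Y"
        by (rule cod_cong') auto
      also have "\<dots> \<in> T"
        by (rule cod_mem[of T V]) (use x mn less.prems(1) Cons T less.hyps in \<open>auto simp: subspace_0\<close>)
      finally show ?thesis .
    qed
    ultimately show ?thesis using T by (simp add: Cons FF_Cons subspace_diff)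
  qed
qed

lemma FF_apply:
  assumes T: "subspace T" "lin_on T h"
    and "\<And>Z. hom V Z \<Longrightarrow> \<phi> Z \<in> T"
    and mn: "\<And>d b. b \<in> V d \<Longrightarrow> maps V (m b) V 0 \<and> maps V (n b) V 0" and "hom V X"
  shows "FF m n (\<lambda>Z. h (\<phi> Z)) X = h (FF m n \<phi> X)"
  using assms(3,5)
proof (induction "length X" arbitrary: X \<phi> rule: less_induct)
  case less
  show ?case
  proof (cases X)
    case Nil then show ?thesis by simp
  next
    case (Cons x Y)
    have x: "snd x \<in> V (fst x)" "hom V Y" using less.prems(2) Cons by simp_all
    let ?M = "\<lambda>Z. \<phi> (x # Z) + cod \<phi> (m (snd x)) 0 Z"
    have c: "cod \<phi> (m (snd x)) 0 Z \<in> T" if "hom V Z" for Z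
      by (rule cod_mem[of T V]) (use that x mn less.prems T in auto)
    have M: "?M Z \<in> T" if "hom V Z" for Z
      using that c x less.prems(1) T by (simp add: subspace_add)
    have "FF m n (\<lambda>Z. h (\<phi> (x # Z)) + cod (\<lambda>Z. h (\<phi> Z)) (m (snd x)) 0 Z) Y = FF m n (\<lambda>Z. h (?M Z)) Y"
    proof (rule FF_cong[of V])
      fix Z assume Z: "hom V Z"
      have "cod (\<lambda>Z. h (\<phi> Z)) (m (snd x)) 0 Z = h (cod \<phi> (m (snd x)) 0 Z)"
        by (rule cod_apply[of T h V]) (use T x mn Z less.prems(1) in auto)
      then show "h (\<phi> (x # Z)) + cod (\<lambda>Z. h (\<phi> Z)) (m (snd x)) 0 Z = h (?M Z)"
        using Z x c less.prems(1) by (simp add: lin_on_simps[OF T])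
    qed (use x mn in auto)
    also have "\<dots> = h (FF m n ?M Y)"
      by (rule less.hyps) (use Cons M x in auto)
    finally have 1: "FF m n (\<lambda>Z. h (\<phi> (x # Z)) + cod (\<lambda>Z. h (\<phi> Z)) (m (snd x)) 0 Z) Y = h (FF m n ?M Y)" .
    have FT: "FF m n \<phi> Z \<in> T" if "hom V Z" for Z
      by (rule FF_mem[of T V]) (use T mn that less.prems(1) in auto)
    have "cod (FF m n (\<lambda>Z. h (\<phi> Z))) (n (snd x)) 0 Y = cod (\<lambda>Z. h (FF m n \<phi> Z)) (n (snd x)) 0 Y"
      by (rule cod_cong[of V], rule less.hyps) (use Cons x mn less.prems(1) in auto)
    also have "\<dots> = h (cod (FF m n \<phi>) (n (snd x)) 0 Y)"
      by (rule cod_apply[of T h V]) (use T x mn FT in auto)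
    finally have 2: "cod (FF m n (\<lambda>Z. h (\<phi> Z))) (n (snd x)) 0 Y = h (cod (FF m n \<phi>) (n (snd x)) 0 Y)" .
    have "FF m n ?M Y \<in> T" by (rule FF_mem[of T V]) (use T mn x M in auto)
    moreover have "cod (FF m n \<phi>) (n (snd x)) 0 Y \<in> T"
      by (rule cod_mem[of T V]) (use T x mn FT in auto)
    ultimately show ?thesis using 1 2 by (simp add: Cons FF_Cons lin_on_simps[OF T])
  qed
qed

text \<open>This makes \<open>F\<close> a coalgebra morphism. Prepending an entry and acting by a
  coderivation are both compatible with splittings, the latter by \<open>cod_unsh\<close>, and the
  recursion of \<open>F\<close> is built from nothing else; so both sides satisfy the same recursion
  on the first entry.\<close>

lemma FF_unsh:
  assumes "hom (V0 UNIV) X"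
  shows "FF m n (unsh \<psi> 0) X = unsh (\<lambda>A B. FF m n (\<lambda>A'. FF m n (\<psi> A') B) A) 0 X"
  using assms
proof (induction "length X" arbitrary: X \<psi> rule: less_induct)
  case less
  show ?case
  proof (cases X)
    case (Cons x Y)
    obtain b where x: "x = (0, b)" using less.prems Cons by (cases x) auto
    have Y: "hom (V0 UNIV) Y" using less.prems Cons by simp
    let ?P = "\<lambda>A B. FF m n (\<lambda>A'. FF m n (\<psi> A') B) A"
    show ?thesis
    proof (cases "Y = []")
      case True then show ?thesis by (simp add: Cons FF_Cons)
    next
      case False
      \<comment> \<open>The operator that prepends \<open>b\<close> and adds the coderivation of
        \<open>m b\<close>, applied to a split tensor: once to the left factor and once to the right
        one.\<close>
      let ?\<psi>2 = "\<lambda>A B. (\<psi> (x # A) B + cod (\<lambda>A. \<psi> A B) (m b) 0 A) + (\<psi> A (x # B) + cod (\<psi> A) (m b) 0 B)"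
      have "FF m n (\<lambda>Z. unsh \<psi> 0 (x # Z) + cod (unsh \<psi> 0) (m b) 0 Z) Y = FF m n (unsh ?\<psi>2 0) Y"
        by (rule FF_cong[of "V0 UNIV"])
          (use Y False in \<open>auto simp: cod_unsh x unsh_add add.assoc add.left_commute\<close>)
      also have "\<dots> = unsh (\<lambda>A B. FF m n (\<lambda>A'. FF m n (?\<psi>2 A') B) A) 0 Y"
        by (rule less.hyps) (use Y Cons in auto)
      finally have 1: "FF m n (\<lambda>Z. unsh \<psi> 0 (x # Z) + cod (unsh \<psi> 0) (m b) 0 Z) Y
          = unsh (\<lambda>A B. FF m n (\<lambda>A'. FF m n (?\<psi>2 A') B) A) 0 Y" .
      have "cod (FF m n (unsh \<psi> 0)) (n b) 0 Y = cod (unsh ?P 0) (n b) 0 Y"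
        by (rule cod_cong[of "V0 UNIV"], rule less.hyps) (use Y Cons in auto)
      also have "\<dots> = unsh (\<lambda>A B. cod (\<lambda>A. ?P A B) (n b) 0 A + cod (?P A) (n b) 0 B) 0 Y"
        by (simp add: cod_unsh)
      finally have 2: "cod (FF m n (unsh \<psi> 0)) (n b) 0 Y
          = unsh (\<lambda>A B. cod (\<lambda>A. ?P A B) (n b) 0 A + cod (?P A) (n b) 0 B) 0 Y" .
      have 3: "FF m n (\<lambda>A'. FF m n (?\<psi>2 A') B) A
          = (?P (x # A) B + ?P A (x # B)) + (cod (\<lambda>A. ?P A B) (n b) 0 A + cod (?P A) (n b) 0 B)" for A B
      proof -
        have "?P (x # A) B = FF m n (\<lambda>A'. FF m n (\<lambda>B'. \<psi> (x # A') B' + cod (\<lambda>A. \<psi> A B') (m b) 0 A') B) A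
            - cod (\<lambda>A. ?P A B) (n b) 0 A"
          by (simp add: FF_Cons x FF_add FF_cod_swap)
        moreover have "?P A (x # B) = FF m n (\<lambda>A'. FF m n (\<lambda>B'. \<psi> A' (x # B') + cod (\<psi> A') (m b) 0 B') B) A
            - cod (?P A) (n b) 0 B"
          by (simp add: FF_Cons x FF_diff FF_cod_swap)
        ultimately show ?thesis by (simp add: FF_add)
      qed
      have sx: "snd x = b" "fst x = 0" by (simp_all add: x)
      have "FF m n (unsh \<psi> 0) (x # Y) = unsh (\<lambda>A B. ?P (x # A) B + ?P A (x # B)) 0 Y"
        unfolding FF_Cons sx 1 2 3 by (simp only: unsh_add add_diff_cancel_right')
      then show ?thesis using False by (simp only: Cons) (simp add: sx unsh_add)
    qed
  qed simp
qed

text \<open>The components of \<open>F\<close>, that is, its part with values in tensors of length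
  one.\<close>

definition fhat :: "('a \<Rightarrow> (int \<times> 'a::real_vector) list \<Rightarrow> 'a) \<Rightarrow> ('a \<Rightarrow> (int \<times> 'a) list \<Rightarrow> 'a)
    \<Rightarrow> (int \<times> 'a) list \<Rightarrow> 'a"
  where "fhat m n = FF m n (\<lambda>W. if length W = 1 then snd (hd W) else 0)"

lemma maps_fhat:
  assumes S: "subspace S" and mn: "\<And>b. b \<in> S \<Longrightarrow> maps (V0 S) (m b) (V0 S) 0 \<and> maps (V0 S) (n b) (V0 S) 0"
  shows "maps (V0 S) (fhat m n) (V0 S) 0"
proof -
  have "fhat m n X \<in> S" if "hom (V0 S) X" for X
    unfolding fhat_def
  proof (rule FF_mem[of S "V0 S"])
    fix Z assume "hom (V0 S) Z"
    then show "(if length Z = 1 then snd (hd Z) else 0) \<in> S"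
      using S by (cases Z) (auto simp: subspace_0)
  qed (use assms that in auto)
  then show ?thesis by (simp add: maps_V0_iff)
qed

text \<open>The intertwiner is the coalgebra morphism with components \<open>fhat\<close>.\<close>

lemma FF_eq_FX:
  assumes S: "subspace S" and mn: "\<And>b. b \<in> S \<Longrightarrow> maps (V0 S) (m b) (V0 S) 0 \<and> maps (V0 S) (n b) (V0 S) 0"
    and "mlin (V0 S) \<phi>" "hom (V0 S) X"
  shows "FF m n \<phi> X = FX (fhat m n) \<phi> X"
  using assms(3,4)
proof (induction "length X" arbitrary: X \<phi> rule: less_induct)
  case less
  show ?case
  proof (cases "X = []")
    case False
    let ?\<psi> = "\<lambda>A B. if length B = 1 then \<phi> (A @ B) else 0"
    have XU: "hom (V0 UNIV) X" using less.prems(2) by (auto simp: hom_def)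
    have "FF m n \<phi> X = FF m n (unsh ?\<psi> 0) X"
      by (rule FF_cong[of "V0 UNIV"]) (use False XU unsh_last[of _ \<phi> 0] in auto)
    also have "\<dots> = unsh (\<lambda>A B. FF m n (\<lambda>A'. FF m n (?\<psi> A') B) A) 0 X"
      by (rule FF_unsh[OF XU])
    also have "\<dots> = unsh (\<lambda>A B. FX (fhat m n) (\<lambda>W. \<phi> (W @ [(dg B, fhat m n B)])) A) 0 X"
    proof (rule unsh_cong[of "V0 S"])
      fix A B assume AB: "hom (V0 S) A" "hom (V0 S) B" "B \<noteq> []" "length A + length B = length X"
      have l: "length A < length X" using AB(3,4) by (metis length_greater_0_conv less_add_same_cancel1)
      have fB: "fhat m n B \<in> S" using maps_fhat[of S m n, OF S mn] AB by (simp add: maps_V0_iff)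
      have "FF m n (\<lambda>A'. FF m n (?\<psi> A') B) A = FF m n (\<lambda>W. \<phi> (W @ [(0, fhat m n B)])) A"
      proof (rule FF_cong[of "V0 S"])
        fix A' assume A': "hom (V0 S) A'"
        let ?h = "\<lambda>u. \<phi> (A' @ [(0, u)])"
        let ?p = "\<lambda>W :: (int \<times> 'a) list. if length W = 1 then snd (hd W) else 0"
        have h: "lin_on S ?h" unfolding lin_on_def using less.prems(1) A' by (auto simp: mlinD)
        have "FF m n (?\<psi> A') B = FF m n (\<lambda>Z. ?h (?p Z)) B"
        proof (rule FF_cong[of "V0 S"])
          fix Z assume Z: "hom (V0 S) Z"
          show "?\<psi> A' Z = ?h (?p Z)"
          proof (cases "length Z = 1")
            case True
            then show ?thesis using Z by (cases Z) auto
          next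
            case False
            then show ?thesis using lin_on_simps(1)[OF S h] by simp
          qed
        qed (use mn AB in auto)
        also have "\<dots> = ?h (FF m n ?p B)"
        proof (rule FF_apply[OF S h, of "V0 S"])
          fix Z assume "hom (V0 S) Z"
          then show "?p Z \<in> S" using S by (cases Z) (auto simp: subspace_0)
        qed (use mn AB in auto)
        finally show "FF m n (?\<psi> A') B = \<phi> (A' @ [(0, fhat m n B)])" by (simp add: fhat_def)
      qed (use mn AB in auto)
      also have "\<dots> = FX (fhat m n) (\<lambda>W. \<phi> (W @ [(0, fhat m n B)])) A"
        by (rule less.hyps[OF l mlin_snoc]) (use less.prems AB fB in auto)
      finally show "FF m n (\<lambda>A'. FF m n (?\<psi> A') B) A = FX (fhat m n) (\<lambda>W. \<phi> (W @ [(dg B, fhat m n B)])) A"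
        using AB by (simp add: hom_V0_dg)
    qed (rule less.prems)
    also have "\<dots> = FX (fhat m n) \<phi> X" using False by (simp add: FX_step)
    finally show ?thesis .
  qed simp
qed

text \<open>In the first slot linearity comes from that of \<open>m\<close> and \<open>n\<close> in
  their index, in later slots from the induction. The term \<open>cod (FF m n \<phi>)\<close> asks
  for multilinearity of \<open>FF m n \<phi>\<close> itself on shorter lists; cutting off at length
  \<open>N\<close> turns this partial knowledge into an \<open>mlin\<close> statement to which the
  lemmas on \<open>cod\<close> apply.\<close>

lemma mlin_FF:
  assumes S: "subspace S"
    and mn: "\<And>b. b \<in> S \<Longrightarrow> maps (V0 S) (m b) (V0 S) 0 \<and> maps (V0 S) (n b) (V0 S) 0"
      "\<And>b. b \<in> S \<Longrightarrow> mlin (V0 S) (m b) \<and> mlin (V0 S) (n b)"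
    and lin: "\<And>u v c X. u \<in> S \<Longrightarrow> v \<in> S \<Longrightarrow> hom (V0 S) X \<Longrightarrow> X \<noteq> [] \<Longrightarrow>
      m (c *\<^sub>R u + v) X = c *\<^sub>R m u X + m v X \<and> n (c *\<^sub>R u + v) X = c *\<^sub>R n u X + n v X"
    and \<phi>: "mlin (V0 S) \<phi>"
  shows "mlin (V0 S) (FF m n \<phi>)"
proof -
  have cV: "closedV (V0 S)" using S by (rule closedV_V0)
  let ?T = "\<lambda>N \<phi> X. if length X \<le> N then FF m n \<phi> X else 0"
  have "mlin (V0 S) (?T N \<phi>)" for N
    using \<phi>
  proof (induction N arbitrary: \<phi>)
    case 0 then show ?case by (auto simp: mlin_def)
  next
    case (Suc N)
    have FN: "cod (FF m n \<phi>) g 0 Y = cod (?T N \<phi>) g 0 Y" if "length Y \<le> N" for g Y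
      by (rule cod_cong') (use that in auto)
    have MM: "mlin (V0 S) (\<lambda>Z. \<phi> (x # Z) + cod \<phi> (m (snd x)) 0 Z)" if "snd x \<in> V0 S (fst x)" for x
      using that Suc.prems mn cV by (intro mlin_add mlin_Cons mlin_cod) auto
    show ?case
      unfolding mlin_def
    proof (intro allI impI)
      fix X Y d u v c assume h: "hom (V0 S) X" "hom (V0 S) Y" "u \<in> V0 S d" "v \<in> V0 S d"
      let ?w = "c *\<^sub>R u + v"
      have d: "d = 0" "u \<in> S" "v \<in> S" "?w \<in> S" using h S by (auto intro: subspace_add subspace_scale)
      show "?T (Suc N) \<phi> (X @ (d, ?w) # Y) = c *\<^sub>R ?T (Suc N) \<phi> (X @ (d, u) # Y) + ?T (Suc N) \<phi> (X @ (d, v) # Y)"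
      proof (cases "length X + length Y \<le> N")
        case True
        show ?thesis
        proof (cases X)
          case Nil
          have lY: "length Y \<le> N" using True Nil by simp
          have "FF m n (\<lambda>Z. \<phi> ((0, ?w) # Z) + cod \<phi> (m ?w) 0 Z) Y
              = FF m n (\<lambda>Z. c *\<^sub>R (\<phi> ((0, u) # Z) + cod \<phi> (m u) 0 Z) + (\<phi> ((0, v) # Z) + cod \<phi> (m v) 0 Z)) Y"
          proof (rule FF_cong[of "V0 S"])
            fix Z assume Z: "hom (V0 S) Z"
            have "cod \<phi> (m ?w) 0 Z = cod \<phi> (\<lambda>Y. c *\<^sub>R m u Y + m v Y) 0 Z"
              by (rule cod_cong[of "V0 S"]) (use Z d mn lin in auto)
            also have "\<dots> = c *\<^sub>R cod \<phi> (m u) 0 Z + cod \<phi> (m v) 0 Z"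
              by (rule cod_lin_g[OF cV Suc.prems]) (use Z d mn in auto)
            finally show "\<phi> ((0, ?w) # Z) + cod \<phi> (m ?w) 0 Z
              = c *\<^sub>R (\<phi> ((0, u) # Z) + cod \<phi> (m u) 0 Z) + (\<phi> ((0, v) # Z) + cod \<phi> (m v) 0 Z)"
              using mlinD0[OF Suc.prems Z, of u 0 v c] d by (simp add: algebra_simps)
          qed (use h mn in auto)
          also have "\<dots> = c *\<^sub>R FF m n (\<lambda>Z. \<phi> ((0, u) # Z) + cod \<phi> (m u) 0 Z) Y
              + FF m n (\<lambda>Z. \<phi> ((0, v) # Z) + cod \<phi> (m v) 0 Z) Y"
            by (simp only: FF_lin)
          finally have 1: "FF m n (\<lambda>Z. \<phi> ((0, ?w) # Z) + cod \<phi> (m ?w) 0 Z) Y = \<dots>" .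
          have "cod (?T N \<phi>) (n ?w) 0 Y = cod (?T N \<phi>) (\<lambda>Y. c *\<^sub>R n u Y + n v Y) 0 Y"
            by (rule cod_cong[of "V0 S"]) (use h d mn lin in auto)
          also have "\<dots> = c *\<^sub>R cod (?T N \<phi>) (n u) 0 Y + cod (?T N \<phi>) (n v) 0 Y"
            by (rule cod_lin_g[OF cV Suc.IH[OF Suc.prems]]) (use h d mn in auto)
          finally show ?thesis
            using 1 Nil lY d by (simp add: FF_Cons FN algebra_simps)
        next
          case (Cons x X')
          have x: "snd x \<in> V0 S (fst x)" "hom (V0 S) X'" using Cons h by simp_all
          have l: "length X' + length Y < N" using True Cons by simp
          have "?T N (\<lambda>Z. \<phi> (x # Z) + cod \<phi> (m (snd x)) 0 Z) (X' @ (d, ?w) # Y)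
             = c *\<^sub>R ?T N (\<lambda>Z. \<phi> (x # Z) + cod \<phi> (m (snd x)) 0 Z) (X' @ (d, u) # Y)
               + ?T N (\<lambda>Z. \<phi> (x # Z) + cod \<phi> (m (snd x)) 0 Z) (X' @ (d, v) # Y)"
            by (rule mlinD[OF Suc.IH[OF MM[OF x(1)]]]) (use h x in auto)
          moreover have "mlin (V0 S) (cod (?T N \<phi>) (n (snd x)) 0)"
            by (rule mlin_cod[OF cV Suc.IH[OF Suc.prems]]) (use x mn in auto)
          then have "cod (?T N \<phi>) (n (snd x)) 0 (X' @ (d, ?w) # Y)
             = c *\<^sub>R cod (?T N \<phi>) (n (snd x)) 0 (X' @ (d, u) # Y)
               + cod (?T N \<phi>) (n (snd x)) 0 (X' @ (d, v) # Y)"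
            by (rule mlinD) (use h x in auto)
          ultimately show ?thesis
            using l by (simp add: Cons FF_Cons FN algebra_simps)
        qed
      qed simp
    qed
  qed
  then have T: "mlin (V0 S) (?T N \<phi>)" for N .
  show ?thesis
    unfolding mlin_def
  proof (intro allI impI)
    fix X Y d u v c assume h: "hom (V0 S) X" "hom (V0 S) Y" "u \<in> V0 S d" "v \<in> V0 S d"
    show "FF m n \<phi> (X @ (d, c *\<^sub>R u + v) # Y) = c *\<^sub>R FF m n \<phi> (X @ (d, u) # Y) + FF m n \<phi> (X @ (d, v) # Y)"
      using mlinD[OF T[of "Suc (length X + length Y)"] h, of c] by simp
  qed
qed

text \<open>\<open>G\<close> and \<open>S\<close> stand for the sections of A and of L/A. The
  relation \<open>K\<close> expresses \<open>q a\<close> on \<open>b\<close> followed by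
  \<open>X\<close> through operators evaluated on \<open>X\<close>, and so drives all inductions on
  the number of arguments.\<close>

locale even_struct =
  fixes S :: "'b::real_vector set" and G :: "'g set" and br :: "'g \<Rightarrow> 'g \<Rightarrow> 'g" and c :: "'b \<Rightarrow> 'g \<Rightarrow> 'g"
    and q :: "'g \<Rightarrow> (int \<times> 'b) list \<Rightarrow> 'b" and n :: "'b \<Rightarrow> (int \<times> 'b) list \<Rightarrow> 'b"
  assumes S: "subspace S"
    and br_G: "a \<in> G \<Longrightarrow> a' \<in> G \<Longrightarrow> br a a' \<in> G"
    and c_G: "b \<in> S \<Longrightarrow> a \<in> G \<Longrightarrow> c b a \<in> G"
    and q_maps: "a \<in> G \<Longrightarrow> maps (V0 S) (q a) (V0 S) 0"
    and q_mlin: "a \<in> G \<Longrightarrow> mlin (V0 S) (q a)"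
    and n_maps: "b \<in> S \<Longrightarrow> maps (V0 S) (n b) (V0 S) 0"
    and n_mlin: "b \<in> S \<Longrightarrow> mlin (V0 S) (n b)"
    and n_lin: "\<lbrakk>u \<in> S; v \<in> S; hom (V0 S) X; X \<noteq> []\<rbrakk> \<Longrightarrow> n (r *\<^sub>R u + v) X = r *\<^sub>R n u X + n v X"
    and K: "b \<in> S \<Longrightarrow> a \<in> G \<Longrightarrow> hom (V0 S) X \<Longrightarrow> X \<noteq> [] \<Longrightarrow>
      q a ((0, b) # X) + com (q a) 0 (n b) 0 X = n (q a [(0, b)]) X + q (c b a) X"
begin

lemma cV: "closedV (V0 S)"
  using S by (rule closedV_V0)

lemma q_S: "\<lbrakk>a \<in> G; X \<noteq> []; hom (V0 S) X\<rbrakk> \<Longrightarrow> q a X \<in> S"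
  using q_maps by (auto simp: maps_V0_iff)

lemma q_Cons: "b \<in> S \<Longrightarrow> a \<in> G \<Longrightarrow> hom (V0 S) X \<Longrightarrow> X \<noteq> [] \<Longrightarrow>
    q a ((0, b) # X) = (n (q a [(0, b)]) X + q (c b a) X) - com (q a) 0 (n b) 0 X"
  using K[of b a X] by (simp add: algebra_simps)

end

text \<open>\<open>flat\<close> is the case of one argument in \<open>q_bracket\<close>.
  \<open>q_jacobi\<close> says that \<open>c b\<close> is a derivation of the bracket up to terms in
  which a and a' differentiate b; it will come from the Jacobi identity for j b, a and a'.\<close>

locale even_rep = even_struct +
  assumes flat: "b \<in> S \<Longrightarrow> a \<in> G \<Longrightarrow> a' \<in> G \<Longrightarrow>
      q a [(0, q a' [(0, b)])] - q a' [(0, q a [(0, b)])] = q (br a a') [(0, b)]"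
    and q_jacobi: "b \<in> S \<Longrightarrow> a \<in> G \<Longrightarrow> a' \<in> G \<Longrightarrow> hom (V0 S) X \<Longrightarrow> X \<noteq> [] \<Longrightarrow>
      q (c b (br a a')) X = q (c (q a' [(0, b)]) a) X - q (c (q a [(0, b)]) a') X
        + q (br (c b a) a') X + q (br a (c b a')) X"
begin

text \<open>With first entry \<open>b\<close>, \<open>K\<close> rewrites everything through
  operators on the rest \<open>Y\<close>. The commutators with \<open>n b\<close> combine, by the
  Jacobi identity for \<open>com\<close>, into the commutator of [q_a, q_a'] with
  \<open>n b\<close>, where the induction hypothesis applies. The remaining \<open>n\<close> terms
  match by \<open>flat\<close>, the terms with \<open>c\<close> by \<open>q_jacobi\<close> and the
  induction hypothesis.\<close>

theorem q_bracket:
  assumes "hom (V0 S) X" "X \<noteq> []" "a \<in> G" "a' \<in> G"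
  shows "com (q a) 0 (q a') 0 X = q (br a a') X"
  using assms
proof (induction "length X" arbitrary: X a a' rule: less_induct)
  case less
  obtain b Y where X: "X = (0, b) # Y" and b: "b \<in> S" and Y: "hom (V0 S) Y"
    using less.prems by (cases X) auto
  note a = less.prems(3) and a' = less.prems(4)
  show ?case
  proof (cases "Y = []")
    case True
    then show ?thesis using flat[OF b a a'] by (simp add: X com_def)
  next
    case False
    have D: "q a [(0, b)] \<in> S" "q a' [(0, b)] \<in> S" using q_S a a' b by simp_all
    have DD: "q a [(0, q a' [(0, b)])] \<in> S" "q a' [(0, q a [(0, b)])] \<in> S" using q_S a a' D by simp_all
    note G = a a' c_G[OF b a] c_G[OF b a'] br_G[OF a a']
    note mm = q_maps q_mlin n_maps n_mlin G b D DD Y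
    have mc: "maps (V0 S) (com (q a) 0 (n b) 0) (V0 S) 0" "mlin (V0 S) (com (q a) 0 (n b) 0)"
      if "a \<in> G" for a using that mm cV by (auto intro!: maps_com mlin_com)
    have exp: "cod (q a) (q a') 0 X
       = (n (q a [(0, q a' [(0, b)])]) Y + q (c (q a' [(0, b)]) a) Y - com (q a) 0 (n (q a' [(0, b)])) 0 Y)
       + (cod (n (q a [(0, b)])) (q a') 0 Y + cod (q (c b a)) (q a') 0 Y - cod (com (q a) 0 (n b) 0) (q a') 0 Y)
       + (cod (q a) (n (q a' [(0, b)])) 0 Y + cod (q a) (q (c b a')) 0 Y - cod (q a) (com (q a') 0 (n b) 0) 0 Y)"
      if a: "a \<in> G" and a': "a' \<in> G" for a a'
    proof -
      have D: "q a [(0, b)] \<in> S" "q a' [(0, b)] \<in> S" using q_S a a' b by simp_all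
      note G = a a' c_G[OF b a] c_G[OF b a']
      have "cod (\<lambda>Z. q a ((0, b) # Z)) (q a') 0 Y
          = cod (\<lambda>Z. (n (q a [(0, b)]) Z + q (c b a) Z) - com (q a) 0 (n b) 0 Z) (q a') 0 Y"
        by (rule cod_cong[of "V0 S"]) (use q_Cons b G q_maps Y in auto)
      moreover have "cod (q a) (\<lambda>Z. q a' ((0, b) # Z)) 0 Y
          = cod (q a) (\<lambda>Z. (n (q a' [(0, b)]) Z + q (c b a') Z) - com (q a') 0 (n b) 0 Z) 0 Y"
        by (rule cod_cong[of "V0 S"]) (use q_Cons b G q_maps Y in \<open>auto intro!: maps_Cons\<close>)
      moreover have "\<dots> = cod (q a) (n (q a' [(0, b)])) 0 Y + cod (q a) (q (c b a')) 0 Y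
          - cod (q a) (com (q a') 0 (n b) 0) 0 Y"
        using mm mc G D cV by (simp add: cod_diff_g[of "V0 S"] cod_add_g[of "V0 S"] maps_add)
      moreover have "q a ((0, q a' [(0, b)]) # Y)
          = (n (q a [(0, q a' [(0, b)])]) Y + q (c (q a' [(0, b)]) a) Y) - com (q a) 0 (n (q a' [(0, b)])) 0 Y"
        by (rule q_Cons) (use D G Y False in auto)
      ultimately show ?thesis by (simp add: X cod_diff_f cod_add_f)
    qed
    have Jac: "com (com (q a) 0 (n b) 0) 0 (q a') 0 Y + com (q a) 0 (com (q a') 0 (n b) 0) 0 Y
        = com (com (q a) 0 (q a') 0) 0 (n b) 0 Y"
      using com_Jacobi[OF cV, of "q a" 0 "q a'" 0 "n b" 0 Y] com_skew[of "q a'" 0 "com (q a) 0 (n b) 0" 0 Y] mm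
      by simp
    have IH: "com (com (q a) 0 (q a') 0) 0 (n b) 0 Y = com (q (br a a')) 0 (n b) 0 Y"
      by (rule com_cong[of "V0 S"]) (use mm cV less.hyps X in \<open>auto intro!: maps_com\<close>)
    have IH1: "com (q (c b a)) 0 (q a') 0 Y = q (br (c b a) a') Y"
      by (rule less.hyps) (use X Y False G in auto)
    have IH2: "com (q a) 0 (q (c b a')) 0 Y = q (br a (c b a')) Y"
      by (rule less.hyps) (use X Y False G in auto)
    have N: "n (q a [(0, q a' [(0, b)])]) Y = n (q (br a a') [(0, b)]) Y + n (q a' [(0, q a [(0, b)])]) Y"
    proof -
      have "q (br a a') [(0, b)] \<in> S" using q_S G b by simp
      then show ?thesis
        using n_lin[of "q (br a a') [(0, b)]" "q a' [(0, q a [(0, b)])]" Y 1] DD Y False flat[OF b a a', symmetric]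
        by simp
    qed
    have R: "q (br a a') X = (n (q (br a a') [(0, b)]) Y + q (c b (br a a')) Y) - com (q (br a a')) 0 (n b) 0 Y"
      unfolding X by (rule q_Cons) (use G b Y False in auto)
    show ?thesis
      unfolding R IH[symmetric] Jac[symmetric] q_jacobi[OF b a a' Y False] IH1[symmetric] IH2[symmetric]
      unfolding com_def[of "q a" 0 "q a'"] exp[OF a a'] exp[OF a' a] N
      by (simp add: com_def)
  qed
qed

end

text \<open>Induction on the number of arguments, for all \<phi> and \<open>a\<close> at once.
  \<open>K\<close> is used for \<open>q\<close>, \<open>n\<close> on the source and for
  \<open>q'\<close>, \<open>m\<close> on the target, with the commutators expanded by
  \<open>cod_comm\<close>. What remains are instances of the claim on shorter lists and the
  recursion of \<open>FF\<close> for the entry nabla_a b; the terms with \<open>c b a\<close> match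
  because both structures have the same \<open>c\<close>.\<close>

theorem FF_intertwine:
  fixes \<phi> :: "(int \<times> 'b::real_vector) list \<Rightarrow> 'd::real_vector"
  assumes 1: "even_struct S G br c q n" and 2: "even_struct S G br c q' m"
    and D: "\<And>a b. a \<in> G \<Longrightarrow> b \<in> S \<Longrightarrow> q' a [(0, b)] = q a [(0, b)]"
    and "mlin (V0 S) \<phi>" "hom (V0 S) X" "a \<in> G"
  shows "cod (FF m n \<phi>) (q a) 0 X = FF m n (cod \<phi> (q' a) 0) X"
proof -
  interpret A: even_struct S G br c q n by fact
  interpret B: even_struct S G br c q' m by fact
  note cV = A.cV
  have mn: "maps (V0 S) (m b) (V0 S) 0 \<and> maps (V0 S) (n b) (V0 S) 0" if "b \<in> V0 S d" for b d
    using that A.n_maps B.n_maps by simp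
  have FFm: "mlin (V0 S) (FF m n \<phi>)" if "mlin (V0 S) \<phi>" for \<phi> :: "(int \<times> 'b) list \<Rightarrow> 'd"
    by (rule mlin_FF[OF A.S]) (use that A.n_maps B.n_maps A.n_mlin B.n_mlin A.n_lin B.n_lin in auto)
  show ?thesis
    using assms(4-)
  proof (induction "length X" arbitrary: X \<phi> a rule: less_induct)
    case less
    note \<phi> = less.prems(1) and a = less.prems(3)
    show ?case
    proof (cases X)
      case (Cons x Y)
      obtain b where x: "x = (0, b)" and b: "b \<in> S" and Y: "hom (V0 S) Y"
        using less.prems Cons by (cases x) auto
      have lY: "length Y < length X" by (simp add: Cons)
      let ?F = "FF m n"
      let ?b = "q a [(0, b)]"
      have Db: "?b \<in> S" using A.q_S[OF a, of "[(0, b)]"] b by simp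
      have cG: "c b a \<in> G" using A.c_G b a by simp
      let ?M = "\<lambda>b \<phi> Z. \<phi> ((0, b) # Z) + cod \<phi> (m b) 0 Z"
      have M: "mlin (V0 S) (?M b \<phi>)" if "mlin (V0 S) \<phi>" "b \<in> S" for b
          and \<phi> :: "(int \<times> 'b) list \<Rightarrow> 'd"
        using that B.n_mlin B.n_maps cV by (intro mlin_add mlin_Cons mlin_cod) auto
      note mm = A.q_maps A.q_mlin A.n_maps A.n_mlin B.q_maps B.q_mlin B.n_maps B.n_mlin a b Db cG Y
      have FC: "?F \<phi> ((0, b) # Z) = ?F (?M b \<phi>) Z - cod (?F \<phi>) (n b) 0 Z" for b Z
          and \<phi> :: "(int \<times> 'b) list \<Rightarrow> 'd"
        by (simp add: FF_Cons)
      have "cod (?F \<phi>) (\<lambda>Z. q a ((0, b) # Z)) 0 Y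
          = cod (?F \<phi>) (\<lambda>Z. (n ?b Z + q (c b a) Z) - com (q a) 0 (n b) 0 Z) 0 Y"
        by (rule cod_cong[of "V0 S"]) (use A.q_Cons b a mm in \<open>auto intro!: maps_Cons\<close>)
      also have "\<dots> = cod (?F \<phi>) (n ?b) 0 Y + cod (?F \<phi>) (q (c b a)) 0 Y - cod (?F \<phi>) (com (q a) 0 (n b) 0) 0 Y"
        using mm cV FFm[OF \<phi>]
        by (simp add: cod_diff_g[of "V0 S"] cod_add_g[of "V0 S"] maps_add maps_com)
      also have "cod (?F \<phi>) (com (q a) 0 (n b) 0) 0 Y
          = cod (cod (?F \<phi>) (q a) 0) (n b) 0 Y - cod (cod (?F \<phi>) (n b) 0) (q a) 0 Y"
        using cod_comm[OF cV FFm[OF \<phi>], of "q a" 0 "n b" 0 Y] mm by simp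
      finally have E3: "cod (?F \<phi>) (\<lambda>Z. q a ((0, b) # Z)) 0 Y = cod (?F \<phi>) (n ?b) 0 Y
         + cod (?F \<phi>) (q (c b a)) 0 Y
         - (cod (cod (?F \<phi>) (q a) 0) (n b) 0 Y - cod (cod (?F \<phi>) (n b) 0) (q a) 0 Y)" .
      have "cod (?F \<phi>) (q a) 0 X = ?F \<phi> ((0, ?b) # Y) + cod (\<lambda>Z. ?F \<phi> ((0, b) # Z)) (q a) 0 Y
          + cod (?F \<phi>) (\<lambda>Z. q a ((0, b) # Z)) 0 Y"
        by (simp add: Cons x)
      also have "\<dots> = ?F (?M ?b \<phi>) Y + cod (?F (?M b \<phi>)) (q a) 0 Y + cod (?F \<phi>) (q (c b a)) 0 Y
          - cod (cod (?F \<phi>) (q a) 0) (n b) 0 Y"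
        unfolding FC E3 by (simp add: cod_diff_f)
      also have "cod (?F (?M b \<phi>)) (q a) 0 Y = ?F (cod (?M b \<phi>) (q' a) 0) Y"
        by (rule less.hyps[OF lY M]) (use \<phi> a b Y in auto)
      also have "cod (?F \<phi>) (q (c b a)) 0 Y = ?F (cod \<phi> (q' (c b a)) 0) Y"
        by (rule less.hyps[OF lY]) (use \<phi> cG Y in auto)
      also have "cod (cod (?F \<phi>) (q a) 0) (n b) 0 Y = cod (?F (cod \<phi> (q' a) 0)) (n b) 0 Y"
        by (rule cod_cong[of "V0 S"], rule less.hyps) (use Cons \<phi> mm in auto)
      finally have L: "cod (?F \<phi>) (q a) 0 X = ?F (?M ?b \<phi>) Y + ?F (cod (?M b \<phi>) (q' a) 0) Y
          + ?F (cod \<phi> (q' (c b a)) 0) Y - cod (?F (cod \<phi> (q' a) 0)) (n b) 0 Y" .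
      have "?F (cod \<phi> (q' a) 0) X = ?F (?M b (cod \<phi> (q' a) 0)) Y - cod (?F (cod \<phi> (q' a) 0)) (n b) 0 Y"
        by (simp add: Cons x FC)
      also have "?F (?M b (cod \<phi> (q' a) 0)) Y
          = ?F (\<lambda>Z. (?M ?b \<phi> Z + cod (?M b \<phi>) (q' a) 0 Z) + cod \<phi> (q' (c b a)) 0 Z) Y"
      proof (rule FF_cong[of "V0 S"])
        fix Z assume Z: "hom (V0 S) Z"
        have "cod \<phi> (\<lambda>Z. q' a ((0, b) # Z)) 0 Z
            = cod \<phi> (\<lambda>Z. (m ?b Z + q' (c b a) Z) - com (q' a) 0 (m b) 0 Z) 0 Z"
          by (rule cod_cong[of "V0 S"]) (use B.q_Cons D b a mm Z in \<open>auto intro!: maps_Cons\<close>)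
        also have "\<dots> = cod \<phi> (m ?b) 0 Z + cod \<phi> (q' (c b a)) 0 Z - cod \<phi> (com (q' a) 0 (m b) 0) 0 Z"
          using mm cV \<phi> Z
          by (simp add: cod_diff_g[of "V0 S"] cod_add_g[of "V0 S"] maps_add maps_com)
        also have "cod \<phi> (com (q' a) 0 (m b) 0) 0 Z
            = cod (cod \<phi> (q' a) 0) (m b) 0 Z - cod (cod \<phi> (m b) 0) (q' a) 0 Z"
          using cod_comm[OF cV \<phi>, of "q' a" 0 "m b" 0 Z] mm Z by simp
        finally show "?M b (cod \<phi> (q' a) 0) Z = (?M ?b \<phi> Z + cod (?M b \<phi>) (q' a) 0 Z) + cod \<phi> (q' (c b a)) 0 Z"
          using D[OF a b] by (simp add: cod_add_f)
      qed (use mn Y in auto)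
      finally show ?thesis unfolding L by (simp only: FF_add) 
    qed simp
  qed
qed

text \<open>Multilinearity over a ring acting by \<open>act\<close>: \<open>slot act r X X'\<close> says that
  \<open>X'\<close> arises from \<open>X\<close> by letting \<open>r\<close> act on one entry.\<close>

inductive slot :: "('r \<Rightarrow> 'b \<Rightarrow> 'b) \<Rightarrow> 'b set \<Rightarrow> 'r \<Rightarrow> (int \<times> 'b) list \<Rightarrow> (int \<times> 'b) list \<Rightarrow> bool"
  for act S r where
  here: "u \<in> S \<Longrightarrow> hom (V0 S) Y \<Longrightarrow> slot act S r ((0, u) # Y) ((0, act r u) # Y)"
| there: "slot act S r X X' \<Longrightarrow> v \<in> S \<Longrightarrow> slot act S r ((0, v) # X) ((0, v) # X')"

lemma slot_hom: "slot act S r X X' \<Longrightarrow> hom (V0 S) X"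
  by (induction rule: slot.induct) auto

lemma slot_hom': "slot act S r X X' \<Longrightarrow> (\<And>u. u \<in> S \<Longrightarrow> act r u \<in> S) \<Longrightarrow> hom (V0 S) X'"
  by (induction rule: slot.induct) auto

lemma slot_length: "slot act S r X X' \<Longrightarrow> length X' = length X \<and> X \<noteq> [] \<and> X' \<noteq> []"
  by (induction rule: slot.induct) auto

text \<open>The set \<open>L\<close> of admissible lengths is a parameter because operators with a
  first-order unary part are linear over the ring only from two arguments on, and because the
  inductions assert linearity up to a given length.\<close>

definition Clin :: "('r \<Rightarrow> 'b \<Rightarrow> 'b) \<Rightarrow> 'b set \<Rightarrow> 'r set \<Rightarrow> nat set \<Rightarrow> ((int \<times> 'b) list \<Rightarrow> 'b) \<Rightarrow> bool" where
  "Clin act S C L f \<longleftrightarrow> (\<forall>r X X'. r \<in> C \<longrightarrow> slot act S r X X' \<longrightarrow> length X \<in> L \<longrightarrow> f X' = act r (f X))"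

lemma ClinD: "\<lbrakk>Clin act S C L f; r \<in> C; slot act S r X X'; length X \<in> L\<rbrakk> \<Longrightarrow> f X' = act r (f X)"
  by (auto simp: Clin_def)

lemma Clin_Cons:
  "\<lbrakk>Clin act S C L f; v \<in> S; Suc ` L' \<subseteq> L\<rbrakk> \<Longrightarrow> Clin act S C L' (\<lambda>Y. f ((0, v) # Y))"
  unfolding Clin_def[where L = L']
  by (intro allI impI, rule ClinD[where f = f and L = L and act = act and S = S])
    (auto intro!: slot.there)

lemma Clin_snoc:
  assumes "Clin act S C L f" "v \<in> S" "Suc ` L' \<subseteq> L"
  shows "Clin act S C L' (\<lambda>Y. f (Y @ [(0, v)]))"
proof -
  have s: "slot act S r (X @ [(0, v)]) (X' @ [(0, v)])" if "slot act S r X X'" for X X' r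
    using that assms(2) by (induction rule: slot.induct) (auto intro: slot.intros)
  show ?thesis unfolding Clin_def
    by (intro allI impI, rule ClinD[OF assms(1)]) (use assms(3) s in auto)
qed

lemma Clin_last:
  assumes "Clin act S C L f" "hom (V0 S) W" "Suc (length W) \<in> L" "r \<in> C" "u \<in> S"
  shows "f (W @ [(0, act r u)]) = act r (f (W @ [(0, u)]))"
proof -
  have "slot act S r (W @ [(0, u)]) (W @ [(0, act r u)])"
    using assms(2,5) by (induction W) (auto intro: slot.intros)
  then show ?thesis by (rule ClinD[OF assms(1,4)]) (use assms(3) in simp)
qed

lemma unsh_slot:
  assumes lin: "linear (act r)"
    and "\<And>A A' B. \<lbrakk>slot act S r A A'; hom (V0 S) B; B \<noteq> []; length A + length B = length X\<rbrakk> \<Longrightarrow> \<psi> A' B = act r (\<psi> A B)"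
    and "\<And>A B B'. \<lbrakk>slot act S r B B'; hom (V0 S) A; length A + length B = length X\<rbrakk> \<Longrightarrow> \<psi> A B' = act r (\<psi> A B)"
    and "slot act S r X X'"
  shows "unsh \<psi> 0 X' = act r (unsh \<psi> 0 X)"
  using assms(4,2,3)
proof (induction arbitrary: \<psi> rule: slot.induct)
  case (here u Y)
  show ?case
  proof (cases "Y = []")
    case True
    then show ?thesis using here(4)[of "[(0, u)]" "[(0, act r u)]" "[]"] here(1) by (simp add: slot.here)
  next
    case False
    have "unsh (\<lambda>A B. \<psi> ((0, act r u) # A) B) 0 Y = unsh (\<lambda>A B. act r (\<psi> ((0, u) # A) B)) 0 Y"
      by (rule unsh_cong[of "V0 S"]) (use here in \<open>auto intro!: here(3) slot.here\<close>)
    moreover have "unsh (\<lambda>A B. \<psi> A ((0, act r u) # B)) 0 Y = unsh (\<lambda>A B. act r (\<psi> A ((0, u) # B))) 0 Y"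
      by (rule unsh_cong[of "V0 S"]) (use here in \<open>auto intro!: here(4) slot.here\<close>)
    ultimately show ?thesis using False by (simp add: unsh_apply[OF lin] linear_add[OF lin])
  qed
next
  case (there X X' v)
  have ne: "X \<noteq> []" "X' \<noteq> []" using slot_length[OF there(1)] by auto
  have "unsh (\<lambda>A B. \<psi> ((0, v) # A) B) 0 X' = act r (unsh (\<lambda>A B. \<psi> ((0, v) # A) B) 0 X)"
    by (rule there.IH) (use there in \<open>auto intro!: there.prems slot.there\<close>)
  moreover have "unsh (\<lambda>A B. \<psi> A ((0, v) # B)) 0 X' = act r (unsh (\<lambda>A B. \<psi> A ((0, v) # B)) 0 X)"
    by (rule there.IH) (use there in \<open>auto intro!: there.prems slot.there\<close>)
  ultimately show ?case using ne by (simp add: linear_add[OF lin])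
qed

text \<open>If the slot lies among the remaining entries, the induction applies. If it lies in the
  block split off, \<open>f\<close> passes the ring element to its value and \<phi> passes it on to
  the outside.\<close>

lemma Clin_FX:
  assumes lin: "\<And>r. linear (act r)" and f: "maps (V0 S) f (V0 S) 0" "Clin act S C {..N} f"
    and "Clin act S C {..N} \<phi>"
  shows "Clin act S C {..N} (FX f \<phi>)"
proof -
  have "FX f \<phi> X' = act r (FX f \<phi> X)" if "r \<in> C" "slot act S r X X'" "length X \<le> N" for X X' r
    using that(2,3) assms(4) f(2)
  proof (induction "length X" arbitrary: X X' N \<phi> rule: less_induct)
    case less
    have ne: "X \<noteq> []" "X' \<noteq> []" using slot_length[OF less.prems(1)] by auto
    let ?\<psi> = "\<lambda>Y Z. FX f (\<lambda>W. \<phi> (W @ [(dg Z, f Z)])) Y"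
    have fS: "f Z \<in> S" if "hom (V0 S) Z" "Z \<noteq> []" for Z using f(1) that by (simp add: maps_V0_iff)
    have "unsh ?\<psi> 0 X' = act r (unsh ?\<psi> 0 X)"
    proof (rule unsh_slot[of act r S X ?\<psi> X', OF lin _ _ less.prems(1)])
      fix A A' B assume AB: "slot act S r A A'" "hom (V0 S) B" "B \<noteq> []" "length A + length B = length X"
      have l: "length A < length X" using AB(3,4) by (metis length_greater_0_conv less_add_same_cancel1)
      have dB: "dg B = 0" using AB by (simp add: hom_V0_dg)
      have "Clin act S C {..N - 1} (\<lambda>W. \<phi> (W @ [(0, f B)]))"
        by (rule Clin_snoc[OF less.prems(3)]) (use fS AB less.prems(2) l in auto)
      moreover have "Clin act S C {..N - 1} f" using less.prems(4) by (auto simp: Clin_def)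
      ultimately show "?\<psi> A' B = act r (?\<psi> A B)"
        unfolding dB by (intro less.hyps[OF l AB(1), of "N - 1"]) (use l less.prems(2) in auto)
    next
      fix A B B' assume AB: "slot act S r B B'" "hom (V0 S) A" "length A + length B = length X"
      have hB: "hom (V0 S) B" "B \<noteq> []" "B' \<noteq> []" using slot_hom[OF AB(1)] slot_length[OF AB(1)] by auto
      have dB: "dg B = 0" using hB by (simp add: hom_V0_dg)
      have dB': "dg B' = 0" using AB(1) by (induction rule: slot.induct) (auto simp: hom_V0_dg)
      have lB: "1 \<le> length B" using hB(2) by (cases B) auto
      have "f B' = act r (f B)" by (rule ClinD[OF less.prems(4) that(1) AB(1)]) (use AB(3) less.prems(2) in auto)
      then have "FX f (\<lambda>W. \<phi> (W @ [(0, f B')])) A = FX f (\<lambda>W. act r (\<phi> (W @ [(0, f B)]))) A"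
        using that(1) fS[OF hB(1,2)] less.prems(2) AB lB
        by (intro FX_cong[OF _ f(1) AB(2)]) (auto intro!: Clin_last[OF less.prems(3)])
      then show "?\<psi> A B' = act r (?\<psi> A B)"
        unfolding dB dB' by (simp add: FX_apply[OF lin])
    qed
    then show ?case using ne by (simp add: FX_step)
  qed
  then show ?thesis by (auto simp: Clin_def)
qed

text \<open>A unary component preserves the length, so only lists exactly as long as
  \<open>X\<close> matter; \<open>cod_cong\<close> would ask for agreement on shorter ones
  too.\<close>

lemma cod_unary_cong:
  assumes "closedV V" "mlin V f" "mlin V f'" "maps V g V e" "unary g" "hom V X"
    and "\<And>Z. hom V Z \<Longrightarrow> length Z = length X \<Longrightarrow> f Z = f' Z"
  shows "cod f g e X = cod f' g e X"
  using assms(2,3,6,7)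
proof (induction X arbitrary: f f')
  case (Cons x X)
  have x: "snd x \<in> V (fst x)" "hom V X" using Cons.prems by simp_all
  have "cod (\<lambda>Y. f (x # Y)) g e X = cod (\<lambda>Y. f' (x # Y)) g e X"
    by (rule Cons.IH) (use Cons.prems x in \<open>auto intro: mlin_Cons\<close>)
  moreover have "f ((e + fst x, g [x]) # X) = f' ((e + fst x, g [x]) # X)"
    by (rule Cons.prems(4)) (use x maps_single[OF assms(4)] in auto)
  ultimately show ?case
    using cod_unary_Cons[OF assms(1) Cons.prems(1) assms(4,5) x]
      cod_unary_Cons[OF assms(1) Cons.prems(2) assms(4,5) x] by simp
qed simp

lemma cod_linear: "linear h \<Longrightarrow> cod (\<lambda>Z. h (f Z)) g e X = h (cod f g e X)"
  by (rule cod_apply[of UNIV h "\<lambda>_. UNIV"]) (auto simp: lin_on_def linear_add linear_scale)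

lemma mlin_linear: "linear h \<Longrightarrow> mlin V f \<Longrightarrow> mlin V (\<lambda>X. h (f X))"
  by (simp add: mlin_def linear_add linear_scale)

text \<open>The ring element is differentiated only when \<open>g\<close> hits the slot in which it
  acts. This happens once and contributes the single term with the symbol \<open>s\<close>.\<close>

lemma cod_slot_unary:
  assumes S: "subspace S" and lin: "\<And>r. linear (act r)" and act: "\<And>r u. r \<in> C \<Longrightarrow> u \<in> S \<Longrightarrow> act r u \<in> S"
    and g: "unary g" "maps (V0 S) g (V0 S) 0" and r: "r \<in> C" "s \<in> C"
    and gs: "\<And>u. u \<in> S \<Longrightarrow> g [(0, act r u)] = act r (g [(0, u)]) + act s u"
    and "slot act S r X X'" "mlin (V0 S) f" "Clin act S C {length X} f"
  shows "cod f g 0 X' = act r (cod f g 0 X) + act s (f X)"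
  using assms(9-)
proof (induction arbitrary: f rule: slot.induct)
  case (here u Y)
  note cV = closedV_V0[OF S]
  have ru: "act r u \<in> S" "act s u \<in> S" using act r here by auto
  have gu: "g [(0, u)] \<in> S" using g(2) here(1) by (simp add: maps_V0_iff)
  have rgu: "act r (g [(0, u)]) \<in> S" using act r gu by simp
  have eq: "f ((0, act r' w) # Z) = act r' (f ((0, w) # Z))" if "w \<in> S" "hom (V0 S) Z" "length Z = length Y" "r' \<in> C" for Z w r'
    by (rule ClinD[OF here(4) that(4) slot.here]) (use that in auto)
  have m: "mlin (V0 S) (\<lambda>Z. f ((0, w) # Z))" if "w \<in> S" for w
    by (rule mlin_Cons) (use here(3) that in auto)
  have "cod (\<lambda>Z. f ((0, act r u) # Z)) g 0 Y = cod (\<lambda>Z. act r (f ((0, u) # Z))) g 0 Y"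
    by (rule cod_unary_cong[OF cV]) (use m ru here g mlin_linear[OF lin] r in \<open>auto intro!: eq\<close>)
  also have "\<dots> = act r (cod (\<lambda>Z. f ((0, u) # Z)) g 0 Y)" by (rule cod_linear[OF lin])
  moreover have "f ((0, g [(0, act r u)]) # Y) = act r (f ((0, g [(0, u)]) # Y)) + act s (f ((0, u) # Y))"
    using mlinD0[OF here(3,2), of "act r (g [(0, u)])" 0 "act s u" 1] rgu ru here gu r by (simp add: gs eq)
  ultimately show ?case
    using cod_unary_Cons[OF cV here(3) g(2,1), of "(0, act r u)" Y] cod_unary_Cons[OF cV here(3) g(2,1), of "(0, u)" Y]
      ru here(1,2) by (simp add: linear_add[OF lin] del: cod.simps)
next
  case (there X X' v)
  note cV = closedV_V0[OF S]
  have h: "hom (V0 S) X" "hom (V0 S) X'"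
    using slot_hom[OF there(1)] slot_hom'[OF there(1)] act r by auto
  have gv: "g [(0, v)] \<in> S" using g(2) there(2) by (simp add: maps_V0_iff)
  have "cod (\<lambda>Z. f ((0, v) # Z)) g 0 X' = act r (cod (\<lambda>Z. f ((0, v) # Z)) g 0 X) + act s (f ((0, v) # X))"
    by (rule there.IH) (use there in \<open>auto intro!: mlin_Cons Clin_Cons\<close>)
  moreover have "f ((0, g [(0, v)]) # X') = act r (f ((0, g [(0, v)]) # X))"
    by (rule ClinD[OF there(5) r(1) slot.there[OF there(1) gv]]) simp
  ultimately show ?case
    using cod_unary_Cons[OF cV there(4) g(2,1), of "(0, v)" X'] cod_unary_Cons[OF cV there(4) g(2,1), of "(0, v)" X]
      there(2) h by (simp add: linear_add[OF lin] del: cod.simps)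
qed

lemma cod_act_unary:
  assumes S: "subspace S" and lin: "\<And>r. linear (act r)" and act: "\<And>r u. r \<in> C \<Longrightarrow> u \<in> S \<Longrightarrow> act r u \<in> S"
    and g: "unary g" "maps (V0 S) g (V0 S) 0" and r: "r \<in> C"
    and "mlin (V0 S) f" "Clin act S C {length X} f" "hom (V0 S) X"
  shows "cod f (\<lambda>Y. act r (g Y)) 0 X = act r (cod f g 0 X)"
proof -
  have cV: "closedV (V0 S)" by (rule closedV_V0[OF S])
  have u: "unary (\<lambda>Y. act r (g Y))" using g(1) linear_0[OF lin] by (auto simp: unary_def)
  have m: "maps (V0 S) (\<lambda>Y. act r (g Y)) (V0 S) 0" using g(2) act r by (auto simp: maps_V0_iff)
  show ?thesis using assms(7-)
  proof (induction X arbitrary: f)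
    case Nil then show ?case using linear_0[OF lin] by simp
  next
    case (Cons x X)
    then obtain v where x: "x = (0, v)" "v \<in> S" "hom (V0 S) X" by (cases x) auto
    have gv: "g [(0, v)] \<in> S" using g(2) x by (simp add: maps_V0_iff)
    have "cod (\<lambda>Y. f ((0, v) # Y)) (\<lambda>Y. act r (g Y)) 0 X = act r (cod (\<lambda>Y. f ((0, v) # Y)) g 0 X)"
      by (rule Cons.IH) (use x Cons.prems in \<open>auto intro!: mlin_Cons Clin_Cons\<close>)
    moreover have "f ((0, act r (g [(0, v)])) # X) = act r (f ((0, g [(0, v)]) # X))"
      by (rule ClinD[OF Cons.prems(2) r slot.here]) (use gv x in auto)
    ultimately show ?case
      using cod_unary_Cons[OF cV Cons.prems(1) m u, of "(0, v)" X] cod_unary_Cons[OF cV Cons.prems(1) g(2,1), of "(0, v)" X] x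
      by (simp add: linear_add[OF lin] del: cod.simps)
  qed
qed

lemma fhat_single [simp]: "fhat m n [x] = snd x"
  by (simp add: fhat_def FF_Cons)

lemma fhat_Cons:
  assumes mn: "\<And>b. b \<in> S \<Longrightarrow> maps (V0 S) (m b) (V0 S) 0 \<and> maps (V0 S) (n b) (V0 S) 0"
    and "b \<in> S" "hom (V0 S) X" "X \<noteq> []"
  shows "fhat m n ((0, b) # X) = FF m n (m b) X - cod (fhat m n) (n b) 0 X"
proof -
  let ?p = "\<lambda>W :: (int \<times> 'a) list. if length W = 1 then snd (hd W) else 0"
  have "FF m n (\<lambda>Z. ?p ((0, b) # Z) + cod ?p (m b) 0 Z) X = FF m n (m b) X"
  proof (rule FF_cong[of "V0 S"])
    fix Z :: "(int \<times> 'a) list" assume "(Z = []) = (X = [])"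
    then have Z: "Z \<noteq> []" using assms(4) by simp
    have "unary ?p" by (auto simp: unary_def)
    from cod_of_unary[OF this Z] show "?p ((0, b) # Z) + cod ?p (m b) 0 Z = m b Z" using Z by simp
  qed (use mn assms in auto)
  then show ?thesis by (simp add: fhat_def FF_Cons)
qed

text \<open>For the first slot, \<open>m\<close> and \<open>n\<close> are linear in their index. For
  a later slot, \<open>n b\<close> and the unary part of \<open>m b\<close> each leave an extra
  term, \<open>s\<close> acting on the value of \<open>fhat\<close>. The symbol is the same for
  both, so the difference in the recursion of \<open>fhat\<close> cancels it.\<close>

theorem Clin_fhat:
  assumes S: "subspace S" and lin: "\<And>r. linear (act r)" and act: "\<And>r u. r \<in> C \<Longrightarrow> u \<in> S \<Longrightarrow> act r u \<in> S"
    and mn: "\<And>b. b \<in> S \<Longrightarrow> maps (V0 S) (m b) (V0 S) 0 \<and> maps (V0 S) (n b) (V0 S) 0"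
      "\<And>b. b \<in> S \<Longrightarrow> mlin (V0 S) (m b) \<and> mlin (V0 S) (n b)"
      "\<And>u v c X. u \<in> S \<Longrightarrow> v \<in> S \<Longrightarrow> hom (V0 S) X \<Longrightarrow> X \<noteq> [] \<Longrightarrow>
        m (c *\<^sub>R u + v) X = c *\<^sub>R m u X + m v X \<and> n (c *\<^sub>R u + v) X = c *\<^sub>R n u X + n v X"
    and un: "\<And>b. b \<in> S \<Longrightarrow> unary (n b)"
    and sym: "\<And>b r. b \<in> S \<Longrightarrow> r \<in> C \<Longrightarrow> \<exists>s\<in>C. \<forall>u\<in>S. n b [(0, act r u)] = act r (n b [(0, u)]) + act s u
        \<and> m b [(0, act r u)] = act r (m b [(0, u)]) + act s u"
    and m2: "\<And>b. b \<in> S \<Longrightarrow> Clin act S C {2..} (m b)"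
    and mnC: "\<And>b r X. b \<in> S \<Longrightarrow> r \<in> C \<Longrightarrow> hom (V0 S) X \<Longrightarrow> X \<noteq> [] \<Longrightarrow>
        m (act r b) X = act r (m b X) \<and> n (act r b) X = act r (n b X)"
  shows "Clin act S C UNIV (fhat m n)"
proof -
  let ?f = "fhat m n"
  have fmaps: "maps (V0 S) ?f (V0 S) 0" by (rule maps_fhat[OF S mn(1)])
  have fmlin: "mlin (V0 S) ?f"
    unfolding fhat_def
  proof (rule mlin_FF[OF S mn])
    show "mlin (V0 S) (\<lambda>W. if length W = 1 then snd (hd W) else 0)"
      by (auto simp: mlin_def)
  qed
  have "Clin act S C {..N} ?f" for N
  proof (induction N)
    case 0 show ?case by (auto simp: Clin_def dest: slot_length)
  next
    case (Suc N)
    show ?case unfolding Clin_def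
    proof (intro allI impI)
      fix r W W' assume r: "r \<in> C" and W: "slot act S r W W'" and l: "length W \<in> {..Suc N}"
      have CN: "Clin act S C {k} ?f" if "k \<le> N" for k
        using Suc that by (auto simp: Clin_def)
      from W show "?f W' = act r (?f W)"
      proof cases
        case (here u Y)
        show ?thesis
        proof (cases "Y = []")
          case True then show ?thesis using here by simp
        next
          case False
          have ru: "act r u \<in> S" using act r here by simp
          have "FF m n (m (act r u)) Y = FF m n (\<lambda>Z. act r (m u Z)) Y"
            by (rule FF_cong[of "V0 S"]) (use mn(1) mnC here r False in auto)
          also have "\<dots> = act r (FF m n (m u) Y)"
            by (rule FF_apply[of UNIV "act r" "V0 S"])
              (use mn(1) here in \<open>auto simp: lin_on_def linear_add[OF lin] linear_scale[OF lin]\<close>)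
          moreover have "cod ?f (n (act r u)) 0 Y = cod ?f (\<lambda>Z. act r (n u Z)) 0 Y"
            by (rule cod_cong[of "V0 S"]) (use mn(1) mnC here r ru in auto)
          moreover have "\<dots> = act r (cod ?f (n u) 0 Y)"
            by (rule cod_act_unary[OF S lin act _ _ r fmlin CN]) (use mn un here l in auto)
          ultimately show ?thesis
            using fhat_Cons[of S m n, OF mn(1)] here ru False by (simp add: linear_diff[OF lin])
        qed
      next
        case (there X X' b)
        have ne: "X \<noteq> []" "X' \<noteq> []" "length X \<le> N" using slot_length[OF there(3)] l there by auto
        have h: "hom (V0 S) X" "hom (V0 S) X'" using slot_hom[OF there(3)] slot_hom'[OF there(3)] act r by auto
        obtain s where s: "s \<in> C" "\<And>u. u \<in> S \<Longrightarrow> n b [(0, act r u)] = act r (n b [(0, u)]) + act s u"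
          "\<And>u. u \<in> S \<Longrightarrow> m b [(0, act r u)] = act r (m b [(0, u)]) + act s u"
          using sym[OF there(4) r] by blast
        let ?m1 = "\<lambda>X. if length X = 1 then m b X else 0" and ?m2 = "\<lambda>X. if length X = 1 then 0 else m b X"
        \<comment> \<open>The unary part of \<open>m b\<close> carries the symbol and is separated;
          the rest is linear over the ring and covered by \<open>Clin_FX\<close>.\<close>
        have dec: "FF m n (m b) Z = m b [(0, ?f Z)] + FX ?f ?m2 Z" if "hom (V0 S) Z" "Z \<noteq> []" for Z
        proof -
          have "FF m n (m b) Z = FX ?f (m b) Z"
            by (rule FF_eq_FX[OF S mn(1)]) (use mn(2) there that in auto)
          also have "\<dots> = FX ?f (\<lambda>X. ?m1 X + ?m2 X) Z"
            by (rule arg_cong[of _ _ "\<lambda>\<phi>. FX ?f \<phi> Z"]) auto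
          also have "\<dots> = FX ?f ?m1 Z + FX ?f ?m2 Z" by (rule FX_add)
          also have "FX ?f ?m1 Z = m b [(0, ?f Z)]"
            using FX_unary[of ?m1 Z ?f] that by (simp add: unary_def hom_V0_dg)
          finally show ?thesis .
        qed
        have fX: "?f X' = act r (?f X)" by (rule ClinD[OF Suc r there(3)]) (use ne in simp)
        have fS: "?f X \<in> S" using fmaps h ne by (simp add: maps_V0_iff)
        have "Clin act S C {..N} ?m2"
          unfolding Clin_def
        proof (intro allI impI)
          fix r X X' assume a: "r \<in> C" "slot act S r X X'"
          have "X \<noteq> []" "length X' = length X" using slot_length[OF a(2)] by auto
          moreover then have "length X > 0" by simp
          then have "length X \<noteq> 1 \<Longrightarrow> 2 \<le> length X" by linarith
          ultimately show "?m2 X' = act r (?m2 X)"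
            using ClinD[OF m2[OF there(4)] a] by (auto simp: linear_0[OF lin])
        qed
        from ClinD[OF Clin_FX[OF lin fmaps Suc this] r there(3)]
        have 1: "FX ?f ?m2 X' = act r (FX ?f ?m2 X)" using ne by simp
        have 2: "cod ?f (n b) 0 X' = act r (cod ?f (n b) 0 X) + act s (?f X)"
          by (rule cod_slot_unary[OF S lin act _ _ r s(1,2) there(3) fmlin CN]) (use mn un there ne in auto)
        show ?thesis
          using fhat_Cons[of S m n, OF mn(1)] there ne h dec 1 2 fX fS s(3)
          by (simp add: linear_diff[OF lin] linear_add[OF lin])
      qed
    qed
  qed
  then show ?thesis by (auto simp: Clin_def)
qed

section \<open>Shuffle and partition sums\<close>

definition inv_sign :: "nat list \<Rightarrow> nat \<Rightarrow> nat \<Rightarrow> real"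
  where "inv_sign ds a b = (if b < a then (- 1) ^ (ds ! a * ds ! b) else 1)"

lemma koszul_inv_sign: "koszul ds \<sigma> = (\<Prod>k<length \<sigma>. \<Prod>i<k. inv_sign ds (\<sigma> ! i) (\<sigma> ! k))"
  by (simp add: koszul_def inv_sign_def)

lemma koszul_snoc: "koszul ds (\<sigma> @ [x]) = koszul ds \<sigma> * (\<Prod>a\<leftarrow>\<sigma>. inv_sign ds a x)"
proof -
  have "(\<Prod>i<length \<sigma>. inv_sign ds (\<sigma> ! i) x) = (\<Prod>a\<leftarrow>\<sigma>. inv_sign ds a x)"
    by (simp add: prod.list_conv_set_nth atLeast0LessThan)
  moreover have "(\<Prod>k<length \<sigma>. \<Prod>i<k. inv_sign ds ((\<sigma> @ [x]) ! i) ((\<sigma> @ [x]) ! k)) = koszul ds \<sigma>"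
    unfolding koszul_inv_sign by (intro prod.cong refl) (auto simp: nth_append)
  ultimately show ?thesis
    by (simp add: koszul_inv_sign[of ds "\<sigma> @ [x]"] nth_append)
qed

definition cross :: "nat list \<Rightarrow> nat list \<Rightarrow> nat list \<Rightarrow> real"
  where "cross ds \<sigma> \<tau> = (\<Prod>b\<leftarrow>\<tau>. \<Prod>a\<leftarrow>\<sigma>. inv_sign ds a b)"

lemma koszul_append: "koszul ds (\<sigma> @ \<tau>) = koszul ds \<sigma> * koszul ds \<tau> * cross ds \<sigma> \<tau>"
proof (induction \<tau> rule: rev_induct)
  case Nil then show ?case by (simp add: koszul_def cross_def)
next
  case (snoc x \<tau>)
  have "koszul ds (\<sigma> @ \<tau> @ [x]) = koszul ds (\<sigma> @ \<tau>) * ((\<Prod>a\<leftarrow>\<sigma>. inv_sign ds a x) * (\<Prod>a\<leftarrow>\<tau>. inv_sign ds a x))"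
    using koszul_snoc[of ds "\<sigma> @ \<tau>" x] by simp
  then show ?case by (simp add: snoc koszul_snoc cross_def)
qed

lemma koszul_sorted: "sorted \<sigma> \<Longrightarrow> koszul ds \<sigma> = 1"
proof (induction \<sigma> rule: rev_induct)
  case Nil then show ?case by (simp add: koszul_def)
next
  case (snoc x \<sigma>)
  have "(\<Prod>a\<leftarrow>\<sigma>. inv_sign ds a x) = (\<Prod>a\<leftarrow>\<sigma>. 1)"
    using snoc.prems by (intro arg_cong[of _ _ prod_list] map_cong refl) (auto simp: sorted_append inv_sign_def)
  also have "\<dots> = 1" by (induction \<sigma>) simp_all
  finally show ?case using snoc by (simp add: koszul_snoc sorted_append)
qed

lemma koszul_shuffle: "\<sigma> \<in> shuffle_lists k p \<Longrightarrow> koszul ds \<sigma> = cross ds (take k \<sigma>) (drop k \<sigma>)"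
  using koszul_append[of ds "take k \<sigma>" "drop k \<sigma>"] by (simp add: shuffle_lists_def koszul_sorted)

lemma inv_sign_Suc [simp]:
  "inv_sign (d # ds) (Suc a) (Suc b) = inv_sign ds a b" "inv_sign (d # ds) 0 b = 1"
  by (simp_all add: inv_sign_def)

lemma cross_left: "cross (d # ds) (0 # map Suc \<sigma>) (map Suc \<tau>) = cross ds \<sigma> \<tau>"
  by (simp add: cross_def comp_def)

text \<open>The index \<open>0\<close> stands behind all of \<sigma> but is smaller, so it forms an
  inversion with each of its entries.\<close>

lemma cross_right: "cross (d # ds) (map Suc \<sigma>) (0 # map Suc \<tau>) = sg (int d * int (sum_list (pick ds \<sigma>))) * cross ds \<sigma> \<tau>"
proof -
  have "(\<Prod>a\<leftarrow>\<sigma>. inv_sign (d # ds) (Suc a) 0) = sg (int d * int (sum_list (pick ds \<sigma>)))"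
    by (induction \<sigma>) (simp_all add: inv_sign_def sg_norm sg_power[symmetric] mult.commute)
  then show ?thesis by (simp add: cross_def comp_def)
qed

lemma length_shuffle: "\<sigma> \<in> shuffle_lists k p \<Longrightarrow> length \<sigma> = k + p"
  using distinct_card[of \<sigma>] by (simp add: shuffle_lists_def)

lemma finite_shuffle: "finite (shuffle_lists k p)"
proof (rule finite_subset[OF _ finite_lists_length_eq[of "{..<k + p}" "k + p"]])
  show "shuffle_lists k p \<subseteq> {xs. set xs \<subseteq> {..<k + p} \<and> length xs = k + p}"
  proof
    fix \<sigma> assume "\<sigma> \<in> shuffle_lists k p"
    moreover from this have "length \<sigma> = k + p" by (rule length_shuffle)
    ultimately show "\<sigma> \<in> {xs. set xs \<subseteq> {..<k + p} \<and> length xs = k + p}"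
      unfolding shuffle_lists_def by blast
  qed
qed simp

lemma shuffle_0: "shuffle_lists 0 0 = {[]}"
proof -
  have "\<sigma> \<in> shuffle_lists 0 0 \<longleftrightarrow> \<sigma> = []" for \<sigma>
    using length_shuffle[of \<sigma> 0 0] unfolding shuffle_lists_def by (cases \<sigma>) simp_all
  then show ?thesis by blast
qed

lemma Suc_preds: "0 \<notin> set xs \<Longrightarrow> \<exists>ys. xs = map Suc ys"
  by (rule exI[of _ "map (\<lambda>x. x - 1) xs"]) (auto simp: comp_def intro!: map_idI[symmetric], metis Suc_pred not_gr_zero)

lemma pred_set:
  assumes "insert 0 (Suc ` A) = {..<Suc n}"
  shows "A = {..<n}"
proof -
  have "insert 0 (Suc ` A) = insert 0 (Suc ` {..<n})"
    using assms by (simp only: lessThan_Suc_eq_insert_0)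
  then have "Suc ` A = Suc ` {..<n}"
    by (subst (asm) insert_ident) auto
  then show ?thesis by (simp only: inj_image_eq_iff[OF inj_Suc])
qed

text \<open>The smallest index opens one of the two increasing blocks; deleting it and lowering the
  others leaves a smaller shuffle. This mirrors the recursion of \<open>cod\<close> on the first
  entry.\<close>

lemma shuffle_step:
  assumes "k + p > 0"
  shows "shuffle_lists k p = (if k = 0 then {} else (\<lambda>\<sigma>. 0 # map Suc \<sigma>) ` shuffle_lists (k - 1) p)
     \<union> (if p = 0 then {} else (\<lambda>\<sigma>. map Suc (take k \<sigma>) @ 0 # map Suc (drop k \<sigma>)) ` shuffle_lists k (p - 1))"
    (is "_ = ?A \<union> ?B")
proof (intro equalityI subsetI)
  fix \<sigma> assume s: "\<sigma> \<in> shuffle_lists k p"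
  define \<alpha> \<beta> where ab: "\<alpha> = take k \<sigma>" "\<beta> = drop k \<sigma>"
  have sg: "\<sigma> = \<alpha> @ \<beta>" and l: "length \<alpha> = k" "length \<beta> = p" using length_shuffle[OF s] by (simp_all add: ab)
  have srt: "sorted \<alpha>" "sorted \<beta>" "distinct (\<alpha> @ \<beta>)" "set (\<alpha> @ \<beta>) = {..<k + p}"
    using s by (auto simp: shuffle_lists_def ab simp flip: set_append)
  have "0 \<in> set (\<alpha> @ \<beta>)" using srt(4) assms by simp
  then consider "0 \<in> set \<alpha>" | "0 \<in> set \<beta>" by auto
  then show "\<sigma> \<in> ?A \<union> ?B"
  proof cases
    case 1
    then obtain \<alpha>1 where a: "\<alpha> = 0 # \<alpha>1" using srt(1) by (cases \<alpha>) auto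
    then have "0 \<notin> set (\<alpha>1 @ \<beta>)" using srt(3) by auto
    then obtain \<rho> where r: "\<alpha>1 @ \<beta> = map Suc \<rho>" using Suc_preds by blast
    have k: "k = Suc (k - 1)" "length \<alpha>1 = k - 1" using a l by auto
    have "insert 0 (Suc ` set \<rho>) = {..<k + p}" using srt(4) a r by (metis list.set_map set_simps(2) append_Cons)
    also have "k + p = Suc (k - 1 + p)" using k by simp
    finally have "set \<rho> = {..<k - 1 + p}" by (rule pred_set)
    moreover have "take (k - 1) (map Suc \<rho>) = \<alpha>1" "drop (k - 1) (map Suc \<rho>) = \<beta>"
      using r[symmetric] k(2) by simp_all
    then have "sorted (map Suc (take (k - 1) \<rho>))" "sorted (map Suc (drop (k - 1) \<rho>))"
      using srt a by (simp_all add: take_map drop_map)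
    then have "sorted (take (k - 1) \<rho>)" "sorted (drop (k - 1) \<rho>)" by (simp_all add: sorted_map)
    moreover have "distinct \<rho>" using srt(3) a r by (auto simp: distinct_map)
    ultimately have "\<rho> \<in> shuffle_lists (k - 1) p" by (simp add: shuffle_lists_def)
    then show ?thesis using a r k(1) sg by auto
  next
    case 2
    then obtain \<beta>1 where b: "\<beta> = 0 # \<beta>1" using srt(2) by (cases \<beta>) auto
    then have "0 \<notin> set (\<alpha> @ \<beta>1)" using srt(3) by auto
    then obtain \<rho> where r: "\<alpha> @ \<beta>1 = map Suc \<rho>" using Suc_preds by blast
    have p: "p = Suc (p - 1)" "length \<beta>1 = p - 1" using b l by auto
    have "set (\<alpha> @ \<beta>) = insert 0 (set (\<alpha> @ \<beta>1))" using b by auto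
    then have "insert 0 (Suc ` set \<rho>) = {..<k + p}" using srt(4) r by (metis list.set_map)
    also have "k + p = Suc (k + (p - 1))" using p by simp
    finally have "set \<rho> = {..<k + (p - 1)}" by (rule pred_set)
    moreover have t: "take k (map Suc \<rho>) = \<alpha>" "drop k (map Suc \<rho>) = \<beta>1"
      using r[symmetric] l by simp_all
    then have "sorted (map Suc (take k \<rho>))" "sorted (map Suc (drop k \<rho>))"
      using srt b by (simp_all add: take_map drop_map)
    then have "sorted (take k \<rho>)" "sorted (drop k \<rho>)" by (simp_all add: sorted_map)
    moreover have "distinct (map Suc \<rho>)" using srt(3) b r by (metis distinct_append distinct.simps(2) disjoint_insert(2) list.simps(15))
    then have "distinct \<rho>" by (simp add: distinct_map)
    ultimately have "\<rho> \<in> shuffle_lists k (p - 1)" by (simp add: shuffle_lists_def)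
    moreover have "\<sigma> = map Suc (take k \<rho>) @ 0 # map Suc (drop k \<rho>)"
      using t sg b by (simp add: take_map drop_map)
    ultimately show ?thesis using p(1) by auto
  qed
next
  fix \<sigma> assume "\<sigma> \<in> ?A \<union> ?B"
  then consider \<rho> where "k \<noteq> 0" "\<rho> \<in> shuffle_lists (k - 1) p" "\<sigma> = 0 # map Suc \<rho>"
    | \<rho> where "p \<noteq> 0" "\<rho> \<in> shuffle_lists k (p - 1)" "\<sigma> = map Suc (take k \<rho>) @ 0 # map Suc (drop k \<rho>)"
    by (auto split: if_splits)
  then show "\<sigma> \<in> shuffle_lists k p"
  proof cases
    case 1
    then obtain k' where k: "k = Suc k'" by (cases k) auto
    have "insert 0 (Suc ` {..<k' + p}) = {..<Suc (k' + p)}" by (rule lessThan_Suc_eq_insert_0[symmetric])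
    then show ?thesis using 1 k
      by (auto simp: shuffle_lists_def distinct_map take_map drop_map sorted_map)
  next
    case 2
    then obtain p' where p: "p = Suc p'" by (cases p) auto
    have l: "length \<rho> = k + p'" using length_shuffle[OF 2(2)] p by simp
    have i: "insert 0 (Suc ` {..<k + p'}) = {..<Suc (k + p')}" by (rule lessThan_Suc_eq_insert_0[symmetric])
    have r: "distinct \<rho>" "set \<rho> = {..<k + p'}" "sorted (take k \<rho>)" "sorted (drop k \<rho>)"
      using 2 p by (auto simp: shuffle_lists_def)
    have "set (take k \<rho>) \<union> set (drop k \<rho>) = {..<k + p'}" using r(2) by (metis append_take_drop_id set_append)
    then have s: "set \<sigma> = {..<k + p}" using 2 p i by (simp add: image_Un[symmetric])
    moreover have "distinct \<sigma>" by (rule card_distinct) (use s 2 l p in simp)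
    moreover have "take k \<sigma> = map Suc (take k \<rho>)" "drop k \<sigma> = 0 # map Suc (drop k \<rho>)" using 2 l by simp_all
    ultimately show ?thesis using r by (simp add: shuffle_lists_def sorted_map)
  qed
qed

definition shsum :: "nat \<Rightarrow> nat \<Rightarrow> (nat list \<Rightarrow> nat list \<Rightarrow> 'b::real_vector) \<Rightarrow> 'b"
  where "shsum k p \<Theta> = (\<Sum>\<sigma>\<in>shuffle_lists k p. \<Theta> (take k \<sigma>) (drop k \<sigma>))"

lemma shsum_0: "shsum 0 0 \<Theta> = \<Theta> [] []"
  by (simp add: shsum_def shuffle_0)

lemma shsum_scale: "shsum k p (\<lambda>\<alpha> \<beta>. c *\<^sub>R \<Theta> \<alpha> \<beta>) = c *\<^sub>R shsum k p \<Theta>"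
  by (simp add: shsum_def scaleR_sum_right)

lemma shsum_step:
  assumes "k + p > 0"
  shows "shsum k p \<Theta> = (if k = 0 then 0 else shsum (k - 1) p (\<lambda>\<alpha> \<beta>. \<Theta> (0 # map Suc \<alpha>) (map Suc \<beta>)))
    + (if p = 0 then 0 else shsum k (p - 1) (\<lambda>\<alpha> \<beta>. \<Theta> (map Suc \<alpha>) (0 # map Suc \<beta>)))"
proof -
  let ?a = "\<lambda>\<sigma>. 0 # map Suc \<sigma>" and ?b = "\<lambda>\<sigma>. map Suc (take k \<sigma>) @ 0 # map Suc (drop k \<sigma>)"
  let ?A = "if k = 0 then {} else ?a ` shuffle_lists (k - 1) p" and ?B = "if p = 0 then {} else ?b ` shuffle_lists k (p - 1)"
  have dis: "?A \<inter> ?B = {}"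
  proof -
    have "?a \<rho> \<noteq> ?b \<rho>'" if "k \<noteq> 0" "\<rho>' \<in> shuffle_lists k (p - 1)" for \<rho> \<rho>'
      using length_shuffle[OF that(2)] that(1) by (cases \<rho>'; cases k) auto
    then show ?thesis by auto
  qed
  have "shsum k p \<Theta> = (\<Sum>\<sigma>\<in>?A. \<Theta> (take k \<sigma>) (drop k \<sigma>)) + (\<Sum>\<sigma>\<in>?B. \<Theta> (take k \<sigma>) (drop k \<sigma>))"
    unfolding shsum_def shuffle_step[OF assms]
    by (rule sum.union_disjoint) (use dis finite_shuffle in auto)
  moreover have "(\<Sum>\<sigma>\<in>?A. \<Theta> (take k \<sigma>) (drop k \<sigma>))
      = (if k = 0 then 0 else shsum (k - 1) p (\<lambda>\<alpha> \<beta>. \<Theta> (0 # map Suc \<alpha>) (map Suc \<beta>)))"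
  proof (cases k)
    case (Suc k')
    have "inj_on ?a (shuffle_lists k' p)" by (auto simp: inj_on_def)
    then show ?thesis using Suc
      by (simp add: shsum_def sum.reindex comp_def take_map drop_map)
  qed simp
  moreover have "(\<Sum>\<sigma>\<in>?B. \<Theta> (take k \<sigma>) (drop k \<sigma>))
      = (if p = 0 then 0 else shsum k (p - 1) (\<lambda>\<alpha> \<beta>. \<Theta> (map Suc \<alpha>) (0 # map Suc \<beta>)))"
  proof (cases p)
    case (Suc p')
    have "inj_on ?b (shuffle_lists k p')"
    proof (rule inj_onI)
      fix \<rho> \<rho>' assume *: "\<rho> \<in> shuffle_lists k p'" "\<rho>' \<in> shuffle_lists k p'" "?b \<rho> = ?b \<rho>'"
      have "length (take k \<rho>) = length (take k \<rho>')" using length_shuffle[OF *(1)] length_shuffle[OF *(2)] by simp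
      then have "take k \<rho> = take k \<rho>'" "drop k \<rho> = drop k \<rho>'" using *(3) by (simp_all add: inj_map_eq_map)
      then show "\<rho> = \<rho>'" by (metis append_take_drop_id)
    qed
    moreover have "take k (?b \<rho>) = map Suc (take k \<rho>)" "drop k (?b \<rho>) = 0 # map Suc (drop k \<rho>)"
      if "\<rho> \<in> shuffle_lists k p'" for \<rho> using length_shuffle[OF that] by simp_all
    ultimately show ?thesis using Suc
      by (simp add: shsum_def sum.reindex comp_def cong: sum.cong)
  qed simp
  ultimately show ?thesis by simp
qed

lemma sum_triangle_Suc:
  fixes g :: "nat \<Rightarrow> nat \<Rightarrow> 'b::comm_monoid_add"
  shows "(\<Sum>k<Suc m. \<Sum>p<Suc m - k. if k = 0 then 0 else g (k - 1) p) = (\<Sum>k<m. \<Sum>p<m - k. g k p)"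
    and "(\<Sum>k<Suc m. \<Sum>p<Suc m - k. if p = 0 then 0 else g k (p - 1)) = (\<Sum>k<m. \<Sum>p<m - k. g k p)"
proof -
  show "(\<Sum>k<Suc m. \<Sum>p<Suc m - k. if k = 0 then 0 else g (k - 1) p) = (\<Sum>k<m. \<Sum>p<m - k. g k p)"
    by (subst sum.lessThan_Suc_shift) simp
  have "(\<Sum>p<Suc m - k. if p = 0 then 0 else g k (p - 1)) = (\<Sum>p<m - k. g k p)" if "k \<le> m" for k
    using that by (simp only: Suc_diff_le sum.lessThan_Suc_shift) simp
  then have "(\<Sum>k<Suc m. \<Sum>p<Suc m - k. if p = 0 then 0 else g k (p - 1)) = (\<Sum>k<Suc m. \<Sum>p<m - k. g k p)"
    by - (rule sum.cong[OF refl], simp)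
  then show "(\<Sum>k<Suc m. \<Sum>p<Suc m - k. if p = 0 then 0 else g k (p - 1)) = (\<Sum>k<m. \<Sum>p<m - k. g k p)"
    by simp
qed

abbreviation degs :: "nat list \<Rightarrow> 'a list \<Rightarrow> (int \<times> 'a) list"
  where "degs ds vs \<equiv> zip (map int ds) vs"

text \<open>The three terms of \<open>cod\<close> are the cases k = p = 0, index \<open>0\<close> in
  the first block, and index \<open>0\<close> in the second block. Only the first k + p entries are
  shuffled; the entry at position \<open>k + p\<close> closes the block of \<open>G\<close>. The
  triangle of pairs (k, p) for the longer list decomposes accordingly by
  \<open>sum_triangle_Suc\<close>.\<close>

lemma cod_eq_shuffle_sum:
  fixes F :: "(int \<times> 'a) list \<Rightarrow> 'b::real_vector"
  assumes "length ds = length vs"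
  shows "cod F G e (degs ds vs) = (\<Sum>k<length vs. \<Sum>p<length vs - k. shsum k p (\<lambda>\<alpha> \<beta>.
     (cross ds \<alpha> \<beta> * sg (e * int (sum_list (pick ds \<alpha>)))) *\<^sub>R
     F (pick (degs ds vs) \<alpha> @ [(e + int (sum_list (pick ds \<beta>)) + int (ds ! (k + p)), G (pick (degs ds vs) \<beta> @ [degs ds vs ! (k + p)]))]
        @ drop (k + p + 1) (degs ds vs))))"
  using assms
proof (induction ds vs arbitrary: F G e rule: list_induct2)
  case Nil then show ?case by simp
next
  case (Cons d ds v vs)
  let ?X = "degs ds vs" and ?x = "(int d, v)" and ?m = "length vs"
  let ?T = "\<lambda>ds X F G e k p \<alpha> \<beta>. (cross ds \<alpha> \<beta> * sg (e * int (sum_list (pick ds \<alpha>)))) *\<^sub>R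
     F (pick X \<alpha> @ [(e + int (sum_list (pick ds \<beta>)) + int (ds ! (k + p)), G (pick X \<beta> @ [X ! (k + p)]))]
        @ drop (k + p + 1) X)"
  have pk: "pick (y # Y) (map Suc \<alpha>) = pick Y \<alpha>" for y and Y :: "'c list" and \<alpha> by simp
  have step: "shsum k p (?T (d # ds) (?x # ?X) F G e k p)
      = (if k = 0 \<and> p = 0 then F ((e + int d, G [?x]) # ?X) else 0)
      + ((if k = 0 then 0 else sg (e * int d) *\<^sub>R shsum (k - 1) p (?T ds ?X (\<lambda>Y. F (?x # Y)) G e (k - 1) p))
      + (if p = 0 then 0 else shsum k (p - 1) (?T ds ?X F (\<lambda>Y. G (?x # Y)) (e + int d) k (p - 1))))" for k p
  proof (cases "k = 0 \<and> p = 0")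
    case True
    then show ?thesis by (simp add: shsum_0 cross_def)
  next
    case False
    let ?\<Theta> = "?T (d # ds) (?x # ?X) F G e k p"
    have "shsum (k - 1) p (\<lambda>\<alpha> \<beta>. ?\<Theta> (0 # map Suc \<alpha>) (map Suc \<beta>))
        = shsum (k - 1) p (\<lambda>\<alpha> \<beta>. sg (e * int d) *\<^sub>R ?T ds ?X (\<lambda>Y. F (?x # Y)) G e (k - 1) p \<alpha> \<beta>)" if "k \<noteq> 0"
      by (rule arg_cong[of _ _ "shsum (k - 1) p"], use that in \<open>cases k\<close>)
        (simp_all add: fun_eq_iff cross_left sg_norm comp_def mult.commute mult.left_commute)
    then have A: "(if k = 0 then 0 else shsum (k - 1) p (\<lambda>\<alpha> \<beta>. ?\<Theta> (0 # map Suc \<alpha>) (map Suc \<beta>)))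
      = (if k = 0 then 0 else sg (e * int d) *\<^sub>R shsum (k - 1) p (?T ds ?X (\<lambda>Y. F (?x # Y)) G e (k - 1) p))"
      unfolding shsum_scale by argo
    have "shsum k (p - 1) (\<lambda>\<alpha> \<beta>. ?\<Theta> (map Suc \<alpha>) (0 # map Suc \<beta>))
        = shsum k (p - 1) (\<lambda>\<alpha> \<beta>. ?T ds ?X F (\<lambda>Y. G (?x # Y)) (e + int d) k (p - 1) \<alpha> \<beta>)" if "p \<noteq> 0"
      by (rule arg_cong[of _ _ "shsum k (p - 1)"], use that in \<open>cases p\<close>)
        (simp_all add: fun_eq_iff cross_right sg_norm comp_def mult.commute mult.left_commute add.assoc add.left_commute)
    then have B: "(if p = 0 then 0 else shsum k (p - 1) (\<lambda>\<alpha> \<beta>. ?\<Theta> (map Suc \<alpha>) (0 # map Suc \<beta>)))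
      = (if p = 0 then 0 else shsum k (p - 1) (?T ds ?X F (\<lambda>Y. G (?x # Y)) (e + int d) k (p - 1)))"
      by argo
    have "k + p > 0" using False by simp
    show ?thesis
      unfolding shsum_step[OF \<open>k + p > 0\<close>, of ?\<Theta>] A B by (simp only: False if_False add_0_left)
  qed
  have z: "(\<Sum>k<Suc ?m. \<Sum>p<Suc ?m - k. if k = 0 \<and> p = 0 then F ((e + int d, G [?x]) # ?X) else 0)
      = F ((e + int d, G [?x]) # ?X)"
    by (subst sum.lessThan_Suc_shift) (simp add: sum.lessThan_Suc_shift)
  have "(\<Sum>k<Suc ?m. \<Sum>p<Suc ?m - k. shsum k p (?T (d # ds) (?x # ?X) F G e k p))
     = F ((e + int d, G [?x]) # ?X)
       + ((\<Sum>k<?m. \<Sum>p<?m - k. sg (e * int d) *\<^sub>R shsum k p (?T ds ?X (\<lambda>Y. F (?x # Y)) G e k p))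
       + (\<Sum>k<?m. \<Sum>p<?m - k. shsum k p (?T ds ?X F (\<lambda>Y. G (?x # Y)) (e + int d) k p)))"
    unfolding step sum.distrib z sum_triangle_Suc(1)[where g = "\<lambda>k p. sg (e * int d) *\<^sub>R shsum k p (?T ds ?X (\<lambda>Y. F (?x # Y)) G e k p)"]
      sum_triangle_Suc(2)[where g = "\<lambda>k p. shsum k p (?T ds ?X F (\<lambda>Y. G (?x # Y)) (e + int d) k p)"] ..
  then show ?case
    using Cons.IH[of "\<lambda>Y. F (?x # Y)" G e] Cons.IH[of F "\<lambda>Y. G (?x # Y)" "e + int d"]
    by (simp add: scaleR_sum_right add.assoc)
qed

lemma sum_triangle_swap:
  fixes h :: "nat \<Rightarrow> nat \<Rightarrow> 'b::comm_monoid_add"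
  shows "(\<Sum>p<n. \<Sum>k<n - p. h k p) = (\<Sum>k<n. \<Sum>p<n - k. h k p)"
proof -
  have "(\<Sum>(p, k)\<in>(SIGMA p:{..<n}. {..<n - p}). h k p) = (\<Sum>(k, p)\<in>(SIGMA k:{..<n}. {..<n - k}). h k p)"
    by (rule sum.reindex_bij_witness[where i = prod.swap and j = prod.swap]) auto
  then show ?thesis by (simp add: sum.Sigma)
qed

lemma shuffle_term:
  assumes l: "length ds = length vs" and kp: "k < length vs" "p < length vs - k" and s: "\<sigma> \<in> shuffle_lists k p"
  shows "map snd (pick (degs ds vs) (take k \<sigma>) @ [z] @ drop (k + p + 1) (degs ds vs))
      = pick vs (take k \<sigma>) @ [snd z] @ drop (k + p + 1) vs"
    "map snd (pick (degs ds vs) (drop k \<sigma>) @ [degs ds vs ! (k + p)]) = pick vs (drop k \<sigma>) @ [vs ! (k + p)]"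
    "koszul ds \<sigma> * (- 1) ^ sum_list (pick ds (take k \<sigma>))
      = cross ds (take k \<sigma>) (drop k \<sigma>) * sg (1 * int (sum_list (pick ds (take k \<sigma>))))"
proof -
  have "set \<sigma> = {..<k + p}" using s by (simp add: shuffle_lists_def)
  then have i: "i < length vs" if "i \<in> set \<sigma>" for i using that kp by auto
  have m: "map snd (drop m (degs ds vs)) = drop m vs" for m
    using l by (simp add: drop_map[symmetric])
  have "snd (degs ds vs ! i) = vs ! i" if "i < length vs" for i using that l by simp
  then show "map snd (pick (degs ds vs) (take k \<sigma>) @ [z] @ drop (k + p + 1) (degs ds vs))
      = pick vs (take k \<sigma>) @ [snd z] @ drop (k + p + 1) vs"
    "map snd (pick (degs ds vs) (drop k \<sigma>) @ [degs ds vs ! (k + p)]) = pick vs (drop k \<sigma>) @ [vs ! (k + p)]"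
    using kp i m by (auto dest: in_set_takeD in_set_dropD)
  show "koszul ds \<sigma> * (- 1) ^ sum_list (pick ds (take k \<sigma>))
      = cross ds (take k \<sigma>) (drop k \<sigma>) * sg (1 * int (sum_list (pick ds (take k \<sigma>))))"
    by (simp add: koszul_shuffle[OF s] sg_power)
qed

lemma morphism_lhs_eq_cod:
  fixes f :: "'a list \<Rightarrow> 'b::real_vector"
  assumes l: "length ds = length vs"
  shows "(\<Sum>k<length vs. \<Sum>p<length vs - k. \<Sum>\<sigma>\<in>shuffle_lists k p.
           (koszul ds \<sigma> * (-1) ^ sum_list (pick ds (take k \<sigma>))) *\<^sub>R
           f (pick vs (take k \<sigma>) @ [lam (pick vs (drop k \<sigma>) @ [vs ! (k + p)])] @ drop (k + p + 1) vs))
      = cod (\<lambda>X. f (map snd X)) (\<lambda>X. lam (map snd X)) 1 (degs ds vs)"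
  unfolding cod_eq_shuffle_sum[OF l] shsum_def
proof (intro sum.cong refl)
  fix k p \<sigma> assume *: "k \<in> {..<length vs}" "p \<in> {..<length vs - k}" "\<sigma> \<in> shuffle_lists k p"
  then have kp: "k < length vs" "p < length vs - k" by simp_all
  show "(koszul ds \<sigma> * (-1) ^ sum_list (pick ds (take k \<sigma>))) *\<^sub>R
           f (pick vs (take k \<sigma>) @ [lam (pick vs (drop k \<sigma>) @ [vs ! (k + p)])] @ drop (k + p + 1) vs)
     = (cross ds (take k \<sigma>) (drop k \<sigma>) * sg (1 * int (sum_list (pick ds (take k \<sigma>))))) *\<^sub>R
         f (map snd (pick (degs ds vs) (take k \<sigma>) @
           [(1 + int (sum_list (pick ds (drop k \<sigma>))) + int (ds ! (k + p)),
             lam (map snd (pick (degs ds vs) (drop k \<sigma>) @ [degs ds vs ! (k + p)])))]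
           @ drop (k + p + 1) (degs ds vs)))"
    unfolding shuffle_term[OF l kp *(3)] by simp
qed

text \<open>A change of indices: the definition counts the arity j of the inner operation and the
  position k of its last argument, whereas \<open>cod\<close> counts the j - 1 shuffled arguments
  inside and the k - j entries in front.\<close>

lemma leibniz_lhs_eq_cod:
  fixes lam :: "'a::real_vector list \<Rightarrow> 'a"
  assumes l: "length ds = length vs"
  shows "(\<Sum>j=1..length vs. \<Sum>k=j..length vs. \<Sum>\<sigma>\<in>shuffle_lists (k - j) (j - 1).
           (koszul ds \<sigma> * (-1) ^ sum_list (pick ds (take (k - j) \<sigma>))) *\<^sub>R
           lam (pick vs (take (k - j) \<sigma>) @ [lam (pick vs (drop (k - j) \<sigma>) @ [vs ! (k - 1)])] @ drop k vs))
      = cod (\<lambda>X. lam (map snd X)) (\<lambda>X. lam (map snd X)) 1 (degs ds vs)"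
proof -
  let ?n = "length vs"
  let ?T = "\<lambda>k p \<sigma>. (koszul ds \<sigma> * (-1) ^ sum_list (pick ds (take k \<sigma>))) *\<^sub>R
           lam (pick vs (take k \<sigma>) @ [lam (pick vs (drop k \<sigma>) @ [vs ! (k + p)])] @ drop (k + p + 1) vs)"
  let ?S = "\<lambda>j k. \<Sum>\<sigma>\<in>shuffle_lists (k - j) (j - 1).
           (koszul ds \<sigma> * (-1) ^ sum_list (pick ds (take (k - j) \<sigma>))) *\<^sub>R
           lam (pick vs (take (k - j) \<sigma>) @ [lam (pick vs (drop (k - j) \<sigma>) @ [vs ! (k - 1)])] @ drop k vs)"
  have inner: "(\<Sum>k=Suc p..?n. ?S (Suc p) k) = (\<Sum>k<?n - p. \<Sum>\<sigma>\<in>shuffle_lists k p. ?T k p \<sigma>)" if "p < ?n" for p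
    by (rule sum.reindex_bij_witness[where i = "\<lambda>k. k + Suc p" and j = "\<lambda>k. k - Suc p"]) (use that in auto)
  have "(\<Sum>j=1..?n. \<Sum>k=j..?n. ?S j k) = (\<Sum>p<?n. \<Sum>k=Suc p..?n. ?S (Suc p) k)"
    by (rule sum.reindex_bij_witness[where i = Suc and j = "\<lambda>j. j - 1"]) auto
  also have "\<dots> = (\<Sum>p<?n. \<Sum>k<?n - p. \<Sum>\<sigma>\<in>shuffle_lists k p. ?T k p \<sigma>)"
    by (rule sum.cong[OF refl], rule inner) simp
  also have "\<dots> = (\<Sum>k<?n. \<Sum>p<?n - k. \<Sum>\<sigma>\<in>shuffle_lists k p. ?T k p \<sigma>)"
    by (rule sum_triangle_swap)
  finally show ?thesis unfolding morphism_lhs_eq_cod[OF l] .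
qed

abbreviation "slos \<equiv> sorted_list_of_set"

definition crs :: "nat list \<Rightarrow> nat set \<Rightarrow> nat set \<Rightarrow> real"
  where "crs ds K L = (\<Prod>b\<in>L. \<Prod>a\<in>K. inv_sign ds a b)"

lemma cross_eq_crs: "distinct \<sigma> \<Longrightarrow> distinct \<tau> \<Longrightarrow> cross ds \<sigma> \<tau> = crs ds (set \<sigma>) (set \<tau>)"
  by (simp add: cross_def crs_def prod.distinct_set_conv_list)

lemma slos_eqI: "sorted_wrt (<) xs \<Longrightarrow> set xs = A \<Longrightarrow> slos A = xs" for xs :: "nat list"
  by (rule strict_sorted_equal) auto

lemma slos_insert_less: "finite K \<Longrightarrow> (\<And>k. k \<in> K \<Longrightarrow> j < k) \<Longrightarrow> slos (insert j K) = j # slos K"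
  for j :: nat
  by (rule slos_eqI) auto

text \<open>Stated for an increasing list of positions instead of a list of entries, so that blocks
  can be named as sets, as in the partition sums.\<close>

lemma unsh_eq_sum:
  assumes "sorted_wrt (<) js" "js \<noteq> []" "\<And>i. fst (x i) = int (ds ! i)"
  shows "unsh \<psi> e (map x js) = (\<Sum>K\<in>Pow (set (butlast js)).
     (sg (e * (\<Sum>i\<in>K. fst (x i))) * crs ds K (set js - K)) *\<^sub>R \<psi> (map x (slos K)) (map x (slos (set js - K))))"
  using assms(1,2)
proof (induction js arbitrary: \<psi> e)
  case (Cons j js)
  show ?case
  proof (cases "js = []")
    case True then show ?thesis by (simp add: crs_def)
  next
    case False
    let ?B = "set (butlast js)"
    have j: "j < k" if "k \<in> set js" for k using Cons.prems that by simp
    have B: "?B \<subseteq> set js" by (meson in_set_butlastD subsetI)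
    have jB: "j \<notin> ?B" using B j by auto
    let ?t = "\<lambda>K. (sg (e * (\<Sum>i\<in>K. fst (x i))) * crs ds K (set (j # js) - K)) *\<^sub>R
        \<psi> (map x (slos K)) (map x (slos (set (j # js) - K)))"
    have t1: "?t (insert j K) = sg (e * fst (x j)) *\<^sub>R ((sg (e * (\<Sum>i\<in>K. fst (x i))) * crs ds K (set js - K)) *\<^sub>R
        \<psi> (x j # map x (slos K)) (map x (slos (set js - K))))" if K: "K \<subseteq> ?B" for K
    proof -
      have f: "finite K" and Kj: "j \<notin> K" using K jB finite_subset by auto
      have d: "set (j # js) - insert j K = set js - K" using j by auto
      have "slos (insert j K) = j # slos K" by (rule slos_insert_less[OF f]) (use K B j in auto)
      moreover have "crs ds (insert j K) (set js - K) = crs ds K (set js - K)"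
        unfolding crs_def by (rule prod.cong[OF refl]) (use f Kj j less_asym in \<open>fastforce simp: inv_sign_def\<close>)
      ultimately show ?thesis using f Kj d by (simp add: sg_norm)
    qed
    have t2: "?t K = (sg ((e + fst (x j)) * (\<Sum>i\<in>K. fst (x i))) * crs ds K (set js - K)) *\<^sub>R
        \<psi> (map x (slos K)) (x j # map x (slos (set js - K)))" if K: "K \<subseteq> ?B" for K
    proof -
      have f: "finite K" and Kj: "j \<notin> K" using K jB finite_subset by auto
      have d: "set (j # js) - K = insert j (set js - K)" using Kj by auto
      have s: "slos (insert j (set js - K)) = j # slos (set js - K)" by (rule slos_insert_less) (use j in auto)
      have "(\<Prod>a\<in>K. inv_sign ds a j) = (\<Prod>a\<in>K. sg (fst (x j) * fst (x a)))"
        using K B j by (intro prod.cong) (auto simp: inv_sign_def assms(3) sg_power[symmetric] mult.commute)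
      also have "\<dots> = sg (fst (x j) * (\<Sum>i\<in>K. fst (x i)))"
        using f by (induction K rule: finite_induct) (simp_all add: sg_norm)
      finally have "crs ds K (insert j (set js - K)) = sg (fst (x j) * (\<Sum>i\<in>K. fst (x i))) * crs ds K (set js - K)"
        unfolding crs_def using j by (subst prod.insert) auto
      then show ?thesis unfolding d s by (simp add: sg_norm mult.assoc)
    qed
    have "(\<Sum>K\<in>Pow (set (butlast (j # js))). ?t K) = (\<Sum>K\<in>Pow (insert j ?B). ?t K)" using False by simp
    also have "\<dots> = (\<Sum>K\<in>Pow ?B. ?t K) + (\<Sum>K\<in>insert j ` Pow ?B. ?t K)"
      unfolding Pow_insert using jB by (intro sum.union_disjoint) auto
    also have "(\<Sum>K\<in>insert j ` Pow ?B. ?t K) = (\<Sum>K\<in>Pow ?B. ?t (insert j K))"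
      using jB by (subst sum.reindex) (auto simp: inj_on_def)
    also have "\<dots> = sg (e * fst (x j)) *\<^sub>R unsh (\<lambda>Y Z. \<psi> (x j # Y) Z) e (map x js)"
    proof -
      have "unsh (\<lambda>Y Z. \<psi> (x j # Y) Z) e (map x js) = (\<Sum>K\<in>Pow ?B. (sg (e * (\<Sum>i\<in>K. fst (x i))) * crs ds K (set js - K)) *\<^sub>R
        \<psi> (x j # map x (slos K)) (map x (slos (set js - K))))"
        by (rule Cons.IH) (use Cons.prems False in auto)
      then show ?thesis
        unfolding scaleR_sum_right by (simp only: scaleR_sum_right) (rule sum.cong[OF refl], rule t1, simp)
    qed
    also have "(\<Sum>K\<in>Pow ?B. ?t K) = unsh (\<lambda>Y Z. \<psi> Y (x j # Z)) (e + fst (x j)) (map x js)"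
    proof -
      have "unsh (\<lambda>Y Z. \<psi> Y (x j # Z)) (e + fst (x j)) (map x js)
        = (\<Sum>K\<in>Pow ?B. (sg ((e + fst (x j)) * (\<Sum>i\<in>K. fst (x i))) * crs ds K (set js - K)) *\<^sub>R
        \<psi> (map x (slos K)) (x j # map x (slos (set js - K))))"
        by (rule Cons.IH) (use Cons.prems False in auto)
      then show ?thesis
        by (simp only:) (rule sum.cong[OF refl], rule t2, simp)
    qed
    finally show ?thesis using False by simp
  qed
qed simp

text \<open>\<open>max_ordered_partitions\<close> for an arbitrary index set, since removing the
  last block does not leave an initial segment.\<close>

definition mop :: "nat set \<Rightarrow> nat set list set"
  where "mop J = {Is. partition_on J (set Is) \<and> sorted_wrt (<) (map Max Is)}"

lemma mop_empty: "mop {} = {[]}"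
proof -
  have "Is \<in> mop {} \<longleftrightarrow> Is = []" for Is
    by (cases Is) (auto simp: mop_def partition_on_def)
  then show ?thesis by blast
qed

text \<open>As the maxima increase, the last block is the one containing \<open>Max J\<close>, and
  the union \<open>K\<close> of the other blocks can be any subset avoiding it. \<open>FX\<close>
  splits off its blocks in the same way.\<close>

lemma mop_step:
  assumes J: "finite J" "J \<noteq> {}"
  shows "mop J = (\<Union>K\<in>Pow (J - {Max J}). (\<lambda>Is. Is @ [J - K]) ` mop K)"
proof (intro equalityI subsetI)
  fix Is assume Is: "Is \<in> mop J"
  then have p: "\<Union>(set Is) = J" "disjoint (set Is)" "{} \<notin> set Is" and s: "sorted_wrt (<) (map Max Is)"
    by (auto simp: mop_def partition_on_def)
  have "Is \<noteq> []" using p(1) J by auto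
  then obtain Is' I where I: "Is = Is' @ [I]" by (metis append_butlast_last_id)
  have fin: "finite B" if "B \<in> set Is" for B using p(1) that J finite_subset by (metis Union_upper)
  have lt: "Max B < Max I" if "B \<in> set Is'" for B using s that by (auto simp: I sorted_wrt_append)
  have MI: "Max J \<in> I"
  proof -
    have "Max J \<in> J" using J by simp
    then obtain B where B: "B \<in> set Is" "Max J \<in> B" using p(1) by auto
    have "Max I \<in> J" using p fin[of I] I by (metis Max_in UnionI in_set_conv_decomp)
    then have "Max I \<le> Max J" using J by simp
    also have "Max J \<le> Max B" using B fin by simp
    finally have "B \<notin> set Is'" using lt by force
    then show ?thesis using B I by auto
  qed
  let ?K = "J - I"
  have "I \<subseteq> J" using p(1) I by auto
  then have JK: "J - ?K = I" by auto
  have nI: "B \<noteq> I" if "B \<in> set Is'" for B using lt[OF that] by auto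
  have dI: "B \<inter> I = {}" if "B \<in> set Is'" for B
    by (rule disjointD[OF p(2)]) (use that nI[OF that] I in auto)
  then have "\<Union>(set Is') = ?K" using p(1) I by auto
  moreover have "disjoint (set Is')"
    by (rule disjointI, rule disjointD[OF p(2)]) (auto simp: I)
  ultimately have "Is' \<in> mop ?K"
    using p(3) s by (simp add: mop_def partition_on_def I sorted_wrt_append)
  moreover have "?K \<in> Pow (J - {Max J})" using MI by auto
  ultimately show "Is \<in> (\<Union>K\<in>Pow (J - {Max J}). (\<lambda>Is. Is @ [J - K]) ` mop K)"
    using I JK by (intro UN_I[of ?K] image_eqI[of _ _ Is']) simp_all
next
  fix Is assume "Is \<in> (\<Union>K\<in>Pow (J - {Max J}). (\<lambda>Is. Is @ [J - K]) ` mop K)"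
  then obtain K Is' where K: "K \<subseteq> J - {Max J}" and Is': "Is' \<in> mop K" and I: "Is = Is' @ [J - K]" by auto
  have p: "\<Union>(set Is') = K" "disjoint (set Is')" "{} \<notin> set Is'" and s: "sorted_wrt (<) (map Max Is')"
    using Is' by (auto simp: mop_def partition_on_def)
  have M: "Max J \<in> J - K" using K J by auto
  have MM: "Max (J - K) = Max J" using M J by (intro Max_eqI) auto
  have "Max B < Max J" if "B \<in> set Is'" for B
  proof -
    have B: "B \<subseteq> K" "B \<noteq> {}" using p that by auto
    then have "finite B" using K J by (meson finite_Diff finite_subset)
    then have "Max B \<in> J - {Max J}" using B K by (meson Max_in subset_eq)
    then show ?thesis using J by (simp add: le_neq_implies_less)
  qed
  then have "sorted_wrt (<) (map Max Is)" using s I MM by (auto simp: sorted_wrt_append)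
  moreover have "partition_on J (set Is)"
    unfolding partition_on_def
  proof (intro conjI)
    show "\<Union>(set Is) = J" using p K I by auto
    have "B \<inter> (J - K) = {}" if "B \<in> set Is'" for B using p(1) that by auto
    then have "pairwise disjnt (insert (J - K) (set Is'))"
      using p(2) by (auto simp: pairwise_insert disjnt_def)
    then show "disjoint (set Is)" using I by simp
    show "{} \<notin> set Is" using p(3) M I by auto
  qed
  ultimately show "Is \<in> mop J" by (simp add: mop_def)
qed

lemma mop_facts:
  assumes "Is \<in> mop J" "finite J"
  shows "\<Union>(set Is) = J" "\<And>I. I \<in> set Is \<Longrightarrow> finite I" "set (concat (map slos Is)) = J" "distinct (concat (map slos Is))"
proof -
  show 1: "\<Union>(set Is) = J" using assms by (auto simp: mop_def partition_on_def)
  show 2: "finite I" if "I \<in> set Is" for I using 1 that assms(2) by (metis Union_upper finite_subset)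
  then show "set (concat (map slos Is)) = J" using 1 by auto
  have s: "sorted_wrt (<) (map Max Is)" and d: "disjoint (set Is)" "{} \<notin> set Is"
    using assms by (auto simp: mop_def partition_on_def)
  have "distinct (map Max Is)" using s by (simp add: strict_sorted_iff)
  then have dI: "distinct Is" by (simp add: distinct_map)
  have "inj_on slos (set Is)" using 2 by (metis inj_onI sorted_list_of_set.set_sorted_key_list_of_set)
  then have "distinct (map slos Is)" using dI by (simp add: distinct_map)
  moreover have "set ys \<inter> set zs = {}" if yz: "ys \<in> set (map slos Is)" "zs \<in> set (map slos Is)" "ys \<noteq> zs" for ys zs
  proof -
    obtain I K where IK: "I \<in> set Is" "K \<in> set Is" "ys = slos I" "zs = slos K" using yz by auto
    then have "I \<inter> K = {}" using disjointD[OF d(1) IK(1,2)] yz(3) by blast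
    then show ?thesis using IK 2 by simp
  qed
  ultimately show "distinct (concat (map slos Is))"
    by (intro distinct_concat) auto
qed

lemma finite_mop: "finite J \<Longrightarrow> finite (mop J)"
proof (induction "card J" arbitrary: J rule: less_induct)
  case less
  show ?case
  proof (cases "J = {}")
    case True then show ?thesis by (simp add: mop_empty)
  next
    case False
    have "finite (mop K)" if "K \<subseteq> J - {Max J}" for K
    proof (rule less.hyps)
      have "K \<subset> J" using that Max_in[OF less.prems False] by auto
      then show "card K < card J" using less.prems by (rule psubset_card_mono[rotated])
      show "finite K" using that less.prems by (meson finite_Diff finite_subset)
    qed
    then show ?thesis using less.prems False by (simp add: mop_step)
  qed
qed

lemma FX_eq_sum:
  assumes "finite J" "\<And>i. fst (x i) = int (ds ! i)"
  shows "FX f \<phi> (map x (slos J)) = (\<Sum>Is\<in>mop J. koszul ds (concat (map slos Is)) *\<^sub>R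
     \<phi> (map (\<lambda>I. (dg (map x (slos I)), f (map x (slos I)))) Is))"
  using assms(1)
proof (induction "card J" arbitrary: J \<phi> rule: less_induct)
  case less
  show ?case
  proof (cases "J = {}")
    case True then show ?thesis by (simp add: mop_empty koszul_def)
  next
    case False
    let ?g = "\<lambda>I. (dg (map x (slos I)), f (map x (slos I)))"
    let ?B = "J - {Max J}"
    have ne: "slos J \<noteq> []" using less.prems False by simp
    have srt: "sorted_wrt (<) (slos J)" using less.prems by simp
    have setJ: "set (slos J) = J" using less.prems by simp
    have bl: "set (butlast (slos J)) = ?B"
    proof -
      have "slos J = slos ?B @ [Max J]"
      proof (rule slos_eqI)
        have "insert (Max J) (J - {Max J}) = J"
          by (rule insert_Diff) (rule Max_in[OF less.prems False])
        then show "set (slos ?B @ [Max J]) = J" using less.prems by simp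
        show "sorted_wrt (<) (slos ?B @ [Max J])"
          using less.prems by (auto simp: sorted_wrt_append less_le)
      qed
      then show ?thesis using less.prems by simp
    qed
    have fK: "finite K" "card K < card J" if "K \<in> Pow ?B" for K
    proof -
      have "K \<subset> J" using that Max_in[OF less.prems False] by auto
      then show "card K < card J" using less.prems by (rule psubset_card_mono[rotated])
      show "finite K" using that less.prems by (meson PowD finite_Diff finite_subset)
    qed
    have dis: "inj_on (\<lambda>Is. Is @ [J - K]) (mop K)" for K by (auto simp: inj_on_def)
    \<comment> \<open>The last block is listed increasingly, so it contributes only the inversions
      with the blocks before it.\<close>
    have k: "koszul ds (concat (map slos (Is @ [J - K]))) = koszul ds (concat (map slos Is)) * crs ds K (J - K)"
      if "K \<in> Pow ?B" "Is \<in> mop K" for K Is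
      using mop_facts[OF that(2) fK(1)[OF that(1)]] less.prems
      by (simp add: koszul_append koszul_sorted cross_eq_crs)
    have "FX f \<phi> (map x (slos J)) = unsh (\<lambda>Y Z. FX f (\<lambda>W. \<phi> (W @ [(dg Z, f Z)])) Y) 0 (map x (slos J))"
      by (rule FX_step) (use ne in simp)
    also have "\<dots> = (\<Sum>K\<in>Pow ?B. crs ds K (J - K) *\<^sub>R FX f (\<lambda>W. \<phi> (W @ [?g (J - K)])) (map x (slos K)))"
      unfolding unsh_eq_sum[OF srt ne assms(2)] bl setJ by simp
    also have "\<dots> = (\<Sum>K\<in>Pow ?B. \<Sum>Is\<in>mop K. koszul ds (concat (map slos (Is @ [J - K]))) *\<^sub>R \<phi> (map ?g (Is @ [J - K])))"
    proof (rule sum.cong[OF refl])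
      fix K assume K: "K \<in> Pow ?B"
      show "crs ds K (J - K) *\<^sub>R FX f (\<lambda>W. \<phi> (W @ [?g (J - K)])) (map x (slos K))
        = (\<Sum>Is\<in>mop K. koszul ds (concat (map slos (Is @ [J - K]))) *\<^sub>R \<phi> (map ?g (Is @ [J - K])))"
        unfolding less.hyps[OF fK(2)[OF K] fK(1)[OF K]] scaleR_sum_right
        by (rule sum.cong[OF refl]) (simp only: k[OF K], simp add: mult.commute)
    qed
    also have "\<dots> = (\<Sum>K\<in>Pow ?B. \<Sum>Is\<in>(\<lambda>Is. Is @ [J - K]) ` mop K. koszul ds (concat (map slos Is)) *\<^sub>R \<phi> (map ?g Is))"
      by (simp only: sum.reindex[OF dis] comp_def)
    also have "\<dots> = (\<Sum>Is\<in>mop J. koszul ds (concat (map slos Is)) *\<^sub>R \<phi> (map ?g Is))"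
      unfolding mop_step[OF less.prems False]
    proof (rule sum.UNION_disjoint[symmetric])
      show "finite (Pow ?B)" using less.prems by simp
      show "\<forall>K\<in>Pow ?B. finite ((\<lambda>Is. Is @ [J - K]) ` mop K)" using fK finite_mop by blast
      show "\<forall>K\<in>Pow ?B. \<forall>K'\<in>Pow ?B. K \<noteq> K' \<longrightarrow> (\<lambda>Is. Is @ [J - K]) ` mop K \<inter> (\<lambda>Is. Is @ [J - K']) ` mop K' = {}"
        by auto
    qed
    finally show ?thesis .
  qed
qed

lemma nths_eq_pick: "I \<subseteq> {..<length xs} \<Longrightarrow> nths xs I = map ((!) xs) (slos I)"
proof -
  assume I: "I \<subseteq> {..<length xs}"
  have "nths xs I = map ((!) xs) (filter (\<lambda>i. i \<in> I) [0..<length xs])"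
  proof (induction xs rule: rev_induct)
    case (snoc x xs)
    have "map ((!) (xs @ [x])) (filter (\<lambda>i. i \<in> I) [0..<length xs]) = map ((!) xs) (filter (\<lambda>i. i \<in> I) [0..<length xs])"
      by (rule map_cong) (auto simp: nth_append)
    then show ?case using snoc by (simp add: nths_append nths_singleton)
  qed simp
  moreover have "filter (\<lambda>i. i \<in> I) [0..<length xs] = slos I"
    using I by (intro slos_eqI[symmetric]) (auto intro: sorted_wrt_filter)
  ultimately show ?thesis by simp
qed

lemma morphism_rhs_eq_FX:
  fixes lam' :: "'b list \<Rightarrow> 'c::real_vector"
  assumes l: "length ds = length bs"
  shows "(\<Sum>Is\<in>max_ordered_partitions (length bs).
           koszul ds (concat (map sorted_list_of_set Is)) *\<^sub>R lam' (map (\<lambda>I. f (nths bs I)) Is))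
    = FX (\<lambda>X. f (map snd X)) (\<lambda>X. lam' (map snd X)) (degs ds bs)"
proof -
  define x where "x = (\<lambda>i. (int (ds ! i), bs ! i))"
  have X: "degs ds bs = map x (slos {..<length bs})"
    using l by (intro nth_equalityI) (auto simp: x_def lessThan_atLeast0)
  have m: "map snd (map x (slos I)) = nths bs I" if "I \<subseteq> {..<length bs}" for I
    using nths_eq_pick[OF that] by (simp add: x_def comp_def)
  have "FX (\<lambda>X. f (map snd X)) (\<lambda>X. lam' (map snd X)) (degs ds bs)
     = (\<Sum>Is\<in>mop {..<length bs}. koszul ds (concat (map slos Is)) *\<^sub>R
     lam' (map snd (map (\<lambda>I. (dg (map x (slos I)), f (map snd (map x (slos I))))) Is)))"
    unfolding X by (rule FX_eq_sum) (simp_all add: x_def)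
  also have "\<dots> = (\<Sum>Is\<in>max_ordered_partitions (length bs).
           koszul ds (concat (map slos Is)) *\<^sub>R lam' (map (\<lambda>I. f (nths bs I)) Is))"
  proof (rule sum.cong)
    show "mop {..<length bs} = max_ordered_partitions (length bs)"
      by (simp add: mop_def max_ordered_partitions_def)
    fix Is assume "Is \<in> max_ordered_partitions (length bs)"
    then have "I \<subseteq> {..<length bs}" if "I \<in> set Is" for I
      using that by (auto simp: max_ordered_partitions_def partition_on_def)
    then have "map (\<lambda>I. f (map snd (map x (slos I)))) Is = map (\<lambda>I. f (nths bs I)) Is"
      by (intro map_cong refl arg_cong[of _ _ f] m)
    then have "map snd (map (\<lambda>I. (dg (map x (slos I)), f (map snd (map x (slos I))))) Is) = map (\<lambda>I. f (nths bs I)) Is"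
      by (simp add: comp_def)
    then show "koszul ds (concat (map slos Is)) *\<^sub>R
         lam' (map snd (map (\<lambda>I. (dg (map x (slos I)), f (map snd (map x (slos I))))) Is))
       = koszul ds (concat (map slos Is)) *\<^sub>R lam' (map (\<lambda>I. f (nths bs I)) Is)" by (simp only:)
  qed
  finally show ?thesis ..
qed

section \<open>Alternating forms and their contractions\<close>

definition ctr :: "('m \<Rightarrow> 'v) \<Rightarrow> ('m, 'v, 'e) form \<Rightarrow> ('m, 'v, 'e) form"
  where "ctr a w = (\<lambda>as. w (a # as))"

lemma ctr_apply: "ctr a w as = w (a # as)"
  by (simp add: ctr_def)

lemma ctr_simps [simp]: "ctr a 0 = 0"
  "ctr a (w + w') = ctr a w + ctr a w'" "ctr a (w - w') = ctr a w - ctr a w'" "ctr a (c *\<^sub>R w) = c *\<^sub>R ctr a w"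
  "ctr a (- w) = - ctr a w"
  by (simp_all add: ctr_def fun_eq_iff scaleR_fun_def)

lemma linear_ctr: "linear (ctr a)"
  by (rule linearI) simp_all

text \<open>The induction principle behind the identities for forms: compare the values on no
  arguments, then the contractions.\<close>

lemma form_eqI: "w [] = w' [] \<Longrightarrow> (\<And>a. ctr a w = ctr a w') \<Longrightarrow> w = w'"
  by (rule ext, case_tac x) (auto simp: ctr_def fun_eq_iff)

lemma form_apply:
  fixes w w' :: "('m, 'v, 'e::real_vector) form"
  shows "(w + w') as = w as + w' as" "(w - w') as = w as - w' as" "(- w) as = - w as"
    "(c *\<^sub>R w) as = c *\<^sub>R w as" "(0 :: ('m, 'v, 'e) form) as = 0"
  by (simp_all add: scaleR_fun_def)

definition smulF :: "('m \<Rightarrow> real) \<Rightarrow> ('m, 'v, 'e::real_vector) form \<Rightarrow> ('m, 'v, 'e) form"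
  where "smulF f w = (\<lambda>as. smul f (w as))"

lemma smulF_apply: "smulF f w as = smul f (w as)"
  by (simp add: smulF_def)

lemma smul_simps [simp]: "smul f 0 = 0" "smul f (s + t) = smul f s + smul f t" "smul f (s - t) = smul f s - smul f t"
  "smul f (- s) = - smul f s" "smul (\<lambda>_. c) s = c *\<^sub>R s"
  by (simp_all add: smul_def fun_eq_iff scaleR_add_right scaleR_diff_right scaleR_fun_def)

lemma smul_smul: "smul f (smul g s) = smul (\<lambda>x. f x * g x) s"
  by (simp add: smul_def)

lemma smul_add_left: "smul (f + g) s = smul f s + smul g s"
  by (simp add: smul_def fun_eq_iff scaleR_add_left)

lemma smul_real: "smul f g = (\<lambda>x. f x * g x)"
  by (simp add: smul_def)

lemma linear_smul: "linear (smul f)"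
  by (rule linearI) (simp_all add: smul_scaleR)

lemma smulF_simps [simp]: "smulF f 0 = 0" "smulF f (s + t) = smulF f s + smulF f t" "smulF f (s - t) = smulF f s - smulF f t"
  "smulF f (- s) = - smulF f s" "smulF (\<lambda>_. c) s = c *\<^sub>R s" "ctr a (smulF f w) = smulF f (ctr a w)"
  "smulF f (c *\<^sub>R s) = c *\<^sub>R smulF f s"
  by (rule ext, simp add: smulF_apply ctr_apply form_apply smul_scaleR)+

declare plus_fun_apply [simp del] zero_fun_apply [simp del] minus_apply [simp del] uminus_apply [simp del]

lemmas app = ctr_apply smulF_apply form_apply

lemma app_Nil:
  fixes w w' :: "('m, 'v, 'e::real_vector) form"
  shows "(w + w') [] = w [] + w' []" "(w - w') [] = w [] - w' []" "(- w) [] = - w []"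
    "(c *\<^sub>R w) [] = c *\<^sub>R w []" "(0 :: ('m, 'v, 'e) form) [] = 0" "smulF f w [] = smul f (w [])"
  by (simp_all add: app)

definition Cmod :: "('m \<Rightarrow> real) set \<Rightarrow> ('m \<Rightarrow> 'e::real_vector) set \<Rightarrow> bool" where
  "Cmod C S \<longleftrightarrow> 0 \<in> S \<and> (\<forall>f\<in>C. \<forall>s\<in>S. \<forall>s'\<in>S. smul f s + s' \<in> S)"

lemma ctr_0_iff:
  fixes w :: "('m, 'v, 'e::real_vector) form"
  shows "ctr a w = 0 \<longleftrightarrow> (\<forall>as. w (a # as) = 0)"
proof
  assume "ctr a w = 0"
  then have "ctr a w as = 0" for as by (simp add: app)
  then show "\<forall>as. w (a # as) = 0" by (simp add: app)
next
  assume z: "\<forall>as. w (a # as) = 0"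
  show "ctr a w = 0"
  proof
    fix as show "ctr a w as = 0 as" using z by (simp add: app)
  qed
qed

text \<open>Alternating forms by recursion on the degree. Linearity and vanishing on repetitions are
  asked for in the leading slots only, because contractions are again forms of this kind;
  \<open>alt_forms_eq\<close> recovers the original description.\<close>

primrec AF :: "('m \<Rightarrow> real) set \<Rightarrow> ('m \<Rightarrow> 'v::real_vector) set \<Rightarrow> ('m \<Rightarrow> 'e::real_vector) set
    \<Rightarrow> nat \<Rightarrow> ('m, 'v, 'e) form set" where
  "AF C G S 0 = {w. w [] \<in> S \<and> (\<forall>a. ctr a w = 0)}"
| "AF C G S (Suc p) = {w. w [] = 0 \<and> (\<forall>a. a \<notin> G \<longrightarrow> ctr a w = 0) \<and> (\<forall>a. ctr a w \<in> AF C G S p) \<and>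
     (\<forall>a\<in>G. \<forall>a'\<in>G. \<forall>f\<in>C. ctr (smul f a + a') w = smulF f (ctr a w) + ctr a' w) \<and>
     (\<forall>a\<in>G. ctr a (ctr a w) = 0)}"

locale cring =
  fixes C :: "('m \<Rightarrow> real) set"
  assumes C_const [simp]: "(\<lambda>_. c) \<in> C"
    and C_mult: "f \<in> C \<Longrightarrow> g \<in> C \<Longrightarrow> (\<lambda>x. f x * g x) \<in> C"
    and C_add: "f \<in> C \<Longrightarrow> g \<in> C \<Longrightarrow> f + g \<in> C"
begin

lemma Cmod_C: "Cmod C C"
  using C_const[of 0] by (auto simp: Cmod_def smul_real C_mult C_add zero_fun_def)

end

locale cmodule = cring C for C :: "('m \<Rightarrow> real) set" +
  fixes S :: "('m \<Rightarrow> 'e::real_vector) set"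
  assumes Cmod: "Cmod C S"
begin

lemma S_zero [simp]: "0 \<in> S"
  using Cmod by (simp add: Cmod_def)

lemma S_lin: "\<lbrakk>f \<in> C; s \<in> S; s' \<in> S\<rbrakk> \<Longrightarrow> smul f s + s' \<in> S"
  using Cmod by (simp add: Cmod_def)

lemma S_smul: "f \<in> C \<Longrightarrow> s \<in> S \<Longrightarrow> smul f s \<in> S"
  using S_lin[of f s 0] by simp

lemma S_add: "s \<in> S \<Longrightarrow> s' \<in> S \<Longrightarrow> s + s' \<in> S"
  using S_lin[of "\<lambda>_. 1" s s'] by simp

lemma S_scale: "s \<in> S \<Longrightarrow> c *\<^sub>R s \<in> S"
  using S_smul[of "\<lambda>_. c" s] by simp

lemma S_minus: "s \<in> S \<Longrightarrow> - s \<in> S"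
  using S_scale[of s "-1"] by simp

lemma S_diff: "s \<in> S \<Longrightarrow> s' \<in> S \<Longrightarrow> s - s' \<in> S"
  using S_add[of s "- s'"] S_minus by simp

lemma subspace_S: "subspace S"
  by (simp add: subspace_def S_add S_scale)

end

locale form_mod = M: cmodule C S + N: cmodule C G for C :: "('m \<Rightarrow> real) set"
    and S :: "('m \<Rightarrow> 'e::real_vector) set" and G :: "('m \<Rightarrow> 'v::real_vector) set"
begin

abbreviation "AA \<equiv> AF C G S"

lemma AF_lin: "\<lbrakk>w \<in> AA p; w' \<in> AA p; f \<in> C\<rbrakk> \<Longrightarrow> smulF f w + w' \<in> AA p"
proof (induction p arbitrary: w w')
  case 0
  then have "smul f (w []) + w' [] \<in> S" by (intro M.S_lin) simp_all
  with 0 show ?case by (simp add: app_Nil)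
next
  case (Suc p)
  have "smul f (smul g u) = smul g (smul f u)" for g and u :: "'m \<Rightarrow> 'e" by (rule smul_left_commute)
  then have sw: "smulF f (smulF g u) = smulF g (smulF f u)" for g and u :: "('m, 'v, 'e) form"
    by (simp add: fun_eq_iff smulF_def)
  show ?case using Suc by (simp add: sw app_Nil add.left_commute add.commute)
qed

lemma AF_zero [simp]: "0 \<in> AA p"
  by (induction p) (simp_all add: app_Nil)

lemma AF_smulF: "w \<in> AA p \<Longrightarrow> f \<in> C \<Longrightarrow> smulF f w \<in> AA p"
  using AF_lin[of w p 0 f] by simp

lemma AF_add: "w \<in> AA p \<Longrightarrow> w' \<in> AA p \<Longrightarrow> w + w' \<in> AA p"
  using AF_lin[of w p w' "\<lambda>_. 1"] by simp

lemma AF_scale: "w \<in> AA p \<Longrightarrow> c *\<^sub>R w \<in> AA p"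
  using AF_smulF[of w p "\<lambda>_. c"] by simp

lemma subspace_AF: "subspace (AA p)"
  by (simp add: subspace_def AF_add AF_scale)

lemma AF_val: "w \<in> AA p \<Longrightarrow> w as \<in> S"
proof (induction p arbitrary: w as)
  case 0 then show ?case by (cases as) (auto simp: ctr_0_iff)
next
  case (Suc p)
  show ?case
  proof (cases as)
    case (Cons a as')
    have "ctr a w \<in> AA p" using Suc.prems by simp
    from Suc.IH[OF this, of as'] show ?thesis by (simp add: Cons app)
  qed (use Suc.prems in simp)
qed

lemma AF_out: "w \<in> AA p \<Longrightarrow> \<not> (length as = p \<and> set as \<subseteq> G) \<Longrightarrow> w as = 0"
proof (induction p arbitrary: w as)
  case 0
  then obtain a as' where as: "as = a # as'" by (cases as) auto
  have "ctr a w = 0" using 0 by simp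
  then have "ctr a w as' = 0" by (simp add: app)
  then show ?case by (simp add: as app)
next
  case (Suc p)
  show ?case
  proof (cases as)
    case (Cons a as')
    have 1: "ctr a w as' = 0"
    proof (cases "a \<in> G")
      case True
      show ?thesis by (rule Suc.IH) (use Suc.prems Cons True in auto)
    next
      case False
      then have "ctr a w = 0" using Suc.prems by simp
      then show ?thesis by (simp add: app)
    qed
    then show ?thesis by (simp add: Cons app)
  qed (use Suc.prems in simp)
qed

text \<open>Polarisation: double contraction with a + b vanishes.\<close>

lemma ctr_anti:
  assumes "w \<in> AA p" "a \<in> G" "b \<in> G"
  shows "ctr a (ctr b w) = - ctr b (ctr a w)"
proof (cases p)
  case 0 then show ?thesis using assms by simp
next
  case (Suc q)
  have lin: "ctr (a + b) u = ctr a u + ctr b u" if "u \<in> AA k" for u k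
  proof (cases k)
    case (Suc l)
    have "ctr (smul (\<lambda>_. 1) a + b) u = smulF (\<lambda>_. 1) (ctr a u) + ctr b u"
      using that assms Suc by (simp del: smul_simps smulF_simps)
    then show ?thesis by simp
  qed (use that in simp)
  have z: "ctr c (ctr c w) = 0" if "c \<in> G" for c using assms(1) that Suc by simp
  have q: "ctr c w \<in> AA q" for c using assms(1) Suc by simp
  have "a + b \<in> G" using assms by (simp add: N.S_add)
  from z[OF this] have "ctr a (ctr b w) + ctr b (ctr a w) = 0"
    unfolding lin[OF assms(1)] using lin[OF q] z assms(2,3) by (simp add: add.commute)
  then show ?thesis by (simp add: eq_neg_iff_add_eq_0)
qed

text \<open>If the head recurs later in the list, exchanging the first two arguments by
  \<open>ctr_anti\<close> moves the repetition into a contraction, where the induction hypothesis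
  applies.\<close>

lemma AF_repeat:
  "\<lbrakk>w \<in> AA p; i < length as; k < length as; i \<noteq> k; as ! i = as ! k\<rbrakk> \<Longrightarrow> w as = 0"
proof (induction p arbitrary: w as i k)
  case 0
  then have "as \<noteq> []" by auto
  then show ?case using AF_out[OF 0(1)] by simp
next
  case (Suc p)
  show ?case
  proof (cases "length as = Suc p \<and> set as \<subseteq> G")
    case False then show ?thesis using AF_out[OF Suc.prems(1)] by simp
  next
    case True
    then obtain a as' where as: "as = a # as'" and a: "a \<in> G" and as': "set as' \<subseteq> G" by (cases as) auto
    have cw: "ctr c w \<in> AA p" for c using Suc.prems(1) by simp
    have head: "w as = 0" if ain: "a \<in> set as'"
    proof -
      obtain b bs where b: "as' = b # bs" using ain by (cases as') simp_all
      show ?thesis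
      proof (cases "a = b")
        case True
        have "ctr a (ctr a w) = 0" using Suc.prems(1) a by simp
        then have "ctr a (ctr a w) bs = 0" by (simp only: app)
        then show ?thesis using as b True by (simp add: app)
      next
        case False
        then have "a \<in> set bs" using ain b by simp
        then obtain l where l: "l < length bs" "bs ! l = a" by (auto simp: in_set_conv_nth)
        have "ctr b w (a # bs) = 0"
          by (rule Suc.IH[OF cw, of 0 _ "Suc l"]) (use l in auto)
        moreover have "w (a # b # bs) = - w (b # a # bs)"
          using ctr_anti[OF Suc.prems(1), of b a] a as' b by (simp add: fun_eq_iff app)
        ultimately show ?thesis using as b by (simp add: app)
      qed
    qed
    consider "i = 0" | "k = 0" | i' k' where "i = Suc i'" "k = Suc k'" by (cases i; cases k) auto
    then show ?thesis
    proof cases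
      case 1
      then obtain k' where "k = Suc k'" using Suc.prems(4) by (cases k) auto
      then show ?thesis using 1 Suc.prems as by (intro head) auto
    next
      case 2
      then obtain i' where "i = Suc i'" using Suc.prems(4) by (cases i) auto
      then show ?thesis using 2 Suc.prems as nth_mem[of i' as'] by (intro head) auto
    next
      case 3
      have "ctr a w as' = 0" by (rule Suc.IH[OF cw, of i' _ k']) (use 3 Suc.prems as in auto)
      then show ?thesis by (simp add: as app)
    qed
  qed
qed

lemma AF_slot_lin:
  "w \<in> AA p \<Longrightarrow> length as = p \<Longrightarrow> set as \<subseteq> G \<Longrightarrow> i < p \<Longrightarrow> a \<in> G \<Longrightarrow> f \<in> C \<Longrightarrow>
    w (as[i := smul f (as ! i) + a]) = smul f (w as) + w (as[i := a])"
proof (induction p arbitrary: w as i)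
  case (Suc p)
  then obtain b bs where as: "as = b # bs" "b \<in> G" "set bs \<subseteq> G" "length bs = p" by (cases as) auto
  show ?case
  proof (cases i)
    case 0
    have "ctr (smul f b + a) w = smulF f (ctr b w) + ctr a w" using Suc.prems as by simp
    then have "ctr (smul f b + a) w bs = (smulF f (ctr b w) + ctr a w) bs" by simp
    then show ?thesis using 0 as by (simp add: app)
  next
    case (Suc i')
    have "ctr b w (bs[i' := smul f (bs ! i') + a]) = smul f (ctr b w bs) + ctr b w (bs[i' := a])"
      by (rule Suc.IH) (use Suc.prems as Suc in auto)
    then show ?thesis using as Suc by (simp add: app)
  qed
qed simp

lemma alt_forms_eq: "alt_forms C G S p = AA p"
proof (intro equalityI subsetI)
  fix w assume "w \<in> AA p"
  then show "w \<in> alt_forms C G S p"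
    using AF_out AF_val AF_slot_lin AF_repeat unfolding alt_forms_def by auto
next
  fix w assume "w \<in> alt_forms C G S p"
  then show "w \<in> AA p"
  proof (induction p arbitrary: w)
    case 0
    then show ?case by (auto simp: alt_forms_def ctr_0_iff)
  next
    case (Suc p)
    have out: "w as = 0" if "\<not> (length as = Suc p \<and> set as \<subseteq> G)" for as
      using Suc.prems that by (auto simp: alt_forms_def)
    have inn: "w as \<in> S" "\<lbrakk>i < Suc p; a \<in> G; f \<in> C\<rbrakk> \<Longrightarrow> w (as[i := smul f (as ! i) + a]) = smul f (w as) + w (as[i := a])"
      "\<lbrakk>i < Suc p; k < Suc p; i \<noteq> k; as ! i = as ! k\<rbrakk> \<Longrightarrow> w as = 0"
      if "length as = Suc p \<and> set as \<subseteq> G" for as i k f a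
      using Suc.prems that by (auto simp: alt_forms_def)
    have z: "ctr a w = 0" if "a \<notin> G" for a using out that by (auto simp: ctr_0_iff)
    have cG: "ctr a w \<in> AA p" if a: "a \<in> G" for a
    proof (rule Suc.IH)
      show "ctr a w \<in> alt_forms C G S p"
        unfolding alt_forms_def
      proof (intro CollectI conjI allI impI ballI)
        fix as assume "\<not> (length as = p \<and> set as \<subseteq> G)"
        then show "ctr a w as = 0" using out[of "a # as"] by (auto simp: app)
      next
        fix as assume "length as = p \<and> set as \<subseteq> G"
        then show "ctr a w as \<in> S" using inn(1)[of "a # as"] a by (simp add: app)
      next
        fix as i b f assume "length as = p \<and> set as \<subseteq> G" "i < p" "b \<in> G" "f \<in> C"
        then show "ctr a w (as[i := smul f (as ! i) + b]) = smul f (ctr a w as) + ctr a w (as[i := b])"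
          using inn(2)[of "a # as" "Suc i" b f] a by (simp add: app)
      next
        fix as i k assume "length as = p \<and> set as \<subseteq> G" "i < p" "k < p" "i \<noteq> k \<and> as ! i = as ! k"
        then show "ctr a w as = 0"
          using inn(3)[of "a # as" "Suc i" "Suc k"] a by (simp add: app)
      qed
    qed
    have "ctr (smul f a + a') w = smulF f (ctr a w) + ctr a' w" if "a \<in> G" "a' \<in> G" "f \<in> C" for a a' f
    proof
      fix as
      show "ctr (smul f a + a') w as = (smulF f (ctr a w) + ctr a' w) as"
      proof (cases "length as = p \<and> set as \<subseteq> G")
        case True then show ?thesis using inn(2)[of "a # as" 0 a' f] that by (simp add: app)
      next
        case False
        then have "w (b # as) = 0" for b by (intro out) auto
        then show ?thesis by (simp add: app)
      qed
    qed
    moreover have "ctr a (ctr a w) = 0" if "a \<in> G" for a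
    proof
      fix as
      show "ctr a (ctr a w) as = 0 as"
      proof (cases "length (a # a # as) = Suc p \<and> set (a # a # as) \<subseteq> G")
        case True
        from inn(3)[OF this, of 0 1] True show ?thesis by (simp add: app)
      next
        case False
        from out[OF this] show ?thesis by (simp add: app)
      qed
    qed
    moreover have "\<forall>a. ctr a w \<in> AA p" using cG z AF_zero by metis
    moreover have "w [] = 0" by (rule out) simp
    ultimately show "w \<in> AA (Suc p)" using z by simp
  qed
qed

text \<open>Negative degrees carry the zero space, so that a contraction lowers the degree by one
  without exception.\<close>

definition AZ :: "int \<Rightarrow> ('m, 'v, 'e) form set"
  where "AZ d = (if d < 0 then {0} else AA (nat d))"

lemma subspace_AZ: "subspace (AZ d)"
  by (simp add: AZ_def subspace_AF subspace_single_0)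

lemma AZ_int [simp]: "AZ (int p) = AA p"
  by (simp add: AZ_def)

lemma AZ_zero [simp]: "0 \<in> AZ d"
  by (simp add: subspace_0 subspace_AZ)

lemma AZ_val: "w \<in> AZ d \<Longrightarrow> w as \<in> S"
  by (auto simp: AZ_def AF_val split: if_splits)

lemma AZ_out: "w \<in> AZ d \<Longrightarrow> int (length as) \<noteq> d \<Longrightarrow> w as = 0"
  using AF_out[of w "nat d" as] by (cases "d < 0"; cases "length as = nat d") (auto simp: AZ_def app)

lemma AZ_ctr: "w \<in> AZ d \<Longrightarrow> ctr a w \<in> AZ (d - 1)"
proof (cases "d \<le> 0")
  case True
  assume "w \<in> AZ d"
  then have "ctr a w = 0" using True by (cases "d = 0") (auto simp: AZ_def)
  then show ?thesis by simp
next
  case False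
  assume "w \<in> AZ d"
  moreover obtain p where "d = int (Suc p)" using False by (intro that[of "nat (d - 1)"]) simp
  ultimately show ?thesis by (simp del: of_nat_Suc) (simp add: AZ_def)
qed

lemma AZ_ctr_out: "w \<in> AZ d \<Longrightarrow> a \<notin> G \<Longrightarrow> ctr a w = 0"
  by (cases "nat d") (auto simp: AZ_def split: if_splits)

lemma AZ_ctr_lin: "\<lbrakk>w \<in> AZ d; a \<in> G; a' \<in> G; f \<in> C\<rbrakk> \<Longrightarrow> ctr (smul f a + a') w = smulF f (ctr a w) + ctr a' w"
  by (cases "nat d") (auto simp: AZ_def split: if_splits)

lemma AZ_ctr_add: "\<lbrakk>w \<in> AZ d; a \<in> G; a' \<in> G\<rbrakk> \<Longrightarrow> ctr (a + a') w = ctr a w + ctr a' w"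
  using AZ_ctr_lin[of w d a a' "\<lambda>_. 1"] by simp

lemma AZ_ctr_minus: "w \<in> AZ d \<Longrightarrow> a \<in> G \<Longrightarrow> ctr (- a) w = - ctr a w"
  using AZ_ctr_lin[of w d a 0 "\<lambda>_. - 1"] AZ_ctr_lin[of w d 0 0 "\<lambda>_. 1"] by simp

lemma AZ_ctr_ctr: "\<lbrakk>w \<in> AZ d; a \<in> G; b \<in> G\<rbrakk> \<Longrightarrow> ctr a (ctr b w) = - ctr b (ctr a w)"
proof (cases "d < 0")
  case False
  assume "w \<in> AZ d" "a \<in> G" "b \<in> G"
  with False show ?thesis by (intro ctr_anti[of w "nat d"]) (simp_all add: AZ_def)
qed (simp add: AZ_def)

lemma AZ_ctr_ctr_same: "w \<in> AZ d \<Longrightarrow> a \<in> G \<Longrightarrow> ctr a (ctr a w) = 0"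
  by (cases "nat d") (auto simp: AZ_def split: if_splits)

lemma AZ_lin: "\<lbrakk>w \<in> AZ d; w' \<in> AZ d; f \<in> C\<rbrakk> \<Longrightarrow> smulF f w + w' \<in> AZ d"
  using AF_lin by (auto simp: AZ_def split: if_splits)

lemma AZ_I:
  assumes "d \<ge> 0" "d > 0 \<Longrightarrow> w [] = 0" "d = 0 \<Longrightarrow> w [] \<in> S" "\<And>a. a \<notin> G \<Longrightarrow> ctr a w = 0"
    "\<And>a. a \<in> G \<Longrightarrow> ctr a w \<in> AZ (d - 1)"
    "\<And>a a' f. \<lbrakk>a \<in> G; a' \<in> G; f \<in> C\<rbrakk> \<Longrightarrow> ctr (smul f a + a') w = smulF f (ctr a w) + ctr a' w"
    "\<And>a. a \<in> G \<Longrightarrow> ctr a (ctr a w) = 0"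
  shows "w \<in> AZ d"
proof (cases "d = 0")
  case True
  have "ctr a w = 0" for a using assms(4,5)[of a] True by (auto simp: AZ_def)
  then show ?thesis using True assms(3) by (simp add: AZ_def)
next
  case False
  then obtain p where p: "d = int (Suc p)" using assms(1) by (intro that[of "nat (d - 1)"]) simp
  have "ctr a w \<in> AA p" for a using assms(4,5)[of a] p by (cases "a \<in> G") (auto simp: AZ_def)
  then have "w \<in> AA (Suc p)" using assms(2,4,6,7) p by simp
  then show ?thesis using p by (simp only: AZ_int)
qed

end

section \<open>Wedge products and their contractions\<close>

lemma wedge_insert_Nil: "wedge_insert w \<Phi> [] = \<Phi> (w []) []"
  by (simp add: wedge_insert_def shuffle_sign_def)

lemma finite_inversions: "finite I \<Longrightarrow> finite {(i, k). i \<in> I \<and> k \<notin> I \<and> k < (i::nat)}"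
  by (rule finite_subset[of _ "SIGMA i:I. {..<i}"]) auto

lemma shuffle_sign_insert: "shuffle_sign (insert 0 (Suc ` I)) = shuffle_sign I"
proof -
  let ?S = "\<lambda>I. {(i, k). i \<in> I \<and> k \<notin> I \<and> k < (i::nat)}"
  have "?S (insert 0 (Suc ` I)) = map_prod Suc Suc ` ?S I"
  proof (intro equalityI subsetI)
    fix x assume "x \<in> ?S (insert 0 (Suc ` I))"
    then obtain i k where x: "x = (i, k)" "i \<in> insert 0 (Suc ` I)" "k \<notin> insert 0 (Suc ` I)" "k < i" by blast
    then obtain i' k' where "i = Suc i'" "k = Suc k'" by (metis gr_implies_not0 insertCI not0_implies_Suc)
    then show "x \<in> map_prod Suc Suc ` ?S I" using x by (intro image_eqI[of _ _ "(i', k')"]) auto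
  qed auto
  moreover have "inj_on (map_prod Suc Suc) (?S I)" by (auto simp: inj_on_def)
  ultimately show ?thesis by (simp add: shuffle_sign_def card_image)
qed

text \<open>Here the new first argument goes to the second factor and is passed by all of
  \<open>I\<close>; in \<open>shuffle_sign_insert\<close> it goes to the first factor and is passed
  by none.\<close>

lemma shuffle_sign_Suc:
  assumes "finite I"
  shows "shuffle_sign (Suc ` I) = (- 1) ^ card I * shuffle_sign I"
proof -
  let ?S = "\<lambda>I. {(i, k). i \<in> I \<and> k \<notin> I \<and> k < (i::nat)}"
  have eq: "?S (Suc ` I) = map_prod Suc Suc ` ?S I \<union> (\<lambda>i. (Suc i, 0)) ` I"
  proof (intro equalityI subsetI)
    fix x assume "x \<in> ?S (Suc ` I)"
    then obtain i k where x: "x = (Suc i, k)" "i \<in> I" "k \<notin> Suc ` I" "k < Suc i" by blast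
    show "x \<in> map_prod Suc Suc ` ?S I \<union> (\<lambda>i. (Suc i, 0)) ` I"
    proof (cases k)
      case (Suc k')
      then have "x = map_prod Suc Suc (i, k')" "(i, k') \<in> ?S I" using x by auto
      then show ?thesis by blast
    qed (use x in auto)
  qed auto
  have "card (?S (Suc ` I)) = card (map_prod Suc Suc ` ?S I) + card ((\<lambda>i. (Suc i, 0::nat)) ` I)"
    unfolding eq by (rule card_Un_disjoint) (use finite_inversions[OF assms] assms in auto)
  also have "card (map_prod Suc Suc ` ?S I) = card (?S I)"
    by (rule card_image) (auto simp: inj_on_def)
  also have "card ((\<lambda>i. (Suc i, 0::nat)) ` I) = card I"
    by (rule card_image) (auto simp: inj_on_def)
  finally show ?thesis by (simp add: shuffle_sign_def power_add)
qed

text \<open>The first argument goes to one of the two factors. About \<open>w\<close> only its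
  vanishing off degree \<open>d\<close> is assumed, so the rule is available for proving that the
  product is alternating.\<close>

lemma ctr_wedge_insert:
  fixes w :: "('m, 'v, 'e::real_vector) form" and \<Phi> :: "('m \<Rightarrow> 'e) \<Rightarrow> ('m, 'v, 'f::real_vector) form"
  assumes w: "\<And>as. int (length as) \<noteq> d \<Longrightarrow> w as = 0" and \<Phi>: "\<Phi> 0 = 0"
  shows "ctr a (wedge_insert w \<Phi>) = wedge_insert (ctr a w) \<Phi> + sg d *\<^sub>R wedge_insert w (\<lambda>b. ctr a (\<Phi> b))"
proof
  fix as :: "('m \<Rightarrow> 'v) list"
  let ?n = "length as"
  let ?t = "\<lambda>I. shuffle_sign I *\<^sub>R \<Phi> (w (nths (a # as) I)) (nths (a # as) (- I))"
  have P: "Pow {..<Suc ?n} = (\<lambda>I. Suc ` I) ` Pow {..<?n} \<union> (\<lambda>I. insert 0 (Suc ` I)) ` Pow {..<?n}"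
    unfolding lessThan_Suc_eq_insert_0 Pow_insert
    by (simp add: image_Pow_surj[OF refl, symmetric] image_image)
  have i1: "inj_on (\<lambda>I. Suc ` I) (Pow {..<?n})" by (rule inj_on_image_Pow) simp
  have i2: "inj_on (\<lambda>I. insert 0 (Suc ` I)) (Pow {..<?n})"
  proof (rule inj_onI)
    fix I J :: "nat set" assume "insert 0 (Suc ` I) = insert 0 (Suc ` J)"
    then have "Suc ` I = Suc ` J" by (subst (asm) insert_ident) auto
    then show "I = J" by (simp add: inj_image_eq_iff)
  qed
  have t1: "?t (Suc ` I) = sg d *\<^sub>R (shuffle_sign I *\<^sub>R ctr a (\<Phi> (w (nths as I))) (nths as (- I)))"
    if "I \<in> Pow {..<?n}" for I
  proof -
    have fin: "finite I" using that finite_subset by auto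
    have n: "nths (a # as) (Suc ` I) = nths as I" "nths (a # as) (- (Suc ` I)) = a # nths as (- I)"
      by (auto simp: nths_Cons intro!: arg_cong2[of _ _ _ _ nths])
    show ?thesis
    proof (cases "int (length (nths as I)) = d")
      case True
      have "{i. i < ?n \<and> i \<in> I} = I" using that by auto
      then have "card I = length (nths as I)" by (simp add: length_nths)
      then have "(- 1) ^ card I = sg d" unfolding True[symmetric] by (simp only: sg_power)
      then show ?thesis by (simp add: n shuffle_sign_Suc[OF fin] ctr_apply)
    next
      case False
      then show ?thesis by (simp add: n w \<Phi> form_apply)
    qed
  qed
  have t2: "?t (insert 0 (Suc ` I)) = shuffle_sign I *\<^sub>R \<Phi> (ctr a w (nths as I)) (nths as (- I))" for I
  proof -
    have n: "nths (a # as) (insert 0 (Suc ` I)) = a # nths as I" "nths (a # as) (- insert 0 (Suc ` I)) = nths as (- I)"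
      by (auto simp: nths_Cons intro!: arg_cong2[of _ _ _ _ nths])
    show ?thesis by (simp only: n shuffle_sign_insert ctr_apply)
  qed
  have "ctr a (wedge_insert w \<Phi>) as = (\<Sum>I\<in>Pow {..<Suc ?n}. ?t I)"
    by (simp add: ctr_apply wedge_insert_def)
  also have "\<dots> = (\<Sum>I\<in>Pow {..<?n}. ?t (Suc ` I)) + (\<Sum>I\<in>Pow {..<?n}. ?t (insert 0 (Suc ` I)))"
    unfolding P by (subst sum.union_disjoint) (auto simp: sum.reindex[OF i1] sum.reindex[OF i2])
  also have "(\<Sum>I\<in>Pow {..<?n}. ?t (Suc ` I)) = (sg d *\<^sub>R wedge_insert w (\<lambda>b. ctr a (\<Phi> b))) as"
    using t1 by (simp add: form_apply wedge_insert_def scaleR_sum_right)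
  also have "(\<Sum>I\<in>Pow {..<?n}. ?t (insert 0 (Suc ` I))) = wedge_insert (ctr a w) \<Phi> as"
    unfolding t2 by (simp add: wedge_insert_def)
  finally show "ctr a (wedge_insert w \<Phi>) as
      = (wedge_insert (ctr a w) \<Phi> + sg d *\<^sub>R wedge_insert w (\<lambda>b. ctr a (\<Phi> b))) as"
    by (simp add: form_apply add.commute)
qed

lemma wedge_insert_lin_right:
  "wedge_insert w (\<lambda>b. smulF f (\<Phi> b) + \<Psi> b) = smulF f (wedge_insert w \<Phi>) + wedge_insert w \<Psi>"
  by (rule ext) (simp add: wedge_insert_def app sum.distrib scaleR_add_right smul_sum smul_scaleR)

lemma wedge_insert_zero_right [simp]: "wedge_insert w (\<lambda>b. 0) = 0"
  by (rule ext) (simp add: wedge_insert_def app)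

lemma wedge_insert_add_right: "wedge_insert w (\<lambda>b. \<Phi> b + \<Psi> b) = wedge_insert w \<Phi> + wedge_insert w \<Psi>"
  using wedge_insert_lin_right[of w "\<lambda>_. 1" \<Phi> \<Psi>] by simp

lemma wedge_insert_scale_right: "wedge_insert w (\<lambda>b. c *\<^sub>R \<Phi> b) = c *\<^sub>R wedge_insert w \<Phi>"
  using wedge_insert_lin_right[of w "\<lambda>_. c" \<Phi> "\<lambda>_. 0"] by simp

lemma wedge_insert_cong: "(\<And>as. \<Phi> (w as) = \<Psi> (w as)) \<Longrightarrow> wedge_insert w \<Phi> = wedge_insert w \<Psi>"
  by (rule ext) (simp add: wedge_insert_def)

lemma wedge_insert_zero_left [simp]:
  fixes \<Phi> :: "('m \<Rightarrow> 'e::real_vector) \<Rightarrow> ('m, 'v, 'f::real_vector) form"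
  shows "\<Phi> 0 = 0 \<Longrightarrow> wedge_insert 0 \<Phi> = 0"
  by (rule ext) (simp add: wedge_insert_def app)

lemma wedge_insert_lin_left:
  assumes "\<And>as bs. \<Phi> (smul f (w as) + w' as) = smulF f (\<Phi> (w as)) + \<Phi> (w' as)"
  shows "wedge_insert (smulF f w + w') \<Phi> = smulF f (wedge_insert w \<Phi>) + wedge_insert w' \<Phi>"
  by (rule ext) (simp add: wedge_insert_def app assms sum.distrib scaleR_add_right smul_sum smul_scaleR)

lemma wedge_eq: "wedge \<xi> w = wedge_insert \<xi> (\<lambda>f. smulF f w)"
  by (simp add: wedge_def smulF_def)

lemma smulF_zero_left [simp]: "smulF 0 w = 0"
  by (rule ext) (simp add: app smul_def zero_fun_apply fun_eq_iff)

lemma smulF_add_left: "smulF (f + g) w = smulF f w + smulF g w"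
  by (rule ext) (simp add: app smul_add_left)

lemma smulF_smulF: "smulF f (smulF g w) = smulF (\<lambda>x. f x * g x) w"
  by (rule ext) (simp add: app smul_smul)

lemma smulF_commute: "smulF f (smulF g w) = smulF g (smulF f w)"
  by (simp add: smulF_smulF mult.commute)

lemma wedge_Nil: "wedge \<xi> w [] = smul (\<xi> []) (w [])"
  by (simp add: wedge_eq wedge_insert_Nil smulF_apply)

lemma ctr_wedge: "(\<And>as. int (length as) \<noteq> d \<Longrightarrow> \<xi> as = 0) \<Longrightarrow>
    ctr a (wedge \<xi> w) = wedge (ctr a \<xi>) w + sg d *\<^sub>R wedge \<xi> (ctr a w)"
  unfolding wedge_eq by (subst ctr_wedge_insert[of d]) simp_all

lemma wedge_lin_left: "wedge (smulF f \<xi> + \<eta>) w = smulF f (wedge \<xi> w) + wedge \<eta> w"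
  unfolding wedge_eq by (rule wedge_insert_lin_left) (simp add: smulF_add_left smulF_smulF smul_real)

lemma wedge_lin_right: "wedge \<xi> (smulF f w + w') = smulF f (wedge \<xi> w) + wedge \<xi> w'"
  unfolding wedge_eq by (simp only: smulF_simps smulF_commute[of _ f] wedge_insert_lin_right)

lemma wedge_zero [simp]: "wedge 0 w = 0" "wedge \<xi> 0 = 0"
  by (simp_all add: wedge_eq)

lemma wedge_simps: "wedge (\<xi> + \<eta>) w = wedge \<xi> w + wedge \<eta> w" "wedge \<xi> (w + w') = wedge \<xi> w + wedge \<xi> w'"
  "wedge (c *\<^sub>R \<xi>) w = c *\<^sub>R wedge \<xi> w" "wedge \<xi> (c *\<^sub>R w) = c *\<^sub>R wedge \<xi> w"
  using wedge_lin_left[of "\<lambda>_. 1" \<xi> \<eta> w] wedge_lin_right[of \<xi> "\<lambda>_. 1" w w']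
    wedge_lin_left[of "\<lambda>_. c" \<xi> 0 w] wedge_lin_right[of \<xi> "\<lambda>_. c" w 0] by simp_all

lemma wedge_minus: "wedge (- \<xi>) w = - wedge \<xi> w" "wedge \<xi> (- w) = - wedge \<xi> w"
  using wedge_simps(3)[of "-1" \<xi> w] wedge_simps(4)[of \<xi> "-1" w] by simp_all

lemma wedge_diff: "wedge (\<xi> - \<eta>) w = wedge \<xi> w - wedge \<eta> w" "wedge \<xi> (w - w') = wedge \<xi> w - wedge \<xi> w'"
  unfolding diff_conv_add_uminus by (simp_all only: wedge_simps wedge_minus)

definition Clinear :: "('m \<Rightarrow> real) set \<Rightarrow> ('m \<Rightarrow> 'e::real_vector) set \<Rightarrow> (('m \<Rightarrow> 'e) \<Rightarrow> ('m, 'v, 'f::real_vector) form) \<Rightarrow> bool"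
  where "Clinear C S \<Phi> \<longleftrightarrow> (\<forall>f\<in>C. \<forall>s\<in>S. \<forall>s'\<in>S. \<Phi> (smul f s + s') = smulF f (\<Phi> s) + \<Phi> s')"

lemma ClinearD: "\<lbrakk>Clinear C S \<Phi>; f \<in> C; s \<in> S; s' \<in> S\<rbrakk> \<Longrightarrow> \<Phi> (smul f s + s') = smulF f (\<Phi> s) + \<Phi> s'"
  by (simp add: Clinear_def)

lemma Clinear_ctr: "Clinear C S \<Phi> \<Longrightarrow> Clinear C S (\<lambda>b. ctr a (\<Phi> b))"
  by (simp add: Clinear_def)

lemma (in cmodule) Clinear_zero: "Clinear C S \<Phi> \<Longrightarrow> \<Phi> 0 = 0"
  using ClinearD[of C S \<Phi> "\<lambda>_. 1" 0 0] by simp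

lemma (in cmodule) Clinear_smul: "\<lbrakk>Clinear C S \<Phi>; f \<in> C; s \<in> S\<rbrakk> \<Longrightarrow> \<Phi> (smul f s) = smulF f (\<Phi> s)"
  using ClinearD[of C S \<Phi> f s 0] Clinear_zero by simp

locale form_mod2 = E: form_mod C S G + F: form_mod C T G
  for C :: "('m \<Rightarrow> real) set" and S :: "('m \<Rightarrow> 'e::real_vector) set" and T :: "('m \<Rightarrow> 'f::real_vector) set"
    and G :: "('m \<Rightarrow> 'v::real_vector) set"
begin

text \<open>By \<open>AZ_I\<close> everything is read off the contractions, each of which lowers one
  of the two degrees. The measure is zero only when both degrees are negative. In a double
  contraction with the same section the two mixed terms carry the opposite signs \<open>sg p\<close>
  and \<open>sg (p - 1)\<close>.\<close>

lemma wedge_insert_AZ: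
  assumes "w \<in> E.AZ p" "Clinear C S \<Phi>" "\<And>s. s \<in> S \<Longrightarrow> \<Phi> s \<in> F.AZ q"
  shows "wedge_insert w \<Phi> \<in> F.AZ (p + q)"
proof -
  have "wedge_insert w \<Phi> \<in> F.AZ (p + q)" if "nat (p + 1) + nat (q + 1) \<le> n" for n
    using assms that
  proof (induction n arbitrary: w \<Phi> p q)
    case 0
    then have "w = 0" by (simp add: E.AZ_def split: if_splits)
    then show ?case using E.M.Clinear_zero[OF 0(2)] by simp
  next
    case (Suc n)
    note \<Phi>0 = E.M.Clinear_zero[OF Suc.prems(2)]
    have wS: "w as \<in> S" for as by (rule E.AZ_val[OF Suc.prems(1)])
    show ?case
    proof (cases "p < 0 \<or> q < 0")
      case True
      have "wedge_insert w \<Phi> = 0"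
      proof (cases "p < 0")
        case True
        then have "w = 0" using Suc.prems(1) by (simp add: E.AZ_def)
        then show ?thesis using \<Phi>0 by simp
      next
        case False
        then have q: "q < 0" using True by simp
        have "\<Phi> (w as) = 0" for as using Suc.prems(3)[OF wS[of as]] q by (simp add: F.AZ_def)
        then have "wedge_insert w \<Phi> = wedge_insert w (\<lambda>b. 0)" by (intro wedge_insert_cong)
        then show ?thesis by simp
      qed
      then show ?thesis by simp
    next
      case False
      then have pq: "p \<ge> 0" "q \<ge> 0" by simp_all
      have ct: "ctr a (wedge_insert w \<Phi>) = wedge_insert (ctr a w) \<Phi> + sg p *\<^sub>R wedge_insert w (\<lambda>b. ctr a (\<Phi> b))" for a
        by (rule ctr_wedge_insert) (use E.AZ_out[OF Suc.prems(1)] \<Phi>0 in auto)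
      have ct1: "ctr a (wedge_insert (ctr a w) \<Phi>) = wedge_insert (ctr a (ctr a w)) \<Phi> + sg (p - 1) *\<^sub>R wedge_insert (ctr a w) (\<lambda>b. ctr a (\<Phi> b))" for a
        by (rule ctr_wedge_insert) (use E.AZ_out[OF E.AZ_ctr[OF Suc.prems(1)]] \<Phi>0 in auto)
      have ct2: "ctr a (wedge_insert w (\<lambda>b. ctr a (\<Phi> b))) = wedge_insert (ctr a w) (\<lambda>b. ctr a (\<Phi> b)) + sg p *\<^sub>R wedge_insert w (\<lambda>b. ctr a (ctr a (\<Phi> b)))" for a
        by (rule ctr_wedge_insert) (use E.AZ_out[OF Suc.prems(1)] \<Phi>0 in auto)
      show ?thesis
      proof (rule F.AZ_I)
        show "p + q \<ge> 0" using pq by simp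
        show "wedge_insert w \<Phi> [] = 0" if "p + q > 0"
        proof (cases "p > 0")
          case True
          then have "w [] = 0" by (intro E.AZ_out[OF Suc.prems(1)]) simp
          then show ?thesis by (simp add: wedge_insert_Nil \<Phi>0 form_apply)
        next
          case False
          then have "q > 0" using that by simp
          then show ?thesis unfolding wedge_insert_Nil by (intro F.AZ_out[OF Suc.prems(3)[OF wS]]) simp
        qed
        show "wedge_insert w \<Phi> [] \<in> T" if "p + q = 0"
          unfolding wedge_insert_Nil by (rule F.AZ_val[OF Suc.prems(3)[OF wS]])
        show "ctr a (wedge_insert w \<Phi>) = 0" if "a \<notin> G" for a
        proof -
          have "wedge_insert w (\<lambda>b. ctr a (\<Phi> b)) = wedge_insert w (\<lambda>b. 0)"
            by (rule wedge_insert_cong) (rule F.AZ_ctr_out[OF Suc.prems(3)[OF wS] that])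
          then show ?thesis unfolding ct E.AZ_ctr_out[OF Suc.prems(1) that] by (simp add: \<Phi>0)
        qed
        show "ctr a (wedge_insert w \<Phi>) \<in> F.AZ (p + q - 1)" if "a \<in> G" for a
        proof -
          have "wedge_insert (ctr a w) \<Phi> \<in> F.AZ ((p - 1) + q)"
            by (rule Suc.IH[OF E.AZ_ctr[OF Suc.prems(1)] Suc.prems(2,3)]) (use Suc.prems(4) pq in auto)
          moreover have "wedge_insert w (\<lambda>b. ctr a (\<Phi> b)) \<in> F.AZ (p + (q - 1))"
            by (rule Suc.IH[OF Suc.prems(1) Clinear_ctr[OF Suc.prems(2)] F.AZ_ctr[OF Suc.prems(3)]]) (use Suc.prems(4) pq in auto)
          moreover have "(p - 1) + q = p + q - 1" "p + (q - 1) = p + q - 1" by simp_all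
          ultimately show ?thesis unfolding ct
            by (simp add: subspace_add[OF F.subspace_AZ] subspace_scale[OF F.subspace_AZ])
        qed
        show "ctr (smul f a + a') (wedge_insert w \<Phi>) = smulF f (ctr a (wedge_insert w \<Phi>)) + ctr a' (wedge_insert w \<Phi>)"
          if a: "a \<in> G" "a' \<in> G" "f \<in> C" for a a' f
        proof -
          have "wedge_insert w (\<lambda>b. ctr (smul f a + a') (\<Phi> b)) = wedge_insert w (\<lambda>b. smulF f (ctr a (\<Phi> b)) + ctr a' (\<Phi> b))"
            by (rule wedge_insert_cong) (rule F.AZ_ctr_lin[OF Suc.prems(3)[OF wS] a])
          moreover have "wedge_insert (smulF f (ctr a w) + ctr a' w) \<Phi> = smulF f (wedge_insert (ctr a w) \<Phi>) + wedge_insert (ctr a' w) \<Phi>"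
            by (rule wedge_insert_lin_left, rule ClinearD[OF Suc.prems(2) a(3)]) (simp_all add: ctr_apply wS)
          ultimately show ?thesis unfolding ct E.AZ_ctr_lin[OF Suc.prems(1) a]
            by (simp add: wedge_insert_lin_right scaleR_add_right)
        qed
        show "ctr a (ctr a (wedge_insert w \<Phi>)) = 0" if a: "a \<in> G" for a
        proof -
          have "wedge_insert w (\<lambda>b. ctr a (ctr a (\<Phi> b))) = wedge_insert w (\<lambda>b. 0)"
            by (rule wedge_insert_cong) (rule F.AZ_ctr_ctr_same[OF Suc.prems(3)[OF wS] a])
          then show ?thesis
            unfolding ct ctr_simps ct1 ct2 E.AZ_ctr_ctr_same[OF Suc.prems(1) a] by (simp add: \<Phi>0 sg_diff)
        qed
      qed
    qed
  qed
  then show ?thesis by blast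
qed

end

section \<open>Lie derivatives and the Chevalley--Eilenberg differential\<close>

lemma smul_zero_left [simp]: "smul 0 s = 0"
  by (simp add: smul_def zero_fun_def)

context form_mod2
begin

text \<open>Associativity of the product: both sides agree on no arguments and have the same
  contractions.\<close>

lemma wedge_insert_wedge:
  fixes \<omega> :: "('m, 'v, real) form" and \<Phi> :: "('m \<Rightarrow> 'e) \<Rightarrow> ('m, 'v, 'f) form"
  assumes \<omega>: "\<And>as. int (length as) \<noteq> p \<Longrightarrow> \<omega> as = 0" "\<And>as. \<omega> as \<in> C"
    and w: "\<And>as. int (length as) \<noteq> q \<Longrightarrow> w as = 0" "\<And>as. w as \<in> S"
    and \<Phi>: "Clinear C S \<Phi>"
  shows "wedge_insert (wedge \<omega> w) \<Phi> = wedge \<omega> (wedge_insert w \<Phi>)"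
proof
  fix as
  show "wedge_insert (wedge \<omega> w) \<Phi> as = wedge \<omega> (wedge_insert w \<Phi>) as"
    using assms
  proof (induction as arbitrary: p q \<omega> w \<Phi>)
    case Nil
    then show ?case using E.M.Clinear_smul[OF Nil(5)]
      by (simp add: wedge_insert_Nil wedge_Nil smulF_apply)
  next
    case (Cons a as)
    note \<Phi>0 = E.M.Clinear_zero[OF Cons.prems(5)]
    have wo: "wedge \<omega> w as = 0" if "int (length as) \<noteq> p + q" for as
    proof -
      have "smul (\<omega> (nths as I)) (w (nths as (- I))) = 0" if "I \<in> Pow {..<length as}" for I
      proof (cases "int (length (nths as I)) = p")
        case True
        have "length (nths as I) + length (nths as (- I)) = length as"
        proof -
          have "length as = card ({i. i < length as \<and> i \<in> I} \<union> {i. i < length as \<and> i \<in> - I})"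
            by (subst (1) card_lessThan[symmetric]) (rule arg_cong[of _ _ card], auto)
          also have "\<dots> = card {i. i < length as \<and> i \<in> I} + card {i. i < length as \<and> i \<in> - I}"
            by (rule card_Un_disjoint) auto
          finally show ?thesis by (simp add: length_nths)
        qed
        then have "int (length (nths as (- I))) \<noteq> q" using True \<open>int (length as) \<noteq> p + q\<close> by linarith
        then show ?thesis by (simp add: Cons.prems(3))
      next
        case False then show ?thesis by (simp add: Cons.prems(1))
      qed
      then show ?thesis by (simp add: wedge_def wedge_insert_def)
    qed
    have cw: "ctr a (wedge \<omega> w) = wedge (ctr a \<omega>) w + sg p *\<^sub>R wedge \<omega> (ctr a w)"
      by (rule ctr_wedge) (rule Cons.prems(1))
    have S: "wedge \<eta> u as \<in> S" if "\<And>as. \<eta> as \<in> C" "\<And>as. u as \<in> S"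
      for \<eta> :: "('m, 'v, real) form" and u :: "('m, 'v, 'e) form" and as
      unfolding wedge_def wedge_insert_def
      by (intro subspace_sum[OF E.M.subspace_S] subspace_scale[OF E.M.subspace_S] E.M.S_smul that)
    have l: "wedge_insert (wedge (ctr a \<omega>) w + sg p *\<^sub>R wedge \<omega> (ctr a w)) \<Phi>
       = wedge_insert (wedge (ctr a \<omega>) w) \<Phi> + sg p *\<^sub>R wedge_insert (wedge \<omega> (ctr a w)) \<Phi>"
    proof -
      have "wedge_insert (smulF (\<lambda>_. sg p) (wedge \<omega> (ctr a w)) + wedge (ctr a \<omega>) w) \<Phi>
        = smulF (\<lambda>_. sg p) (wedge_insert (wedge \<omega> (ctr a w)) \<Phi>) + wedge_insert (wedge (ctr a \<omega>) w) \<Phi>"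
        by (rule wedge_insert_lin_left, rule ClinearD[OF Cons.prems(5)])
          (auto intro!: S simp: ctr_apply Cons.prems)
      then show ?thesis by (simp add: add.commute)
    qed
    have I1: "wedge_insert (wedge (ctr a \<omega>) w) \<Phi> as = wedge (ctr a \<omega>) (wedge_insert w \<Phi>) as"
      by (rule Cons.IH[of "p - 1" _ q]) (use Cons.prems in \<open>auto simp: ctr_apply\<close>)
    have I2: "wedge_insert (wedge \<omega> (ctr a w)) \<Phi> as = wedge \<omega> (wedge_insert (ctr a w) \<Phi>) as"
      by (rule Cons.IH[of p _ "q - 1"]) (use Cons.prems in \<open>auto simp: ctr_apply\<close>)
    have I3: "wedge_insert (wedge \<omega> w) (\<lambda>b. ctr a (\<Phi> b)) as = wedge \<omega> (wedge_insert w (\<lambda>b. ctr a (\<Phi> b))) as"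
      by (rule Cons.IH[of p _ q]) (use Cons.prems in \<open>auto intro: Clinear_ctr\<close>)
    have "ctr a (wedge_insert (wedge \<omega> w) \<Phi>) as = (wedge_insert (ctr a (wedge \<omega> w)) \<Phi>
        + sg (p + q) *\<^sub>R wedge_insert (wedge \<omega> w) (\<lambda>b. ctr a (\<Phi> b))) as"
      by (subst ctr_wedge_insert[OF wo]) (simp_all add: \<Phi>0)
    also have "\<dots> = wedge (ctr a \<omega>) (wedge_insert w \<Phi>) as
       + (sg p *\<^sub>R wedge \<omega> (wedge_insert (ctr a w) \<Phi>) as
       + sg (p + q) *\<^sub>R wedge \<omega> (wedge_insert w (\<lambda>b. ctr a (\<Phi> b))) as)"
      unfolding cw l by (simp only: form_apply I1 I2 I3 add.assoc)
    also have "\<dots> = ctr a (wedge \<omega> (wedge_insert w \<Phi>)) as"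
    proof -
      have "ctr a (wedge_insert w \<Phi>) = wedge_insert (ctr a w) \<Phi> + sg q *\<^sub>R wedge_insert w (\<lambda>b. ctr a (\<Phi> b))"
        by (rule ctr_wedge_insert) (use Cons.prems(3) \<Phi>0 in auto)
      then show ?thesis
        by (subst ctr_wedge[of p]) (simp_all add: Cons.prems(1) wedge_simps form_apply scaleR_add_right sg_add)
    qed
    finally show ?case by (simp only: ctr_apply)
  qed
qed

lemma wedge_insert_commute:
  fixes \<omega> :: "('m, 'v, real) form" and \<Phi> :: "('m \<Rightarrow> 'e) \<Rightarrow> ('m, 'v, 'f) form"
  assumes \<omega>: "\<And>as. int (length as) \<noteq> p \<Longrightarrow> \<omega> as = 0"
    and w: "\<And>as. int (length as) \<noteq> q \<Longrightarrow> w as = 0" and \<Phi>: "\<Phi> 0 = 0"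
  shows "wedge_insert w (\<lambda>b. wedge \<omega> (\<Phi> b)) = sg (p * q) *\<^sub>R wedge \<omega> (wedge_insert w \<Phi>)"
proof
  fix as
  show "wedge_insert w (\<lambda>b. wedge \<omega> (\<Phi> b)) as = (sg (p * q) *\<^sub>R wedge \<omega> (wedge_insert w \<Phi>)) as"
    using assms
  proof (induction as arbitrary: p q \<omega> w \<Phi>)
    case Nil
    show ?case
    proof (cases "p = 0 \<or> q = 0")
      case True then show ?thesis by (auto simp: wedge_insert_Nil wedge_Nil form_apply)
    next
      case False
      then have "\<omega> [] = 0" using Nil by auto
      then show ?thesis by (simp add: wedge_insert_Nil wedge_Nil form_apply)
    qed
  next
    case (Cons a as)
    have I1: "wedge_insert (ctr a w) (\<lambda>b. wedge \<omega> (\<Phi> b)) as = (sg (p * (q - 1)) *\<^sub>R wedge \<omega> (wedge_insert (ctr a w) \<Phi>)) as"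
      by (rule Cons.IH) (use Cons.prems in \<open>auto simp: ctr_apply\<close>)
    have I2: "wedge_insert w (\<lambda>b. wedge (ctr a \<omega>) (\<Phi> b)) as = (sg ((p - 1) * q) *\<^sub>R wedge (ctr a \<omega>) (wedge_insert w \<Phi>)) as"
      by (rule Cons.IH) (use Cons.prems in \<open>auto simp: ctr_apply\<close>)
    have I3: "wedge_insert w (\<lambda>b. wedge \<omega> (ctr a (\<Phi> b))) as = (sg (p * q) *\<^sub>R wedge \<omega> (wedge_insert w (\<lambda>b. ctr a (\<Phi> b)))) as"
      by (rule Cons.IH) (use Cons.prems in auto)
    have c: "ctr a (wedge \<omega> u) = wedge (ctr a \<omega>) u + sg p *\<^sub>R wedge \<omega> (ctr a u)" for u :: "('m, 'v, 'f) form"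
      by (rule ctr_wedge) (rule Cons.prems(1))
    have c2: "ctr a (wedge_insert w \<Phi>) = wedge_insert (ctr a w) \<Phi> + sg q *\<^sub>R wedge_insert w (\<lambda>b. ctr a (\<Phi> b))"
      by (rule ctr_wedge_insert) (use Cons.prems in auto)
    have c1: "ctr a (wedge_insert w (\<lambda>b. wedge \<omega> (\<Phi> b))) = wedge_insert (ctr a w) (\<lambda>b. wedge \<omega> (\<Phi> b))
        + sg q *\<^sub>R wedge_insert w (\<lambda>b. ctr a (wedge \<omega> (\<Phi> b)))"
      by (rule ctr_wedge_insert) (use Cons.prems in auto)
    have "ctr a (wedge_insert w (\<lambda>b. wedge \<omega> (\<Phi> b))) as = ctr a (sg (p * q) *\<^sub>R wedge \<omega> (wedge_insert w \<Phi>)) as"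
      unfolding c1 c ctr_simps c2
      by (simp add: wedge_insert_add_right wedge_insert_scale_right form_apply I1 I2 I3 wedge_simps
          scaleR_add_right sg_norm sg_add mult.commute mult.left_commute)
    then show ?case by (simp only: ctr_apply)
  qed
qed

end

text \<open>The Lie derivative, defined through its commutator with contractions, [L_a, iota_b] =
  iota_[a,b]. In this form it suits induction on the arguments; \<open>lie_explicit\<close> gives
  the alternating sum.\<close>

fun lieF :: "('a \<Rightarrow> 'a \<Rightarrow> 'a) \<Rightarrow> ('a \<Rightarrow> 'b \<Rightarrow> 'b) \<Rightarrow> 'a set \<Rightarrow> 'a \<Rightarrow> ('a list \<Rightarrow> 'b::ab_group_add) \<Rightarrow> 'a list \<Rightarrow> 'b" where
  "lieF br D G a w [] = D a (w [])"
| "lieF br D G a w (b # as) = (if b \<in> G then lieF br D G a (\<lambda>cs. w (b # cs)) as - w (br a b # as) else 0)"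

text \<open>Lie--Rinehart data: functions, sections of an algebroid and the anchor. They are used
  both for A and for the whole of L.\<close>

locale lr_alg = cring C + N: cmodule C G for C :: "('m \<Rightarrow> real) set" and G :: "('m \<Rightarrow> 'v::real_vector) set" +
  fixes br :: "('m \<Rightarrow> 'v) \<Rightarrow> ('m \<Rightarrow> 'v) \<Rightarrow> 'm \<Rightarrow> 'v" and rho :: "('m \<Rightarrow> 'v) \<Rightarrow> ('m \<Rightarrow> real) \<Rightarrow> 'm \<Rightarrow> real"
  assumes br_G: "a \<in> G \<Longrightarrow> b \<in> G \<Longrightarrow> br a b \<in> G"
    and br_skew: "a \<in> G \<Longrightarrow> b \<in> G \<Longrightarrow> br a b = - br b a"
    and br_jac: "\<lbrakk>a \<in> G; b \<in> G; c \<in> G\<rbrakk> \<Longrightarrow> br a (br b c) = br (br a b) c + br b (br a c)"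
    and br_lin: "\<lbrakk>a \<in> G; b \<in> G; c \<in> G; f \<in> C\<rbrakk> \<Longrightarrow> br a (smul f b + c) = smul f (br a b) + smul (rho a f) b + br a c"
    and rho_C: "a \<in> G \<Longrightarrow> f \<in> C \<Longrightarrow> rho a f \<in> C"
begin

lemma br_lin_left:
  assumes "a \<in> G" "b \<in> G" "c \<in> G" "f \<in> C"
  shows "br (smul f b + c) a = smul f (br b a) - smul (rho a f) b + br c a"
proof -
  have "br (smul f b + c) a = - br a (smul f b + c)"
    by (rule br_skew) (use assms N.S_lin in auto)
  also have "\<dots> = smul f (- br a b) - smul (rho a f) b + (- br a c)" using assms by (simp add: br_lin)
  finally show ?thesis using assms br_skew[of b a] br_skew[of c a] by simp
qed

end

locale lr_mod = lr_alg C G br rho + form_mod C S G for C :: "('m \<Rightarrow> real) set" and G :: "('m \<Rightarrow> 'v::real_vector) set"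
    and S :: "('m \<Rightarrow> 'e::real_vector) set" and br rho +
  fixes D :: "('m \<Rightarrow> 'v) \<Rightarrow> ('m \<Rightarrow> 'e) \<Rightarrow> 'm \<Rightarrow> 'e"
  assumes D_S: "a \<in> G \<Longrightarrow> s \<in> S \<Longrightarrow> D a s \<in> S"
    and D_lin: "\<lbrakk>a \<in> G; s \<in> S; t \<in> S; f \<in> C\<rbrakk> \<Longrightarrow> D a (smul f s + t) = smul f (D a s) + smul (rho a f) s + D a t"
    and D_const: "\<lbrakk>a \<in> G; s \<in> S; t \<in> S\<rbrakk> \<Longrightarrow> D a (c *\<^sub>R s + t) = c *\<^sub>R D a s + D a t"
    and D_left: "\<lbrakk>a \<in> G; b \<in> G; s \<in> S; f \<in> C\<rbrakk> \<Longrightarrow> D (smul f a + b) s = smul f (D a s) + D b s"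
begin

abbreviation "lie \<equiv> lieF br D G"
abbreviation "ce \<equiv> ce_diff br G D"

lemma ctr_lie: "ctr b (lie a w) = (if b \<in> G then lie a (ctr b w) - ctr (br a b) w else 0)"
  by (rule ext) (simp add: ctr_def form_apply)

lemma lie_Cons: "lie a w (b # as) = (if b \<in> G then lie a (ctr b w) as - w (br a b # as) else 0)"
  by (simp add: ctr_def)

lemma lie_Nil: "lie a w [] = D a (w [])"
  by simp

lemma D_zero: "a \<in> G \<Longrightarrow> D a 0 = 0"
  using D_const[of a 0 0 1] by simp

lemma lie_lin:
  assumes "a \<in> G" "f \<in> C" "u \<in> AZ p" "v \<in> AZ q"
  shows "lie a (smulF f u + v) = smulF f (lie a u) + smulF (rho a f) u + lie a v"
proof
  fix as show "lie a (smulF f u + v) as = (smulF f (lie a u) + smulF (rho a f) u + lie a v) as"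
    using assms
  proof (induction as arbitrary: u v p q)
    case Nil then show ?case by (simp add: app D_lin AZ_val)
  next
    case (Cons b as)
    show ?case
    proof (cases "b \<in> G")
      case True
      have IH: "lie a (ctr b (smulF f u + v)) as
          = (smulF f (lie a (ctr b u)) + smulF (rho a f) (ctr b u) + lie a (ctr b v)) as"
        unfolding ctr_simps smulF_simps
        by (rule Cons.IH) (use Cons.prems in \<open>auto intro: AZ_ctr\<close>)
      have "lie a (smulF f u + v) (b # as) = lie a (ctr b (smulF f u + v)) as - (smulF f u + v) (br a b # as)"
        using True by (simp only: lie_Cons if_True)
      also note IH
      also have "(smulF f (lie a (ctr b u)) + smulF (rho a f) (ctr b u) + lie a (ctr b v)) as - (smulF f u + v) (br a b # as)
          = (smulF f (lie a u) + smulF (rho a f) u + lie a v) (b # as)"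
        using True by (simp add: lie_Cons app del: lieF.simps)
      finally show ?thesis .
    next
      case False
      then have "ctr b u as = 0" using AZ_ctr_out[OF Cons.prems(3)] by (simp add: form_apply)
      then show ?thesis using False by (simp add: app)
    qed
  qed
qed

lemma lie_const:
  assumes "a \<in> G" "\<And>as. u as \<in> S" "\<And>as. v as \<in> S"
  shows "lie a (c *\<^sub>R u + v) = c *\<^sub>R lie a u + lie a v"
proof
  fix as show "lie a (c *\<^sub>R u + v) as = (c *\<^sub>R lie a u + lie a v) as"
    using assms
  proof (induction as arbitrary: u v)
    case Nil then show ?case by (simp add: app D_const)
  next
    case (Cons b as)
    have IH: "lie a (ctr b (c *\<^sub>R u + v)) as = (c *\<^sub>R lie a (ctr b u) + lie a (ctr b v)) as"
      unfolding ctr_simps by (rule Cons.IH) (use Cons.prems in \<open>auto simp: ctr_apply\<close>)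
    have "lie a (c *\<^sub>R u + v) (b # as) = (if b \<in> G then lie a (ctr b (c *\<^sub>R u + v)) as - (c *\<^sub>R u + v) (br a b # as) else 0)"
      by (simp only: lie_Cons)
    also note IH
    also have "(if b \<in> G then (c *\<^sub>R lie a (ctr b u) + lie a (ctr b v)) as - (c *\<^sub>R u + v) (br a b # as) else 0)
        = (c *\<^sub>R lie a u + lie a v) (b # as)"
      by (simp add: lie_Cons app scaleR_diff_right del: lieF.simps)
    finally show ?case .
  qed
qed

lemma lie_zero: "a \<in> G \<Longrightarrow> lie a 0 = 0"
  using lie_const[of a 0 0 1] by (simp add: app)

text \<open>For linearity over functions, the anchor term that \<open>br_lin\<close> produces
  cancels the one that \<open>lie_lin\<close> produces.\<close>

lemma lie_AZ: "a \<in> G \<Longrightarrow> w \<in> AZ d \<Longrightarrow> lie a w \<in> AZ d"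
proof -
  assume a: "a \<in> G"
  have "lie a w \<in> AZ d" if "w \<in> AZ d" "d < int n" for w d n
    using that
  proof (induction n arbitrary: w d)
    case 0 then show ?case using lie_zero[OF a] by (simp add: AZ_def)
  next
    case (Suc n)
    note w = Suc.prems(1)
    note v = AZ_val[OF w]
    have cv: "ctr b w as \<in> S" for b as by (simp add: ctr_apply v)
    show ?case
    proof (cases "d < 0")
      case True then show ?thesis using Suc.prems lie_zero[OF a] by (simp add: AZ_def)
    next
      case False
      show ?thesis
      proof (rule AZ_I)
        show "d \<ge> 0" using False by simp
        show "lie a w [] = 0" if "d > 0" using AZ_out[OF w, of "[]"] that D_zero[OF a] by simp
        show "lie a w [] \<in> S" using v D_S a by simp
        show "ctr b (lie a w) = 0" if "b \<notin> G" for b using that by (simp add: ctr_lie)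
        show "ctr b (lie a w) \<in> AZ (d - 1)" if "b \<in> G" for b
          using that Suc.prems a br_G by (simp add: ctr_lie subspace_diff[OF subspace_AZ] AZ_ctr Suc.IH)
        show "ctr (smul f b + b') (lie a w) = smulF f (ctr b (lie a w)) + ctr b' (lie a w)"
          if b: "b \<in> G" "b' \<in> G" "f \<in> C" for b b' f
        proof -
          have G: "smul f b + b' \<in> G" "br a b \<in> G" "br a b' \<in> G" "smul (rho a f) b \<in> G" "rho a f \<in> C"
            using b a by (auto intro: N.S_lin N.S_smul br_G rho_C)
          have "ctr (smul f (br a b) + smul (rho a f) b + br a b') w
              = smulF f (ctr (br a b) w) + (smulF (rho a f) (ctr b w) + ctr (br a b') w)"
          proof -
            have "smul (rho a f) b + br a b' \<in> G" using G by (simp add: N.S_add)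
            then have "ctr (smul f (br a b) + (smul (rho a f) b + br a b')) w
                = smulF f (ctr (br a b) w) + ctr (smul (rho a f) b + br a b') w"
              by (intro AZ_ctr_lin[OF w]) (use G b in auto)
            also have "ctr (smul (rho a f) b + br a b') w = smulF (rho a f) (ctr b w) + ctr (br a b') w"
              by (intro AZ_ctr_lin[OF w]) (use G b in auto)
            finally show ?thesis by (simp add: add.assoc)
          qed
          moreover have "lie a (smulF f (ctr b w) + ctr b' w) = smulF f (lie a (ctr b w)) + smulF (rho a f) (ctr b w) + lie a (ctr b' w)"
            by (rule lie_lin) (use a b w in \<open>auto intro: AZ_ctr\<close>)
          ultimately show ?thesis
            using b G a by (simp add: ctr_lie AZ_ctr_lin[OF w] br_lin)
        qed
        show "ctr b (ctr b (lie a w)) = 0" if b: "b \<in> G" for b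
        proof -
          have "ctr b (ctr (br a b) w) = - ctr (br a b) (ctr b w)"
            by (rule AZ_ctr_ctr[OF w]) (use a b br_G in auto)
          then show ?thesis using b a lie_zero[OF a] AZ_ctr_ctr_same[OF w b] by (simp add: ctr_lie)
        qed
      qed
    qed
  qed
  from this[of w d "nat (d + 1)"] show "w \<in> AZ d \<Longrightarrow> lie a w \<in> AZ d" by linarith
qed

end

lemma smul_minus_left: "smul (\<lambda>x. - f x) s = - smul f s"
  by (simp add: smul_def fun_eq_iff uminus_apply)

context lr_mod
begin

lemma ce_Nil: "ce w [] = 0"
  by (simp add: ce_diff_def)

lemma ce_out: "\<not> set as \<subseteq> G \<Longrightarrow> ce w as = 0"
  by (simp add: ce_diff_def)

lemma lie_out: "\<lbrakk>w \<in> AZ d; a \<in> G; \<not> set as \<subseteq> G\<rbrakk> \<Longrightarrow> lie a w as = 0"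
proof (induction as arbitrary: w d)
  case (Cons b as)
  show ?case
  proof (cases "b \<in> G")
    case True
    then have as: "\<not> set as \<subseteq> G" using Cons.prems by auto
    have "w (br a b # as) = 0"
      using as AF_out[of w "nat d" "br a b # as"] Cons.prems(1) by (cases "d < 0") (auto simp: AZ_def form_apply)
    moreover have "lie a (ctr b w) as = 0" by (rule Cons.IH[OF AZ_ctr[OF Cons.prems(1)] Cons.prems(2) as])
    ultimately show ?thesis by (simp add: lie_Cons del: lieF.simps)
  qed simp
qed simp

lemma AZ_swap: "\<lbrakk>w \<in> AZ d; a \<in> G; b \<in> G\<rbrakk> \<Longrightarrow> w (a # b # as) = - w (b # a # as)"
proof -
  assume w: "w \<in> AZ d" and ab: "a \<in> G" "b \<in> G"
  have "ctr b (ctr a w) as = (- ctr a (ctr b w)) as" by (simp only: AZ_ctr_ctr[OF w ab(2,1)])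
  then show ?thesis by (simp add: app)
qed

lemma nths_Compl_Suc: "nths (a # as) (- {Suc k}) = a # nths as (- {k})"
  "nths (a # as) (- {0}) = as" "nths (a # as) (- {Suc i, Suc k}) = a # nths as (- {i, k})"
  "nths (a # as) (- {0, Suc k}) = nths as (- {k})"
proof -
  have "{j. Suc j \<in> - {Suc k}} = - {k}" "{j. Suc j \<in> - {Suc i, Suc k}} = - {i, k}"
    "{j. Suc j \<in> - {0, Suc k}} = - {k}" by auto
  then show "nths (a # as) (- {Suc k}) = a # nths as (- {k})"
    "nths (a # as) (- {Suc i, Suc k}) = a # nths as (- {i, k})"
    "nths (a # as) (- {0, Suc k}) = nths as (- {k})" by (simp_all add: nths_Cons)
  have "{j. Suc j \<in> - {0}} = UNIV" by auto
  then show "nths (a # as) (- {0}) = as" by (simp add: nths_Cons nths_all)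
qed

lemma lie_explicit:
  assumes "w \<in> AZ d" "a \<in> G" "set as \<subseteq> G"
  shows "lie a w as = D a (w as) - (\<Sum>k<length as. (- 1) ^ k *\<^sub>R w (br a (as ! k) # nths as (- {k})))"
  using assms
proof (induction as arbitrary: w d)
  case (Cons b as)
  have b: "b \<in> G" "set as \<subseteq> G" using Cons.prems by auto
  have "lie a (ctr b w) as = D a (ctr b w as) - (\<Sum>k<length as. (- 1) ^ k *\<^sub>R ctr b w (br a (as ! k) # nths as (- {k})))"
    by (rule Cons.IH[OF AZ_ctr[OF Cons.prems(1)] Cons.prems(2) b(2)])
  also have "\<dots> = D a (w (b # as)) - (\<Sum>k<length as. (- 1) ^ k *\<^sub>R w (b # br a (as ! k) # nths as (- {k})))"
    by (simp add: ctr_apply)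
  finally have IH: "lie a (ctr b w) as = \<dots>" .
  have "(\<Sum>k<length (b # as). (- 1) ^ k *\<^sub>R w (br a ((b # as) ! k) # nths (b # as) (- {k})))
     = w (br a b # as) + (\<Sum>k<length as. - ((- 1) ^ k *\<^sub>R w (br a (as ! k) # b # nths as (- {k}))))"
    by (simp add: sum.lessThan_Suc_shift nths_Compl_Suc del: sum.lessThan_Suc)
  also have "(\<Sum>k<length as. - ((- 1) ^ k *\<^sub>R w (br a (as ! k) # b # nths as (- {k}))))
     = (\<Sum>k<length as. (- 1) ^ k *\<^sub>R w (b # br a (as ! k) # nths as (- {k})))"
  proof (rule sum.cong[OF refl])
    fix k assume "k \<in> {..<length as}"
    then have "br a (as ! k) \<in> G" using br_G[OF Cons.prems(2)] b(2) by (simp add: subset_iff)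
    from AZ_swap[OF Cons.prems(1) this b(1), of "nths as (- {k})"]
    show "- ((- 1) ^ k *\<^sub>R w (br a (as ! k) # b # nths as (- {k}))) = (- 1) ^ k *\<^sub>R w (b # br a (as ! k) # nths as (- {k}))"
      by simp
  qed
  finally show ?case
    using b by (simp add: lie_Cons IH del: lieF.simps)
qed simp

lemma ctr_ce_out: "a \<notin> G \<Longrightarrow> ctr a (ce w) = 0"
  by (simp add: ctr_0_iff ce_diff_def)

text \<open>Cartan's formula. The terms of the Chevalley--Eilenberg sum in which the first argument
  differentiates or enters a bracket make up \<open>lie_explicit\<close>; in all others it is a
  plain argument, brought to the front by \<open>AZ_swap\<close>.\<close>

lemma ctr_ce:
  assumes w: "w \<in> AZ d" and a: "a \<in> G"
  shows "ctr a (ce w) = lie a w - ce (ctr a w)"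
proof
  fix as
  show "ctr a (ce w) as = (lie a w - ce (ctr a w)) as"
  proof (cases "set as \<subseteq> G")
    case False
    then show ?thesis using ce_out lie_out[OF w a] by (simp add: app)
  next
    case True
    let ?n = "length as"
    let ?A = "\<lambda>w as. \<Sum>i<length as. (-1) ^ i *\<^sub>R D (as ! i) (w (nths as (- {i})))"
    let ?B = "\<lambda>w as. \<Sum>k<length as. \<Sum>i<k. (-1) ^ (i + k) *\<^sub>R w (br (as ! i) (as ! k) # nths as (- {i, k}))"
    have ce: "ce v bs = ?A v bs + ?B v bs" if "set bs \<subseteq> G" for v bs using that by (simp add: ce_diff_def)
    have "?A w (a # as) = D a (w as) + (\<Sum>i<?n. - ((-1) ^ i *\<^sub>R D (as ! i) (w (a # nths as (- {i})))))"
      by (simp add: sum.lessThan_Suc_shift nths_Compl_Suc del: sum.lessThan_Suc)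
    then have A: "?A w (a # as) = D a (w as) - ?A (ctr a w) as" by (simp add: ctr_apply sum_negf)
    have "?B w (a # as) = (\<Sum>k<?n. \<Sum>i<Suc k. (-1) ^ (i + Suc k) *\<^sub>R w (br ((a # as) ! i) (as ! k) # nths (a # as) (- {i, Suc k})))"
      by (simp only: length_Cons sum.lessThan_Suc_shift) (simp del: sum.lessThan_Suc)
    also have "\<dots> = (\<Sum>k<?n. - ((-1) ^ k *\<^sub>R w (br a (as ! k) # nths as (- {k})))
        + (\<Sum>i<k. (-1) ^ (i + k) *\<^sub>R w (br (as ! i) (as ! k) # a # nths as (- {i, k}))))"
      by (simp add: sum.lessThan_Suc_shift nths_Compl_Suc del: sum.lessThan_Suc)
    also have "\<dots> = - (\<Sum>k<?n. (-1) ^ k *\<^sub>R w (br a (as ! k) # nths as (- {k}))) - ?B (ctr a w) as"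
    proof -
      have "(\<Sum>i<k. (-1) ^ (i + k) *\<^sub>R w (br (as ! i) (as ! k) # a # nths as (- {i, k})))
          = - (\<Sum>i<k. (-1) ^ (i + k) *\<^sub>R ctr a w (br (as ! i) (as ! k) # nths as (- {i, k})))" if "k < ?n" for k
        unfolding sum_negf[symmetric]
      proof (rule sum.cong[OF refl])
        fix i assume "i \<in> {..<k}"
        then have "br (as ! i) (as ! k) \<in> G" using that True by (intro br_G) (auto simp: subset_iff)
        from AZ_swap[OF w this a, of "nths as (- {i, k})"]
        show "(-1) ^ (i + k) *\<^sub>R w (br (as ! i) (as ! k) # a # nths as (- {i, k}))
          = - ((-1) ^ (i + k) *\<^sub>R ctr a w (br (as ! i) (as ! k) # nths as (- {i, k})))"
          by (simp add: ctr_apply)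
      qed
      then show ?thesis by (simp add: sum.distrib sum_negf sum_subtractf)
    qed
    finally have B: "?B w (a # as) = - (\<Sum>k<?n. (-1) ^ k *\<^sub>R w (br a (as ! k) # nths as (- {k}))) - ?B (ctr a w) as" .
    have "ctr a (ce w) as = ?A w (a # as) + ?B w (a # as)" unfolding ctr_apply by (rule ce) (use True a in simp)
    also have "\<dots> = lie a w as - (?A (ctr a w) as + ?B (ctr a w) as)"
      unfolding A B lie_explicit[OF w a True] by simp
    also have "\<dots> = (lie a w - ce (ctr a w)) as" using ce[OF True] by (simp add: form_apply)
    finally show ?thesis .
  qed
qed

lemma ce_const:
  assumes "\<And>as. u as \<in> S" "\<And>as. v as \<in> S"
  shows "ce (c *\<^sub>R u + v) = c *\<^sub>R ce u + ce v"
proof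
  fix as
  show "ce (c *\<^sub>R u + v) as = (c *\<^sub>R ce u + ce v) as"
  proof (cases "set as \<subseteq> G")
    case True
    have "(\<Sum>i<length as. (-1) ^ i *\<^sub>R D (as ! i) ((c *\<^sub>R u + v) (nths as (- {i}))))
       = (\<Sum>i<length as. c *\<^sub>R ((-1) ^ i *\<^sub>R D (as ! i) (u (nths as (- {i})))) + (-1) ^ i *\<^sub>R D (as ! i) (v (nths as (- {i}))))"
      using True by (intro sum.cong refl) (simp add: form_apply D_const assms subset_iff scaleR_add_right scaleR_left_commute mult.commute)
    then show ?thesis
      using True by (simp add: ce_diff_def form_apply sum.distrib scaleR_add_right scaleR_sum_right mult.commute)
  qed (simp add: ce_diff_def form_apply)
qed

lemma ce_zero: "ce 0 = 0"
  using ce_const[of 0 0 1] by (simp add: form_apply)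

lemma ce_minus: "(\<And>as. u as \<in> S) \<Longrightarrow> ce (- u) = - ce u"
  using ce_const[of u 0 "-1"] ce_zero by (simp add: form_apply)

text \<open>The classical L_(fc) = f L_c + df wedge iota_c, with the last term written as the
  failure of \<open>ce\<close> to commute with \<open>f\<close> on the contraction by c. In this
  shape it combines with Cartan's formula to show that \<open>ce w\<close> is linear over functions
  in \<open>ce_AZ\<close>.\<close>

lemma ce_smulF:
  assumes "w \<in> AZ d" "c \<in> G" "c' \<in> G" "f \<in> C"
  shows "lie (smul f c + c') w = smulF f (lie c w) + lie c' w + (ce (smulF f (ctr c w)) - smulF f (ce (ctr c w)))"
proof
  fix as
  show "lie (smul f c + c') w as = (smulF f (lie c w) + lie c' w + (ce (smulF f (ctr c w)) - smulF f (ce (ctr c w)))) as"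
    using assms(1)
  proof (induction as arbitrary: w d)
    case Nil
    then show ?case using assms by (simp add: app ce_Nil D_left AZ_val)
  next
    case (Cons e as)
    note w = Cons.prems
    have cw: "ctr a w \<in> AZ (d - 1)" "ctr a (ctr b w) \<in> AZ (d - 1 - 1)" for a b
      by (rule AZ_ctr[OF w], rule AZ_ctr[OF AZ_ctr[OF w]])
    show ?case
    proof (cases "e \<in> G")
      case False
      then show ?thesis by (simp add: app ce_out)
    next
      case True
      let ?g = "rho e f"
      have g: "?g \<in> C" using rho_C True assms by simp
      have G: "br c e \<in> G" "br c' e \<in> G" "smul ?g c \<in> G" using assms True br_G g N.S_smul by auto
      have br: "ctr (br (smul f c + c') e) w = smulF f (ctr (br c e) w) - smulF ?g (ctr c w) + ctr (br c' e) w"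
      proof -
        have "br (smul f c + c') e = smul f (br c e) + (smul (\<lambda>x. - ?g x) c + br c' e)"
          using br_lin_left[of e c c' f] assms True by (simp add: smul_minus_left)
        moreover have mg: "(\<lambda>x. - ?g x) \<in> C" using C_mult[OF C_const[of "-1"] g] by simp
        then have "smul (\<lambda>x. - ?g x) c + br c' e \<in> G" using N.S_lin assms G by simp
        ultimately have "ctr (br (smul f c + c') e) w = smulF f (ctr (br c e) w) + ctr (smul (\<lambda>x. - ?g x) c + br c' e) w"
          using AZ_ctr_lin[OF w] G assms by simp
        also have "ctr (smul (\<lambda>x. - ?g x) c + br c' e) w = smulF (\<lambda>x. - ?g x) (ctr c w) + ctr (br c' e) w"
          by (rule AZ_ctr_lin[OF w]) (use G assms mg in auto)
        also have "smulF (\<lambda>x. - ?g x) (ctr c w) = - smulF ?g (ctr c w)"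
          by (rule ext) (simp add: app smul_minus_left)
        finally show ?thesis by simp
      qed
      have anti: "ctr e (ctr c w) = - ctr c (ctr e w)" by (rule AZ_ctr_ctr[OF w True assms(2)])
      have L: "lie e (smulF f (ctr c w)) = smulF f (lie e (ctr c w)) + smulF ?g (ctr c w)"
        using lie_lin[OF True assms(4) cw(1)[of c] AZ_zero] lie_zero[OF True] by simp
      have s: "smulF f (ctr a w) \<in> AZ (d - 1)" for a using AZ_lin[OF cw(1)[of a] AZ_zero assms(4)] by simp
      have v: "smulF f (ctr c (ctr e w)) as \<in> S" "ctr c (ctr e w) as \<in> S" for as
        using AZ_val[OF AZ_lin[OF cw(2) AZ_zero assms(4)]] AZ_val[OF cw(2)] by simp_all
      have m: "ce (- smulF f (ctr c (ctr e w))) = - ce (smulF f (ctr c (ctr e w)))"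
        "ce (- ctr c (ctr e w)) = - ce (ctr c (ctr e w))"
        by (rule ce_minus, rule v)+
      have "ctr e (lie (smul f c + c') w) as = (lie (smul f c + c') (ctr e w) - ctr (br (smul f c + c') e) w) as"
        using True by (simp add: ctr_lie)
      also have "\<dots> = (smulF f (lie c (ctr e w)) + lie c' (ctr e w) + (ce (smulF f (ctr c (ctr e w))) - smulF f (ce (ctr c (ctr e w))))
          - (smulF f (ctr (br c e) w) - smulF ?g (ctr c w) + ctr (br c' e) w)) as"
        unfolding br using Cons.IH[OF cw(1)[of e]] by (simp only: form_apply)
      also have "\<dots> = ctr e (smulF f (lie c w) + lie c' w + (ce (smulF f (ctr c w)) - smulF f (ce (ctr c w)))) as"
        using True by (simp add: ctr_lie ctr_ce[OF s] ctr_ce[OF cw(1)] L anti m smulF_apply form_apply)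
      finally show ?thesis by (simp only: ctr_apply[of e])
    qed
  qed
qed

lemma ce_AZ: "w \<in> AZ d \<Longrightarrow> ce w \<in> AZ (d + 1)"
proof -
  have "ce w \<in> AZ (d + 1)" if "w \<in> AZ d" "d < int n" for w d n
    using that
  proof (induction n arbitrary: w d)
    case 0
    then have "w = 0" by (simp add: AZ_def)
    then show ?case by (simp only: ce_zero AZ_zero)
  next
    case (Suc n)
    note w = Suc.prems(1)
    have cw: "ctr a w \<in> AZ (d - 1)" "ctr a (ctr b w) \<in> AZ (d - 1 - 1)" for a b
      by (rule AZ_ctr[OF w], rule AZ_ctr[OF AZ_ctr[OF w]])
    show ?case
    proof (cases "d < 0")
      case True
      then have "w = 0" using w by (simp add: AZ_def)
      then show ?thesis by (simp only: ce_zero AZ_zero)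
    next
      case False
      show ?thesis
      proof (rule AZ_I)
        show "d + 1 \<ge> 0" using False by simp
        show "ce w [] = 0" by (rule ce_Nil)
        show "ce w [] \<in> S" by (simp add: ce_Nil)
        show "ctr b (ce w) = 0" if "b \<notin> G" for b using that by (rule ctr_ce_out)
        show "ctr b (ce w) \<in> AZ (d + 1 - 1)" if "b \<in> G" for b
          using Suc.IH[OF cw(1)[of b]] Suc.prems(2) lie_AZ[OF that w]
          by (simp add: ctr_ce[OF w that] subspace_diff[OF subspace_AZ])
        show "ctr (smul f b + b') (ce w) = smulF f (ctr b (ce w)) + ctr b' (ce w)"
          if b: "b \<in> G" "b' \<in> G" "f \<in> C" for b b' f
        proof -
          have G: "smul f b + b' \<in> G" using b N.S_lin by simp
          have v: "smulF f (ctr b w) as \<in> S" "ctr b' w as \<in> S" for as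
            using AZ_val[OF AZ_lin[OF cw(1) AZ_zero b(3)]] AZ_val[OF cw(1)] by simp_all
          have "ce (smulF f (ctr b w) + ctr b' w) = ce (smulF f (ctr b w)) + ce (ctr b' w)"
            using ce_const[of "smulF f (ctr b w)" "ctr b' w" 1] v by simp
          then show ?thesis
            unfolding ctr_ce[OF w G] ctr_ce[OF w b(1)] ctr_ce[OF w b(2)] ce_smulF[OF w b] AZ_ctr_lin[OF w b]
            by simp
        qed
        show "ctr b (ctr b (ce w)) = 0" if b: "b \<in> G" for b
        proof -
          have "br b b + br b b = 0" using br_skew[OF b b] by (simp only: eq_neg_iff_add_eq_0)
          then have "2 *\<^sub>R br b b = 0" by (simp only: scaleR_2)
          then have "br b b = 0" by simp
          then have "ctr (br b b) w = 0" using AZ_ctr_lin[OF w, of 0 0 "\<lambda>_. 1"] by simp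
          then show ?thesis
            using b ce_zero by (simp add: ctr_ce[OF w] ctr_lie ctr_ce[OF cw(1)] AZ_ctr_ctr_same[OF w])
        qed
      qed
    qed
  qed
  from this[of w d "nat (d + 1)"] show "w \<in> AZ d \<Longrightarrow> ce w \<in> AZ (d + 1)" by linarith
qed

end

locale lr_mod2 = K: lr_mod C G C br rho rho + E: lr_mod C G S br rho D
  for C :: "('m \<Rightarrow> real) set" and G :: "('m \<Rightarrow> 'v::real_vector) set"
    and S :: "('m \<Rightarrow> 'e::real_vector) set" and br rho and D :: "('m \<Rightarrow> 'v) \<Rightarrow> ('m \<Rightarrow> 'e) \<Rightarrow> 'm \<Rightarrow> 'e"
begin

sublocale W: form_mod2 C C S G ..

lemma Clinear_smulF: "Clinear C C (\<lambda>f. smulF f (w :: ('m, 'v, 'e) form))"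
  by (simp add: Clinear_def smulF_add_left smulF_smulF smul_real)

lemma wedge_AZ:
  assumes "\<omega> \<in> K.AZ p" "w \<in> E.AZ q" shows "wedge \<omega> w \<in> E.AZ (p + q)"
  unfolding wedge_eq by (rule W.wedge_insert_AZ[OF assms(1) Clinear_smulF])
    (use E.AZ_lin[OF assms(2) E.AZ_zero] in simp)

lemma ctr_wedge': "\<omega> \<in> K.AZ p \<Longrightarrow> ctr a (wedge \<omega> w) = wedge (ctr a \<omega>) w + sg p *\<^sub>R wedge \<omega> (ctr a w)"
  by (rule ctr_wedge) (rule K.AZ_out)

lemma lie_wedge:
  assumes "a \<in> G" "\<omega> \<in> K.AZ p" "w \<in> E.AZ q"
  shows "E.lie a (wedge \<omega> w) = wedge (K.lie a \<omega>) w + wedge \<omega> (E.lie a w)"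
proof
  fix as
  show "E.lie a (wedge \<omega> w) as = (wedge (K.lie a \<omega>) w + wedge \<omega> (E.lie a w)) as"
    using assms(2,3)
  proof (induction as arbitrary: \<omega> w p q)
    case Nil
    then show ?case using E.D_lin[OF assms(1), of "w []" 0 "\<omega> []"] E.AZ_val K.AZ_val E.D_zero assms(1)
      by (simp add: form_apply wedge_Nil add.commute)
  next
    case (Cons b as)
    note \<omega> = Cons.prems(1) and w = Cons.prems(2)
    have la: "K.lie a \<omega> \<in> K.AZ p" "E.lie a w \<in> E.AZ q" using K.lie_AZ E.lie_AZ assms(1) \<omega> w by auto
    have "ctr b (E.lie a (wedge \<omega> w)) as = ctr b (wedge (K.lie a \<omega>) w + wedge \<omega> (E.lie a w)) as"
    proof (cases "b \<in> G")
      case True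
      have v: "wedge (ctr b \<omega>) w bs \<in> S" "wedge \<omega> (ctr b w) bs \<in> S" for bs
        using E.AZ_val[OF wedge_AZ[OF K.AZ_ctr[OF \<omega>] w]] E.AZ_val[OF wedge_AZ[OF \<omega> E.AZ_ctr[OF w]]] by auto
      have "E.lie a (ctr b (wedge \<omega> w)) = E.lie a (sg p *\<^sub>R wedge \<omega> (ctr b w) + wedge (ctr b \<omega>) w)"
        unfolding ctr_wedge'[OF \<omega>] by (simp add: add.commute)
      also have "\<dots> = sg p *\<^sub>R E.lie a (wedge \<omega> (ctr b w)) + E.lie a (wedge (ctr b \<omega>) w)"
        by (rule E.lie_const[OF assms(1)]) (use v in auto)
      finally have 1: "E.lie a (ctr b (wedge \<omega> w)) = \<dots>" .
      show ?thesis
        using True Cons.IH[OF \<omega> E.AZ_ctr[OF w], of b] Cons.IH[OF K.AZ_ctr[OF \<omega>] w, of b]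
        unfolding E.ctr_lie 1
        by (simp add: ctr_wedge'[OF \<omega>] ctr_wedge'[OF la(1)] E.ctr_lie K.ctr_lie wedge_diff form_apply
            scaleR_add_right scaleR_diff_right)
    next
      case False
      then show ?thesis using K.AZ_ctr_out[OF \<omega> False] E.AZ_ctr_out[OF la(2) False] E.AZ_ctr_out[OF w False]
        by (simp add: E.ctr_lie ctr_wedge'[OF \<omega>] ctr_wedge'[OF la(1)] K.ctr_lie)
    qed
    then show ?case by (simp only: ctr_apply[of b])
  qed
qed

text \<open>By Cartan's formula the contractions of both sides reduce to the product rule
  \<open>lie_wedge\<close> and to the same identity on fewer arguments.\<close>

lemma ce_wedge:
  assumes "\<omega> \<in> K.AZ p" "w \<in> E.AZ q"
  shows "E.ce (wedge \<omega> w) = wedge (K.ce \<omega>) w + sg p *\<^sub>R wedge \<omega> (E.ce w)"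
proof
  fix as
  show "E.ce (wedge \<omega> w) as = (wedge (K.ce \<omega>) w + sg p *\<^sub>R wedge \<omega> (E.ce w)) as"
    using assms
  proof (induction as arbitrary: \<omega> w p q)
    case Nil
    then show ?case by (simp add: form_apply wedge_Nil K.ce_Nil E.ce_Nil)
  next
    case (Cons b as)
    note \<omega> = Cons.prems(1) and w = Cons.prems(2)
    have la: "K.ce \<omega> \<in> K.AZ (p + 1)" "E.ce w \<in> E.AZ (q + 1)" using K.ce_AZ E.ce_AZ \<omega> w by auto
    have "ctr b (E.ce (wedge \<omega> w)) as = ctr b (wedge (K.ce \<omega>) w + sg p *\<^sub>R wedge \<omega> (E.ce w)) as"
    proof (cases "b \<in> G")
      case True
      have v: "wedge (ctr b \<omega>) w bs \<in> S" "wedge \<omega> (ctr b w) bs \<in> S" for bs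
        using E.AZ_val[OF wedge_AZ[OF K.AZ_ctr[OF \<omega>] w]] E.AZ_val[OF wedge_AZ[OF \<omega> E.AZ_ctr[OF w]]] by auto
      have "E.ce (ctr b (wedge \<omega> w)) = E.ce (sg p *\<^sub>R wedge \<omega> (ctr b w) + wedge (ctr b \<omega>) w)"
        unfolding ctr_wedge'[OF \<omega>] by (simp add: add.commute)
      also have "\<dots> = sg p *\<^sub>R E.ce (wedge \<omega> (ctr b w)) + E.ce (wedge (ctr b \<omega>) w)"
        by (rule E.ce_const) (use v in auto)
      finally have 1: "E.ce (ctr b (wedge \<omega> w)) = \<dots>" .
      show ?thesis
        using True Cons.IH[OF \<omega> E.AZ_ctr[OF w], of b] Cons.IH[OF K.AZ_ctr[OF \<omega>] w, of b]
        unfolding E.ctr_ce[OF wedge_AZ[OF \<omega> w] True] 1 lie_wedge[OF True \<omega> w]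
        by (simp add: ctr_wedge'[OF \<omega>] ctr_wedge'[OF la(1)] E.ctr_ce[OF w] K.ctr_ce[OF \<omega>] wedge_diff form_apply
            scaleR_add_right scaleR_diff_right sg_add sg_diff)
    next
      case False
      then show ?thesis using K.AZ_ctr_out[OF \<omega> False] E.AZ_ctr_out[OF w False] E.ctr_ce_out[OF False] K.ctr_ce_out[OF False]
        by (simp add: ctr_wedge'[OF \<omega>] ctr_wedge'[OF la(1)])
    qed
    then show ?case by (simp only: ctr_apply[of b])
  qed
qed

end

section \<open>Multilinear extension to forms\<close>

lemma insert_forms_lin_right:
  "insert_forms ws (\<lambda>bs. smulF f (\<Phi> bs) + \<Psi> bs) = smulF f (insert_forms ws \<Phi>) + insert_forms ws \<Psi>"
  by (induction ws arbitrary: \<Phi> \<Psi>) (simp_all add: wedge_insert_lin_right)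

lemma insert_forms_cong:
  assumes "\<And>bs. length bs = length ws \<Longrightarrow> set bs \<subseteq> S \<Longrightarrow> \<Phi> bs = \<Psi> bs" "\<And>w as. w \<in> set ws \<Longrightarrow> w as \<in> S"
  shows "insert_forms ws \<Phi> = insert_forms ws \<Psi>"
  using assms
proof (induction ws arbitrary: \<Phi> \<Psi>)
  case (Cons w ws)
  have "insert_forms ws (\<lambda>bs. \<Phi> (b # bs)) = insert_forms ws (\<lambda>bs. \<Psi> (b # bs))" if "b \<in> S" for b
    by (rule Cons.IH) (use Cons.prems that in auto)
  then show ?case using Cons.prems(2) by (auto intro!: wedge_insert_cong)
qed simp

lemma insert_forms_zero_right: "insert_forms ws (\<lambda>bs. 0) = 0"
  by (induction ws) simp_all

lemma insert_forms_Nil_arg: "insert_forms ws \<Phi> [] = \<Phi> (map (\<lambda>w. w []) ws) []"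
  by (induction ws arbitrary: \<Phi>) (simp_all add: wedge_insert_Nil)

lemma cod_wedge_insert:
  "cod (\<lambda>Y. wedge_insert w (\<lambda>b. \<Gamma> b Y)) g e X = wedge_insert w (\<lambda>b. cod (\<Gamma> b) g e X)"
  by (induction X arbitrary: \<Gamma> g e) (simp_all add: wedge_insert_add_right wedge_insert_scale_right)

text \<open>The family is indexed by the number of arguments, so that a single function on lists of
  all lengths results; this is the kind of component that \<open>cod\<close> takes.\<close>

definition insF :: "(nat \<Rightarrow> ('m \<Rightarrow> 'e) list \<Rightarrow> ('m, 'v, 'f::real_vector) form) \<Rightarrow> (int \<times> ('m, 'v, 'e) form) list
    \<Rightarrow> ('m, 'v, 'f) form"
  where "insF \<Phi> X = insert_forms (map snd X) (\<Phi> (length X))"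

lemma insF_Cons: "insF \<Phi> (x # X) = wedge_insert (snd x) (\<lambda>b. insF (\<lambda>k bs. \<Phi> (Suc k) (b # bs)) X)"
  by (simp add: insF_def)

lemma insF_Nil: "insF \<Phi> X [] = \<Phi> (length X) (map (\<lambda>x. snd x []) X) []"
  by (simp add: insF_def insert_forms_Nil_arg comp_def)

context form_mod2
begin

text \<open>Multilinearity over \<open>C\<close> by recursion on the first argument, in step with
  the nesting in \<open>insert_forms\<close>.\<close>

primrec mC :: "nat \<Rightarrow> (('m \<Rightarrow> 'e) list \<Rightarrow> ('m, 'v, 'f) form) \<Rightarrow> int \<Rightarrow> bool" where
  "mC 0 \<Phi> q \<longleftrightarrow> \<Phi> [] \<in> F.AZ q"
| "mC (Suc k) \<Phi> q \<longleftrightarrow> (\<forall>b\<in>S. mC k (\<lambda>bs. \<Phi> (b # bs)) q) \<and>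
     (\<forall>f\<in>C. \<forall>s\<in>S. \<forall>s'\<in>S. \<forall>bs. length bs = k \<longrightarrow> set bs \<subseteq> S \<longrightarrow>
        \<Phi> ((smul f s + s') # bs) = smulF f (\<Phi> (s # bs)) + \<Phi> (s' # bs))"

lemma mC_val: "\<lbrakk>mC k \<Phi> q; length bs = k; set bs \<subseteq> S\<rbrakk> \<Longrightarrow> \<Phi> bs \<in> F.AZ q"
proof (induction k arbitrary: \<Phi> bs)
  case (Suc k)
  then obtain b bs' where bs: "bs = b # bs'" "b \<in> S" "length bs' = k" "set bs' \<subseteq> S" by (cases bs) auto
  have "(\<lambda>bs. \<Phi> (b # bs)) bs' \<in> F.AZ q"
    by (rule Suc.IH) (use Suc.prems(1) bs in auto)
  then show ?case by (simp add: bs)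
qed simp

lemma mC_ctr: "mC k \<Phi> q \<Longrightarrow> mC k (\<lambda>bs. ctr a (\<Phi> bs)) (q - 1)"
  by (induction k arbitrary: \<Phi>) (simp_all add: F.AZ_ctr)

lemma hom_val: "hom E.AZ X \<Longrightarrow> w \<in> set (map snd X) \<Longrightarrow> w as \<in> S"
  using E.AZ_val by (auto simp: hom_def)

lemma Clinear_insF:
  assumes "mC (Suc (length X)) (\<Phi> (Suc (length X))) q" "hom E.AZ X"
  shows "Clinear C S (\<lambda>b. insF (\<lambda>k bs. \<Phi> (Suc k) (b # bs)) X)"
  unfolding Clinear_def insF_def insert_forms_lin_right[symmetric]
  by (intro ballI insert_forms_cong[where S = S]) (use assms(1) hom_val[OF assms(2)] in auto)

lemma insF_AZ:
  assumes "mC (length X) (\<Phi> (length X)) q" "hom E.AZ X"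
  shows "insF \<Phi> X \<in> F.AZ (dg X + q)"
  using assms
proof (induction X arbitrary: \<Phi>)
  case Nil then show ?case by (simp add: insF_def)
next
  case (Cons x X)
  have "wedge_insert (snd x) (\<lambda>b. insF (\<lambda>k bs. \<Phi> (Suc k) (b # bs)) X) \<in> F.AZ (fst x + (dg X + q))"
    by (rule wedge_insert_AZ) (use Cons Clinear_insF in auto)
  then show ?case by (simp add: insF_Cons add.assoc)
qed

lemma Clinear_insF':
  assumes "\<And>k. k \<ge> 1 \<Longrightarrow> mC k (\<Phi> k) q" "hom E.AZ X"
  shows "Clinear C S (\<lambda>b. insF (\<lambda>k bs. \<Phi> (Suc k) (b # bs)) X)"
  by (rule Clinear_insF[where q = q, OF _ assms(2)]) (rule assms(1), simp)

lemma insF_zero_arg':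
  assumes "\<And>k. k \<ge> 1 \<Longrightarrow> mC k (\<Phi> k) q" "hom E.AZ X"
  shows "insF (\<lambda>k bs. \<Phi> (Suc k) (0 # bs)) X = 0"
  by (rule E.M.Clinear_zero[OF Clinear_insF'[where \<Phi> = \<Phi> and q = q]]) (use assms in auto)

lemma mlin_insF:
  assumes "\<And>k. k \<ge> 1 \<Longrightarrow> mC k (\<Phi> k) q"
  shows "mlin E.AZ (insF \<Phi>)"
  unfolding mlin_def
proof (intro allI impI)
  fix X Y d u v c assume h: "hom E.AZ X" "hom E.AZ Y" "u \<in> E.AZ d" "v \<in> E.AZ d"
  show "insF \<Phi> (X @ (d, c *\<^sub>R u + v) # Y) = c *\<^sub>R insF \<Phi> (X @ (d, u) # Y) + insF \<Phi> (X @ (d, v) # Y)"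
    using h assms
  proof (induction X arbitrary: \<Phi>)
    case Nil
    let ?\<Psi> = "\<lambda>b. insF (\<lambda>k bs. \<Phi> (Suc k) (b # bs)) Y"
    have "wedge_insert (smulF (\<lambda>_. c) u + v) ?\<Psi> = smulF (\<lambda>_. c) (wedge_insert u ?\<Psi>) + wedge_insert v ?\<Psi>"
      by (rule wedge_insert_lin_left, rule ClinearD[OF Clinear_insF'[where \<Phi> = \<Phi> and q = q]])
        (use Nil E.AZ_val in auto)
    then show ?case by (simp add: insF_Cons)
  next
    case (Cons x X)
    have "wedge_insert (snd x) (\<lambda>b. insF (\<lambda>k bs. \<Phi> (Suc k) (b # bs)) (X @ (d, c *\<^sub>R u + v) # Y))
      = wedge_insert (snd x) (\<lambda>b. c *\<^sub>R insF (\<lambda>k bs. \<Phi> (Suc k) (b # bs)) (X @ (d, u) # Y)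
          + insF (\<lambda>k bs. \<Phi> (Suc k) (b # bs)) (X @ (d, v) # Y))"
    proof (rule wedge_insert_cong)
      fix as
      have xs: "snd x as \<in> S" using Cons.prems(1) E.AZ_val by auto
      have m: "mC k (\<lambda>bs. \<Phi> (Suc k) (snd x as # bs)) q" for k using Cons.prems(5)[of "Suc k"] xs by simp
      show "insF (\<lambda>k bs. \<Phi> (Suc k) (snd x as # bs)) (X @ (d, c *\<^sub>R u + v) # Y)
        = c *\<^sub>R insF (\<lambda>k bs. \<Phi> (Suc k) (snd x as # bs)) (X @ (d, u) # Y)
          + insF (\<lambda>k bs. \<Phi> (Suc k) (snd x as # bs)) (X @ (d, v) # Y)"
        by (rule Cons.IH) (use Cons.prems m in auto)
    qed
    then show ?case by (simp add: insF_Cons wedge_insert_add_right wedge_insert_scale_right)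
  qed
qed

text \<open>Contraction as a unary component; its coderivation of degree -1 contracts one entry at a
  time.\<close>

definition iop :: "('m \<Rightarrow> 'v) \<Rightarrow> (int \<times> ('m, 'v, 'e) form) list \<Rightarrow> ('m, 'v, 'e) form"
  where "iop a X = (if length X = 1 then ctr a (snd (hd X)) else 0)"

lemma iop_single [simp]: "iop a [x] = ctr a (snd x)"
  by (simp add: iop_def)

lemma unary_iop: "unary (iop a)"
  by (simp add: unary_def iop_def)

lemma closedV_AZ: "closedV E.AZ"
  using E.subspace_AZ by (auto simp: closedV_def subspace_add subspace_scale)

lemma maps_iop: "maps E.AZ (iop a) E.AZ (- 1)"
  unfolding maps_def
proof (intro allI impI)
  fix X assume X: "X \<noteq> []" "hom E.AZ X"
  show "iop a X \<in> E.AZ (dg X + - 1)"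
  proof (cases "length X = 1")
    case True
    then obtain x where "X = [x]" by (auto simp: length_Suc_conv)
    then show ?thesis using X E.AZ_ctr by simp
  qed (simp add: iop_def)
qed

lemma mlin_iop: "mlin E.AZ (iop a)"
  unfolding mlin_def iop_def by auto

text \<open>The contraction hits one of the entries or the form produced by \<Phi>; it reaches the
  latter after passing all entries, which accounts for \<open>sg (dg X)\<close>.\<close>

lemma ctr_insF:
  assumes "\<And>k. k \<ge> 1 \<Longrightarrow> mC k (\<Phi> k) q" "hom E.AZ X"
  shows "ctr a (insF \<Phi> X) = cod (insF \<Phi>) (iop a) (- 1) X + sg (dg X) *\<^sub>R insF (\<lambda>k bs. ctr a (\<Phi> k bs)) X"
  using assms
proof (induction X arbitrary: \<Phi>)
  case Nil then show ?case by (simp add: insF_def)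
next
  case (Cons x X)
  let ?\<Phi> = "\<lambda>b k bs. \<Phi> (Suc k) (b # bs)"
  let ?\<Psi> = "\<lambda>b. insF (?\<Phi> b) X"
  have x: "snd x \<in> E.AZ (fst x)" "hom E.AZ X" using Cons.prems(2) by simp_all
  have c: "ctr a (wedge_insert (snd x) ?\<Psi>) = wedge_insert (ctr a (snd x)) ?\<Psi>
      + sg (fst x) *\<^sub>R wedge_insert (snd x) (\<lambda>b. ctr a (?\<Psi> b))"
    by (rule ctr_wedge_insert)
      (use E.AZ_out[OF x(1)] insF_zero_arg'[where \<Phi> = \<Phi> and q = q, OF Cons.prems(1) x(2)] in auto)
  have "wedge_insert (snd x) (\<lambda>b. ctr a (?\<Psi> b))
     = wedge_insert (snd x) (\<lambda>b. cod (insF (?\<Phi> b)) (iop a) (- 1) X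
         + sg (dg X) *\<^sub>R insF (\<lambda>k bs. ctr a (?\<Phi> b k bs)) X)"
  proof (rule wedge_insert_cong)
    fix as
    have xs: "snd x as \<in> S" using x E.AZ_val by auto
    have m: "mC k (?\<Phi> (snd x as) k) q" for k using Cons.prems(1)[of "Suc k"] xs by simp
    show "ctr a (?\<Psi> (snd x as)) = cod (insF (?\<Phi> (snd x as))) (iop a) (- 1) X
         + sg (dg X) *\<^sub>R insF (\<lambda>k bs. ctr a (?\<Phi> (snd x as) k bs)) X"
      by (rule Cons.IH[OF m x(2)])
  qed
  also have "\<dots> = cod (\<lambda>Y. insF \<Phi> (x # Y)) (iop a) (- 1) X
      + sg (dg X) *\<^sub>R insF (\<lambda>k bs. ctr a (\<Phi> k bs)) (x # X)"
    by (simp add: insF_Cons cod_wedge_insert wedge_insert_add_right wedge_insert_scale_right)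
  finally have I: "wedge_insert (snd x) (\<lambda>b. ctr a (?\<Psi> b)) = \<dots>" .
  have "cod (insF \<Phi>) (iop a) (- 1) (x # X) = insF \<Phi> ((- 1 + fst x, iop a [x]) # X)
      + sg (- 1 * fst x) *\<^sub>R cod (\<lambda>Y. insF \<Phi> (x # Y)) (iop a) (- 1) X"
    by (rule cod_unary_Cons[OF closedV_AZ mlin_insF maps_iop unary_iop x]) (rule Cons.prems(1))
  then show ?case
    unfolding insF_Cons[of \<Phi> x X] c I by (simp add: insF_Cons[of \<Phi>] scaleR_add_right sg_add add.assoc del: cod.simps)
qed

lemma insF_twist:
  assumes "\<And>k. k \<ge> 1 \<Longrightarrow> mC k (\<Phi> k) q" "hom E.AZ X"
  shows "insert_forms (map parity_twist (map snd X)) (\<Phi> (length X)) = sg (dg X) *\<^sub>R insF \<Phi> X"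
  using assms
proof (induction X arbitrary: \<Phi>)
  case Nil then show ?case by (simp add: insF_def)
next
  case (Cons x X)
  let ?\<Phi> = "\<lambda>b k bs. \<Phi> (Suc k) (b # bs)"
  have x: "snd x \<in> E.AZ (fst x)" "hom E.AZ X" using Cons.prems(2) by simp_all
  have tw: "parity_twist (snd x) = smulF (\<lambda>_. sg (fst x)) (snd x) + 0"
  proof
    fix as show "parity_twist (snd x) as = (smulF (\<lambda>_. sg (fst x)) (snd x) + 0) as"
    proof (cases "int (length as) = fst x")
      case True
      then have "(- 1) ^ length as = sg (fst x)" by (metis sg_power)
      then show ?thesis by (simp add: parity_twist_def form_apply)
    next
      case False
      then show ?thesis using E.AZ_out[OF x(1)] by (simp add: parity_twist_def form_apply)
    qed
  qed
  have xs: "snd x as \<in> S" for as using x E.AZ_val by auto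
  have "wedge_insert (parity_twist (snd x)) (\<lambda>b. insF (?\<Phi> b) X) = smulF (\<lambda>_. sg (fst x)) (wedge_insert (snd x) (\<lambda>b. insF (?\<Phi> b) X)) + wedge_insert 0 (\<lambda>b. insF (?\<Phi> b) X)"
    unfolding tw
    by (rule wedge_insert_lin_left, rule ClinearD[OF Clinear_insF'[where \<Phi> = \<Phi> and q = q, OF Cons.prems(1) x(2)]]) (use xs in \<open>auto simp: form_apply\<close>)
  moreover have "wedge_insert (0 :: ('m, 'v, 'e) form) (\<lambda>b. insF (?\<Phi> b) X) = 0"
    using insF_zero_arg'[where \<Phi> = \<Phi> and q = q, OF Cons.prems(1) x(2)] by simp
  moreover have "wedge_insert (parity_twist (snd x)) (\<lambda>b. insert_forms (map parity_twist (map snd X)) (?\<Phi> b (length X)))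
    = wedge_insert (parity_twist (snd x)) (\<lambda>b. sg (dg X) *\<^sub>R insF (?\<Phi> b) X)"
  proof (rule wedge_insert_cong)
    fix as
    have xs: "parity_twist (snd x) as \<in> S" using xs E.M.S_scale by (simp add: parity_twist_def)
    have m: "mC k (?\<Phi> (parity_twist (snd x) as) k) q" for k using Cons.prems(1)[of "Suc k"] xs by simp
    show "insert_forms (map parity_twist (map snd X)) (?\<Phi> (parity_twist (snd x) as) (length X)) = sg (dg X) *\<^sub>R insF (?\<Phi> (parity_twist (snd x) as)) X"
      by (rule Cons.IH[OF m x(2)])
  qed
  ultimately show ?case
    by (simp add: insF_Cons wedge_insert_scale_right sg_add mult.commute)
qed

text \<open>The factor \<omega> leaves its slot by associativity and then passes the entries in
  front of it by graded commutativity.\<close>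

lemma insF_wedge:
  assumes "\<And>k. k \<ge> 1 \<Longrightarrow> mC k (\<Phi> k) q" "hom E.AZ X" "hom E.AZ Y" "u \<in> E.AZ d"
    and \<omega>: "\<And>as. int (length as) \<noteq> p \<Longrightarrow> \<omega> as = 0" "\<And>as. \<omega> as \<in> C"
  shows "insF \<Phi> (X @ (p', wedge \<omega> u) # Y) = sg (p * dg X) *\<^sub>R wedge \<omega> (insF \<Phi> (X @ (d, u) # Y))"
  using assms(1-4)
proof (induction X arbitrary: \<Phi>)
  case Nil
  have "wedge_insert (wedge \<omega> u) (\<lambda>b. insF (\<lambda>k bs. \<Phi> (Suc k) (b # bs)) Y)
    = wedge \<omega> (wedge_insert u (\<lambda>b. insF (\<lambda>k bs. \<Phi> (Suc k) (b # bs)) Y))"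
    by (rule wedge_insert_wedge[OF \<omega> E.AZ_out[OF Nil(4)] E.AZ_val[OF Nil(4)] Clinear_insF'[where \<Phi> = \<Phi> and q = q, OF Nil(1) Nil(3)]]) auto
  then show ?case by (simp add: insF_Cons)
next
  case (Cons x X)
  let ?\<Phi> = "\<lambda>b k bs. \<Phi> (Suc k) (b # bs)"
  have x: "snd x \<in> E.AZ (fst x)" "hom E.AZ X" using Cons.prems(2) by simp_all
  have h: "hom E.AZ (X @ (d, u) # Y)" using x Cons.prems by simp
  have "wedge_insert (snd x) (\<lambda>b. insF (?\<Phi> b) (X @ (p', wedge \<omega> u) # Y))
     = wedge_insert (snd x) (\<lambda>b. sg (p * dg X) *\<^sub>R wedge \<omega> (insF (?\<Phi> b) (X @ (d, u) # Y)))"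
  proof (rule wedge_insert_cong)
    fix as
    have xs: "snd x as \<in> S" using x E.AZ_val by auto
    have m: "mC k (?\<Phi> (snd x as) k) q" for k using Cons.prems(1)[of "Suc k"] xs by simp
    show "insF (?\<Phi> (snd x as)) (X @ (p', wedge \<omega> u) # Y)
        = sg (p * dg X) *\<^sub>R wedge \<omega> (insF (?\<Phi> (snd x as)) (X @ (d, u) # Y))"
      by (rule Cons.IH[OF m x(2) Cons.prems(3,4)])
  qed
  also have "\<dots> = sg (p * dg X) *\<^sub>R (sg (p * fst x) *\<^sub>R wedge \<omega> (wedge_insert (snd x) (\<lambda>b. insF (?\<Phi> b) (X @ (d, u) # Y))))"
    unfolding wedge_insert_scale_right
    by (subst wedge_insert_commute[OF \<omega>(1) E.AZ_out[OF x(1)]]) (use insF_zero_arg'[where \<Phi> = \<Phi> and q = q, OF Cons.prems(1) h] in auto)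
  finally show ?case by (simp add: insF_Cons sg_norm mult.commute)
qed

end

section \<open>Vanishing of operators that commute with contractions\<close>

lemma dg_nonneg: "\<forall>x\<in>set X. fst x \<ge> 0 \<Longrightarrow> dg X \<ge> 0"
  by (induction X) auto

lemma dg_0_nonneg: "\<forall>x\<in>set X. fst x \<ge> 0 \<Longrightarrow> dg X = 0 \<Longrightarrow> \<forall>x\<in>set X. fst x = 0"
proof (induction X)
  case (Cons x X)
  have "dg X \<ge> 0" using Cons.prems by (intro dg_nonneg) simp
  moreover have "fst x \<ge> 0" using Cons.prems(1) by simp
  moreover have "fst x + dg X = 0" using Cons.prems(2) by simp
  ultimately have x: "fst x = 0" "dg X = 0" by linarith+
  have "\<forall>x\<in>set X. fst x = 0"
    by (rule Cons.IH) (use Cons.prems(1) x(2) in simp_all)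
  then show ?case using x(1) by simp
qed simp

context form_mod
begin

sublocale D: form_mod2 C S S G ..

text \<open>Induction on the total degree of the entries: the contractions of \<open>E X\<close> are
  given by \<open>E\<close> on entries of smaller total degree. The value on no arguments vanishes
  for degree reasons unless \<open>e\<close> and all degrees are 0, which is the case covered by
  \<open>b\<close>. Entries of negative degree are zero, and \<open>z\<close> applies.\<close>

lemma contraction_zero:
  assumes z: "zv AZ E" and m: "maps AZ E AZ e" and e: "e \<ge> 0"
    and c: "\<And>a X. \<lbrakk>a \<in> G; hom AZ X; X \<noteq> []\<rbrakk> \<Longrightarrow> ctr a (E X) = sg e *\<^sub>R cod E (D.iop a) (- 1) X"
    and b: "\<And>X. \<lbrakk>e = 0; X \<noteq> []; hom AZ X; (\<forall>x\<in>set X. fst x = 0)\<rbrakk> \<Longrightarrow> E X [] = 0"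
    and X: "hom AZ X" "X \<noteq> []"
  shows "E X = 0"
proof -
  have neg: "E X = 0" if X: "hom AZ X" "x \<in> set X" "fst x < 0" for X x
  proof -
    have "snd x = 0" using X by (auto simp: hom_def AZ_def)
    then show ?thesis using X(1,2) by (intro zvD[OF z]) (auto intro: rev_image_eqI)
  qed
  have "E X = 0" if "hom AZ X" "X \<noteq> []" "\<forall>x\<in>set X. fst x \<ge> 0" "dg X < int n" for X n
    using that
  proof (induction n arbitrary: X)
    case 0
    have "dg X \<ge> 0" by (rule dg_nonneg[OF 0(3)])
    then show ?case using 0 by simp
  next
    case (Suc n)
    have dX: "dg X \<ge> 0" by (rule dg_nonneg[OF Suc.prems(3)])
    have ca: "ctr a (E X) = 0" for a
    proof (cases "a \<in> G")
      case True
      have "cod E (D.iop a) (- 1) X = 0"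
      proof (rule cod_vanish[of AZ, OF _ D.maps_iop Suc.prems(1)])
        fix Z assume Z: "hom AZ Z" "Z \<noteq> []" "dg Z = dg X + - 1"
        show "E Z = 0"
        proof (cases "\<forall>x\<in>set Z. fst x \<ge> 0")
          case True
          show ?thesis by (rule Suc.IH[OF Z(1,2) True]) (use Z(3) Suc.prems(4) in linarith)
        next
          case False
          then obtain x where "x \<in> set Z" "fst x < 0" by auto
          then show ?thesis by (rule neg[OF Z(1)])
        qed
      qed
      then show ?thesis using c[OF True Suc.prems(1,2)] by simp
    next
      case False
      then show ?thesis using AZ_ctr_out m Suc.prems by (auto simp: maps_def)
    qed
    have "E X [] = 0"
    proof (cases "dg X + e = 0")
      case True
      then have d0: "e = 0" "dg X = 0" using dX e by auto
      have "\<forall>x\<in>set X. fst x = 0"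
        by (rule dg_0_nonneg[OF Suc.prems(3) d0(2)])
      then show ?thesis using b d0 Suc.prems by blast
    next
      case False
      have "E X \<in> AZ (dg X + e)" using m Suc.prems by (auto simp: maps_def)
      then show ?thesis by (rule AZ_out) (use False in simp)
    qed
    then have "E X [] = (0 :: ('m, 'v, 'e) form) []" by (simp add: form_apply)
    then show ?case by (rule form_eqI) (simp add: ca)
  qed
  note nn = this
  show ?thesis
  proof (cases "\<forall>x\<in>set X. fst x \<ge> 0")
    case True
    then have "dg X \<ge> 0" by (rule dg_nonneg)
    then have "dg X < int (nat (dg X + 1))" by linarith
    then show ?thesis by (rule nn[OF X True])
  next
    case False
    then obtain x where "x \<in> set X" "fst x < 0" by auto
    then show ?thesis by (rule neg[OF X(1)])
  qed
qed

end

section \<open>The Kapranov operations on forms and their contractions\<close>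

definition qop :: "('g \<Rightarrow> 'b \<Rightarrow> 'b) \<Rightarrow> (nat \<Rightarrow> 'b list \<Rightarrow> 'g list \<Rightarrow> 'b) \<Rightarrow> 'g \<Rightarrow> (int \<times> 'b) list \<Rightarrow> 'b"
  where "qop D R a Y = (if length Y = 1 then D a (snd (hd Y)) else R (length Y) (map snd Y) [a])"

definition unop :: "('a \<Rightarrow> 'b::zero) \<Rightarrow> (int \<times> 'a) list \<Rightarrow> 'b"
  where "unop h X = (if length X = 1 then h (snd (hd X)) else 0)"

lemma unop_single [simp]: "unop h [x] = h (snd x)"
  by (simp add: unop_def)

lemma unary_unop: "unary (unop h)"
  by (simp add: unary_def unop_def)

lemma unop_other: "length X \<noteq> 1 \<Longrightarrow> unop h X = 0"
  by (simp add: unop_def)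

lemma maps_unop:
  assumes "\<And>d. subspace (V d)" "\<And>d w. w \<in> V d \<Longrightarrow> h w \<in> V (d + e)"
  shows "maps V (unop h) V e"
  unfolding maps_def
proof (intro allI impI)
  fix X assume X: "X \<noteq> []" "hom V X"
  show "unop h X \<in> V (dg X + e)"
  proof (cases "length X = 1")
    case True
    then obtain x where "X = [x]" by (auto simp: length_Suc_conv)
    then show ?thesis using X assms(2) by simp
  qed (simp add: unop_def subspace_0[OF assms(1)])
qed

lemma mlin_unop:
  assumes "\<And>d u v c. u \<in> V d \<Longrightarrow> v \<in> V d \<Longrightarrow> h (c *\<^sub>R u + v) = c *\<^sub>R h u + h v"
  shows "mlin V (unop h)"
  unfolding mlin_def unop_def using assms by auto

text \<open>Contracting a component with values in degree 0 leads to degree -1, where only zero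
  lives.\<close>

lemma (in form_mod) mC_cong_ctr2:
  assumes "k \<ge> 1 \<Longrightarrow> D.mC k (\<Phi> k) 0" "length X = k" "k \<ge> 1" "hom AZ X"
  shows "insF (\<lambda>k bs. ctr a (\<Phi> k bs)) X = 0"
proof -
  have "insert_forms (map snd X) (\<lambda>bs. ctr a (\<Phi> k bs)) = insert_forms (map snd X) (\<lambda>bs. 0)"
  proof (rule insert_forms_cong[where S = S])
    fix bs assume "length bs = length (map snd X)" "set bs \<subseteq> S"
    then have "\<Phi> k bs \<in> AZ 0" using D.mC_val[OF assms(1)[OF assms(3)]] assms(2) by simp
    then have "ctr a (\<Phi> k bs) \<in> AZ (0 - 1)" by (rule AZ_ctr)
    then show "ctr a (\<Phi> k bs) = 0" by (simp add: AZ_def)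
  qed (use D.hom_val[OF assms(4)] in auto)
  then show ?thesis using assms(2) by (simp add: insF_def insert_forms_zero_right)
qed

locale kap_forms = lr_mod C G S br rho D
  for C :: "('m \<Rightarrow> real) set" and G :: "('m \<Rightarrow> 'v::real_vector) set"
    and S :: "('m \<Rightarrow> 'e::real_vector) set" and br rho and D :: "('m \<Rightarrow> 'v) \<Rightarrow> ('m \<Rightarrow> 'e) \<Rightarrow> 'm \<Rightarrow> 'e" +
  fixes R :: "nat \<Rightarrow> ('m \<Rightarrow> 'e) list \<Rightarrow> ('m, 'v, 'e) form"
  assumes R_mC: "k \<ge> 1 \<Longrightarrow> D.mC k (R k) 1"
    and R_1: "R (Suc 0) bs = 0"
begin

text \<open>\<open>R\<close> vanishes on one argument, so there only the differential acts. The sign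
  is the product of the parity twists of the entries, collected by
  \<open>insF_twist\<close>.\<close>

definition "lam X = unop ce X + sg (dg X) *\<^sub>R insF R X"

text \<open>The Lie derivative together with the contracted components is the commutator of
  \<open>lam\<close> with the contraction by \<open>a\<close>, see
  \<open>com_iop_lam\<close>.\<close>

definition "hat a X = unop (lie a) X + insF (\<lambda>k bs. ctr a (R k bs)) X"

lemma Rc_mC: "k \<ge> 1 \<Longrightarrow> D.mC k (\<lambda>bs. ctr a (R k bs)) 0"
  using D.mC_ctr[OF R_mC] by simp

lemma insF_single: "\<Phi> (Suc 0) = (\<lambda>_. 0) \<Longrightarrow> insF \<Phi> [x] = 0"
  by (simp add: insF_def)

lemma lam_single: "lam [x] = ce (snd x)"
  using insF_single[of R x, OF ext] by (simp add: lam_def R_1)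

lemma lam_multi: "length X \<noteq> 1 \<Longrightarrow> lam X = sg (dg X) *\<^sub>R insF R X"
  by (simp add: lam_def unop_other)

lemma maps_ce: "maps AZ (unop ce) AZ 1"
  by (rule maps_unop[OF subspace_AZ]) (rule ce_AZ)

lemma maps_lie: "a \<in> G \<Longrightarrow> maps AZ (unop (lie a)) AZ 0"
  by (rule maps_unop[OF subspace_AZ]) (simp add: lie_AZ)

lemma mlin_ce: "mlin AZ (unop ce)"
  by (rule mlin_unop) (intro ce_const AZ_val)

lemma mlin_lie: "a \<in> G \<Longrightarrow> mlin AZ (unop (lie a))"
  by (rule mlin_unop) (intro lie_const AZ_val)

lemma maps_insF:
  assumes "\<And>k. k \<ge> 1 \<Longrightarrow> D.mC k (\<Phi> k) q"
  shows "maps AZ (insF \<Phi>) AZ q"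
  unfolding maps_def
proof (intro allI impI)
  fix X :: "(int \<times> ('m, 'v, 'e) form) list" assume "X \<noteq> []" "hom AZ X"
  then show "insF \<Phi> X \<in> AZ (dg X + q)" by (intro D.insF_AZ assms) (simp_all add: Suc_leI)
qed

lemma maps_sgF:
  assumes "maps AZ f AZ e" shows "maps AZ (\<lambda>X. sg (dg X) *\<^sub>R f X) AZ e"
  using assms subspace_AZ by (auto simp: maps_def subspace_scale)

lemma mlin_sgF:
  assumes "mlin AZ f" shows "mlin AZ (\<lambda>X. sg (dg X) *\<^sub>R f X)"
  unfolding mlin_def by (auto simp: mlinD[OF assms] scaleR_add_right)

lemma maps_lam: "maps AZ lam AZ 1"
  unfolding lam_def
  by (intro maps_add D.closedV_AZ maps_ce maps_sgF maps_insF R_mC)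

lemma mlin_lam: "mlin AZ lam"
  unfolding lam_def
  by (intro mlin_add mlin_ce mlin_sgF) (rule D.mlin_insF, rule R_mC)

lemma maps_hat: "a \<in> G \<Longrightarrow> maps AZ (hat a) AZ 0"
  unfolding hat_def
  by (intro maps_add D.closedV_AZ maps_lie maps_insF Rc_mC)

lemma mlin_hat: "a \<in> G \<Longrightarrow> mlin AZ (hat a)"
  unfolding hat_def
  by (intro mlin_add mlin_lie, assumption) (rule D.mlin_insF, rule Rc_mC)

lemma com_iop: "X \<noteq> [] \<Longrightarrow> com (D.iop a) (- 1) E e X = ctr a (E X) - sg e *\<^sub>R cod E (D.iop a) (- 1) X"
  by (simp add: com_def cod_of_unary[OF D.unary_iop])

lemma com_iop_lam:
  assumes a: "a \<in> G" and X: "hom AZ X" "X \<noteq> []"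
  shows "com (D.iop a) (- 1) lam 1 X = hat a X"
proof -
  have "cod lam (D.iop a) (- 1) X = cod (unop ce) (D.iop a) (- 1) X + cod (\<lambda>Z. sg (dg Z) *\<^sub>R insF R Z) (D.iop a) (- 1) X"
    unfolding lam_def cod_add_f ..
  also have "cod (\<lambda>Z. sg (dg Z) *\<^sub>R insF R Z) (D.iop a) (- 1) X = cod (\<lambda>Z. - sg (dg X) *\<^sub>R insF R Z) (D.iop a) (- 1) X"
    by (rule cod_cong'[where e = "- 1"]) (simp add: sg_diff)
  also have "\<dots> = - sg (dg X) *\<^sub>R cod (insF R) (D.iop a) (- 1) X" by (rule cod_scale_f)
  also have "cod (unop ce) (D.iop a) (- 1) X = ce (D.iop a X)"
    using cod_of_unary[OF unary_unop X(2)] by simp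
  finally have 1: "cod lam (D.iop a) (- 1) X = ce (D.iop a X) - sg (dg X) *\<^sub>R cod (insF R) (D.iop a) (- 1) X" by simp
  have 2: "ctr a (insF R X) = cod (insF R) (D.iop a) (- 1) X + sg (dg X) *\<^sub>R insF (\<lambda>k bs. ctr a (R k bs)) X"
    by (rule D.ctr_insF[OF R_mC X(1)])
  have 3: "ctr a (unop ce X) + ce (D.iop a X) = unop (lie a) X"
  proof (cases "length X = 1")
    case True
    then obtain x where x: "X = [x]" by (auto simp: length_Suc_conv)
    then have "snd x \<in> AZ (fst x)" using X by simp
    from ctr_ce[OF this a] show ?thesis by (simp add: x)
  qed (simp add: unop_def D.iop_def ce_zero)
  have "com (D.iop a) (- 1) lam 1 X = ctr a (lam X) + cod lam (D.iop a) (- 1) X"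
    using com_iop[OF X(2)] by simp
  also have "\<dots> = (ctr a (unop ce X) + ce (D.iop a X)) + insF (\<lambda>k bs. ctr a (R k bs)) X"
    unfolding 1 by (simp add: lam_def 2 scaleR_add_right)
  finally show ?thesis by (simp add: 3 hat_def)
qed

text \<open>On one entry this is Cartan's rule [iota_c, L_a] = iota_[c,a]. The components with
  several arguments have degree 0 and commute with contractions.\<close>

lemma com_iop_hat:
  assumes a: "a \<in> G" "c \<in> G" and X: "hom AZ X" "X \<noteq> []"
  shows "com (D.iop c) (- 1) (hat a) 0 X = D.iop (br c a) X"
proof -
  have "cod (hat a) (D.iop c) (- 1) X = cod (unop (lie a)) (D.iop c) (- 1) X + cod (insF (\<lambda>k bs. ctr a (R k bs))) (D.iop c) (- 1) X"
    unfolding hat_def cod_add_f ..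
  also have "cod (unop (lie a)) (D.iop c) (- 1) X = lie a (D.iop c X)"
    using cod_of_unary[OF unary_unop X(2)] by simp
  finally have 1: "cod (hat a) (D.iop c) (- 1) X = lie a (D.iop c X) + cod (insF (\<lambda>k bs. ctr a (R k bs))) (D.iop c) (- 1) X" .
  have 2: "ctr c (insF (\<lambda>k bs. ctr a (R k bs)) X) = cod (insF (\<lambda>k bs. ctr a (R k bs))) (D.iop c) (- 1) X
      + sg (dg X) *\<^sub>R insF (\<lambda>k bs. ctr c (ctr a (R k bs))) X"
    by (rule D.ctr_insF[OF Rc_mC X(1)])
  have 4: "insF (\<lambda>k bs. ctr c (ctr a (R k bs))) X = 0"
    by (rule mC_cong_ctr2[where k = "length X", OF _ refl _ X(1)]) (use X(2) Rc_mC in \<open>auto simp: Suc_le_eq\<close>)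
  have 3: "ctr c (unop (lie a) X) - lie a (D.iop c X) = D.iop (br c a) X"
  proof (cases "length X = 1")
    case True
    then obtain x where x: "X = [x]" by (auto simp: length_Suc_conv)
    then have "snd x \<in> AZ (fst x)" using X by simp
    then have "ctr (br c a) (snd x) = - ctr (br a c) (snd x)"
      using br_skew[OF a(2,1)] AZ_ctr_minus br_G[OF a] by simp
    then show ?thesis by (simp add: x ctr_lie a)
  qed (simp add: unop_def D.iop_def lie_zero a)
  have "com (D.iop c) (- 1) (hat a) 0 X = ctr c (hat a X) - cod (hat a) (D.iop c) (- 1) X"
    using com_iop[OF X(2)] by simp
  also have "\<dots> = ctr c (unop (lie a) X) - lie a (D.iop c X)"
    unfolding 1 by (simp add: hat_def 2 4)
  finally show ?thesis by (simp add: 3)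
qed

lemma iop_add: "\<lbrakk>a \<in> G; b \<in> G; hom AZ X\<rbrakk> \<Longrightarrow> D.iop (a + b) X = D.iop a X + D.iop b X"
  by (cases X) (auto simp: D.iop_def AZ_ctr_add)

lemma iop_minus: "a \<in> G \<Longrightarrow> hom AZ X \<Longrightarrow> D.iop (- a) X = - D.iop a X"
  by (cases X) (auto simp: D.iop_def AZ_ctr_minus)

lemma hat_Nil_arg: "a \<in> G \<Longrightarrow> hat a X [] = qop D R a (mapv (\<lambda>w. w []) X)"
proof (cases "length X = 1")
  case True
  then obtain x where x: "X = [x]" by (auto simp: length_Suc_conv)
  then show ?thesis using insF_single[of "\<lambda>k bs. ctr a (R k bs)" x, OF ext]
    by (simp add: hat_def qop_def lie_Nil R_1)
next
  case False
  then show ?thesis by (simp add: hat_def unop_def qop_def insF_Nil ctr_apply mapv_def comp_def)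
qed

lemma hom_mapv_Nil: "hom AZ X \<Longrightarrow> \<forall>x\<in>set X. fst x = 0 \<Longrightarrow> hom (V0 S) (mapv (\<lambda>w. w []) X)"
  using AZ_val by (induction X) auto

lemma linear_Nil: "linear (\<lambda>w :: ('m, 'v, 'e) form. w [])"
  by (rule linearI) (simp_all add: form_apply)

lemma qop_minus:
  assumes "a \<in> G" "hom (V0 S) Y" "Y \<noteq> []"
  shows "qop D R (- a) Y = - qop D R a Y"
proof (cases "length Y = 1")
  case True
  then obtain y where y: "Y = [y]" by (auto simp: length_Suc_conv)
  then show ?thesis using assms D_left[of a 0 "snd y" "\<lambda>_. - 1"] D_left[of 0 0 "snd y" "\<lambda>_. 1"]
    by (simp add: qop_def)
next
  case False
  have "R (length Y) (map snd Y) \<in> AZ 1"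
    by (rule D.mC_val[OF R_mC]) (use assms in \<open>auto simp: hom_def Suc_le_eq\<close>)
  then have "ctr (- a) (R (length Y) (map snd Y)) [] = - ctr a (R (length Y) (map snd Y)) []"
    using AZ_ctr_minus[OF _ assms(1)] by (simp add: form_apply)
  then show ?thesis using False by (simp add: qop_def ctr_apply)
qed

lemma zv_com: "\<lbrakk>mlin AZ f; maps AZ f AZ e; mlin AZ g; maps AZ g AZ e'\<rbrakk> \<Longrightarrow> zv AZ (com f e g e')"
  by (rule mlin_zv[OF mlin_com[OF D.closedV_AZ]])

text \<open>The contraction principle in degree 0. Contracting with \<open>d\<close> leaves the
  Jacobi identity for d, c and a; on entries of degree 0 the claim is the assumption
  \<open>ev\<close>.\<close>

lemma hat_com_zero:
  assumes ev: "\<And>Y. hom (V0 S) Y \<Longrightarrow> Y \<noteq> [] \<Longrightarrow> com (qop D R a) 0 (qop D R c) 0 Y = qop D R (br a c) Y"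
    and ac: "a \<in> G" "c \<in> G" and X: "hom AZ X" "X \<noteq> []"
  shows "com (hat a) 0 (hat c) 0 X + hat (br c a) X = 0"
proof (rule contraction_zero[of "\<lambda>X. com (hat a) 0 (hat c) 0 X + hat (br c a) X" 0, OF _ _ _ _ _ X])
  note h = mlin_hat[OF ac(1)] maps_hat[OF ac(1)] mlin_hat[OF ac(2)] maps_hat[OF ac(2)]
  have ca: "br c a \<in> G" using ac br_G by simp
  note h' = mlin_hat[OF ca] maps_hat[OF ca]
  have mc: "maps AZ (com (hat a) 0 (hat c) 0) AZ 0" "mlin AZ (com (hat a) 0 (hat c) 0)"
    using maps_com[OF D.closedV_AZ h(2,4)] mlin_com[OF D.closedV_AZ h] by simp_all
  show "zv AZ (\<lambda>X. com (hat a) 0 (hat c) 0 X + hat (br c a) X)"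
    by (rule mlin_zv[OF mlin_add[OF mc(2) h'(1)]])
  show "maps AZ (\<lambda>X. com (hat a) 0 (hat c) 0 X + hat (br c a) X) AZ 0"
    by (rule maps_add[OF D.closedV_AZ mc(1) h'(2)])
  fix d X assume d: "d \<in> G" and X: "hom AZ X" "X \<noteq> []"
  have dG: "br d a \<in> G" "br d c \<in> G" using ac d br_G by simp_all
  note i = D.mlin_iop[of d] D.maps_iop[of d]
  have A: "com (com (D.iop d) (- 1) (hat a) 0) (- 1) (hat c) 0 X = D.iop (br (br d a) c) X"
  proof -
    have "com (com (D.iop d) (- 1) (hat a) 0) (- 1) (hat c) 0 X = com (D.iop (br d a)) (- 1) (hat c) 0 X"
      by (rule com_cong[OF com_iop_hat[OF ac(1) d] refl _ h(4) X(1)])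
        (use maps_com[OF D.closedV_AZ i(2) h(2)] in simp_all)
    then show ?thesis using com_iop_hat[OF ac(2) dG(1) X] by simp
  qed
  have B: "com (hat a) 0 (com (D.iop d) (- 1) (hat c) 0) (- 1) X = - D.iop (br (br d c) a) X"
  proof -
    have "com (hat a) 0 (com (D.iop d) (- 1) (hat c) 0) (- 1) X = com (hat a) 0 (D.iop (br d c)) (- 1) X"
      by (rule com_cong[OF refl com_iop_hat[OF ac(2) d] h(2) _ X(1)])
        (use maps_com[OF D.closedV_AZ i(2) h(4)] in simp_all)
    also have "\<dots> = - com (D.iop (br d c)) (- 1) (hat a) 0 X"
      by (subst com_skew) simp
    finally show ?thesis using com_iop_hat[OF ac(1) dG(2) X] by simp
  qed
  have "com (D.iop d) (- 1) (\<lambda>X. com (hat a) 0 (hat c) 0 X + hat (br c a) X) 0 X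
     = com (D.iop d) (- 1) (com (hat a) 0 (hat c) 0) 0 X + com (D.iop d) (- 1) (hat (br c a)) 0 X"
    using com_lin_right[OF D.closedV_AZ mc(1) h'(2) i(1) X(1), of "- 1" 1] by simp
  also have "com (D.iop d) (- 1) (com (hat a) 0 (hat c) 0) 0 X
      = com (com (D.iop d) (- 1) (hat a) 0) (- 1) (hat c) 0 X + com (hat a) 0 (com (D.iop d) (- 1) (hat c) 0) (- 1) X"
    using com_Jacobi[OF D.closedV_AZ i h X(1)] by simp
  also have "\<dots> + com (D.iop d) (- 1) (hat (br c a)) 0 X = D.iop (br (br d a) c) X - D.iop (br (br d c) a) X + D.iop (br d (br c a)) X"
    unfolding A B com_iop_hat[OF ca d X] by simp
  also have "D.iop (br d (br c a)) X = D.iop (br (br d c) a) X + D.iop (br c (br d a)) X"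
    unfolding br_jac[OF d ac(2,1)] by (rule iop_add[OF _ _ X(1)]) (use br_G ac dG in auto)
  also have "D.iop (br c (br d a)) X = - D.iop (br (br d a) c) X"
    unfolding br_skew[OF ac(2) dG(1)] by (rule iop_minus[OF _ X(1)]) (use br_G ac dG in auto)
  finally show "ctr d (com (hat a) 0 (hat c) 0 X + hat (br c a) X)
      = sg 0 *\<^sub>R cod (\<lambda>X. com (hat a) 0 (hat c) 0 X + hat (br c a) X) (D.iop d) (- 1) X"
    unfolding com_iop[OF X(2)] by simp
next
  fix X :: "(int \<times> ('m, 'v, 'e) form) list" assume X: "X \<noteq> []" "hom AZ X" "\<forall>x\<in>set X. fst x = 0"
  let ?Y = "mapv (\<lambda>w. w []) X"
  have Y: "hom (V0 S) ?Y" "?Y \<noteq> []" using hom_mapv_Nil X by auto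
  have c: "(cod (hat x) (hat y) 0 X) [] = cod (qop D R x) (qop D R y) 0 ?Y" if "x \<in> G" "y \<in> G" for x y
    by (rule cod_mapv[OF linear_Nil]) (use that hat_Nil_arg in auto)
  have "(com (hat a) 0 (hat c) 0 X + hat (br c a) X) [] = com (qop D R a) 0 (qop D R c) 0 ?Y + qop D R (br c a) ?Y"
    using ac br_G by (simp add: com_def form_apply c hat_Nil_arg)
  also have "\<dots> = 0" unfolding ev[OF Y] br_skew[OF ac(2,1)]
    using qop_minus[OF _ Y] br_G ac by simp
  finally show "(com (hat a) 0 (hat c) 0 X + hat (br c a) X) [] = 0" .
qed simp

text \<open>The operator has degree 1, so only its contractions matter. The one with
  \<open>c\<close> is the sum of the commutator of \<open>hat a\<close> with \<open>hat c\<close>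
  and of \<open>hat (br c a)\<close>, which is zero by \<open>hat_com_zero\<close>.\<close>

lemma hat_lam_zero:
  assumes ev: "\<And>a c Y. \<lbrakk>a \<in> G; c \<in> G; hom (V0 S) Y; Y \<noteq> []\<rbrakk> \<Longrightarrow> com (qop D R a) 0 (qop D R c) 0 Y = qop D R (br a c) Y"
    and a: "a \<in> G" and X: "hom AZ X" "X \<noteq> []"
  shows "com (hat a) 0 lam 1 X = 0"
proof (rule contraction_zero[of "com (hat a) 0 lam 1" 1, OF _ _ _ _ _ X])
  note h = mlin_hat[OF a] maps_hat[OF a] mlin_lam maps_lam
  show "zv AZ (com (hat a) 0 lam 1)" by (rule zv_com[OF h])
  show "maps AZ (com (hat a) 0 lam 1) AZ 1" using maps_com[OF D.closedV_AZ h(2,4)] by simp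
  fix c X assume c: "c \<in> G" and X: "hom AZ X" "X \<noteq> []"
  note i = D.mlin_iop[of c] D.maps_iop[of c]
  have A: "com (com (D.iop c) (- 1) (hat a) 0) (- 1) lam 1 X = hat (br c a) X"
  proof -
    have "com (com (D.iop c) (- 1) (hat a) 0) (- 1) lam 1 X = com (D.iop (br c a)) (- 1) lam 1 X"
      by (rule com_cong[OF com_iop_hat[OF a c] refl _ h(4) X(1)])
        (use maps_com[OF D.closedV_AZ i(2) h(2)] in simp_all)
    then show ?thesis using com_iop_lam[OF br_G[OF c a] X] by simp
  qed
  have B: "com (hat a) 0 (com (D.iop c) (- 1) lam 1) 0 X = com (hat a) 0 (hat c) 0 X"
    by (rule com_cong[OF refl com_iop_lam[OF c] h(2) _ X(1)])
      (use maps_com[OF D.closedV_AZ i(2) h(4)] in simp_all)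
  have "com (D.iop c) (- 1) (com (hat a) 0 lam 1) 1 X
     = com (com (D.iop c) (- 1) (hat a) 0) (- 1) lam 1 X + com (hat a) 0 (com (D.iop c) (- 1) lam 1) 0 X"
    using com_Jacobi[OF D.closedV_AZ i h X(1)] by simp
  also have "\<dots> = com (hat a) 0 (hat c) 0 X + hat (br c a) X" unfolding A B by simp
  also have "\<dots> = 0" by (rule hat_com_zero[OF ev[OF a c] a c X])
  finally show "ctr c (com (hat a) 0 lam 1 X) = sg 1 *\<^sub>R cod (com (hat a) 0 lam 1) (D.iop c) (- 1) X"
    unfolding com_iop[OF X(2)] by (simp add: eq_neg_iff_add_eq_0)
qed simp_all

text \<open>The structure equation is half the graded commutator of \<open>lam\<close> with itself,
  and contracting that commutator with \<open>a\<close> gives twice the commutator of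
  \<open>hat a\<close> with \<open>lam\<close>.\<close>

theorem leibniz:
  assumes ev: "\<And>a c Y. \<lbrakk>a \<in> G; c \<in> G; hom (V0 S) Y; Y \<noteq> []\<rbrakk> \<Longrightarrow> com (qop D R a) 0 (qop D R c) 0 Y = qop D R (br a c) Y"
    and X: "hom AZ X" "X \<noteq> []"
  shows "cod lam lam 1 X = 0"
proof -
  have "com lam 1 lam 1 X = 0"
  proof (rule contraction_zero[of "com lam 1 lam 1" 2, OF _ _ _ _ _ X])
    note h = mlin_lam maps_lam
    show "zv AZ (com lam 1 lam 1)" by (rule zv_com[OF h h])
    show "maps AZ (com lam 1 lam 1) AZ 2" using maps_com[OF D.closedV_AZ h(2,2)] by simp
    fix a X assume a: "a \<in> G" and X: "hom AZ X" "X \<noteq> []"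
    note i = D.mlin_iop[of a] D.maps_iop[of a]
    have A: "com (com (D.iop a) (- 1) lam 1) 0 lam 1 X = com (hat a) 0 lam 1 X"
      by (rule com_cong[OF com_iop_lam[OF a] refl _ h(2) X(1)])
        (use maps_com[OF D.closedV_AZ i(2) h(2)] in simp_all)
    have B: "com lam 1 (com (D.iop a) (- 1) lam 1) 0 X = - com (com (D.iop a) (- 1) lam 1) 0 lam 1 X"
      by (subst com_skew) simp
    have "com (D.iop a) (- 1) (com lam 1 lam 1) 2 X
       = com (com (D.iop a) (- 1) lam 1) 0 lam 1 X - com lam 1 (com (D.iop a) (- 1) lam 1) 0 X"
      using com_Jacobi[OF D.closedV_AZ i h h X(1)] by simp
    also have "\<dots> = com (hat a) 0 lam 1 X + com (hat a) 0 lam 1 X" unfolding B A by simp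
    also have "com (hat a) 0 lam 1 X = 0" by (rule hat_lam_zero[OF _ a X]) (rule ev)
    finally have "com (D.iop a) (- 1) (com lam 1 lam 1) 2 X = 0" by simp
    then show "ctr a (com lam 1 lam 1 X) = sg 2 *\<^sub>R cod (com lam 1 lam 1) (D.iop a) (- 1) X"
      unfolding com_iop[OF X(2)] by simp
  qed simp_all
  then have "cod lam lam 1 X + cod lam lam 1 X = 0" by (simp add: com_def)
  then have "2 *\<^sub>R cod lam lam 1 X = 0" by (simp add: scaleR_2)
  then show ?thesis by simp
qed

end

section \<open>Morphisms with components of degree 0\<close>

locale kap_mor = A: kap_forms C G S br rho D R + B: kap_forms C G S br rho D R'
  for C :: "('m \<Rightarrow> real) set" and G :: "('m \<Rightarrow> 'v::real_vector) set"
    and S :: "('m \<Rightarrow> 'e::real_vector) set" and br rho and D :: "('m \<Rightarrow> 'v) \<Rightarrow> ('m \<Rightarrow> 'e) \<Rightarrow> 'm \<Rightarrow> 'e"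
    and R R' :: "nat \<Rightarrow> ('m \<Rightarrow> 'e) list \<Rightarrow> ('m, 'v, 'e) form" +
  fixes F :: "nat \<Rightarrow> ('m \<Rightarrow> 'e) list \<Rightarrow> ('m, 'v, 'e) form"
  assumes F_mC: "k \<ge> 1 \<Longrightarrow> A.D.mC k (F k) 0"
begin

abbreviation "f \<equiv> insF F"

lemma maps_f: "maps A.AZ f A.AZ 0"
  by (rule A.maps_insF) (rule F_mC)

lemma mlin_f: "mlin A.AZ f"
  by (rule A.D.mlin_insF) (rule F_mC)

lemma ctr_f:
  assumes "hom A.AZ X" "X \<noteq> []"
  shows "ctr a (f X) = cod f (A.D.iop a) (- 1) X"
proof -
  have "insF (\<lambda>k bs. ctr a (F k bs)) X = 0"
    by (rule A.mC_cong_ctr2[where k = "length X", OF _ refl _ assms(1)]) (use assms(2) F_mC in \<open>auto simp: Suc_le_eq\<close>)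
  then show ?thesis using A.D.ctr_insF[where \<Phi> = F and q = 0 and a = a, OF F_mC assms(1)] by simp
qed

lemma FX_cod_iop:
  assumes "mlin A.AZ \<phi>" "hom A.AZ X"
  shows "FX f (cod \<phi> (A.D.iop a) (- 1)) X = cod (FX f \<phi>) (A.D.iop a) (- 1) X"
  by (rule FX_cod_unary[OF A.subspace_AZ mlin_f maps_f A.D.mlin_iop A.D.maps_iop A.D.unary_iop _ assms])
    (simp add: ctr_f)

lemma maps_FX: "maps A.AZ \<phi> A.AZ e \<Longrightarrow> maps A.AZ (FX f \<phi>) A.AZ e"
  unfolding maps_def[of _ "FX f \<phi>"]
  by (intro allI impI FX_mem[OF A.subspace_AZ _ maps_f]) (auto simp: maps_def)

lemma zv_FX: "mlin A.AZ \<phi> \<Longrightarrow> zv A.AZ (FX f \<phi>)"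
  by (rule FX_zv[OF mlin_zv[OF mlin_f] maps_f mlin_zv])

lemma zv_diff: "zv V g \<Longrightarrow> zv V h \<Longrightarrow> zv V (\<lambda>X. g X - h X :: 'z::ab_group_add)"
  by (simp add: zv_def)

text \<open>Each of the two terms fails to commute with the contraction by \<open>c\<close>, and
  both fail by \<open>ctr (br c a) (f X)\<close>. So the difference commutes with contractions;
  \<open>ev\<close> is the case of entries of degree 0.\<close>

lemma hat_zero:
  assumes ev: "\<And>Y. hom (V0 S) Y \<Longrightarrow> Y \<noteq> [] \<Longrightarrow>
      cod (\<lambda>Z. F (length Z) (map snd Z) []) (qop D R a) 0 Y = FX (\<lambda>Z. F (length Z) (map snd Z) []) (qop D R' a) Y"
    and a: "a \<in> G" and X: "hom A.AZ X" "X \<noteq> []"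
  shows "cod f (A.hat a) 0 X - FX f (B.hat a) X = 0"
proof (rule A.contraction_zero[of "\<lambda>X. cod f (A.hat a) 0 X - FX f (B.hat a) X" 0, OF _ _ _ _ _ X])
  note hA = A.mlin_hat[OF a] A.maps_hat[OF a] and hB = B.mlin_hat[OF a] B.maps_hat[OF a]
  show "zv A.AZ (\<lambda>X. cod f (A.hat a) 0 X - FX f (B.hat a) X)"
    by (rule zv_diff[OF mlin_zv[OF mlin_cod[OF A.D.closedV_AZ mlin_f hA]] zv_FX[OF hB(1)]])
  show "maps A.AZ (\<lambda>X. cod f (A.hat a) 0 X - FX f (B.hat a) X) A.AZ 0"
    by (rule maps_diff[OF A.D.closedV_AZ maps_cod[OF A.D.closedV_AZ maps_f hA(2)] maps_FX[OF hB(2)]]) simp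
  fix c X assume c: "c \<in> G" and X: "hom A.AZ X" "X \<noteq> []"
  note i = A.D.mlin_iop[of c] A.D.maps_iop[of c]
  have cf: "ctr c (cod f (A.hat a) 0 X) = cod (cod f (A.D.iop c) (- 1)) (A.hat a) 0 X"
    unfolding cod_linear[OF linear_ctr, symmetric]
    by (rule cod_cong[OF ctr_f refl hA(2) X(1)])
  have 1: "ctr c (cod f (A.hat a) 0 X) - cod (cod f (A.hat a) 0) (A.D.iop c) (- 1) X = ctr (br c a) (f X)"
  proof -
    have "ctr c (cod f (A.hat a) 0 X) - cod (cod f (A.hat a) 0) (A.D.iop c) (- 1) X
        = cod f (com (A.D.iop c) (- 1) (A.hat a) 0) (- 1) X"
      unfolding cf using cod_comm[OF A.D.closedV_AZ mlin_f i hA X(1)] by simp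
    also have "\<dots> = cod f (A.D.iop (br c a)) (- 1) X"
      by (rule cod_cong[OF refl A.com_iop_hat[OF a c] _ X(1)])
        (use maps_com[OF A.D.closedV_AZ i(2) hA(2)] in simp_all)
    also have "\<dots> = ctr (br c a) (f X)" by (rule ctr_f[OF X, symmetric])
    finally show ?thesis .
  qed
  have 2: "ctr c (FX f (B.hat a) X) - cod (FX f (B.hat a)) (A.D.iop c) (- 1) X = ctr (br c a) (f X)"
  proof -
    have "ctr c (FX f (B.hat a) X) - cod (FX f (B.hat a)) (A.D.iop c) (- 1) X
      = FX f (\<lambda>Z. ctr c (B.hat a Z)) X - FX f (cod (B.hat a) (A.D.iop c) (- 1)) X"
      unfolding FX_cod_iop[OF hB(1) X(1)] FX_apply[OF linear_ctr] ..
    also have "\<dots> = FX f (\<lambda>Z. ctr c (B.hat a Z) - cod (B.hat a) (A.D.iop c) (- 1) Z) X"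
      using FX_lin[of f "- 1" "cod (B.hat a) (A.D.iop c) (- 1)" "\<lambda>Z. ctr c (B.hat a Z)" X] by simp
    also have "\<dots> = FX f (A.D.iop (br c a)) X"
    proof (rule FX_cong[OF _ maps_f X(1)])
      fix Z assume Z: "hom A.AZ Z" "Z = [] \<longleftrightarrow> X = []"
      then have Z': "Z \<noteq> []" using X by simp
      show "ctr c (B.hat a Z) - cod (B.hat a) (A.D.iop c) (- 1) Z = A.D.iop (br c a) Z"
        using B.com_iop_hat[OF a c Z(1) Z'] B.com_iop[OF Z', of c "B.hat a" 0] by simp
    qed
    also have "\<dots> = ctr (br c a) (f X)" using FX_unary[OF A.D.unary_iop X(2)] by simp
    finally show ?thesis .
  qed
  show "ctr c (cod f (A.hat a) 0 X - FX f (B.hat a) X)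
      = sg 0 *\<^sub>R cod (\<lambda>X. cod f (A.hat a) 0 X - FX f (B.hat a) X) (A.D.iop c) (- 1) X"
    using 1 2 by (simp add: cod_diff_f algebra_simps)
next
  fix X :: "(int \<times> ('m, 'v, 'e) form) list" assume X: "X \<noteq> []" "hom A.AZ X" "\<forall>x\<in>set X. fst x = 0"
  let ?p = "\<lambda>w :: ('m, 'v, 'e) form. w []"
  let ?Y = "mapv ?p X"
  let ?f = "\<lambda>Z. F (length Z) (map snd Z) []"
  have Y: "hom (V0 S) ?Y" "?Y \<noteq> []" using A.hom_mapv_Nil X by auto
  have f: "f X [] = ?f (mapv ?p X)" for X
    by (simp add: insF_Nil mapv_def comp_def)
  have 1: "(cod f (A.hat a) 0 X) [] = cod ?f (qop D R a) 0 ?Y"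
    by (rule cod_mapv[OF A.linear_Nil]) (rule f, rule A.hat_Nil_arg[OF a])
  have 2: "(FX f (B.hat a) X) [] = FX ?f (qop D R' a) ?Y"
    by (rule FX_mapv[OF A.linear_Nil]) (rule B.hat_Nil_arg[OF a], rule f)
  show "(cod f (A.hat a) 0 X - FX f (B.hat a) X) [] = 0"
    by (simp add: form_apply 1 2 ev[OF Y])
qed simp

text \<open>The difference has degree 1, so only its contractions matter, and they reduce to
  \<open>hat_zero\<close>.\<close>

theorem morphism:
  assumes ev: "\<And>a Y. a \<in> G \<Longrightarrow> hom (V0 S) Y \<Longrightarrow> Y \<noteq> [] \<Longrightarrow>
      cod (\<lambda>Z. F (length Z) (map snd Z) []) (qop D R a) 0 Y = FX (\<lambda>Z. F (length Z) (map snd Z) []) (qop D R' a) Y"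
    and X: "hom A.AZ X" "X \<noteq> []"
  shows "cod f A.lam 1 X = FX f B.lam X"
proof -
  have "cod f A.lam 1 X - FX f B.lam X = 0"
  proof (rule A.contraction_zero[of "\<lambda>X. cod f A.lam 1 X - FX f B.lam X" 1, OF _ _ _ _ _ X])
    note hA = A.mlin_lam A.maps_lam and hB = B.mlin_lam B.maps_lam
    show "zv A.AZ (\<lambda>X. cod f A.lam 1 X - FX f B.lam X)"
      by (rule zv_diff[OF mlin_zv[OF mlin_cod[OF A.D.closedV_AZ mlin_f hA]] zv_FX[OF hB(1)]])
    show "maps A.AZ (\<lambda>X. cod f A.lam 1 X - FX f B.lam X) A.AZ 1"
      by (rule maps_diff[OF A.D.closedV_AZ maps_cod[OF A.D.closedV_AZ maps_f hA(2)] maps_FX[OF hB(2)]]) simp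
    fix a X assume a: "a \<in> G" and X: "hom A.AZ X" "X \<noteq> []"
    note i = A.D.mlin_iop[of a] A.D.maps_iop[of a]
    have cf: "ctr a (cod f A.lam 1 X) = cod (cod f (A.D.iop a) (- 1)) A.lam 1 X"
      unfolding cod_linear[OF linear_ctr, symmetric]
      by (rule cod_cong[OF ctr_f refl hA(2) X(1)])
    have 1: "ctr a (cod f A.lam 1 X) + cod (cod f A.lam 1) (A.D.iop a) (- 1) X = cod f (A.hat a) 0 X"
    proof -
      have "ctr a (cod f A.lam 1 X) + cod (cod f A.lam 1) (A.D.iop a) (- 1) X
          = cod f (com (A.D.iop a) (- 1) A.lam 1) 0 X"
        unfolding cf using cod_comm[OF A.D.closedV_AZ mlin_f i hA X(1)] by simp
      also have "\<dots> = cod f (A.hat a) 0 X"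
        by (rule cod_cong[OF refl A.com_iop_lam[OF a] _ X(1)])
          (use maps_com[OF A.D.closedV_AZ i(2) hA(2)] in simp_all)
      finally show ?thesis .
    qed
    have 2: "ctr a (FX f B.lam X) + cod (FX f B.lam) (A.D.iop a) (- 1) X = FX f (B.hat a) X"
    proof -
      have "ctr a (FX f B.lam X) + cod (FX f B.lam) (A.D.iop a) (- 1) X
        = FX f (\<lambda>Z. ctr a (B.lam Z)) X + FX f (cod B.lam (A.D.iop a) (- 1)) X"
        unfolding FX_cod_iop[OF hB(1) X(1)] FX_apply[OF linear_ctr] ..
      also have "\<dots> = FX f (\<lambda>Z. ctr a (B.lam Z) + cod B.lam (A.D.iop a) (- 1) Z) X"
        by (rule FX_add[symmetric])
      also have "\<dots> = FX f (B.hat a) X"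
      proof (rule FX_cong[OF _ maps_f X(1)])
        fix Z assume Z: "hom A.AZ Z" "Z = [] \<longleftrightarrow> X = []"
        then have Z': "Z \<noteq> []" using X by simp
        show "ctr a (B.lam Z) + cod B.lam (A.D.iop a) (- 1) Z = B.hat a Z"
          using B.com_iop_lam[OF a Z(1) Z'] B.com_iop[OF Z', of a B.lam 1] by simp
      qed
      finally show ?thesis .
    qed
    have "cod f (A.hat a) 0 X - FX f (B.hat a) X = 0"
      by (rule hat_zero[OF _ a X]) (rule ev[OF a])
    then show "ctr a (cod f A.lam 1 X - FX f B.lam X)
        = sg 1 *\<^sub>R cod (\<lambda>X. cod f A.lam 1 X - FX f B.lam X) (A.D.iop a) (- 1) X"
      using 1 2 by (simp add: cod_diff_f algebra_simps)
  qed simp_all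
  then show ?thesis by simp
qed

end

section \<open>The Kapranov operations of a Lie pair\<close>

text \<open>Brings the coderivation into the form used in the recursion of \<open>kap_R\<close>, a
  sum over the tensor factors.\<close>

lemma cod_unary_sum:
  assumes "closedV V" "mlin V f" "maps V g V 0" "unary g" "hom V X"
  shows "cod f g 0 X = (\<Sum>i<length X. f (X[i := (fst (X ! i), g [X ! i])]))"
  using assms(2,5)
proof (induction X arbitrary: f)
  case (Cons x X)
  have x: "snd x \<in> V (fst x)" "hom V X" using Cons.prems by simp_all
  show ?case
    using Cons.IH[OF mlin_Cons[OF Cons.prems(1) x(1)] x(2)]
      cod_unary_Cons[OF assms(1) Cons.prems(1) assms(3,4) x]
    by (simp add: sum.lessThan_Suc_shift del: sum.lessThan_Suc cod.simps)
qed simp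

lemma (in form_mod) mC_I:
  assumes "\<And>bs. length bs = k \<Longrightarrow> set bs \<subseteq> S \<Longrightarrow> \<Phi> bs \<in> AZ q"
    and "\<And>xs ys s s' f. length xs + length ys + 1 = k \<Longrightarrow> set xs \<subseteq> S \<Longrightarrow> set ys \<subseteq> S \<Longrightarrow> s \<in> S \<Longrightarrow> s' \<in> S \<Longrightarrow> f \<in> C
      \<Longrightarrow> \<Phi> (xs @ (smul f s + s') # ys) = smulF f (\<Phi> (xs @ s # ys)) + \<Phi> (xs @ s' # ys)"
  shows "D.mC k \<Phi> q"
  using assms
proof (induction k arbitrary: \<Phi>)
  case (Suc k)
  have "D.mC k (\<lambda>bs. \<Phi> (b # bs)) q" if b: "b \<in> S" for b
  proof (rule Suc.IH)
    fix xs ys s s' f assume h: "length xs + length ys + 1 = k" "set xs \<subseteq> S" "set ys \<subseteq> S" "s \<in> S" "s' \<in> S" "f \<in> C"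
    show "\<Phi> (b # xs @ (smul f s + s') # ys) = smulF f (\<Phi> (b # xs @ s # ys)) + \<Phi> (b # xs @ s' # ys)"
      using Suc.prems(2)[of "b # xs" ys s s' f] h b by simp
  qed (use Suc.prems(1) b in simp)
  moreover have "\<Phi> ((smul f s + s') # bs) = smulF f (\<Phi> (s # bs)) + \<Phi> (s' # bs)"
    if "f \<in> C" "s \<in> S" "s' \<in> S" "length bs = k" "set bs \<subseteq> S" for f s s' bs
    using Suc.prems(2)[of "[]" bs s s' f] that by simp
  ultimately show ?case by simp
qed simp

lemma smul_uminus_left: "smul (- f) s = - smul f s"
  using smul_minus_left[of f s] by (simp add: fun_Compl_def)

definition evn :: "'b list \<Rightarrow> (int \<times> 'b) list" where "evn bs = map (Pair 0) bs"

lemma evn_simps [simp]: "length (evn bs) = length bs" "map snd (evn bs) = bs" "evn (xs @ ys) = evn xs @ evn ys"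
  "evn (b # bs) = (0, b) # evn bs" "evn [] = []" "evn bs = [] \<longleftrightarrow> bs = []" "hom (V0 S) (evn bs) \<longleftrightarrow> set bs \<subseteq> S"
  by (auto simp: evn_def comp_def hom_def)

lemma evn_hom: "hom (V0 S) X \<Longrightarrow> evn (map snd X) = X"
  unfolding evn_def map_map by (rule map_idI) (auto simp: hom_def)

lemma hom_V0_obtain:
  assumes "hom (V0 S) X" obtains bs where "X = evn bs" "set bs \<subseteq> S"
  using that[of "map snd X"] evn_hom[OF assms] assms by (auto simp: hom_def)

text \<open>The algebraic content of a Lie pair with a choice of splitting and connection, on spaces
  of sections; smoothness is dealt with when the locale is instantiated. The equations for
  \<open>R\<close> are evaluated on a single section of A, and \<open>R_out\<close> says that there
  is nothing else.\<close>

locale lie_pair_alg = L: lr_mod C L S br rho nab + A: cmodule C A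
  for C :: "('m \<Rightarrow> real) set" and L :: "('m \<Rightarrow> 'v::real_vector) set"
    and S :: "('m \<Rightarrow> 'e::real_vector) set" and br rho nab and A +
  fixes pr :: "('m \<Rightarrow> 'v) \<Rightarrow> 'm \<Rightarrow> 'e" and jj :: "('m \<Rightarrow> 'e) \<Rightarrow> 'm \<Rightarrow> 'v"
    and D :: "('m \<Rightarrow> 'v) \<Rightarrow> ('m \<Rightarrow> 'e) \<Rightarrow> 'm \<Rightarrow> 'e"
    and R :: "nat \<Rightarrow> ('m \<Rightarrow> 'e) list \<Rightarrow> ('m, 'v, 'e) form"
  assumes A_L: "a \<in> A \<Longrightarrow> a \<in> L"
    and br_A: "a \<in> A \<Longrightarrow> a' \<in> A \<Longrightarrow> br a a' \<in> A"
    and rho_br: "\<lbrakk>x \<in> L; y \<in> L; f \<in> C\<rbrakk> \<Longrightarrow> rho (br x y) f = rho x (rho y f) - rho y (rho x f)"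
    and rho_add: "\<lbrakk>x \<in> L; y \<in> L; f \<in> C\<rbrakk> \<Longrightarrow> rho (x + y) f = rho x f + rho y f"
    and pr_S: "l \<in> L \<Longrightarrow> pr l \<in> S"
    and pr_lin: "\<lbrakk>l \<in> L; l' \<in> L; f \<in> C\<rbrakk> \<Longrightarrow> pr (smul f l + l') = smul f (pr l) + pr l'"
    and pr_A: "l \<in> L \<Longrightarrow> l \<in> A \<longleftrightarrow> pr l = 0"
    and jj_L: "b \<in> S \<Longrightarrow> jj b \<in> L"
    and jj_lin: "\<lbrakk>b \<in> S; b' \<in> S; f \<in> C\<rbrakk> \<Longrightarrow> jj (smul f b + b') = smul f (jj b) + jj b'"
    and pr_jj: "b \<in> S \<Longrightarrow> pr (jj b) = b"
    and bott_pr: "a \<in> A \<Longrightarrow> l \<in> L \<Longrightarrow> D a (pr l) = pr (br a l)"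
    and D_nab: "a \<in> A \<Longrightarrow> b \<in> S \<Longrightarrow> D a b = nab a b"
    and R_out: "(\<And>a. a \<in> A \<Longrightarrow> as \<noteq> [a]) \<Longrightarrow> R k bs as = 0"
    and R_0: "R 0 bs = 0"
    and R_1: "R (Suc 0) bs = 0"
    and R_2: "a \<in> A \<Longrightarrow> R 2 [b, e] [a] = nab a (nab (jj b) e) - nab (jj b) (nab a e) - nab (br a (jj b)) e"
    and R_step: "a \<in> A \<Longrightarrow> k \<ge> 2 \<Longrightarrow> length bs = k \<Longrightarrow> R (Suc k) (b # bs) [a]
      = (\<Sum>i<k. R k (bs[i := nab (jj b) (bs ! i)]) [a])
        - (nab (jj b) (R k bs [a]) - R k bs [br (jj b) a - jj (pr (br (jj b) a))])"
begin

lemma pr_simps: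
  "l \<in> L \<Longrightarrow> l' \<in> L \<Longrightarrow> pr (l + l') = pr l + pr l'"
  "l \<in> L \<Longrightarrow> l' \<in> L \<Longrightarrow> pr (l - l') = pr l - pr l'"
  using pr_lin[of l l' "\<lambda>_. 1"] pr_lin[of l' l "\<lambda>_. - 1"] by simp_all

lemma jj_simps:
  "b \<in> S \<Longrightarrow> b' \<in> S \<Longrightarrow> jj (b + b') = jj b + jj b'"
  "b \<in> S \<Longrightarrow> b' \<in> S \<Longrightarrow> jj (b - b') = jj b - jj b'"
  using jj_lin[of b b' "\<lambda>_. 1"] jj_lin[of b' b "\<lambda>_. - 1"] by simp_all

lemma nab_simps:
  "\<lbrakk>l \<in> L; s \<in> S; s' \<in> S\<rbrakk> \<Longrightarrow> nab l (s + s') = nab l s + nab l s'"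
  "l \<in> L \<Longrightarrow> s \<in> S \<Longrightarrow> nab l (- s) = - nab l s"
  "\<lbrakk>l \<in> L; s \<in> S; f \<in> C\<rbrakk> \<Longrightarrow> nab l (smul f s) = smul f (nab l s) + smul (rho l f) s"
  "\<lbrakk>l \<in> L; l' \<in> L; s \<in> S\<rbrakk> \<Longrightarrow> nab (l + l') s = nab l s + nab l' s"
  "\<lbrakk>l \<in> L; l' \<in> L; s \<in> S\<rbrakk> \<Longrightarrow> nab (l - l') s = nab l s - nab l' s"
  "\<lbrakk>l \<in> L; s \<in> S; f \<in> C\<rbrakk> \<Longrightarrow> nab (smul f l) s = smul f (nab l s)"
proof -
  show "\<lbrakk>l \<in> L; s \<in> S; s' \<in> S\<rbrakk> \<Longrightarrow> nab l (s + s') = nab l s + nab l s'"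
    using L.D_const[of l s s' 1] by simp
  show "l \<in> L \<Longrightarrow> s \<in> S \<Longrightarrow> nab l (- s) = - nab l s"
    using L.D_const[of l s 0 "- 1"] L.D_zero by simp
  show "\<lbrakk>l \<in> L; s \<in> S; f \<in> C\<rbrakk> \<Longrightarrow> nab l (smul f s) = smul f (nab l s) + smul (rho l f) s"
    using L.D_lin[of l s 0 f] L.D_zero by simp
  show "\<lbrakk>l \<in> L; l' \<in> L; s \<in> S\<rbrakk> \<Longrightarrow> nab (l + l') s = nab l s + nab l' s"
    using L.D_left[of l l' s "\<lambda>_. 1"] by simp
  show "\<lbrakk>l \<in> L; l' \<in> L; s \<in> S\<rbrakk> \<Longrightarrow> nab (l - l') s = nab l s - nab l' s"
    using L.D_left[of l' l s "\<lambda>_. - 1"] by simp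
  have "nab 0 s = 0" if "s \<in> S" for s
    using L.D_left[of 0 0 s "\<lambda>_. 1"] that by simp
  then show "\<lbrakk>l \<in> L; s \<in> S; f \<in> C\<rbrakk> \<Longrightarrow> nab (smul f l) s = smul f (nab l s)"
    using L.D_left[of l 0 s f] by simp
qed

sublocale AA: lr_mod C A S br rho D
proof unfold_locales
  show "br a b \<in> A" if "a \<in> A" "b \<in> A" for a b using br_A that .
  show "br a b = - br b a" if "a \<in> A" "b \<in> A" for a b using L.br_skew that A_L by blast
  show "br a (br b c) = br (br a b) c + br b (br a c)" if "a \<in> A" "b \<in> A" "c \<in> A" for a b c
    using L.br_jac that A_L by blast
  show "br a (smul f b + c) = smul f (br a b) + smul (rho a f) b + br a c" if "a \<in> A" "b \<in> A" "c \<in> A" "f \<in> C" for a b c f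
    using L.br_lin that A_L by blast
  show "rho a f \<in> C" if "a \<in> A" "f \<in> C" for a f using L.rho_C that A_L by blast
  show "D a s \<in> S" if "a \<in> A" "s \<in> S" for a s using L.D_S that A_L D_nab by simp
  show "D a (smul f s + t) = smul f (D a s) + smul (rho a f) s + D a t" if "a \<in> A" "s \<in> S" "t \<in> S" "f \<in> C" for a s t f
    using L.D_lin[of a s t f] that A_L D_nab L.M.S_lin by simp
  show "D a (c *\<^sub>R s + t) = c *\<^sub>R D a s + D a t" if "a \<in> A" "s \<in> S" "t \<in> S" for a s t c
    using L.D_const[of a s t c] that A_L D_nab L.M.S_lin[of "\<lambda>_. c" s t] by simp
  show "D (smul f a + b) s = smul f (D a s) + D b s" if "a \<in> A" "b \<in> A" "s \<in> S" "f \<in> C" for a b s f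
    using L.D_left[of a b s f] that A_L D_nab A.S_lin by simp
qed

definition "cc b a = br (jj b) a - jj (pr (br (jj b) a))"
definition "nb b = unop (\<lambda>e. - nab (jj b) e)"
definition "qt k a Y = (if length Y \<le> k then qop D R a Y else 0)"
abbreviation "q \<equiv> qop D R"

lemma subS: "subspace S" by (rule L.M.subspace_S)
lemma cV: "closedV (V0 S)" by (rule closedV_V0[OF subS])

lemma brj_L: "b \<in> S \<Longrightarrow> a \<in> A \<Longrightarrow> br (jj b) a \<in> L"
  by (intro L.br_G jj_L A_L)

lemma cc_A: "b \<in> S \<Longrightarrow> a \<in> A \<Longrightarrow> cc b a \<in> A"
  using brj_L[of b a] pr_S pr_jj jj_L L.N.S_diff pr_simps(2)
  by (subst pr_A) (simp_all add: cc_def)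

lemma br_dec: "a \<in> A \<Longrightarrow> b \<in> S \<Longrightarrow> br a (jj b) = jj (D a b) - cc b a"
proof -
  assume h: "a \<in> A" "b \<in> S"
  have s: "br a (jj b) = - br (jj b) a" using L.br_skew h A_L jj_L by blast
  have "D a b = pr (br a (jj b))" using bott_pr[OF h(1) jj_L[OF h(2)]] pr_jj[OF h(2)] by simp
  also have "\<dots> = - pr (br (jj b) a)"
    using pr_simps(2)[of 0 "br (jj b) a"] brj_L[OF h(2,1)] pr_simps(1)[of 0 0] by (simp add: s)
  finally have "jj (D a b) = - jj (pr (br (jj b) a))"
    using jj_simps(2)[of 0 "pr (br (jj b) a)"] jj_simps(1)[of 0 0] pr_S[OF brj_L[OF h(2,1)]] by simp
  then show ?thesis by (simp add: s cc_def)
qed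

text \<open>The anchor term of the bracket is a multiple of a section of A, on which
  \<open>pr\<close> vanishes; it survives the projection to A.\<close>

lemma cc_lin_right:
  assumes "b \<in> S" "a \<in> A" "a' \<in> A" "f \<in> C"
  shows "cc b (smul f a + a') = smul f (cc b a) + (smul (rho (jj b) f) a + cc b a')"
proof -
  note L = jj_L[OF assms(1)] A_L[OF assms(2)] A_L[OF assms(3)] brj_L[OF assms(1,2)] brj_L[OF assms(1,3)]
  have r: "rho (jj b) f \<in> C" using L.rho_C L assms by blast
  have b: "br (jj b) (smul f a + a') = smul f (br (jj b) a) + (smul (rho (jj b) f) a + br (jj b) a')"
    using L.br_lin[OF L(1,2,3) assms(4)] by (simp add: add.assoc)
  have "pr a = 0" using pr_A[OF L(2)] assms(2) by blast
  then have p: "pr (br (jj b) (smul f a + a')) = smul f (pr (br (jj b) a)) + pr (br (jj b) a')"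
    unfolding b using L L.N.S_lin r assms(4) by (simp add: pr_lin)
  show ?thesis unfolding cc_def p unfolding b
    using jj_lin[OF pr_S[OF L(4)] pr_S[OF L(5)] assms(4)] by simp
qed

text \<open>The anchor term of the bracket is a multiple of \<open>jj u\<close>, which the
  projection to A removes.\<close>

lemma cc_lin_left:
  assumes "u \<in> S" "v \<in> S" "a \<in> A" "f \<in> C"
  shows "cc (smul f u + v) a = smul f (cc u a) + cc v a"
proof -
  note L = jj_L[OF assms(1)] jj_L[OF assms(2)] A_L[OF assms(3)] brj_L[OF assms(1,3)] brj_L[OF assms(2,3)]
  have r: "rho a f \<in> C" using L.rho_C L assms by blast
  have b: "br (jj (smul f u + v)) a = smul f (br (jj u) a) + (smul (- rho a f) (jj u) + br (jj v) a)"
    unfolding jj_lin[OF assms(1,2,4)] L.br_lin_left[OF L(3,1,2) assms(4)]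
    by (simp add: smul_uminus_left)
  have r': "- rho a f \<in> C" using L.C_mult[OF L.C_const[of "- 1"] r] by (simp add: fun_Compl_def)
  have p: "pr (br (jj (smul f u + v)) a) = smul f (pr (br (jj u) a)) + (smul (- rho a f) u + pr (br (jj v) a))"
    unfolding b using L L.N.S_lin r' assms by (simp add: pr_lin pr_jj)
  have "jj (pr (br (jj (smul f u + v)) a)) = smul f (jj (pr (br (jj u) a))) + (smul (- rho a f) (jj u) + jj (pr (br (jj v) a)))"
    unfolding p using pr_S[OF L(4)] pr_S[OF L(5)] assms r' L.M.S_lin by (simp add: jj_lin)
  then show ?thesis unfolding cc_def by (simp add: b)
qed

lemma nb_single: "nb b [x] = - nab (jj b) (snd x)" by (simp add: nb_def)
lemma nb_other: "length X \<noteq> 1 \<Longrightarrow> nb b X = 0" by (simp add: nb_def unop_def)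
lemma unary_nb: "unary (nb b)" unfolding nb_def by (rule unary_unop)

lemma single_cases: "length X = 1 \<Longrightarrow> hom (V0 S) X \<Longrightarrow> \<exists>e\<in>S. X = [(0, e)]"
  by (cases X) auto

lemma nb_S: "b \<in> S \<Longrightarrow> hom (V0 S) X \<Longrightarrow> nb b X \<in> S"
proof (cases "length X = 1")
  case True
  assume h: "b \<in> S" "hom (V0 S) X"
  obtain e where "e \<in> S" "X = [(0, e)]" using single_cases[OF True h(2)] by blast
  then show ?thesis using L.D_S[OF jj_L[OF h(1)]] L.M.S_minus by (simp add: nb_single)
qed (simp add: nb_other)

lemma maps_nb: "b \<in> S \<Longrightarrow> maps (V0 S) (nb b) (V0 S) 0"
  by (simp add: maps_V0_iff nb_S)

lemma mlin_nb: "b \<in> S \<Longrightarrow> mlin (V0 S) (nb b)"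
  unfolding nb_def by (rule mlin_unop) (simp add: L.D_const[OF jj_L])

lemma nb_lin:
  assumes "u \<in> S" "v \<in> S" "f \<in> C" "hom (V0 S) X"
  shows "nb (smul f u + v) X = smul f (nb u X) + nb v X"
proof (cases "length X = 1")
  case True
  obtain e where "e \<in> S" "X = [(0, e)]" using single_cases[OF True assms(4)] by blast
  then show ?thesis using assms jj_L by (simp add: nb_single jj_lin L.D_left)
qed (simp add: nb_other)

lemma nb_smul: "\<lbrakk>b \<in> S; e \<in> S; f \<in> C\<rbrakk> \<Longrightarrow> nb b [(0, smul f e)] = smul f (nb b [(0, e)]) + smul (- rho (jj b) f) e"
  by (simp add: nb_single nab_simps jj_L smul_uminus_left)

lemma C_minus: "f \<in> C \<Longrightarrow> - f \<in> C"
  using L.C_mult[OF L.C_const[of "- 1"]] by (force simp: fun_Compl_def)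

lemma q_single: "q a [(0, e)] = D a e" by (simp add: qop_def)

lemma qt_eq: "length X \<le> k \<Longrightarrow> qt k a X = q a X" by (simp add: qt_def)

text \<open>What the induction carries along. Linearity over functions in the entries starts at two
  arguments, because on one argument \<open>q a\<close> is the derivation
  \<open>D a\<close>.\<close>

definition good :: "nat \<Rightarrow> bool" where
  "good k \<longleftrightarrow> (\<forall>a\<in>A. mlin (V0 S) (qt k a)) \<and> (\<forall>a\<in>A. Clin smul S C {2..k} (q a)) \<and>
     (\<forall>a\<in>A. \<forall>X. hom (V0 S) X \<longrightarrow> X \<noteq> [] \<longrightarrow> length X \<le> k \<longrightarrow> q a X \<in> S) \<and>
     (\<forall>a\<in>A. \<forall>a'\<in>A. \<forall>f\<in>C. \<forall>X. hom (V0 S) X \<longrightarrow> X \<noteq> [] \<longrightarrow> length X \<le> k \<longrightarrow>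
        q (smul f a + a') X = smul f (q a X) + q a' X)"

lemma goodD:
  assumes "good k"
  shows "a \<in> A \<Longrightarrow> mlin (V0 S) (qt k a)" "a \<in> A \<Longrightarrow> Clin smul S C {2..k} (q a)"
    "\<lbrakk>a \<in> A; hom (V0 S) X; X \<noteq> []; length X \<le> k\<rbrakk> \<Longrightarrow> q a X \<in> S"
    "a \<in> A \<Longrightarrow> a' \<in> A \<Longrightarrow> f \<in> C \<Longrightarrow> hom (V0 S) X \<Longrightarrow> X \<noteq> [] \<Longrightarrow> length X \<le> k \<Longrightarrow>
        q (smul f a + a') X = smul f (q a X) + q a' X"
  using assms unfolding good_def by simp_all

lemma maps_qt: "good k \<Longrightarrow> a \<in> A \<Longrightarrow> maps (V0 S) (qt k a) (V0 S) 0"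
  unfolding maps_V0_iff qt_def using goodD(3) by (simp add: L.M.S_zero)

definition "H k a b X = nb (D a b) X + qt k (cc b a) X - cod (qt k a) (nb b) 0 X + nb b [(0, qt k a X)]"

lemma nab_curv_smul:
  assumes "a \<in> L" "l \<in> L" "e \<in> S" "f \<in> C"
  shows "nab a (nab l (smul f e)) - nab l (nab a (smul f e)) - nab (br a l) (smul f e)
    = smul f (nab a (nab l e) - nab l (nab a e) - nab (br a l) e)"
  using assms L.D_S L.rho_C L.br_G L.M.S_smul
  by (simp add: nab_simps rho_br) (simp add: smul_def fun_eq_iff minus_apply plus_fun_apply algebra_simps)

text \<open>One recursion serves all arities if \<open>D a\<close> counts as the component with one
  argument. For a single entry in \<open>X\<close> it is the definition of the Atiyah cocycle after
  \<open>br_dec\<close>; for more entries the term \<open>nb (D a b) X\<close> vanishes, because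
  \<open>nb\<close> is unary, and \<open>R_step\<close> remains.\<close>

lemma rec:
  assumes k: "k \<ge> 1" "good k" and X: "length X = k" "hom (V0 S) X" and a: "a \<in> A" and b: "b \<in> S"
  shows "q a ((0, b) # X) = H k a b X"
proof (cases "k = 1")
  case True
  obtain e where e: "e \<in> S" "X = [(0, e)]" using single_cases X True by blast
  note h = jj_L[OF b] A_L[OF a] L.D_S AA.D_S[OF a b] L.D_S[OF jj_L[OF b] e(1)]
  have "q a ((0, b) # X) = nab a (nab (jj b) e) - nab (jj b) (nab a e) - nab (br a (jj b)) e"
    using R_2[OF a, of b e] by (simp add: qop_def e numeral_2_eq_2)
  also have "nab (br a (jj b)) e = nab (jj (D a b)) e - nab (cc b a) e"
    unfolding br_dec[OF a b] by (rule nab_simps(5)) (use h jj_L A_L cc_A a b e in auto)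
  also have "nab a (nab (jj b) e) = - D a (- nab (jj b) e)"
    using D_nab[OF a] nab_simps(2)[OF h(2,5)] h(5) L.M.S_minus by simp
  finally show ?thesis unfolding H_def using e D_nab[OF a e(1)] D_nab[OF cc_A[OF b a] e(1)]
    by (simp add: nb_single qt_eq True q_single algebra_simps)
next
  case False
  then have k2: "k \<ge> 2" using k by simp
  obtain bs where bs: "X = evn bs" "set bs \<subseteq> S" using hom_V0_obtain[OF X(2)] by blast
  have l: "length bs = k" using X bs by simp
  have nbe: "nb b = (\<lambda>Y. (- 1) *\<^sub>R unop (nab (jj b)) Y)" by (simp add: nb_def unop_def fun_eq_iff[where 'a = "(int \<times> ('m \<Rightarrow> 'e)) list"])
  have mp: "maps (V0 S) (unop (nab (jj b))) (V0 S) 0"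
    unfolding maps_V0_iff
  proof (intro allI impI)
    fix X assume X: "X \<noteq> []" "hom (V0 S) X"
    have "unop (nab (jj b)) X = - nb b X" by (simp add: nbe)
    then show "unop (nab (jj b)) X \<in> S" using nb_S[OF b X(2)] L.M.S_minus by simp
  qed
  have "cod (qt k a) (nb b) 0 X = (- 1) *\<^sub>R cod (qt k a) (unop (nab (jj b))) 0 X"
    unfolding nbe by (rule cod_scale_g[OF cV goodD(1)[OF k(2) a] mp X(2)])
  also have "cod (qt k a) (unop (nab (jj b))) 0 X
      = (\<Sum>i<length X. qt k a (X[i := (fst (X ! i), unop (nab (jj b)) [X ! i])]))"
    by (rule cod_unary_sum[OF cV goodD(1)[OF k(2) a] mp unary_unop X(2)])
  also have "\<dots> = (\<Sum>i<k. R k (bs[i := nab (jj b) (bs ! i)]) [a])"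
    by (rule sum.cong) (use l k2 in \<open>simp_all add: bs qt_def qop_def map_update evn_def comp_def\<close>)
  finally have 1: "cod (qt k a) (nb b) 0 X = - (\<Sum>i<k. R k (bs[i := nab (jj b) (bs ! i)]) [a])" by simp
  have "q a ((0, b) # X) = R (Suc k) (b # bs) [a]" using k2 l by (simp add: qop_def bs)
  also have "\<dots> = (\<Sum>i<k. R k (bs[i := nab (jj b) (bs ! i)]) [a]) - (nab (jj b) (R k bs [a]) - R k bs [cc b a])"
    unfolding cc_def by (rule R_step[OF a k2 l])
  also have "R k bs [a] = qt k a X" using k2 l by (simp add: qt_def qop_def bs)
  also have "R k bs [cc b a] = qt k (cc b a) X" using k2 l by (simp add: qt_def qop_def bs)
  finally show ?thesis unfolding H_def 1 using X k2 by (simp add: nb_single nb_other)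
qed

lemma cod_qt_smul:
  assumes k: "k \<ge> 1" "good k" and X: "length X = k" "hom (V0 S) X" and a: "a \<in> A" and u: "u \<in> S" and f: "f \<in> C"
  shows "cod (qt k a) (\<lambda>Y. smul f (nb u Y)) 0 X = smul f (cod (qt k a) (nb u) 0 X) + smul (rho a f) (nb u X)"
proof (cases "k = 1")
  case True
  obtain e where e: "e \<in> S" "X = [(0, e)]" using single_cases X True by blast
  have n: "nb u [(0, e)] \<in> S" using nb_S[OF u, of X] X e by simp
  show ?thesis using AA.D_lin[OF a n L.M.S_zero f] AA.D_zero[OF a] by (simp add: e True qt_eq q_single)
next
  case False
  have "Clin smul S C {length X} (qt k a)"
    unfolding Clin_def
  proof (intro allI impI)
    fix r Y Y' assume h: "r \<in> C" "slot smul S r Y Y'" "length Y \<in> {length X}"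
    have "length Y' = length Y" using slot_length[OF h(2)] by simp
    then show "qt k a Y' = smul r (qt k a Y)"
      using ClinD[OF goodD(2)[OF k(2) a] h(1,2)] h(3) X(1) False k(1) by (simp add: qt_eq)
  qed
  from cod_act_unary[OF subS linear_smul L.M.S_smul unary_nb maps_nb[OF u] f goodD(1)[OF k(2) a] this X(2)]
  show ?thesis using nb_other[of X u] X False by simp
qed

text \<open>For k = 1 a term with \<open>rho a f\<close> arises twice, from differentiating the
  coefficient of \<open>u\<close> in \<open>nb (D a (smul f u + v))\<close> and from the
  \<open>cod\<close> term, with opposite signs. For larger k it is zero.\<close>

lemma H_head:
  assumes k: "k \<ge> 1" "good k" and X: "length X = k" "hom (V0 S) X" and a: "a \<in> A" and uv: "u \<in> S" "v \<in> S" and f: "f \<in> C"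
  shows "H k a (smul f u + v) X = smul f (H k a u X) + H k a v X"
proof -
  have Xn: "X \<noteq> []" using X k by auto
  have Y: "hom (V0 S) [(0, qt k a X)]" using goodD(3)[OF k(2) a X(2) Xn] X by (simp add: qt_eq)
  have r: "rho a f \<in> C" using L.rho_C[OF A_L[OF a] f] .
  have 1: "nb (D a (smul f u + v)) X = smul f (nb (D a u) X) + (smul (rho a f) (nb u X) + nb (D a v) X)"
  proof -
    have "D a (smul f u + v) = smul f (D a u) + (smul (rho a f) u + D a v)"
      using AA.D_lin[OF a uv f] by (simp add: add.assoc)
    then show ?thesis using AA.D_S[OF a] uv f r X(2) L.M.S_lin by (simp add: nb_lin)
  qed
  have 2: "qt k (cc (smul f u + v) a) X = smul f (qt k (cc u a) X) + qt k (cc v a) X"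
    unfolding cc_lin_left[OF uv a f] using goodD(4)[OF k(2) cc_A[OF uv(1) a] cc_A[OF uv(2) a] f X(2) Xn] X by (simp add: qt_eq)
  have m: "maps (V0 S) (\<lambda>Y. smul f (nb u Y)) (V0 S) 0"
    unfolding maps_V0_iff using nb_S[OF uv(1)] L.M.S_smul[OF f] by blast
  have "cod (qt k a) (nb (smul f u + v)) 0 X = cod (qt k a) (\<lambda>Y. smul f (nb u Y) + nb v Y) 0 X"
    by (rule cod_cong[OF refl nb_lin[OF uv f] maps_nb X(2)]) (use uv f L.M.S_lin in auto)
  also have "\<dots> = cod (qt k a) (\<lambda>Y. smul f (nb u Y)) 0 X + cod (qt k a) (nb v) 0 X"
    by (rule cod_add_g[OF cV goodD(1)[OF k(2) a] m maps_nb[OF uv(2)] X(2)])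
  finally have 3: "cod (qt k a) (nb (smul f u + v)) 0 X
      = smul f (cod (qt k a) (nb u) 0 X) + smul (rho a f) (nb u X) + cod (qt k a) (nb v) 0 X"
    by (simp add: cod_qt_smul[OF k X a uv(1) f])
  have 4: "nb (smul f u + v) [(0, qt k a X)] = smul f (nb u [(0, qt k a X)]) + nb v [(0, qt k a X)]"
    by (rule nb_lin[OF uv f Y])
  show ?thesis unfolding H_def 1 2 3 4 by (simp add: algebra_simps)
qed

lemma H_tail:
  assumes k: "k \<ge> 1" "good k" and a: "a \<in> A" and b: "b \<in> S"
  shows "mlin (V0 S) (H k a b)"
proof -
  have "mlin (V0 S) (\<lambda>X. nb b [(0, qt k a X)])"
    unfolding mlin_def
  proof (intro allI impI)
    fix X Y d u v c assume h: "hom (V0 S) X" "hom (V0 S) Y" "u \<in> V0 S d" "v \<in> V0 S d"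
    have "qt k a (X @ (d, u) # Y) \<in> S" "qt k a (X @ (d, v) # Y) \<in> S"
      using maps_qt[OF k(2) a] h unfolding maps_V0_iff by auto
    then show "nb b [(0, qt k a (X @ (d, c *\<^sub>R u + v) # Y))] = c *\<^sub>R nb b [(0, qt k a (X @ (d, u) # Y))] + nb b [(0, qt k a (X @ (d, v) # Y))]"
      by (simp add: mlinD[OF goodD(1)[OF k(2) a] h] nb_single L.D_const[OF jj_L[OF b]])
  qed
  then show ?thesis unfolding H_def
    by (intro mlin_add mlin_diff mlin_nb AA.D_S a b goodD(1)[OF k(2)] cc_A mlin_cod[OF cV _ _ maps_nb])
qed

text \<open>The \<open>cod\<close> term and the outer \<open>nb b\<close> both differentiate
  \<open>f\<close> along j b, and the contributions cancel. With only one entry the other operators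
  would be derivations too; that case is the tensoriality of curvature,
  \<open>nab_curv_smul\<close>.\<close>

lemma H_slot:
  assumes k: "k \<ge> 2" "good k" and a: "a \<in> A" and b: "b \<in> S" and f: "f \<in> C"
    and s: "slot smul S f X X'" "length X = k"
  shows "H k a b X' = smul f (H k a b X)"
proof -
  have X: "hom (V0 S) X" "hom (V0 S) X'" "length X' = k" "X \<noteq> []"
    using slot_hom[OF s(1)] slot_hom'[where act = smul and r = f and S = S, OF s(1) L.M.S_smul[OF f]] slot_length[OF s(1)] s(2) by auto
  have 1: "qt k x X' = smul f (qt k x X)" if "x \<in> A" for x
    using ClinD[OF goodD(2)[OF k(2) that] f s(1)] s(2) X(3) k(1) by (simp add: qt_eq)
  have cl: "Clin smul S C {length X} (qt k a)"
    unfolding Clin_def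
  proof (intro allI impI)
    fix r Y Y' assume h: "r \<in> C" "slot smul S r Y Y'" "length Y \<in> {length X}"
    have "length Y' = length Y" using slot_length[OF h(2)] by simp
    then show "qt k a Y' = smul r (qt k a Y)"
      using ClinD[OF goodD(2)[OF k(2) a] h(1,2)] h(3) s(2) k(1) by (simp add: qt_eq)
  qed
  let ?s = "- rho (jj b) f"
  have sC: "?s \<in> C" by (intro C_minus L.rho_C jj_L b f)
  have 2: "cod (qt k a) (nb b) 0 X' = smul f (cod (qt k a) (nb b) 0 X) + smul ?s (qt k a X)"
    by (rule cod_slot_unary[OF subS linear_smul L.M.S_smul unary_nb maps_nb[OF b] f sC nb_smul[OF b _ f] s(1) goodD(1)[OF k(2) a] cl])
  have v: "qt k a X \<in> S" using goodD(3)[OF k(2) a X(1,4)] s(2) by (simp add: qt_eq)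
  have 3: "nb b [(0, qt k a X')] = smul f (nb b [(0, qt k a X)]) + smul ?s (qt k a X)"
    unfolding 1[OF a] by (rule nb_smul[OF b v f])
  show ?thesis unfolding H_def 1[OF cc_A[OF b a]] 2 3 using s(2) X(3) k(1) by (simp add: nb_other algebra_simps)
qed

text \<open>The anchor term of \<open>cc_lin_right\<close> is cancelled by the one that the outer
  \<open>nb b\<close> produces.\<close>

lemma H_anchor:
  assumes k: "k \<ge> 1" "good k" and X: "length X = k" "hom (V0 S) X" and a: "a \<in> A" "a' \<in> A" and b: "b \<in> S" and f: "f \<in> C"
  shows "H k (smul f a + a') b X = smul f (H k a b X) + H k a' b X"
proof -
  have Xn: "X \<noteq> []" using X k by auto
  have r: "rho (jj b) f \<in> C" using L.rho_C[OF jj_L[OF b] f] .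
  have v: "qt k x X \<in> S" if "x \<in> A" for x using goodD(3)[OF k(2) that X(2) Xn] X by (simp add: qt_eq)
  have ql: "qt k (smul g x + y) Z = smul g (qt k x Z) + qt k y Z" if "x \<in> A" "y \<in> A" "g \<in> C" "hom (V0 S) Z" "Z \<noteq> []" for x y g Z
    using goodD(4)[OF k(2) that(1,2,3,4,5)] by (simp add: qt_def)
  have 1: "nb (D (smul f a + a') b) X = smul f (nb (D a b) X) + nb (D a' b) X"
    unfolding AA.D_left[OF a b f] by (rule nb_lin[OF AA.D_S AA.D_S f X(2)]) (use a b in auto)
  have 2: "qt k (cc b (smul f a + a')) X = smul f (qt k (cc b a) X) + (smul (rho (jj b) f) (qt k a X) + qt k (cc b a') X)"
    unfolding cc_lin_right[OF b a f]
    using ql[OF cc_A[OF b a(1)] A.S_lin[OF r a(1) cc_A[OF b a(2)]] f X(2) Xn] ql[OF a(1) cc_A[OF b a(2)] r X(2) Xn] by simp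
  have "cod (qt k (smul f a + a')) (nb b) 0 X = cod (\<lambda>Z. smul f (qt k a Z) + qt k a' Z) (nb b) 0 X"
    by (rule cod_cong[OF ql[OF a f] refl maps_nb[OF b] X(2)])
  then have 3: "cod (qt k (smul f a + a')) (nb b) 0 X = smul f (cod (qt k a) (nb b) 0 X) + cod (qt k a') (nb b) 0 X"
    unfolding cod_add_f cod_linear[OF linear_smul] .
  have 4: "nb b [(0, qt k (smul f a + a') X)] = smul f (nb b [(0, qt k a X)]) + smul (- rho (jj b) f) (qt k a X) + nb b [(0, qt k a' X)]"
    unfolding ql[OF a f X(2) Xn] using nb_smul[OF b v[OF a(1)] f]
    by (simp add: nb_single nab_simps(1)[OF jj_L[OF b] L.M.S_smul[OF f v[OF a(1)]] v[OF a(2)]])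
  have 5: "smul (- rho (jj b) f) (qt k a X) = - smul (rho (jj b) f) (qt k a X)"
    by (rule smul_uminus_left)
  show ?thesis unfolding H_def 1 2 3 4 5 by (simp add: algebra_simps)
qed

lemma good_1: "good 1"
  unfolding good_def
proof (intro conjI ballI allI impI)
  fix a assume a: "a \<in> A"
  have e: "qt 1 a = (\<lambda>X. unop (D a) X + (if X = [] then qop D R a [] else 0))"
    by (rule ext) (auto simp: qt_def unop_def qop_def le_Suc_eq)
  show "mlin (V0 S) (qt 1 a)"
    unfolding e
    by (intro mlin_add mlin_unop) (auto simp: AA.D_const[OF a] mlin_def)
  show "Clin smul S C {2..1} (q a)" by (simp add: Clin_def)
  fix X assume X: "hom (V0 S) X" "X \<noteq> []" "length X \<le> 1"
  then have "length X = 1" by (cases X) auto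
  then obtain e where e: "e \<in> S" "X = [(0, e)]" using single_cases X by blast
  show "q a X \<in> S" using AA.D_S[OF a e(1)] by (simp add: e q_single)
  fix a' f assume "a' \<in> A" "f \<in> C"
  then show "q (smul f a + a') X = smul f (q a X) + q a' X" using AA.D_left[OF a _ e(1)] by (simp add: e q_single)
qed

lemma good_Suc:
  assumes k: "k \<ge> 1" "good k" shows "good (Suc k)"
  unfolding good_def
proof (intro conjI ballI allI impI)
  fix a assume a: "a \<in> A"
  show "mlin (V0 S) (qt (Suc k) a)"
    unfolding mlin_def
  proof (intro allI impI)
    fix X Y d u v c assume h: "hom (V0 S) X" "hom (V0 S) Y" "u \<in> V0 S d" "v \<in> V0 S d"
    then have d: "d = 0" and uv: "u \<in> S" "v \<in> S" by auto
    have w: "c *\<^sub>R u + v \<in> S" using uv L.M.S_lin[of "\<lambda>_. c" u v] by simp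
    consider "length X + length Y < k" | "length X + length Y = k" | "length X + length Y > k" by linarith
    then show "qt (Suc k) a (X @ (d, c *\<^sub>R u + v) # Y) = c *\<^sub>R qt (Suc k) a (X @ (d, u) # Y) + qt (Suc k) a (X @ (d, v) # Y)"
    proof cases
      case 1
      then show ?thesis using mlinD[OF goodD(1)[OF k(2) a] h, of c] by (simp add: qt_def)
    next
      case 3
      then show ?thesis by (simp add: qt_def)
    next
      case 2
      show ?thesis
      proof (cases X)
        case Nil
        then have l: "length Y = k" using 2 by simp
        have "H k a (smul (\<lambda>_. c) u + v) Y = smul (\<lambda>_. c) (H k a u Y) + H k a v Y"
          by (rule H_head[OF k l h(2) a uv]) simp
        then show ?thesis using Nil l rec[OF k l h(2) a] uv w by (simp add: qt_def d)
      next
        case (Cons x X')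
        then have x: "x = (0, snd x)" "snd x \<in> S" "hom (V0 S) X'" using h(1) by (auto simp: prod_eq_iff)
        have r: "qt (Suc k) a (X @ (d, z) # Y) = H k a (snd x) (X' @ (d, z) # Y)" if "z \<in> S" for z
        proof -
          have "q a ((0, snd x) # X' @ (d, z) # Y) = H k a (snd x) (X' @ (d, z) # Y)"
            by (rule rec[OF k _ _ a x(2)]) (use 2 Cons x h(2) that d in auto)
          then show ?thesis using x(1) 2 Cons by (simp add: qt_def)
        qed
        show ?thesis unfolding r[OF uv(1)] r[OF uv(2)] r[OF w]
          by (rule mlinD[OF H_tail[OF k a x(2)] x(3) h(2,3,4)])
      qed
    qed
  qed
  show "Clin smul S C {2..Suc k} (q a)"
    unfolding Clin_def
  proof (intro allI impI)
    fix f X X' assume f: "f \<in> C" and s: "slot smul S f X X'" and l: "length X \<in> {2..Suc k}"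
    show "q a X' = smul f (q a X)"
    proof (cases "length X = Suc k")
      case False
      then show ?thesis using ClinD[OF goodD(2)[OF k(2) a] f s] l by simp
    next
      case True
      from s show ?thesis
      proof cases
        case (here u Y)
        then have lY: "length Y = k" using True by simp
        have z: "H k a 0 Y = 0"
          using H_head[OF k lY here(4) a L.M.S_zero L.M.S_zero L.C_const[of 1]] by simp
        have "H k a (smul f u + 0) Y = smul f (H k a u Y) + H k a 0 Y"
          by (rule H_head[OF k lY here(4) a here(3) L.M.S_zero f])
        then show ?thesis using rec[OF k lY here(4) a here(3)] rec[OF k lY here(4) a L.M.S_smul[OF f here(3)]] z
          by (simp add: here)
      next
        case (there Y Y' b)
        have lY: "length Y = k" "length Y' = k" using True there slot_length[OF there(3)] by simp_all
        have hY: "hom (V0 S) Y" "hom (V0 S) Y'"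
          using slot_hom[OF there(3)] slot_hom'[where act = smul and r = f and S = S, OF there(3) L.M.S_smul[OF f]] by auto
        have "H k a b Y' = smul f (H k a b Y)" if "k \<ge> 2"
          by (rule H_slot[OF that k(2) a there(4) f there(3) lY(1)])
        moreover have "H k a b Y' = smul f (H k a b Y)" if k1: "k = 1"
        proof -
          obtain e where e: "e \<in> S" "Y = [(0, e)]" using single_cases lY hY k1 by blast
          have "Y' = [(0, smul f e)]" using there(3) unfolding e(2) by cases (auto elim: slot.cases)
          then have "q a ((0, b) # Y') = R 2 [b, smul f e] [a]" "q a ((0, b) # Y) = R 2 [b, e] [a]"
            by (simp_all add: qop_def e numeral_2_eq_2)
          then have "q a ((0, b) # Y') = smul f (q a ((0, b) # Y))"
            using R_2[OF a] nab_curv_smul[OF A_L[OF a] jj_L[OF there(4)] e(1) f] by simp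
          then show ?thesis using rec[OF k lY(1) hY(1) a there(4)] rec[OF k lY(2) hY(2) a there(4)] by simp
        qed
        ultimately show ?thesis using rec[OF k lY(1) hY(1) a there(4)] rec[OF k lY(2) hY(2) a there(4)] k(1)
          by (cases "k = 1") (auto simp: there)
      qed
    qed
  qed
  fix X assume X: "hom (V0 S) X" "X \<noteq> []" "length X \<le> Suc k"
  have c: "length X \<le> k \<or> (\<exists>b Y. b \<in> S \<and> hom (V0 S) Y \<and> length Y = k \<and> X = (0, b) # Y)"
    using X by (cases X) (auto simp: le_Suc_eq)
  have HS: "H k a b Y \<in> S" if "b \<in> S" "hom (V0 S) Y" "length Y = k" for b Y
  proof -
    have Yn: "Y \<noteq> []" using that k by auto
    have 1: "qt k x Y \<in> S" if "x \<in> A" for x using maps_qt[OF k(2) that] \<open>hom (V0 S) Y\<close> Yn unfolding maps_V0_iff by blast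
    have 2: "cod (qt k a) (nb b) 0 Y \<in> S"
      using maps_cod[OF cV maps_qt[OF k(2) a] maps_nb[OF that(1)], of 0] that(2) Yn unfolding maps_V0_iff by simp
    show ?thesis unfolding H_def
      by (intro L.M.S_add L.M.S_diff nb_S 1 2 AA.D_S a that cc_A) (use 1 a in simp)
  qed
  show "q a X \<in> S" using c
  proof
    assume "length X \<le> k" then show ?thesis using goodD(3)[OF k(2) a X(1,2)] by simp
  next
    assume "\<exists>b Y. b \<in> S \<and> hom (V0 S) Y \<and> length Y = k \<and> X = (0, b) # Y"
    then obtain b Y where b: "b \<in> S" "hom (V0 S) Y" "length Y = k" "X = (0, b) # Y" by blast
    show ?thesis unfolding b(4) rec[OF k b(3,2) a b(1)] by (rule HS[OF b(1,2,3)])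
  qed
  fix a' f assume a': "a' \<in> A" and f: "f \<in> C"
  show "q (smul f a + a') X = smul f (q a X) + q a' X" using c
  proof
    assume "length X \<le> k" then show ?thesis using goodD(4)[OF k(2) a a' f X(1,2)] by simp
  next
    assume "\<exists>b Y. b \<in> S \<and> hom (V0 S) Y \<and> length Y = k \<and> X = (0, b) # Y"
    then obtain b Y where b: "b \<in> S" "hom (V0 S) Y" "length Y = k" "X = (0, b) # Y" by blast
    show ?thesis unfolding b(4) rec[OF k b(3,2) a b(1)] rec[OF k b(3,2) a' b(1)] rec[OF k b(3,2) A.S_lin[OF f a a'] b(1)]
      by (rule H_anchor[OF k b(3,2) a a' b(1) f])
  qed
qed

lemma good: "k \<ge> 1 \<Longrightarrow> good k"
proof (induction k)
  case (Suc k)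
  then show ?case using good_1 good_Suc by (cases "k = 0") auto
qed simp

end

lemma slot_mid:
  assumes "hom (V0 S) X" "hom (V0 S) Y" "s \<in> S"
  shows "slot act S r (X @ (0, s) # Y) (X @ (0, act r s) # Y)"
  using assms(1)
proof (induction X)
  case Nil show ?case using slot.here[of s S Y act r] assms by simp
next
  case (Cons x X)
  then have x: "x = (0, snd x)" "snd x \<in> S" by (auto simp: prod_eq_iff)
  have "slot act S r ((0, snd x) # X @ (0, s) # Y) ((0, snd x) # X @ (0, act r s) # Y)"
    by (rule slot.there[OF Cons.IH x(2)]) (use Cons.prems in simp)
  then show ?case using x(1) by simp
qed

lemma mlin_Clin_slot:
  assumes f: "mlin (V0 S) f" "Clin smul S C N f" and h: "hom (V0 S) X" "hom (V0 S) Y" "s \<in> S" "s' \<in> S" "r \<in> C"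
    and "smul r s \<in> S" "length X + length Y + 1 \<in> N"
  shows "f (X @ (0, smul r s + s') # Y) = smul r (f (X @ (0, s) # Y)) + f (X @ (0, s') # Y)"
proof -
  have "f (X @ (0, 1 *\<^sub>R smul r s + s') # Y) = 1 *\<^sub>R f (X @ (0, smul r s) # Y) + f (X @ (0, s') # Y)"
    by (rule mlinD[OF f(1) h(1,2)]) (use assms in auto)
  moreover have "f (X @ (0, smul r s) # Y) = smul r (f (X @ (0, s) # Y))"
    by (rule ClinD[OF f(2) h(5) slot_mid[OF h(1,2,3)]]) (use assms in simp)
  ultimately show ?thesis by simp
qed

lemma FX_cong_fun:
  fixes \<phi> :: "(int \<times> 'a) list \<Rightarrow> 'b::real_vector"
  assumes f: "\<And>Z. hom V Z \<Longrightarrow> Z \<noteq> [] \<Longrightarrow> f Z = f' Z" and "hom V X"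
  shows "FX f \<phi> X = FX f' \<phi> X"
  using assms(2)
proof (induction "length X" arbitrary: X \<phi> rule: less_induct)
  case less
  show ?case
  proof (cases "X = []")
    case False
    have "unsh (\<lambda>Y Z. FX f (\<lambda>W. \<phi> (W @ [(dg Z, f Z)])) Y) 0 X = unsh (\<lambda>Y Z. FX f' (\<lambda>W. \<phi> (W @ [(dg Z, f' Z)])) Y) 0 X"
    proof (rule unsh_cong[OF _ less.prems])
      fix Y Z assume h: "hom V Y" "hom V Z" "Z \<noteq> []" "length Y + length Z = length X"
      then have "length Y < length X" by (cases Z) auto
      from less.hyps[OF this h(1)] show "FX f (\<lambda>W. \<phi> (W @ [(dg Z, f Z)])) Y = FX f' (\<lambda>W. \<phi> (W @ [(dg Z, f' Z)])) Y"
        unfolding f[OF h(2,3)] .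
    qed
    then show ?thesis unfolding FX_step[OF False] .
  qed simp
qed

context lie_pair_alg
begin

section \<open>The relations between the operators q_a, n_b and c\<close>

lemma q_S: "\<lbrakk>a \<in> A; hom (V0 S) X; X \<noteq> []\<rbrakk> \<Longrightarrow> q a X \<in> S"
  using goodD(3)[OF good, of "length X"] by (simp add: Suc_le_eq)

lemma q_lin: "\<lbrakk>a \<in> A; a' \<in> A; f \<in> C; hom (V0 S) X; X \<noteq> []\<rbrakk> \<Longrightarrow> q (smul f a + a') X = smul f (q a X) + q a' X"
  using goodD(4)[OF good, of "length X"] by (simp add: Suc_le_eq)

lemma q_add: "\<lbrakk>a \<in> A; a' \<in> A; hom (V0 S) X; X \<noteq> []\<rbrakk> \<Longrightarrow> q (a + a') X = q a X + q a' X"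
  using q_lin[of a a' "\<lambda>_. 1"] by simp

lemma q_diff: "\<lbrakk>a \<in> A; a' \<in> A; hom (V0 S) X; X \<noteq> []\<rbrakk> \<Longrightarrow> q (a - a') X = q a X - q a' X"
  using q_lin[of a' a "\<lambda>_. - 1"] by simp

lemma mlin_q: "a \<in> A \<Longrightarrow> mlin (V0 S) (q a)"
  unfolding mlin_def
proof (intro allI impI)
  fix X Y d u v c assume a: "a \<in> A" and h: "hom (V0 S) X" "hom (V0 S) Y" "u \<in> V0 S d" "v \<in> V0 S d"
  let ?k = "length X + length Y + 1"
  have "mlin (V0 S) (qt ?k a)" by (rule goodD(1)[OF good a]) simp
  from mlinD[OF this h, of c] show "q a (X @ (d, c *\<^sub>R u + v) # Y) = c *\<^sub>R q a (X @ (d, u) # Y) + q a (X @ (d, v) # Y)"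
    by (simp add: qt_def)
qed

lemma Clin_q: "a \<in> A \<Longrightarrow> Clin smul S C {2..} (q a)"
  unfolding Clin_def
proof (intro allI impI)
  fix r X X' assume a: "a \<in> A" and h: "r \<in> C" "slot smul S r X X'" "length X \<in> {2..}"
  show "q a X' = smul r (q a X)"
    by (rule ClinD[OF goodD(2)[OF good a] h(1,2), of "length X"]) (use h(3) in auto)
qed

lemma maps_q: "a \<in> A \<Longrightarrow> maps (V0 S) (q a) (V0 S) 0"
  by (simp add: maps_V0_iff q_S)

lemma R_eq: "k \<ge> 2 \<Longrightarrow> length bs = k \<Longrightarrow> R k bs [a] = q a (evn bs)"
  by (simp add: qop_def)

lemma R_tail: "as \<noteq> [] \<Longrightarrow> R k bs (a # as) = 0"
  by (rule R_out) auto

lemma R_notin: "a \<notin> A \<Longrightarrow> R k bs (a # as) = 0"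
  by (rule R_out) auto

lemma R_AZ:
  assumes "length bs = k" "set bs \<subseteq> S" "k \<ge> 2"
  shows "R k bs \<in> AA.AZ 1"
proof (rule AA.AZ_I)
  have v: "R k bs [a] = q a (evn bs)" for a using R_eq[OF assms(3,1)] .
  have h: "hom (V0 S) (evn bs)" "evn bs \<noteq> []" using assms by auto
  have z: "ctr b (ctr a (R k bs)) = 0" for a b
    unfolding ctr_0_iff by (simp add: ctr_apply R_tail)
  show "R k bs [] = 0" by (rule R_out) simp
  show "ctr a (R k bs) = 0" if "a \<notin> A" for a
    unfolding ctr_0_iff using R_notin[OF that] by simp
  show "ctr a (R k bs) \<in> AA.AZ (1 - 1)" if a: "a \<in> A" for a
    using q_S[OF a h] z by (simp add: AA.AZ_def ctr_apply[of a] v)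
  show "ctr a (ctr a (R k bs)) = 0" for a by (rule z)
  show "ctr (smul f a + a') (R k bs) = smulF f (ctr a (R k bs)) + ctr a' (R k bs)"
    if "a \<in> A" "a' \<in> A" "f \<in> C" for a a' f
  proof (rule form_eqI)
    show "ctr (smul f a + a') (R k bs) [] = (smulF f (ctr a (R k bs)) + ctr a' (R k bs)) []"
      by (simp add: app v q_lin[OF that h])
  qed (simp add: z)
qed simp_all

lemma R_mC: "k \<ge> 1 \<Longrightarrow> AA.D.mC k (R k) 1"
proof -
  assume k: "k \<ge> 1"
  have k': "k = 1 \<or> k \<ge> 2" using k by auto
  show ?thesis
  proof (rule AA.mC_I)
    fix bs assume "length bs = k" "set bs \<subseteq> S"
    then show "R k bs \<in> AA.AZ 1" using k' R_AZ R_1 by auto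
  next
    fix xs ys s s' f assume h: "length xs + length ys + 1 = k" "set xs \<subseteq> S" "set ys \<subseteq> S" "s \<in> S" "s' \<in> S" "f \<in> C"
    show "R k (xs @ (smul f s + s') # ys) = smulF f (R k (xs @ s # ys)) + R k (xs @ s' # ys)"
      using k'
    proof
      assume "k = 1" then show ?thesis using R_1 by simp
    next
      assume k2: "k \<ge> 2"
      show ?thesis
      proof
        fix as
        show "R k (xs @ (smul f s + s') # ys) as = (smulF f (R k (xs @ s # ys)) + R k (xs @ s' # ys)) as"
        proof (cases "\<exists>a\<in>A. as = [a]")
          case True
          then obtain a where a: "a \<in> A" "as = [a]" by blast
          have "q a (evn xs @ (0, smul f s + s') # evn ys) = smul f (q a (evn xs @ (0, s) # evn ys)) + q a (evn xs @ (0, s') # evn ys)"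
            by (rule mlin_Clin_slot[OF mlin_q[OF a(1)] Clin_q[OF a(1)]]) (use h k2 L.M.S_smul in auto)
          then show ?thesis using R_eq[OF k2] h(1) by (simp add: a(2) app)
        next
          case False
          then show ?thesis by (simp add: app R_out)
        qed
      qed
    qed
  qed
qed

sublocale KF: kap_forms C A S br rho D R
  by unfold_locales (rule R_mC, assumption, rule R_1)

lemma br_0: "a \<in> L \<Longrightarrow> br a 0 = 0"
  using L.br_lin[of a 0 0 "\<lambda>_. 1"] by simp

lemma br_add: "\<lbrakk>a \<in> L; b \<in> L; c \<in> L\<rbrakk> \<Longrightarrow> br a (b + c) = br a b + br a c"
  using L.br_lin[of a b c "\<lambda>_. 1"] L.br_lin[of a b 0 "\<lambda>_. 1"] br_0 by simp

lemma br_diff: "\<lbrakk>a \<in> L; b \<in> L; c \<in> L\<rbrakk> \<Longrightarrow> br a (b - c) = br a b - br a c"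
  using br_add[of a "b - c" c] L.N.S_diff by simp

lemma br_diff_left: "\<lbrakk>a \<in> L; b \<in> L; c \<in> L\<rbrakk> \<Longrightarrow> br (b - c) a = br b a - br c a"
  using br_diff[of a b c] L.br_skew[of "b - c" a] L.br_skew[of b a] L.br_skew[of c a] L.N.S_diff[of b c]
  by (simp add: algebra_simps)

lemma brj: "b \<in> S \<Longrightarrow> a \<in> A \<Longrightarrow> br (jj b) a = cc b a - jj (D a b)"
  using L.br_skew[of "jj b" a] br_dec[of a b] jj_L A_L by simp

lemma flatD:
  assumes "b \<in> S" "a \<in> A" "a' \<in> A"
  shows "D a (D a' b) - D a' (D a b) = D (br a a') b"
proof -
  have l: "jj b \<in> L" "b = pr (jj b)" "br a (jj b) \<in> L" "br a' (jj b) \<in> L"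
    using assms jj_L pr_jj L.br_G A_L by auto
  have "br a (br a' (jj b)) - br a' (br a (jj b)) = br (br a a') (jj b)"
    unfolding L.br_jac[OF A_L[OF assms(2)] A_L[OF assms(3)] l(1)] by simp
  then have "pr (br a (br a' (jj b))) - pr (br a' (br a (jj b))) = pr (br (br a a') (jj b))"
    using pr_simps(2)[of "br a (br a' (jj b))" "br a' (br a (jj b))"] l L.br_G A_L assms by simp
  moreover have "D x b = pr (br x (jj b))" if "x \<in> A" for x
    using bott_pr[OF that l(1)] pr_jj[OF assms(1)] by simp
  ultimately show ?thesis
    using bott_pr[OF assms(2) l(4)] bott_pr[OF assms(3) l(3)] br_A[OF assms(2,3)] assms by simp
qed

text \<open>The Jacobi identity for j b, a and a', with each bracket decomposed by
  \<open>br_dec\<close>. The parts along \<open>jj\<close> cancel by flatness of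
  \<open>D\<close>.\<close>

lemma cc_jacobi:
  assumes "b \<in> S" "a \<in> A" "a' \<in> A"
  shows "cc b (br a a') = cc (D a' b) a - cc (D a b) a' + br (cc b a) a' + br a (cc b a')"
proof -
  note aL = A_L[OF assms(2)] A_L[OF assms(3)]
  have D: "D a b \<in> S" "D a' b \<in> S" "D a (D a' b) \<in> S" "D a' (D a b) \<in> S" using AA.D_S assms by simp_all
  have c: "cc b a \<in> L" "cc b a' \<in> L" using cc_A A_L assms by simp_all
  have 1: "br (jj b) (br a a') = br (br (jj b) a) a' + br a (br (jj b) a')"
    by (rule L.br_jac[OF jj_L[OF assms(1)] aL])
  have 2: "br (jj b) (br a a') = cc b (br a a') - (jj (D a (D a' b)) - jj (D a' (D a b)))"
    unfolding brj[OF assms(1) br_A[OF assms(2,3)]] flatD[OF assms, symmetric] jj_simps(2)[OF D(3,4)] ..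
  have 3: "br (br (jj b) a) a' = br (cc b a) a' - (cc (D a b) a' - jj (D a' (D a b)))"
    unfolding brj[OF assms(1,2)] br_diff_left[OF aL(2) c(1) jj_L[OF D(1)]] brj[OF D(1) assms(3)] ..
  have 4: "br a (br (jj b) a') = br a (cc b a') - (jj (D a (D a' b)) - cc (D a' b) a)"
    unfolding brj[OF assms(1,3)] br_diff[OF aL(1) c(2) jj_L[OF D(2)]] br_dec[OF assms(2) D(2)] ..
  show ?thesis using 1 unfolding 2 3 4 by (simp add: algebra_simps)
qed

lemma even_K:
  assumes "b \<in> S" "a \<in> A" "hom (V0 S) X" "X \<noteq> []"
  shows "q a ((0, b) # X) + com (q a) 0 (nb b) 0 X = nb (q a [(0, b)]) X + q (cc b a) X"
proof -
  let ?k = "length X"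
  have k: "?k \<ge> 1" using assms(4) by (simp add: Suc_le_eq)
  have 1: "cod (qt ?k a) (nb b) 0 X = cod (q a) (nb b) 0 X"
    by (rule cod_cong'[where e = 0]) (simp add: qt_def)
  have 2: "cod (nb b) (q a) 0 X = nb b [(0, q a X)]"
    using cod_of_unary[OF unary_nb assms(4), of b "q a" 0] hom_V0_dg[OF assms(3)] by simp
  have "q a ((0, b) # X) = H ?k a b X"
    by (rule rec[OF k good[OF k] refl assms(3,2,1)])
  then show ?thesis unfolding H_def 1 by (simp add: com_def 2 qt_def q_single)
qed

sublocale EV: even_rep S A br cc q nb
proof unfold_locales
  show "subspace S" by (rule subS)
  fix a a' assume a: "a \<in> A" "a' \<in> A"
  show "br a a' \<in> A" by (rule br_A[OF a])
next
  fix a assume a: "a \<in> A"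
  show "maps (V0 S) (q a) (V0 S) 0" "mlin (V0 S) (q a)" by (rule maps_q[OF a], rule mlin_q[OF a])
next
  fix b assume b: "b \<in> S"
  show "maps (V0 S) (nb b) (V0 S) 0" "mlin (V0 S) (nb b)" by (rule maps_nb[OF b], rule mlin_nb[OF b])
  show "cc b a \<in> A" if "a \<in> A" for a using cc_A[OF b that] .
next
  fix u v X r assume "u \<in> S" "v \<in> S" "hom (V0 S) X" "X \<noteq> []"
  then show "nb (r *\<^sub>R u + v) X = r *\<^sub>R nb u X + nb v X" using nb_lin[of u v "\<lambda>_. r" X] by simp
next
  fix b a X assume "b \<in> S" "a \<in> A" "hom (V0 S) X" "X \<noteq> []"
  then show "q a ((0, b) # X) + com (q a) 0 (nb b) 0 X = nb (q a [(0, b)]) X + q (cc b a) X" by (rule even_K)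
next
  fix b a a' assume "b \<in> S" "a \<in> A" "a' \<in> A"
  then show "q a [(0, q a' [(0, b)])] - q a' [(0, q a [(0, b)])] = q (br a a') [(0, b)]"
    by (simp add: q_single flatD)
next
  fix b a a' X assume h: "b \<in> S" "a \<in> A" "a' \<in> A" "hom (V0 S) X" "X \<noteq> []"
  have m: "cc (D a' b) a \<in> A" "cc (D a b) a' \<in> A" "br (cc b a) a' \<in> A" "br a (cc b a') \<in> A"
    using h AA.D_S cc_A br_A by simp_all
  show "q (cc b (br a a')) X = q (cc (q a' [(0, b)]) a) X - q (cc (q a [(0, b)]) a') X
      + q (br (cc b a) a') X + q (br a (cc b a')) X"
    unfolding cc_jacobi[OF h(1-3)] q_single
    using q_add[OF A.S_add[OF A.S_diff[OF m(1,2)] m(3)] m(4) h(4,5)] q_add[OF A.S_diff[OF m(1,2)] m(3) h(4,5)]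
      q_diff[OF m(1,2) h(4,5)] by simp
qed

lemma kap_leibniz: "hom AA.AZ X \<Longrightarrow> X \<noteq> [] \<Longrightarrow> cod KF.lam KF.lam 1 X = 0"
  by (rule KF.leibniz) (rule EV.q_bracket)

end

section \<open>Comparison of two choices of splitting and connection\<close>

locale lie_pair_alg2 = P: lie_pair_alg C L S br rho nab A pr jj D R + Q: lie_pair_alg C L S br rho nab' A pr jj' D R'
  for C :: "('m \<Rightarrow> real) set" and L :: "('m \<Rightarrow> 'v::real_vector) set"
    and S :: "('m \<Rightarrow> 'e::real_vector) set" and br rho nab nab' A pr jj jj' D R R'
begin

definition "th b = jj' b - jj b"
definition "mm b X = Q.nb b X + Q.q (th b) X"
definition "fh = fhat mm P.nb"
text \<open>A section regarded as a form of degree 0. One formula serves for every \<open>k\<close>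
  because \<open>fh\<close> reads the number of arguments off its list.\<close>

definition "F k bs = (\<lambda>as :: ('m \<Rightarrow> 'v) list. if as = [] then fh (evn bs) else 0)" for k :: nat

lemma th_A: "b \<in> S \<Longrightarrow> th b \<in> A"
  using P.jj_L[of b] Q.jj_L[of b] P.pr_jj Q.pr_jj P.L.N.S_diff
  by (subst P.pr_A) (simp_all add: th_def P.pr_simps)

lemma th_lin: "\<lbrakk>u \<in> S; v \<in> S; f \<in> C\<rbrakk> \<Longrightarrow> th (smul f u + v) = smul f (th u) + th v"
  by (simp add: th_def P.jj_lin Q.jj_lin)

text \<open>Subtract the decompositions \<open>br_dec\<close> of [a, j'b] and [a, j b].\<close>

lemma cc_th: "b \<in> S \<Longrightarrow> a \<in> A \<Longrightarrow> Q.cc b a + br a (th b) = P.cc b a + th (D a b)"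
proof -
  assume h: "b \<in> S" "a \<in> A"
  have "br a (th b) = br a (jj' b) - br a (jj b)"
    unfolding th_def by (rule P.br_diff[OF P.A_L[OF h(2)] Q.jj_L[OF h(1)] P.jj_L[OF h(1)]])
  then show ?thesis unfolding P.br_dec[OF h(2,1)] Q.br_dec[OF h(2,1)] by (simp add: th_def)
qed

lemma mm_lin:
  assumes "u \<in> S" "v \<in> S" "f \<in> C" "hom (V0 S) X" "X \<noteq> []"
  shows "mm (smul f u + v) X = smul f (mm u X) + mm v X"
  using Q.nb_lin[OF assms(1-4)] Q.q_lin[OF th_A[OF assms(1)] th_A[OF assms(2)] assms(3-5)]
  by (simp add: mm_def th_lin[OF assms(1-3)])

lemma maps_mm: "b \<in> S \<Longrightarrow> maps (V0 S) (mm b) (V0 S) 0"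
  unfolding mm_def by (intro maps_add P.cV Q.maps_nb Q.maps_q th_A)

lemma mlin_mm: "b \<in> S \<Longrightarrow> mlin (V0 S) (mm b)"
  unfolding mm_def by (intro mlin_add Q.mlin_nb Q.mlin_q th_A)

text \<open>For the second choice \<open>K\<close> holds with \<open>Q.cc\<close>. The extra
  commutator of \<open>Q.q a\<close> with \<open>Q.q (th b)\<close> is
  \<open>Q.q (br a (th b))\<close> by \<open>q_bracket\<close>, and \<open>cc_th\<close> trades the
  sum of the two for \<open>P.cc b a\<close> and the \<open>th\<close> part of
  \<open>mm (D a b)\<close>.\<close>

lemma mm_K:
  assumes b: "b \<in> S" and a: "a \<in> A" and X: "hom (V0 S) X" "X \<noteq> []"
  shows "Q.q a ((0, b) # X) + com (Q.q a) 0 (mm b) 0 X = mm (Q.q a [(0, b)]) X + Q.q (P.cc b a) X"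
proof -
  have mm_eq: "mm b = (\<lambda>X. Q.nb b X + Q.q (th b) X)" by (rule ext) (simp add: mm_def)
  note t = th_A[OF b] and Db = P.AA.D_S[OF a b]
  have "com (Q.q a) 0 (mm b) 0 X = com (Q.q a) 0 (Q.nb b) 0 X + com (Q.q a) 0 (Q.q (th b)) 0 X"
    using com_lin_right[OF P.cV Q.maps_nb[OF b] Q.maps_q[OF t] Q.mlin_q[OF a] X(1), of 0 1]
    unfolding mm_eq by simp
  also have "com (Q.q a) 0 (Q.q (th b)) 0 X = Q.q (br a (th b)) X"
    by (rule Q.EV.q_bracket[OF X a t])
  finally have "Q.q a ((0, b) # X) + com (Q.q a) 0 (mm b) 0 X
      = Q.nb (D a b) X + (Q.q (Q.cc b a) X + Q.q (br a (th b)) X)"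
    using Q.even_K[OF b a X] by (simp add: Q.q_single algebra_simps)
  also have "Q.q (Q.cc b a) X + Q.q (br a (th b)) X = Q.q (P.cc b a + th (D a b)) X"
    unfolding cc_th[OF b a, symmetric] by (rule Q.q_add[symmetric, OF Q.cc_A[OF b a] P.br_A[OF a t] X])
  also have "\<dots> = Q.q (P.cc b a) X + Q.q (th (D a b)) X"
    by (rule Q.q_add[OF P.cc_A[OF b a] th_A[OF Db] X])
  finally show ?thesis unfolding Q.q_single mm_def[of "D a b"] by (simp only: add_ac)
qed

lemma even2: "even_struct S A br P.cc Q.q mm"
proof unfold_locales
  fix b assume b: "b \<in> S"
  show "maps (V0 S) (mm b) (V0 S) 0" "mlin (V0 S) (mm b)" by (rule maps_mm[OF b], rule mlin_mm[OF b])
next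
  fix u v X r assume "u \<in> S" "v \<in> S" "hom (V0 S) X" "X \<noteq> []"
  then show "mm (r *\<^sub>R u + v) X = r *\<^sub>R mm u X + mm v X" using mm_lin[of u v "\<lambda>_. r" X] by simp
qed (rule P.subS mm_K P.br_A P.cc_A Q.maps_q Q.mlin_q; assumption?)+

lemma mn: "b \<in> S \<Longrightarrow> maps (V0 S) (mm b) (V0 S) 0 \<and> maps (V0 S) (P.nb b) (V0 S) 0"
  using maps_mm P.maps_nb by blast

lemma mn_mlin: "b \<in> S \<Longrightarrow> mlin (V0 S) (mm b) \<and> mlin (V0 S) (P.nb b)"
  using mlin_mm P.mlin_nb by blast

lemma mn_lin: "u \<in> S \<Longrightarrow> v \<in> S \<Longrightarrow> hom (V0 S) X \<Longrightarrow> X \<noteq> [] \<Longrightarrow>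
    mm (c *\<^sub>R u + v) X = c *\<^sub>R mm u X + mm v X \<and> P.nb (c *\<^sub>R u + v) X = c *\<^sub>R P.nb u X + P.nb v X"
  using mm_lin[of u v "\<lambda>_. c" X] P.nb_lin[of u v "\<lambda>_. c" X] by simp

lemma mlin_proj: "mlin (V0 S) (\<lambda>W. if length W = 1 then snd (hd W) else 0)"
  by (auto simp: mlin_def)

lemma mlin_fh: "mlin (V0 S) fh"
  unfolding fh_def fhat_def by (rule mlin_FF[OF P.subS mn mn_mlin mn_lin mlin_proj])

lemma maps_fh: "maps (V0 S) fh (V0 S) 0"
  unfolding fh_def by (rule maps_fhat[OF P.subS mn])

lemma Clin_fh: "Clin smul S C UNIV fh"
  unfolding fh_def
proof (rule Clin_fhat[OF P.subS linear_smul P.L.M.S_smul mn mn_mlin mn_lin])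
  show "unary (P.nb b)" for b by (rule P.unary_nb)
  fix b assume b: "b \<in> S"
  show "Clin smul S C {2..} (mm b)"
    unfolding Clin_def
  proof (intro allI impI)
    fix r X X' assume h: "r \<in> C" "slot smul S r X X'" "length X \<in> {2..}"
    have l: "length X' = length X" using slot_length[OF h(2)] by simp
    show "mm b X' = smul r (mm b X)"
      using ClinD[OF Q.Clin_q[OF th_A[OF b]] h] h(3) l by (simp add: mm_def Q.nb_other)
  qed
  fix r assume r: "r \<in> C"
  \<comment> \<open>The symbols agree because both families represent the action of j b: the
    derivation \<open>D (th b)\<close> contained in \<open>mm b\<close> makes up for differentiating
    along j'b.\<close>
  have "rho (jj' b) r = rho (th b) r + rho (jj b) r"
    using P.rho_add[OF P.A_L[OF th_A[OF b]] P.jj_L[OF b] r] by (simp add: th_def)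
  then have s: "- rho (jj b) r = - rho (jj' b) r + rho (th b) r" by simp
  show "\<exists>s\<in>C. \<forall>u\<in>S. P.nb b [(0, smul r u)] = smul r (P.nb b [(0, u)]) + smul s u
        \<and> mm b [(0, smul r u)] = smul r (mm b [(0, u)]) + smul s u"
  proof (intro bexI ballI conjI)
    fix u assume u: "u \<in> S"
    show "P.nb b [(0, smul r u)] = smul r (P.nb b [(0, u)]) + smul (- rho (jj b) r) u"
      by (rule P.nb_smul[OF b u r])
    have "D (th b) (smul r u) = smul r (D (th b) u) + smul (rho (th b) r) u"
      using P.AA.D_lin[OF th_A[OF b] u P.L.M.S_zero r] P.AA.D_zero[OF th_A[OF b]] by simp
    then show "mm b [(0, smul r u)] = smul r (mm b [(0, u)]) + smul (- rho (jj b) r) u"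
      unfolding s smul_add_left by (simp add: mm_def Q.nb_smul[OF b u r] Q.q_single)
  qed (intro P.C_minus P.L.rho_C P.jj_L b r)
next
  fix b r X assume h: "b \<in> S" "r \<in> C" "hom (V0 S) X" "X \<noteq> []"
  have z: "mm 0 X = 0" "P.nb 0 X = 0"
    using mm_lin[OF P.L.M.S_zero P.L.M.S_zero P.L.C_const[of 1] h(3,4)]
      P.nb_lin[OF P.L.M.S_zero P.L.M.S_zero P.L.C_const[of 1] h(3)] by simp_all
  show "mm (smul r b) X = smul r (mm b X) \<and> P.nb (smul r b) X = smul r (P.nb b X)"
    using mm_lin[OF h(1) P.L.M.S_zero h(2,3,4)] P.nb_lin[OF h(1) P.L.M.S_zero h(2,3)] z by simp
qed

lemma F_mC: "k \<ge> 1 \<Longrightarrow> P.AA.D.mC k (F k) 0"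
proof (rule P.AA.mC_I)
  fix bs assume h: "k \<ge> 1" "length bs = k" "set bs \<subseteq> S"
  have "fh (evn bs) \<in> S"
    using maps_fh[unfolded maps_V0_iff, rule_format, of "evn bs"] h by (cases bs) auto
  moreover have "ctr a (F k bs) = 0" for a unfolding ctr_0_iff by (simp add: F_def)
  ultimately show "F k bs \<in> P.AA.AZ 0" by (simp add: P.AA.AZ_def F_def)
next
  fix xs ys s s' f assume h: "length xs + length ys + 1 = k" "set xs \<subseteq> S" "set ys \<subseteq> S" "s \<in> S" "s' \<in> S" "f \<in> C"
  have "fh (evn xs @ (0, smul f s + s') # evn ys) = smul f (fh (evn xs @ (0, s) # evn ys)) + fh (evn xs @ (0, s') # evn ys)"
    by (rule mlin_Clin_slot[OF mlin_fh Clin_fh]) (use h P.L.M.S_smul in auto)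
  then show "F k (xs @ (smul f s + s') # ys) = smulF f (F k (xs @ s # ys)) + F k (xs @ s' # ys)"
    by (intro ext) (simp add: F_def app)
qed

sublocale M: kap_mor C A S br rho D R R' F
  by unfold_locales (rule F_mC)

lemma kap_morphism: "hom P.AA.AZ X \<Longrightarrow> X \<noteq> [] \<Longrightarrow> cod M.f P.KF.lam 1 X = FX M.f Q.KF.lam X"
proof (rule M.morphism)
  fix a and Y :: "(int \<times> ('m \<Rightarrow> 'e)) list" assume a: "a \<in> A" and Y: "hom (V0 S) Y" "Y \<noteq> []"
  let ?f = "\<lambda>Z. F (length Z) (map snd Z) []"
  let ?\<phi> = "\<lambda>W :: (int \<times> ('m \<Rightarrow> 'e)) list. if length W = 1 then snd (hd W) else 0"
  have f: "?f Z = fh Z" if "hom (V0 S) Z" for Z using evn_hom[OF that] by (simp add: F_def)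
  have u: "unary ?\<phi>" by (simp add: unary_def)
  have "cod ?f (P.q a) 0 Y = cod fh (P.q a) 0 Y"
    by (rule cod_cong[OF f refl P.maps_q[OF a] Y(1)])
  also have "\<dots> = FF mm P.nb (cod ?\<phi> (Q.q a) 0) Y"
    unfolding fh_def fhat_def
    by (rule FF_intertwine[OF P.EV.even_struct_axioms even2 _ mlin_proj Y(1) a]) (simp add: P.q_single Q.q_single)
  \<comment> \<open>An equality of functions, so that it can be rewritten under \<open>FF\<close>;
    on the empty list it rests on \<open>R_0\<close>.\<close>
  also have "cod ?\<phi> (Q.q a) 0 = Q.q a"
  proof
    fix Z show "cod ?\<phi> (Q.q a) 0 Z = Q.q a Z"
    proof (cases "Z = []")
      case True
      have "R' 0 [] [a] = 0" by (simp add: Q.R_0 form_apply)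
      then show ?thesis using True by (simp add: qop_def)
    next
      case False
      then show ?thesis using cod_of_unary[OF u False] by simp
    qed
  qed
  also have "FF mm P.nb (Q.q a) Y = FX fh (Q.q a) Y"
    unfolding fh_def by (rule FF_eq_FX[OF P.subS mn Q.mlin_q[OF a] Y(1)])
  also have "\<dots> = FX ?f (Q.q a) Y"
    by (rule FX_cong_fun[OF f[symmetric] Y(1)])
  finally show "cod ?f (P.q a) 0 Y = FX ?f (Q.q a) Y" .
qed

text \<open>The linear component commutes with contractions and fixes sections, so it is the
  identity. This gives the bijectivity required of an isomorphism.\<close>

lemma f_single: "w \<in> P.AA.AZ d \<Longrightarrow> M.f [(d, w)] = w"
proof
  fix as show "w \<in> P.AA.AZ d \<Longrightarrow> M.f [(d, w)] as = w as"
  proof (induction as arbitrary: d w)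
    case Nil
    show ?case by (simp add: insF_Nil F_def fh_def)
  next
    case (Cons a as)
    have "M.f [(d, w)] (a # as) = ctr a (M.f [(d, w)]) as" by (simp add: ctr_apply)
    also have "\<dots> = M.f [(d - 1, ctr a w)] as"
      using M.ctr_f[of "[(d, w)]" a] Cons.prems cod_unary_Cons[OF P.AA.D.closedV_AZ M.mlin_f P.AA.D.maps_iop P.AA.D.unary_iop, of "(d, w)" "[]" a] by simp
    also have "\<dots> = ctr a w as" by (rule Cons.IH[OF P.AA.AZ_ctr[OF Cons.prems]])
    finally show ?case by (simp add: ctr_apply)
  qed
qed

end

section \<open>Smooth functions and sections\<close>

text \<open>A short coordinate segment through a point of an open set stays in that set, so partial
  derivatives depend on local values only. The condition \<open>i < n\<close> keeps the segment
  inside the Euclidean space of sequences.\<close>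

lemma Euclidean_line:
  assumes "openin (Euclidean_space n) W" "x \<in> W" "i < n"
  shows "\<forall>\<^sub>F t in nhds (x i). x(i := t) \<in> W"
proof -
  have x: "\<forall>k\<ge>n. x k = 0"
    using openin_subset[OF assms(1)] assms(2) by (auto simp: topspace_Euclidean_space)
  have "continuous_map euclideanreal (Euclidean_space n) (\<lambda>t. x(i := t))"
    unfolding Euclidean_space_def continuous_map_in_subtopology continuous_map_componentwise_UNIV
    using x assms(3) by (auto simp: image_subset_iff)
  then have "open {t. x(i := t) \<in> W}"
    using openin_continuous_map_preimage[OF _ assms(1)] by fastforce
  then show ?thesis
    by (rule eventually_nhds_in_open[THEN eventually_mono]) (use assms in auto)
qed

lemma Ck_cont: "Ck_on n k W f \<Longrightarrow> continuous_map (subtopology (Euclidean_space n) W) euclideanreal f"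
  by (cases k) auto

lemma Ck_SucD:
  assumes "Ck_on n (Suc k) W f" "i < n"
  shows "Ck_on n k W (partial i f)"
    "x \<in> W \<Longrightarrow> ((\<lambda>t. f (x(i := t))) has_real_derivative partial i f x) (at (x i))"
proof -
  show "Ck_on n k W (partial i f)" using assms by simp
  show "x \<in> W \<Longrightarrow> ((\<lambda>t. f (x(i := t))) has_real_derivative partial i f x) (at (x i))"
    using assms by (simp add: DERIV_deriv_iff_real_differentiable partial_def)
qed

lemma Ck_cong:
  assumes W: "openin (Euclidean_space n) W" and "\<And>x. x \<in> W \<Longrightarrow> f x = g x" "Ck_on n k W f"
  shows "Ck_on n k W g"
  using assms(2,3)
proof (induction k arbitrary: f g)
  case 0
  then show ?case using continuous_map_eq[of "subtopology (Euclidean_space n) W" euclideanreal f g] by auto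
next
  case (Suc k)
  have c: "continuous_map (subtopology (Euclidean_space n) W) euclideanreal g"
    using continuous_map_eq[OF Ck_cont[OF Suc.prems(2)], of g] Suc.prems(1) by auto
  have d: "((\<lambda>t. g (x(i := t))) has_real_derivative partial i f x) (at (x i))" if "i < n" "x \<in> W" for i x
  proof -
    have "\<forall>\<^sub>F t in nhds (x i). g (x(i := t)) = f (x(i := t))"
      using Euclidean_line[OF W that(2,1)] by eventually_elim (rule Suc.prems(1)[symmetric])
    then show ?thesis
      by (rule DERIV_cong_ev[OF refl _ refl, THEN iffD2]) (rule Ck_SucD(2)[OF Suc.prems(2) that])
  qed
  have "Ck_on n k W (partial i g)" if i: "i < n" for i
  proof (rule Suc.IH[OF _ Ck_SucD(1)[OF Suc.prems(2) i]])
    fix x assume "x \<in> W"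
    then show "partial i f x = partial i g x"
      using DERIV_imp_deriv[OF d[OF i]] by (simp add: partial_def)
  qed
  then show ?case using c d by (auto simp: real_differentiable_def)
qed

lemma Ck_SucI:
  assumes W: "openin (Euclidean_space n) W" and c: "continuous_map (subtopology (Euclidean_space n) W) euclideanreal f"
    and "\<And>i. i < n \<Longrightarrow> Ck_on n k W (h i)"
    and d: "\<And>i x. i < n \<Longrightarrow> x \<in> W \<Longrightarrow> ((\<lambda>t. f (x(i := t))) has_real_derivative h i x) (at (x i))"
  shows "Ck_on n (Suc k) W f"
proof -
  have "Ck_on n k W (partial i f)" if i: "i < n" for i
  proof (rule Ck_cong[OF W _ assms(3)[OF i]])
    fix x assume "x \<in> W"
    then show "h i x = partial i f x" using DERIV_imp_deriv[OF d[OF i]] by (simp add: partial_def)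
  qed
  then show ?thesis using c d by (auto simp: real_differentiable_def)
qed

lemma Ck_Suc_le: "Ck_on n (Suc k) W f \<Longrightarrow> Ck_on n k W f"
  by (induction k arbitrary: f) auto

lemma Ck_mono: "Ck_on n k W f \<Longrightarrow> W' \<subseteq> W \<Longrightarrow> Ck_on n k W' f"
  by (induction k arbitrary: f) (auto intro: continuous_map_from_subtopology_mono)

lemma Ck_const:
  assumes W: "openin (Euclidean_space n) W" shows "Ck_on n k W (\<lambda>_. c)"
proof (induction k arbitrary: c)
  case (Suc k)
  show ?case by (rule Ck_SucI[OF W _ Suc]) (auto intro!: derivative_eq_intros)
qed simp

lemma Ck_add:
  assumes W: "openin (Euclidean_space n) W" and "Ck_on n k W f" "Ck_on n k W g"
  shows "Ck_on n k W (\<lambda>x. f x + g x)"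
  using assms(2,3)
proof (induction k arbitrary: f g)
  case (Suc k)
  show ?case
  proof (rule Ck_SucI[OF W continuous_map_add[OF Ck_cont[OF Suc.prems(1)] Ck_cont[OF Suc.prems(2)]]])
    show "Ck_on n k W (\<lambda>x. partial i f x + partial i g x)" if "i < n" for i
      by (intro Suc.IH Ck_SucD(1)[OF _ that] Suc.prems)
    show "((\<lambda>t. f (x(i := t)) + g (x(i := t))) has_real_derivative partial i f x + partial i g x) (at (x i))"
      if "i < n" "x \<in> W" for i x
      by (rule DERIV_add[OF Ck_SucD(2)[OF Suc.prems(1) that] Ck_SucD(2)[OF Suc.prems(2) that]])
  qed
qed (simp add: continuous_map_add)

lemma Ck_mult:
  assumes W: "openin (Euclidean_space n) W" and "Ck_on n k W f" "Ck_on n k W g"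
  shows "Ck_on n k W (\<lambda>x. f x * g x)"
  using assms(2,3)
proof (induction k arbitrary: f g)
  case (Suc k)
  show ?case
  proof (rule Ck_SucI[OF W continuous_map_real_mult[OF Ck_cont[OF Suc.prems(1)] Ck_cont[OF Suc.prems(2)]]])
    show "Ck_on n k W (\<lambda>x. partial i f x * g x + partial i g x * f x)" if "i < n" for i
      by (intro Ck_add[OF W] Suc.IH Ck_SucD(1)[OF _ that] Suc.prems Ck_Suc_le)
    show "((\<lambda>t. f (x(i := t)) * g (x(i := t))) has_real_derivative partial i f x * g x + partial i g x * f x) (at (x i))"
      if "i < n" "x \<in> W" for i x
      using DERIV_mult[OF Ck_SucD(2)[OF Suc.prems(1) that] Ck_SucD(2)[OF Suc.prems(2) that]] unfolding fun_upd_triv .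
  qed
qed (simp add: continuous_map_real_mult)

text \<open>Continuity is glued by the pasting lemma. Differentiability is a condition at each
  point, and the partial derivatives inherit the local hypothesis with one order less.\<close>

lemma Ck_local:
  assumes "\<And>x. x \<in> W \<Longrightarrow> \<exists>V. x \<in> V \<and> V \<subseteq> W \<and> openin (Euclidean_space n) V \<and> Ck_on n k V f"
  shows "Ck_on n k W f"
  using assms
proof (induction k arbitrary: f)
  have c: "continuous_map (subtopology (Euclidean_space n) W) euclideanreal f"
    if h: "\<And>x. x \<in> W \<Longrightarrow> \<exists>V. x \<in> V \<and> V \<subseteq> W \<and> openin (Euclidean_space n) V \<and> continuous_map (subtopology (Euclidean_space n) V) euclideanreal f" for f
  proof (rule pasting_lemma[where I = "{V. V \<subseteq> W \<and> openin (Euclidean_space n) V \<and> continuous_map (subtopology (Euclidean_space n) V) euclideanreal f}"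
        and T = "\<lambda>V. V" and f = "\<lambda>_. f"])
    fix V assume V: "V \<in> {V. V \<subseteq> W \<and> openin (Euclidean_space n) V \<and> continuous_map (subtopology (Euclidean_space n) V) euclideanreal f}"
    then have "W \<inter> V = V" by blast
    then show "continuous_map (subtopology (subtopology (Euclidean_space n) W) V) euclideanreal f"
      using V by (simp add: subtopology_subtopology)
    show "openin (subtopology (Euclidean_space n) W) V" using V openin_subset_topspace_eq by (auto simp: openin_subtopology)
  qed (use h in auto)
  {
    case 0 show ?case using c 0 by simp
  next
    case (Suc k)
    have "continuous_map (subtopology (Euclidean_space n) W) euclideanreal f"
    proof (rule c)
      fix x assume "x \<in> W"
      from Suc.prems[OF this] obtain V where V: "x \<in> V" "V \<subseteq> W" "openin (Euclidean_space n) V" "Ck_on n (Suc k) V f" by (elim exE conjE)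
      show "\<exists>V. x \<in> V \<and> V \<subseteq> W \<and> openin (Euclidean_space n) V \<and> continuous_map (subtopology (Euclidean_space n) V) euclideanreal f"
        by (intro exI[of _ V] conjI V(1-3) Ck_cont[OF V(4)])
    qed
    moreover have "Ck_on n k W (partial i f)" if "i < n" for i
    proof (rule Suc.IH)
      fix x assume "x \<in> W"
      from Suc.prems[OF this] obtain V where V: "x \<in> V" "V \<subseteq> W" "openin (Euclidean_space n) V" "Ck_on n (Suc k) V f" by (elim exE conjE)
      show "\<exists>V. x \<in> V \<and> V \<subseteq> W \<and> openin (Euclidean_space n) V \<and> Ck_on n k V (partial i f)"
        by (intro exI[of _ V] conjI V(1-3) Ck_SucD(1)[OF V(4) that])
    qed
    moreover have "(\<lambda>t. f (x(i := t))) differentiable (at (x i))" if "i < n" "x \<in> W" for i x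
    proof -
      from Suc.prems[OF that(2)] obtain V where V: "x \<in> V" "Ck_on n (Suc k) V f" by (elim exE conjE)
      show ?thesis using Ck_SucD(2)[OF V(2) that(1) V(1)] by (auto simp only: real_differentiable_def)
    qed
    ultimately show ?case by simp
  }
qed

locale smooth_mfd =
  fixes M :: "('m::{t2_space,second_countable_topology}) manifold"
  assumes M: "smooth_manifold M"
begin

lemma chart_open:
  assumes "(U, \<phi>) \<in> charts M" "open W"
  shows "openin (Euclidean_space (mdim M)) (\<phi> ` (U \<inter> W))"
proof -
  have c: "openin (Euclidean_space (mdim M)) (\<phi> ` U)"
    "homeomorphic_map (top_of_set U) (subtopology (Euclidean_space (mdim M)) (\<phi> ` U)) \<phi>"
    using M assms unfolding smooth_manifold_def by auto
  have "openin (top_of_set U) (U \<inter> W)" using assms(2) by (simp add: openin_open_Int)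
  then have "openin (subtopology (Euclidean_space (mdim M)) (\<phi> ` U)) (\<phi> ` (U \<inter> W))"
    using homeomorphic_map_openness[OF c(2), of "U \<inter> W"] by simp
  then show ?thesis using c(1) openin_trans_full by blast
qed

lemma chart_inv:
  assumes "(U, \<phi>) \<in> charts M" "y \<in> \<phi> ` (U \<inter> W)"
  shows "inv_into U \<phi> y \<in> U \<inter> W" "\<phi> (inv_into U \<phi> y) = y"
proof -
  have "homeomorphic_map (top_of_set U) (subtopology (Euclidean_space (mdim M)) (\<phi> ` U)) \<phi>"
    using M assms unfolding smooth_manifold_def by auto
  then have "inj_on \<phi> U" using homeomorphic_imp_injective_map by fastforce
  then show "inv_into U \<phi> y \<in> U \<inter> W" "\<phi> (inv_into U \<phi> y) = y" using assms(2) by auto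
qed

lemma sfI: "(\<And>U \<phi> k. (U, \<phi>) \<in> charts M \<Longrightarrow> Ck_on (mdim M) k (\<phi> ` (U \<inter> W)) (\<lambda>y. f (inv_into U \<phi> y))) \<Longrightarrow> smooth_fun_on M W f"
  by (auto simp: smooth_fun_on_def smooth_on_def)

lemma sfD: "smooth_fun_on M W f \<Longrightarrow> (U, \<phi>) \<in> charts M \<Longrightarrow> Ck_on (mdim M) k (\<phi> ` (U \<inter> W)) (\<lambda>y. f (inv_into U \<phi> y))"
  by (auto simp: smooth_fun_on_def smooth_on_def)

lemma sf_const: "open W \<Longrightarrow> smooth_fun_on M W (\<lambda>_. c)"
  by (intro sfI Ck_const chart_open)

lemma sf_add:
  assumes "open W" "smooth_fun_on M W f" "smooth_fun_on M W g"
  shows "smooth_fun_on M W (\<lambda>x. f x + g x)"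
proof (rule sfI)
  fix U \<phi> k assume c: "(U, \<phi>) \<in> charts M"
  show "Ck_on (mdim M) k (\<phi> ` (U \<inter> W)) (\<lambda>y. f (inv_into U \<phi> y) + g (inv_into U \<phi> y))"
    by (rule Ck_add[OF chart_open[OF c assms(1)] sfD[OF assms(2) c] sfD[OF assms(3) c]])
qed

lemma sf_mult:
  assumes "open W" "smooth_fun_on M W f" "smooth_fun_on M W g"
  shows "smooth_fun_on M W (\<lambda>x. f x * g x)"
proof (rule sfI)
  fix U \<phi> k assume c: "(U, \<phi>) \<in> charts M"
  show "Ck_on (mdim M) k (\<phi> ` (U \<inter> W)) (\<lambda>y. f (inv_into U \<phi> y) * g (inv_into U \<phi> y))"
    by (rule Ck_mult[OF chart_open[OF c assms(1)] sfD[OF assms(2) c] sfD[OF assms(3) c]])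
qed

lemma sf_sum:
  assumes "open W"
  shows "(\<And>i. i < (r::nat) \<Longrightarrow> smooth_fun_on M W (f i)) \<Longrightarrow> smooth_fun_on M W (\<lambda>x. \<Sum>i<r. f i x)"
proof (induction r)
  case 0
  show ?case using sf_const[OF assms, of 0] by simp
next
  case (Suc r)
  show ?case using sf_add[OF assms Suc.IH Suc.prems[of r]] Suc.prems by simp
qed

lemma sf_mono:
  assumes "smooth_fun_on M W f" "W' \<subseteq> W" shows "smooth_fun_on M W' f"
proof (rule sfI)
  fix U \<phi> k assume c: "(U, \<phi>) \<in> charts M"
  show "Ck_on (mdim M) k (\<phi> ` (U \<inter> W')) (\<lambda>y. f (inv_into U \<phi> y))"
    by (rule Ck_mono[OF sfD[OF assms(1) c]]) (use assms(2) in blast)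
qed

lemma sf_cong:
  assumes "open W" "\<And>x. x \<in> W \<Longrightarrow> f x = g x" "smooth_fun_on M W f"
  shows "smooth_fun_on M W g"
proof (rule sfI)
  fix U \<phi> k assume c: "(U, \<phi>) \<in> charts M"
  show "Ck_on (mdim M) k (\<phi> ` (U \<inter> W)) (\<lambda>y. g (inv_into U \<phi> y))"
  proof (rule Ck_cong[OF chart_open[OF c assms(1)] _ sfD[OF assms(3) c]])
    fix y assume "y \<in> \<phi> ` (U \<inter> W)"
    from chart_inv(1)[OF c this] show "f (inv_into U \<phi> y) = g (inv_into U \<phi> y)" using assms(2) by simp
  qed
qed

lemma sf_local:
  assumes "open W" "\<And>x. x \<in> W \<Longrightarrow> \<exists>V. x \<in> V \<and> open V \<and> smooth_fun_on M (V \<inter> W) f"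
  shows "smooth_fun_on M W f"
proof (rule sfI, rule Ck_local)
  fix U \<phi> k y assume c: "(U, \<phi>) \<in> charts M" and y: "y \<in> \<phi> ` (U \<inter> W)"
  have x: "inv_into U \<phi> y \<in> U \<inter> W" "\<phi> (inv_into U \<phi> y) = y" using chart_inv[OF c y] by auto
  then obtain V where V: "inv_into U \<phi> y \<in> V" "open V" "smooth_fun_on M (V \<inter> W) f" using assms(2) by blast
  have "y \<in> \<phi> ` (U \<inter> (V \<inter> W))" using x V(1) by (metis IntD1 IntD2 IntI image_eqI)
  moreover have "openin (Euclidean_space (mdim M)) (\<phi> ` (U \<inter> (V \<inter> W)))"
    by (rule chart_open[OF c open_Int[OF V(2) assms(1)]])
  ultimately show "\<exists>Z. y \<in> Z \<and> Z \<subseteq> \<phi> ` (U \<inter> W) \<and> openin (Euclidean_space (mdim M)) Z \<and> Ck_on (mdim M) k Z (\<lambda>y. f (inv_into U \<phi> y))"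
    using sfD[OF V(3) c] by (intro exI[of _ "\<phi> ` (U \<inter> (V \<inter> W))"]) auto
qed

lemma cring_Cinf: "cring (Cinf M)"
  by unfold_locales (auto simp: Cinf_def plus_fun_def intro: sf_const sf_mult sf_add)

end

section \<open>Frames, sections and bundle maps\<close>

lemma span_coeff:
  assumes "inj_on e {..<r::nat}" "v \<in> span (e ` {..<r})"
  shows "\<exists>c. v = (\<Sum>i<r. c i *\<^sub>R e i)"
proof -
  obtain u where "v = (\<Sum>w\<in>e ` {..<r}. u w *\<^sub>R w)" using assms(2) by (auto simp: span_finite)
  also have "\<dots> = (\<Sum>i<r. u (e i) *\<^sub>R e i)" using sum.reindex[OF assms(1)] by (simp add: comp_def)
  finally show ?thesis by (rule exI[of _ "\<lambda>i. u (e i)"])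
qed

lemma coeff_unique:
  assumes "inj_on e {..<r::nat}" "independent (e ` {..<r})" "(\<Sum>i<r. a i *\<^sub>R e i) = (\<Sum>i<r. b i *\<^sub>R e i)" "i < r"
  shows "a i = (b i :: real)"
proof -
  let ?u = "\<lambda>w. a (inv_into {..<r} e w) - b (inv_into {..<r} e w)"
  have "(\<Sum>w\<in>e ` {..<r}. ?u w *\<^sub>R w) = (\<Sum>i<r. (a i - b i) *\<^sub>R e i)"
    using sum.reindex[OF assms(1), of "\<lambda>w. ?u w *\<^sub>R w"] assms(1) by (simp add: comp_def)
  also have "\<dots> = 0" using assms(3) by (simp add: scaleR_diff_left sum_subtractf)
  finally have "?u (e i) = 0"
    using independentD[OF assms(2) _ subset_refl, of ?u "e i"] assms(4) by simp
  then show ?thesis using assms(1,4) by simp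
qed

lemma lin_on_sum:
  assumes "subspace T" "lin_on T h" "\<And>i. i < (r::nat) \<Longrightarrow> e i \<in> T"
  shows "h (\<Sum>i<r. g i *\<^sub>R e i) = (\<Sum>i<r. g i *\<^sub>R h (e i))"
  using assms(3)
proof (induction r)
  case 0 then show ?case using lin_on_simps(1)[OF assms(1,2)] by simp
next
  case (Suc r)
  have s: "(\<Sum>i<r. g i *\<^sub>R e i) \<in> T"
    using Suc.prems assms(1) by (intro subspace_sum subspace_scale) auto
  show ?case
    using lin_onD[OF assms(2) Suc.prems[of r] s, of "g r"] Suc by (simp add: add.commute)
qed

context smooth_mfd
begin

lemma frameD:
  assumes "vector_bundle M E" "(U, e) \<in> frames E"
  shows "open U" "x \<in> U \<Longrightarrow> inj_on (\<lambda>i. e i x) {..<vrank E}" "x \<in> U \<Longrightarrow> independent ((\<lambda>i. e i x) ` {..<vrank E})"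
    "x \<in> U \<Longrightarrow> span ((\<lambda>i. e i x) ` {..<vrank E}) = fib E x" "x \<in> U \<Longrightarrow> i < vrank E \<Longrightarrow> e i x \<in> fib E x"
    "i < vrank E \<Longrightarrow> smooth_section_on M E U (e i)"
  using assms unfolding vector_bundle_def smooth_frame_def smooth_section_on_def by fast+

lemma frame_at:
  assumes "vector_bundle M E" obtains U e where "(U, e) \<in> frames E" "x \<in> U"
proof -
  have "x \<in> (\<Union>(U, e)\<in>frames E. U)" using assms unfolding vector_bundle_def by simp
  then show ?thesis using that by auto
qed

lemma subspace_fib: "vector_bundle M E \<Longrightarrow> subspace (fib E x)"
  using frameD(4) frame_at by (metis subspace_span)

lemma section_fib: "s \<in> sections M E \<Longrightarrow> s x \<in> fib E x"
  by (auto simp: sections_def smooth_section_on_def)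

lemma Cmod_sections:
  assumes E: "vector_bundle M E"
  shows "Cmod (Cinf M) (sections M E)"
  unfolding Cmod_def
proof (intro conjI ballI)
  have "smooth_section_on M E UNIV 0"
    unfolding smooth_section_on_def
  proof (intro conjI ballI, goal_cases)
    case 1 then show ?case using subspace_0[OF subspace_fib[OF E]] by (simp add: zero_fun_apply)
  next
    case (2 p)
    then obtain U e where p: "p = (U, e)" "(U, e) \<in> frames E" by (cases p) auto
    have "\<exists>g. (\<forall>i<vrank E. smooth_fun_on M (U \<inter> UNIV) (g i)) \<and> (\<forall>x\<in>U \<inter> UNIV. 0 x = (\<Sum>i<vrank E. g i x *\<^sub>R e i x))"
      using sf_const[OF frameD(1)[OF E p(2)], of 0] by (intro exI[of _ "\<lambda>_ _. 0"]) (simp add: zero_fun_apply)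
    then show ?case by (simp add: p)
  qed
  then show "0 \<in> sections M E" by (simp add: sections_def)
  fix f s t assume h: "f \<in> Cinf M" "s \<in> sections M E" "t \<in> sections M E"
  have "smooth_section_on M E UNIV (smul f s + t)"
    unfolding smooth_section_on_def
  proof (intro conjI ballI, goal_cases)
    case (1 x)
    show ?case using section_fib[OF h(2), of x] section_fib[OF h(3), of x] subspace_fib[OF E, of x]
      by (simp add: plus_fun_apply smul_def subspace_add subspace_scale)
  next
    case (2 p)
    then obtain U e where p: "p = (U, e)" "(U, e) \<in> frames E" by (cases p) auto
    obtain g where g: "\<And>i. i < vrank E \<Longrightarrow> smooth_fun_on M U (g i)" "\<And>x. x \<in> U \<Longrightarrow> s x = (\<Sum>i<vrank E. g i x *\<^sub>R e i x)"
      using h(2) p(2) unfolding sections_def smooth_section_on_def by fastforce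
    obtain g' where g': "\<And>i. i < vrank E \<Longrightarrow> smooth_fun_on M U (g' i)" "\<And>x. x \<in> U \<Longrightarrow> t x = (\<Sum>i<vrank E. g' i x *\<^sub>R e i x)"
      using h(3) p(2) unfolding sections_def smooth_section_on_def by fastforce
    have f: "smooth_fun_on M U f" using h(1) sf_mono by (auto simp: Cinf_def)
    note U = frameD(1)[OF E p(2)]
    have "\<exists>G. (\<forall>i<vrank E. smooth_fun_on M (U \<inter> UNIV) (G i)) \<and> (\<forall>x\<in>U \<inter> UNIV. (smul f s + t) x = (\<Sum>i<vrank E. G i x *\<^sub>R e i x))"
    proof (intro exI[of _ "\<lambda>i x. f x * g i x + g' i x"] conjI allI impI ballI)
      show "smooth_fun_on M (U \<inter> UNIV) (\<lambda>x. f x * g i x + g' i x)" if "i < vrank E" for i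
        using sf_add[OF U sf_mult[OF U f g(1)[OF that]] g'(1)[OF that]] by simp
      show "(smul f s + t) x = (\<Sum>i<vrank E. (f x * g i x + g' i x) *\<^sub>R e i x)" if "x \<in> U \<inter> UNIV" for x
        using g(2)[of x] g'(2)[of x] that
        by (simp add: plus_fun_apply smul_def scaleR_add_left sum.distrib scaleR_sum_right)
    qed
    then show ?case by (simp add: p)
  qed
  then show "smul f s + t \<in> sections M E" by (simp add: sections_def)
qed

lemma bundle_map_lin_on: "bundle_map M E F h \<Longrightarrow> lin_on (fib E x) (h x)"
  by (auto simp: bundle_map_def lin_on_def)

text \<open>In a frame of \<open>F\<close> the coefficients of the image exist pointwise and are
  unique. Near each point they must equal the sums of products of the coefficients of
  \<open>s\<close> in a frame of \<open>E\<close> with those of \<open>h\<close> on that frame;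
  these are smooth, and smoothness is local.\<close>

lemma on_sections_section:
  assumes E: "vector_bundle M E" and F: "vector_bundle M F" and h: "bundle_map M E F h" and s: "s \<in> sections M E"
  shows "on_sections h s \<in> sections M F"
  unfolding sections_def mem_Collect_eq smooth_section_on_def
proof (intro conjI ballI, goal_cases)
  have fibF: "on_sections h s x \<in> fib F x" for x
    using h section_fib[OF s, of x] by (auto simp: bundle_map_def on_sections_def)
  { case (1 x) show ?case by (rule fibF) }
  case (2 p)
  then obtain V e' where p: "p = (V, e')" "(V, e') \<in> frames F" by (cases p) auto
  note V = frameD[OF F p(2)]
  have "\<exists>c. \<forall>x\<in>V. on_sections h s x = (\<Sum>j<vrank F. c x j *\<^sub>R e' j x)"
    by (rule bchoice) (use span_coeff[OF V(2)] V(4) fibF in auto)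
  then obtain c where c: "\<And>x. x \<in> V \<Longrightarrow> on_sections h s x = (\<Sum>j<vrank F. c x j *\<^sub>R e' j x)" by blast
  have "smooth_fun_on M V (\<lambda>x. c x j)" if j: "j < vrank F" for j
  proof (rule sf_local[OF V(1)])
    fix x assume "x \<in> V"
    obtain U e where U: "(U, e) \<in> frames E" "x \<in> U" using frame_at[OF E] by blast
    obtain g where g: "\<And>i. i < vrank E \<Longrightarrow> smooth_fun_on M U (g i)" "\<And>x. x \<in> U \<Longrightarrow> s x = (\<Sum>i<vrank E. g i x *\<^sub>R e i x)"
      using s U(1) unfolding sections_def smooth_section_on_def by fastforce
    have "\<forall>i\<in>{..<vrank E}. \<exists>G. (\<forall>j<vrank F. smooth_fun_on M (V \<inter> U) (G j)) \<and> (\<forall>y\<in>V \<inter> U. h y (e i y) = (\<Sum>j<vrank F. G j y *\<^sub>R e' j y))"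
      using h U(1) p(2) unfolding bundle_map_def smooth_section_on_def by fastforce
    from bchoice[OF this] obtain G where G: "\<And>i j. i < vrank E \<Longrightarrow> j < vrank F \<Longrightarrow> smooth_fun_on M (V \<inter> U) (G i j)"
      "\<And>i y. i < vrank E \<Longrightarrow> y \<in> V \<inter> U \<Longrightarrow> h y (e i y) = (\<Sum>j<vrank F. G i j y *\<^sub>R e' j y)" by auto
    have UV: "open (U \<inter> V)" using frameD(1)[OF E U(1)] V(1) by auto
    have sm: "smooth_fun_on M (U \<inter> V) (\<lambda>y. \<Sum>i<vrank E. g i y * G i j y)"
      by (intro sf_sum UV sf_mult sf_mono[OF g(1)] sf_mono[OF G(1)] j) auto
    have eq: "(\<Sum>i<vrank E. g i y * G i j y) = c y j" if y: "y \<in> U \<inter> V" for y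
    proof (rule coeff_unique[OF V(2) V(3) _ j])
      show "y \<in> V" "y \<in> V" using y by auto
      have "(\<Sum>j<vrank F. c y j *\<^sub>R e' j y) = h y (s y)" using c[of y] y by (simp add: on_sections_def)
      also have "\<dots> = (\<Sum>i<vrank E. g i y *\<^sub>R h y (e i y))"
        unfolding g(2)[OF IntD1[OF y]]
        by (rule lin_on_sum[OF subspace_fib[OF E] bundle_map_lin_on[OF h] frameD(5)[OF E U(1)]]) (use y in auto)
      also have "\<dots> = (\<Sum>i<vrank E. \<Sum>j<vrank F. (g i y * G i j y) *\<^sub>R e' j y)"
        by (rule sum.cong) (use G(2) y in \<open>auto simp: scaleR_sum_right\<close>)
      also have "\<dots> = (\<Sum>j<vrank F. \<Sum>i<vrank E. (g i y * G i j y) *\<^sub>R e' j y)" by (rule sum.swap)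
      finally show "(\<Sum>j<vrank F. (\<Sum>i<vrank E. g i y * G i j y) *\<^sub>R e' j y) = (\<Sum>j<vrank F. c y j *\<^sub>R e' j y)"
        by (simp add: scaleR_sum_left)
    qed
    have "smooth_fun_on M (U \<inter> V) (\<lambda>x. c x j)"
      by (rule sf_cong[OF UV eq sm])
    then show "\<exists>U. x \<in> U \<and> open U \<and> smooth_fun_on M (U \<inter> V) (\<lambda>x. c x j)"
      by (intro exI[of _ U] conjI U(2) frameD(1)[OF E U(1)])
  qed
  then have "\<exists>g. (\<forall>i<vrank F. smooth_fun_on M (V \<inter> UNIV) (g i)) \<and> (\<forall>x\<in>V \<inter> UNIV. on_sections h s x = (\<Sum>i<vrank F. g i x *\<^sub>R e' i x))"
    using c by (intro exI[of _ "\<lambda>j x. c x j"]) auto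
  then show ?case by (simp add: p)
qed

lemma on_sections_lin:
  assumes h: "bundle_map M E F h" and s: "s \<in> sections M E" "t \<in> sections M E"
  shows "on_sections h (smul f s + t) = smul f (on_sections h s) + on_sections h t"
proof
  fix x show "on_sections h (smul f s + t) x = (smul f (on_sections h s) + on_sections h t) x"
    using lin_onD[OF bundle_map_lin_on[OF h] section_fib[OF s(1), of x] section_fib[OF s(2)], of "f x"]
    by (simp add: on_sections_def plus_fun_apply smul_def)
qed

text \<open>Over a frame the derivative along \<open>X\<close> is a combination, with smooth
  coefficients, of the derivatives along the frame sections.\<close>

lemma anchor_Cinf:
  assumes L: "lie_algebroid M L" and X: "X \<in> sections M L" and f: "f \<in> Cinf M"
  shows "anchor_der L X f \<in> Cinf M"
  unfolding Cinf_def mem_Collect_eq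
proof (rule sf_local)
  have E: "vector_bundle M L" using L by (simp add: lie_algebroid_def)
  have lin: "lin_on (fib L x) (\<lambda>v. anchor L x v f)" for x
    using L f unfolding lie_algebroid_def lin_on_def by simp
  fix x :: 'm
  obtain U e where U: "(U, e) \<in> frames L" "x \<in> U" using frame_at[OF E] by blast
  obtain g where g: "\<And>i. i < vrank L \<Longrightarrow> smooth_fun_on M U (g i)" "\<And>x. x \<in> U \<Longrightarrow> X x = (\<Sum>i<vrank L. g i x *\<^sub>R e i x)"
    using X U(1) unfolding sections_def smooth_section_on_def by fastforce
  note oU = frameD(1)[OF E U(1)]
  have "smooth_fun_on M U (anchor_der L (e i) f)" if "i < vrank L" for i
    using L U(1) f that unfolding lie_algebroid_def by fast
  then have sm: "smooth_fun_on M U (\<lambda>y. \<Sum>i<vrank L. g i y * anchor_der L (e i) f y)"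
    by (intro sf_sum oU sf_mult g(1))
  have eq: "(\<Sum>i<vrank L. g i y * anchor_der L (e i) f y) = anchor_der L X f y" if "y \<in> U" for y
  proof -
    have "anchor L y (\<Sum>i<vrank L. g i y *\<^sub>R e i y) f = (\<Sum>i<vrank L. g i y *\<^sub>R anchor L y (e i y) f)"
      by (rule lin_on_sum[where h = "\<lambda>v. anchor L y v f", OF subspace_fib[OF E] lin frameD(5)[OF E U(1)]]) (use that in auto)
    then show ?thesis using g(2)[OF that] by (simp add: anchor_der_def)
  qed
  have "smooth_fun_on M (U \<inter> UNIV) (anchor_der L X f)"
    unfolding Int_UNIV_right by (rule sf_cong[OF oU eq sm])
  then show "\<exists>V. x \<in> V \<and> open V \<and> smooth_fun_on M (V \<inter> UNIV) (anchor_der L X f)"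
    by (intro exI[of _ U] conjI U(2) oU)
qed simp

end

section \<open>The Kapranov Leibniz algebra\<close>

lemma degs_snd: "length ds = length vs \<Longrightarrow> map snd (degs ds vs) = vs"
  by simp

lemma degs_upd:
  assumes "length ds = length vs" "i < length vs"
  shows "degs (ds[i := d]) (vs[i := w]) = take i (degs ds vs) @ (int d, w) # drop (Suc i) (degs ds vs)"
proof -
  have "degs (ds[i := d]) (vs[i := w]) = (degs ds vs)[i := (int d, w)]"
    unfolding map_update by (simp add: zip_update)
  then show ?thesis using assms by (simp add: upd_conv_take_nth_drop)
qed

lemma dg_degs: "length ds = length vs \<Longrightarrow> dg (degs ds vs) = int (sum_list ds)"
  by (induction rule: list_induct2) simp_all

lemma dg_degs_take: "length ds = length vs \<Longrightarrow> dg (take i (degs ds vs)) = int (sum_list (take i ds))"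
proof (induction arbitrary: i rule: list_induct2)
  case (Cons d ds v vs)
  then show ?case by (cases i) simp_all
qed simp

lemma homogeneous_hom:
  assumes "homogeneous V ds vs" "\<And>p. V p = Z (int p)"
  shows "length ds = length vs" "hom Z (degs ds vs)"
proof -
  show "length ds = length vs" using assms(1) by (simp add: homogeneous_def list_all2_lengthD)
  show "hom Z (degs ds vs)"
    using assms(1) unfolding homogeneous_def
    by (induction rule: list_all2_induct) (simp_all add: assms(2))
qed

lemma hom_split: "hom Z X \<Longrightarrow> hom Z (take i X) \<and> hom Z (drop j X)"
  by (auto simp: hom_def dest: in_set_takeD in_set_dropD)

text \<open>Passes from lists tagged with integer degrees to plain lists with a separate list of
  natural degrees.\<close>

lemma graded_multilinear_I:
  assumes V: "\<And>p. V p = Z (int p)" and m: "\<And>X. hom Z X \<Longrightarrow> X \<noteq> [] \<Longrightarrow> m (map snd X) = f X"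
    and f: "maps Z f Z (int e)" "mlin Z f" and k: "k \<ge> 1" and Z: "closedV Z"
  shows "graded_multilinear V V e k m"
  unfolding graded_multilinear_def
proof (intro allI impI, elim conjE, intro conjI allI impI ballI)
  fix ds :: "nat list" and vs :: "'a list" assume l: "length vs = k" and h: "homogeneous V ds vs"
  note H = homogeneous_hom[OF h V]
  let ?X = "degs ds vs"
  have X: "?X \<noteq> []" "map snd ?X = vs" using l k H(1) by auto
  have mX: "m vs = f ?X" using m[OF H(2) X(1)] X(2) by simp
  show "m vs \<in> V (sum_list ds + e)"
    unfolding mX V by (rule mapsD[OF f(1) X(1) H(2)]) (use dg_degs[OF H(1)] in simp)
  fix i u c assume i: "i < k" and u: "u \<in> V (ds ! i)"
  have vi: "vs ! i \<in> Z (int (ds ! i))"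
    using h i l unfolding homogeneous_def V[symmetric] by (auto simp: list_all2_conv_all_nth)
  have u: "u \<in> Z (int (ds ! i))" using u V by simp
  have up: "m (vs[i := w]) = f (take i ?X @ (int (ds ! i), w) # drop (Suc i) ?X)" if "w \<in> Z (int (ds ! i))" for w
  proof -
    have e: "degs ds (vs[i := w]) = take i ?X @ (int (ds ! i), w) # drop (Suc i) ?X"
      using degs_upd[OF H(1), of i "ds ! i" w] i l by simp
    have "m (map snd (degs ds (vs[i := w]))) = f (degs ds (vs[i := w]))"
      unfolding e by (rule m) (use hom_split[OF H(2)] that in auto)
    moreover have "map snd (degs ds (vs[i := w])) = vs[i := w]" using H(1) by (intro degs_snd) simp
    ultimately show ?thesis unfolding e by simp
  qed
  show "m (vs[i := c *\<^sub>R (vs ! i) + u]) = c *\<^sub>R m vs + m (vs[i := u])"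
    using up[OF closedV_lin[OF Z vi u, of c]] up[OF u] up[OF vi] hom_split[OF H(2)]
      mlinD[OF f(2) _ _ vi u, of "take i ?X" "drop (Suc i) ?X" c] by simp
qed

lemma multilinear_over_I:
  assumes V: "\<And>p. gcar V p = Z (int p)" and W: "gact W = gact V"
    and m: "\<And>X. \<lbrakk>hom Z X; X \<noteq> []; length X = k\<rbrakk> \<Longrightarrow> m (map snd X) = f X"
    and act: "\<And>a p d v. a \<in> dga_car A p \<Longrightarrow> v \<in> Z d \<Longrightarrow> gact V a v \<in> Z (int p + d)"
    and f: "\<And>a p X Y d u. a \<in> dga_car A p \<Longrightarrow> hom Z X \<Longrightarrow> hom Z Y \<Longrightarrow> u \<in> Z d \<Longrightarrow> length X + length Y + 1 = k \<Longrightarrow>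
      f (X @ (int p + d, gact V a u) # Y) = sg (int p * (int e + dg X)) *\<^sub>R gact V a (f (X @ (d, u) # Y))"
  shows "multilinear_over A V W e k m"
  unfolding multilinear_over_def
proof (intro allI impI ballI, elim conjE)
  fix ds :: "nat list" and vs i p a assume i: "i < k" and a: "a \<in> dga_car A p"
    and l: "length vs = k" and h: "homogeneous (gcar V) ds vs"
  note H = homogeneous_hom[OF h V]
  let ?X = "degs ds vs"
  have vi: "vs ! i \<in> Z (int (ds ! i))"
    using h i l unfolding homogeneous_def V[symmetric] by (auto simp: list_all2_conv_all_nth)
  have s: "hom Z (take i ?X)" "hom Z (drop (Suc i) ?X)" using hom_split[OF H(2)] by auto
  have ln: "length (take i ?X) + length (drop (Suc i) ?X) + 1 = k" using i l H(1) by simp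
  have up: "m (vs[i := w]) = f (take i ?X @ (int d, w) # drop (Suc i) ?X)" if "w \<in> Z (int d)" for w d
  proof -
    have e: "degs (ds[i := d]) (vs[i := w]) = take i ?X @ (int d, w) # drop (Suc i) ?X"
      by (rule degs_upd[OF H(1)]) (use i l in simp)
    have "m (map snd (take i ?X @ (int d, w) # drop (Suc i) ?X)) = f (take i ?X @ (int d, w) # drop (Suc i) ?X)"
      by (rule m) (use s that ln in auto)
    moreover have "map snd (degs (ds[i := d]) (vs[i := w])) = vs[i := w]" using H(1) by (intro degs_snd) simp
    ultimately show ?thesis unfolding e by simp
  qed
  have "m (vs[i := gact V a (vs ! i)]) = f (take i ?X @ (int p + int (ds ! i), gact V a (vs ! i)) # drop (Suc i) ?X)"
    using up[of "gact V a (vs ! i)" "p + ds ! i"] act[OF a vi] by simp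
  also have "\<dots> = sg (int p * (int e + dg (take i ?X))) *\<^sub>R gact V a (f (take i ?X @ (int (ds ! i), vs ! i) # drop (Suc i) ?X))"
    by (rule f[OF a s vi ln])
  also have "f (take i ?X @ (int (ds ! i), vs ! i) # drop (Suc i) ?X) = m vs"
    using up[OF vi] by simp
  also have "sg (int p * (int e + dg (take i ?X))) = (- 1) ^ (p * (e + sum_list (take i ds)))"
    unfolding dg_degs_take[OF H(1)] sg_power[symmetric] by simp
  finally show "m (vs[i := gact V a (vs ! i)]) = (- 1) ^ (p * (e + sum_list (take i ds))) *\<^sub>R gact W a (m vs)"
    unfolding W .
qed

text \<open>Adds the anchor acting on functions, which provides the differential of the scalar
  forms.\<close>

locale lie_pair_dg = lie_pair_alg C L S br rho nab A pr jj D R + K: lr_mod C A C br rho rho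
  for C :: "('m \<Rightarrow> real) set" and L :: "('m \<Rightarrow> 'v::real_vector) set"
    and S :: "('m \<Rightarrow> 'e::real_vector) set" and br rho nab A pr jj D R
begin

sublocale DG: lr_mod2 C A S br rho D ..

abbreviation "OM \<equiv> \<lparr>dga_car = AF C A C, dga_mul = wedge, dga_one = (\<lambda>as. if as = [] then (\<lambda>x. 1) else 0),
  dga_diff = ce_diff br A rho\<rparr>"

abbreviation "VM \<equiv> \<lparr>gcar = AF C A S, gact = wedge\<rparr>"

definition "kap ws = (if length ws = 1 then ce_diff br A D (hd ws) else insert_forms (map parity_twist ws) (R (length ws)))"

lemma kap_lam:
  assumes "hom AA.AZ X" "X \<noteq> []" shows "kap (map snd X) = KF.lam X"
proof (cases "length X = 1")
  case True
  then obtain x where "X = [x]" by (auto simp: length_Suc_conv)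
  then show ?thesis by (simp add: kap_def KF.lam_single)
next
  case False
  then show ?thesis using AA.D.insF_twist[OF R_mC assms(1)] by (simp add: kap_def KF.lam_multi)
qed

lemma K_AZ: "a \<in> AF C A C p \<Longrightarrow> a \<in> K.AZ (int p)" by simp

lemma wedge_one: "wedge (\<lambda>as. if as = [] then (\<lambda>x. 1) else 0) v = (v :: ('m, 'v, 'e) form)"
proof
  let ?o = "\<lambda>as :: ('m \<Rightarrow> 'v) list. if as = [] then (\<lambda>x :: 'm. 1 :: real) else 0"
  fix as show "wedge ?o v as = v as"
  proof (induction as arbitrary: v)
    case Nil show ?case by (simp add: wedge_Nil)
  next
    case (Cons a as)
    have z: "ctr a ?o = 0" unfolding ctr_0_iff by simp
    have "wedge ?o v (a # as) = ctr a (wedge ?o v) as" by (simp add: ctr_apply)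
    also have "ctr a (wedge ?o v) = wedge ?o (ctr a v)"
      by (subst ctr_wedge[of 0]) (simp_all add: z)
    also have "wedge ?o (ctr a v) as = ctr a v as" by (rule Cons.IH)
    finally show ?case by (simp add: ctr_apply)
  qed
qed

lemma wedge_assoc:
  assumes "a' \<in> AF C A C p'" "a \<in> AF C A C p"
  shows "wedge (wedge a' a) v = wedge a' (wedge a (v :: ('m, 'v, 'e) form))"
  unfolding wedge_eq[of _ v]
  by (rule DG.W.wedge_insert_wedge[OF K.AZ_out[OF K_AZ[OF assms(1)]] K.AZ_val[OF K_AZ[OF assms(1)]]
      K.AZ_out[OF K_AZ[OF assms(2)]] K.AZ_val[OF K_AZ[OF assms(2)]] DG.Clinear_smulF])

text \<open>The structure equation of the Kapranov operations on one argument.\<close>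

lemma ce_ce: "v \<in> AA.AZ d \<Longrightarrow> AA.ce (AA.ce v) = 0"
  using kap_leibniz[of "[(d, v)]"] by (simp add: KF.lam_single)

lemma dg_module_VM: "dg_module OM VM (\<lambda>v. kap [v])"
  unfolding dg_module_def gmodule.simps dga.simps
proof (intro conjI allI ballI)
  show "subspace (AF C A S q)" for q by (rule AA.subspace_AF)
  fix p q and a :: "('m, 'v, real) form" and v :: "('m, 'v, 'e) form"
  assume a: "a \<in> AF C A C p" and v: "v \<in> AF C A S q"
  have v': "v \<in> AA.AZ (int q)" using v by simp
  show "wedge a v \<in> AF C A S (p + q)"
    using DG.wedge_AZ[OF K_AZ[OF a] v'] AA.AZ_int[of "p + q"] by simp
  show "wedge (c *\<^sub>R a + a') v = c *\<^sub>R wedge a v + wedge a' v" for a' c by (simp add: wedge_simps)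
  show "wedge a (c *\<^sub>R v + v') = c *\<^sub>R wedge a v + wedge a v'" for v' c by (simp add: wedge_simps)
  show "wedge (wedge a' a) v = wedge a' (wedge a v)" if "a' \<in> AF C A C p'" for a' p' by (rule wedge_assoc[OF that a])
  show "kap [wedge a v] = wedge (ce_diff br A rho a) v + (- 1) ^ p *\<^sub>R wedge a (kap [v])"
    using DG.ce_wedge[OF K_AZ[OF a] v'] by (simp add: kap_def sg_power)
next
  fix q and v :: "('m, 'v, 'e) form" assume v: "v \<in> AF C A S q"
  have v': "v \<in> AA.AZ (int q)" using v by simp
  show "wedge (\<lambda>as. if as = [] then (\<lambda>x. 1) else 0) v = v" by (rule wedge_one)
  show "kap [v] \<in> AF C A S (q + 1)" using AA.ce_AZ[OF v'] AA.AZ_int[of "q + 1"] by (simp add: kap_def add.commute)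
  show "kap [kap [v]] = 0" using ce_ce[OF v'] by (simp add: kap_def)
  show "kap [c *\<^sub>R v + w] = c *\<^sub>R kap [v] + kap [w]" if "w \<in> AF C A S q" for w c
    using AA.ce_const[of v w c] AA.AF_val[OF v] AA.AF_val[OF that] by (simp add: kap_def)
qed

lemma act_AZ: "a \<in> dga_car OM p \<Longrightarrow> v \<in> AA.AZ d \<Longrightarrow> gact VM a v \<in> AA.AZ (int p + d)"
  using DG.wedge_AZ[OF K_AZ] by simp

lemma insF_act:
  assumes "\<And>k. k \<ge> 1 \<Longrightarrow> AA.D.mC k (\<Phi> k) r" "a \<in> dga_car OM p" "hom AA.AZ X" "hom AA.AZ Y" "u \<in> AA.AZ d"
  shows "insF \<Phi> (X @ (int p + d, gact VM a u) # Y) = sg (int p * dg X) *\<^sub>R gact VM a (insF \<Phi> (X @ (d, u) # Y))"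
proof -
  have a: "a \<in> K.AZ (int p)" using assms(2) by simp
  show ?thesis unfolding gmodule.simps
    by (rule AA.D.insF_wedge[where \<Phi> = \<Phi> and q = r, OF _ assms(3,4,5) K.AZ_out[OF a] K.AZ_val[OF a]]) (rule assms(1))
qed

theorem leibniz_over: "leibniz_inf_over OM VM kap"
  unfolding leibniz_inf_over_def leibniz_inf_def
proof (intro conjI allI impI)
  show "subspace (gcar VM d)" for d by (simp add: AA.subspace_AF)
  show "dg_module OM VM (\<lambda>v. kap [v])" by (rule dg_module_VM)
  show "graded_multilinear (gcar VM) (gcar VM) 1 k kap" if "k \<ge> 1" for k
    by (rule graded_multilinear_I[where f = KF.lam, OF _ kap_lam _ KF.mlin_lam that AA.D.closedV_AZ]) (simp_all add: KF.maps_lam)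
next
  fix k :: nat assume k: "2 \<le> k"
  show "multilinear_over OM VM VM 1 k kap"
  proof (rule multilinear_over_I[where f = KF.lam and Z = AA.AZ and V = VM and A = OM, OF _ refl kap_lam act_AZ])
    fix a p X Y d u
    assume a: "a \<in> dga_car OM p" and h: "hom AA.AZ X" "hom AA.AZ Y" "u \<in> AA.AZ d" "length X + length Y + 1 = k"
    have n: "length (X @ z # Y) \<noteq> 1" for z using h(4) k by simp
    \<comment> \<open>Letting \<open>a\<close> act raises the total degree by \<open>p\<close>;
      together with the sign from \<open>insF_act\<close> this gives the Koszul sign for passing an
      operation of degree 1.\<close>
    have "KF.lam (X @ (int p + d, gact VM a u) # Y) = sg (dg X + int p + d + dg Y) *\<^sub>R insF R (X @ (int p + d, gact VM a u) # Y)"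
      unfolding KF.lam_multi[OF n] by (simp add: add.assoc)
    also have "insF R (X @ (int p + d, gact VM a u) # Y) = sg (int p * dg X) *\<^sub>R gact VM a (insF R (X @ (d, u) # Y))"
      by (rule insF_act[OF R_mC a h(1-3)])
    also have "sg (dg X + int p + d + dg Y) *\<^sub>R \<dots> = sg (int p * (int 1 + dg X)) *\<^sub>R gact VM a (sg (dg X + d + dg Y) *\<^sub>R insF R (X @ (d, u) # Y))"
      by (simp add: sg_add sg_norm wedge_simps mult_ac)
    also have "sg (dg X + d + dg Y) *\<^sub>R insF R (X @ (d, u) # Y) = KF.lam (X @ (d, u) # Y)"
      unfolding KF.lam_multi[OF n] by (simp add: add.assoc)
    finally show "KF.lam (X @ (int p + d, gact VM a u) # Y) = sg (int p * (int 1 + dg X)) *\<^sub>R gact VM a (KF.lam (X @ (d, u) # Y))" .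
  qed simp_all
next
  fix n :: nat and ds and vs :: "('m, 'v, 'e) form list"
  assume n: "1 \<le> n" and "length vs = n \<and> homogeneous (gcar VM) ds vs"
  then have l: "length vs = n" and h: "homogeneous (gcar VM) ds vs" by auto
  have V: "gcar VM p = AA.AZ (int p)" for p by simp
  note H = homogeneous_hom[OF h V]
  have X: "degs ds vs \<noteq> []" using l n H(1) by auto
  have "cod (\<lambda>X. kap (map snd X)) (\<lambda>X. kap (map snd X)) 1 (degs ds vs) = cod KF.lam KF.lam 1 (degs ds vs)"
  proof (rule cod_cong[where V = AA.AZ])
    show "maps AA.AZ (\<lambda>X. kap (map snd X)) AA.AZ 1" using KF.maps_lam kap_lam by (simp add: maps_def)
  qed (use kap_lam H(2) in auto)
  also have "\<dots> = 0" by (rule kap_leibniz[OF H(2) X])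
  finally show "(\<Sum>j=1..n. \<Sum>k=j..n. \<Sum>\<sigma>\<in>shuffle_lists (k - j) (j - 1).
           (koszul ds \<sigma> * (-1) ^ sum_list (pick ds (take (k - j) \<sigma>))) *\<^sub>R
           kap (pick vs (take (k - j) \<sigma>) @
                [kap (pick vs (drop (k - j) \<sigma>) @ [vs ! (k - 1)])] @ drop k vs)) = 0"
    unfolding leibniz_lhs_eq_cod[OF H(1), unfolded l] .
qed

end

locale lie_pair_dg2 = P: lie_pair_dg C L S br rho nab A pr jj D R + Q: lie_pair_dg C L S br rho nab' A pr jj' D R'
  for C :: "('m \<Rightarrow> real) set" and L :: "('m \<Rightarrow> 'v::real_vector) set"
    and S :: "('m \<Rightarrow> 'e::real_vector) set" and br rho nab nab' A pr jj jj' D R R'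
begin

sublocale T: lie_pair_alg2 C L S br rho nab nab' A pr jj jj' D R R' ..

definition "kiso ws = insert_forms ws (T.F (length ws))"

lemma kiso_eq: "kiso (map snd X) = T.M.f X"
  by (simp add: kiso_def insF_def)

theorem isomorphic: "leibniz_inf_isomorphic P.OM P.VM P.kap P.VM Q.kap"
  unfolding leibniz_inf_isomorphic_def leibniz_inf_morphism_def
proof (intro conjI exI[of _ kiso] allI impI)
  show "leibniz_inf_over P.OM P.VM P.kap" "leibniz_inf_over P.OM P.VM Q.kap"
    by (rule P.leibniz_over, rule Q.leibniz_over)
  fix k :: nat assume k: "1 \<le> k"
  show "graded_multilinear (gcar P.VM) (gcar P.VM) 0 k kiso"
    by (rule graded_multilinear_I[where f = T.M.f, OF _ kiso_eq _ T.M.mlin_f k P.AA.D.closedV_AZ]) (simp_all add: T.M.maps_f)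
  show "multilinear_over P.OM P.VM P.VM 0 k kiso"
  proof (rule multilinear_over_I[where f = T.M.f and Z = P.AA.AZ and V = P.VM and A = P.OM, OF _ refl kiso_eq P.act_AZ])
    fix a p X Y d u assume h: "a \<in> dga_car P.OM p" "hom P.AA.AZ X" "hom P.AA.AZ Y" "u \<in> P.AA.AZ d"
    have "T.M.f (X @ (int p + d, gact P.VM a u) # Y) = sg (int p * dg X) *\<^sub>R gact P.VM a (T.M.f (X @ (d, u) # Y))"
      by (rule P.insF_act[where \<Phi> = T.F and r = 0, OF _ h]) (rule T.F_mC)
    then show "T.M.f (X @ (int p + d, gact P.VM a u) # Y) = sg (int p * (int 0 + dg X)) *\<^sub>R gact P.VM a (T.M.f (X @ (d, u) # Y))"
      by (simp only: of_nat_0 add_0)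
  qed simp_all
next
  fix d
  have "kiso [v] = v" if "v \<in> P.AA.AZ (int d)" for v
    using kiso_eq[of "[(int d, v)]"] T.f_single[OF that] by simp
  then show "bij_betw (\<lambda>v. kiso [v]) (gcar P.VM d) (gcar P.VM d)"
    using bij_betw_cong[of "gcar P.VM d" "\<lambda>v. kiso [v]" id "gcar P.VM d"] by simp
next
  fix n :: nat and ds and bs :: "('m, 'v, 'e) form list"
  assume n: "1 \<le> n" and "length bs = n \<and> homogeneous (gcar P.VM) ds bs"
  then have l: "length bs = n" and h: "homogeneous (gcar P.VM) ds bs" by auto
  have V: "gcar P.VM p = P.AA.AZ (int p)" for p by simp
  note H = homogeneous_hom[OF h V]
  have X: "degs ds bs \<noteq> []" using l n H(1) by auto
  have "cod (\<lambda>X. kiso (map snd X)) (\<lambda>X. P.kap (map snd X)) 1 (degs ds bs) = cod T.M.f P.KF.lam 1 (degs ds bs)"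
  proof (rule cod_cong[where V = P.AA.AZ])
    show "maps P.AA.AZ (\<lambda>X. P.kap (map snd X)) P.AA.AZ 1" using P.KF.maps_lam P.kap_lam by (simp add: maps_def)
  qed (use P.kap_lam kiso_eq H(2) in auto)
  also have "\<dots> = FX T.M.f Q.KF.lam (degs ds bs)" by (rule T.kap_morphism[OF H(2) X])
  also have "\<dots> = FX T.M.f (\<lambda>X. Q.kap (map snd X)) (degs ds bs)"
    by (rule FX_cong[OF _ T.M.maps_f H(2)]) (use Q.kap_lam X in auto)
  also have "\<dots> = FX (\<lambda>X. kiso (map snd X)) (\<lambda>X. Q.kap (map snd X)) (degs ds bs)" unfolding kiso_eq ..
  finally show "(\<Sum>k<n. \<Sum>p<n - k. \<Sum>\<sigma>\<in>shuffle_lists k p.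
           (koszul ds \<sigma> * (-1) ^ sum_list (pick ds (take k \<sigma>))) *\<^sub>R
           kiso (pick bs (take k \<sigma>) @
              [P.kap (pick bs (drop k \<sigma>) @ [bs ! (k + p)])] @ drop (k + p + 1) bs)) =
        (\<Sum>Is\<in>max_ordered_partitions n.
           koszul ds (concat (map sorted_list_of_set Is)) *\<^sub>R Q.kap (map (\<lambda>I. kiso (nths bs I)) Is))"
    unfolding morphism_lhs_eq_cod[OF H(1), unfolded l] morphism_rhs_eq_FX[OF H(1), unfolded l] .
qed

end


section \<open>From a Lie pair to the algebraic setting\<close>

lemma sum_form_apply:
  fixes w :: "nat \<Rightarrow> ('m, 'v, 'e::real_vector) form"
  shows "(\<Sum>i<k. w i) as = (\<Sum>i<k. w i as)"
  by (induction k) (simp_all add: form_apply)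

lemma kap_R_out:
  assumes "\<And>a. a \<in> secA P \<Longrightarrow> as \<noteq> [a]"
  shows "kap_R P j nabla k bs as = 0"
proof -
  have one: "one_form P F as = 0" for F
    using assms by (auto simp: one_form_def split: list.splits)
  show ?thesis
  proof (induction k arbitrary: bs)
    case (Suc k)
    consider "k = 0" | "k = Suc 0" | n where "k = Suc (Suc n)" by (cases k rule: nat.exhaust, simp) (metis nat.exhaust)
    then show ?case
    proof cases
      case 3
      show ?thesis using Suc.IH[unfolded 3]
        by (simp add: 3 form_apply sum_form_apply nabla_one_form_def one del: sum.lessThan_Suc)
    qed (simp_all add: one form_apply)
  qed (simp add: form_apply)
qed

lemma lie_pair_lr_mod:
  fixes P :: "('m::{t2_space,second_countable_topology}, 'v::real_vector, 'w::real_vector) lie_pair_data"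
  assumes P: "lie_pair P" and nab: "connection P nabla"
  shows "lr_mod (Cinf (base_mfd P)) (secL P) (secB P) (bracket (alg_L P)) (anchor_der (alg_L P)) nabla"
proof -
  let ?M = "base_mfd P" and ?L = "alg_L P"
  have M: "smooth_manifold ?M" and L: "lie_algebroid ?M ?L" and B: "vector_bundle ?M (quot_B P)"
    using P by (auto simp: lie_pair_def)
  then have VL: "vector_bundle ?M ?L" by (simp add: lie_algebroid_def)
  interpret smooth_mfd ?M by unfold_locales (rule M)
  interpret cring "Cinf ?M" by (rule cring_Cinf)
  interpret LL: cmodule "Cinf ?M" "secL P" by unfold_locales (simp add: secL_def Cmod_sections[OF VL])
  interpret BB: cmodule "Cinf ?M" "secB P" by unfold_locales (simp add: secB_def Cmod_sections[OF B])
  have br: "\<forall>X\<in>secL P. \<forall>Y\<in>secL P.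
        bracket ?L X Y \<in> secL P \<and> bracket ?L X Y = - bracket ?L Y X \<and>
        (\<forall>Z\<in>secL P. \<forall>c. bracket ?L (c *\<^sub>R X + Y) Z = c *\<^sub>R bracket ?L X Z + bracket ?L Y Z) \<and>
        (\<forall>Z\<in>secL P. bracket ?L X (bracket ?L Y Z) + bracket ?L Y (bracket ?L Z X) + bracket ?L Z (bracket ?L X Y) = 0) \<and>
        (\<forall>f\<in>Cinf ?M. bracket ?L X (smul f Y) = smul f (bracket ?L X Y) + smul (anchor_der ?L X f) Y)"
    using L unfolding lie_algebroid_def secL_def by blast
  have b1: "bracket ?L X Y \<in> secL P" if "X \<in> secL P" "Y \<in> secL P" for X Y using br that by blast
  have b2: "bracket ?L X Y = - bracket ?L Y X" if "X \<in> secL P" "Y \<in> secL P" for X Y using br that by blast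
  have b3: "bracket ?L (c *\<^sub>R X + Y) Z = c *\<^sub>R bracket ?L X Z + bracket ?L Y Z"
    if "X \<in> secL P" "Y \<in> secL P" "Z \<in> secL P" for X Y Z c using br that by blast
  have b4: "bracket ?L X (bracket ?L Y Z) + bracket ?L Y (bracket ?L Z X) + bracket ?L Z (bracket ?L X Y) = 0"
    if "X \<in> secL P" "Y \<in> secL P" "Z \<in> secL P" for X Y Z using br that by blast
  have b5: "bracket ?L X (smul f Y) = smul f (bracket ?L X Y) + smul (anchor_der ?L X f) Y"
    if "X \<in> secL P" "Y \<in> secL P" "f \<in> Cinf ?M" for X Y f using br that by blast
  have b6: "bracket ?L Z (c *\<^sub>R X + Y) = c *\<^sub>R bracket ?L Z X + bracket ?L Z Y"
    if "X \<in> secL P" "Y \<in> secL P" "Z \<in> secL P" for X Y Z c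
  proof -
    have "c *\<^sub>R X + Y \<in> secL P" using LL.S_lin[OF C_const[of c] that(1,2)] by simp
    then show ?thesis using b2[of Z "c *\<^sub>R X + Y"] b2[OF that(3,1)] b2[OF that(3,2)] b3[OF that, of c] that by simp
  qed
  \<comment> \<open>Linearity is available for expressions of the form c X + Y, so -X is written as
    (-2) X + X.\<close>
  have b7: "bracket ?L Z (- X) = - bracket ?L Z X" if "X \<in> secL P" "Z \<in> secL P" for X Z
    using b6[OF that(1) that(1) that(2), of "- 2"] by (simp add: scaleR_2 algebra_simps)
  note nb = nab[unfolded connection_def]
  have n1: "nabla l b \<in> secB P" if "l \<in> secL P" "b \<in> secB P" for l b using nb that by blast
  have n2: "nabla (smul f l + l') b = smul f (nabla l b) + nabla l' b"
    if "l \<in> secL P" "l' \<in> secL P" "b \<in> secB P" "f \<in> Cinf ?M" for l l' b f using nb that by blast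
  have n3: "nabla l (c *\<^sub>R b + b') = c *\<^sub>R nabla l b + nabla l b'"
    if "l \<in> secL P" "b \<in> secB P" "b' \<in> secB P" for l b b' c using nb that by blast
  have n4: "nabla l (smul f b) = smul f (nabla l b) + smul (anchor_der ?L l f) b"
    if "l \<in> secL P" "b \<in> secB P" "f \<in> Cinf ?M" for l b f using nb that by blast
  show ?thesis
  proof unfold_locales
    fix a b c f assume h: "a \<in> secL P" "b \<in> secL P"
    show "bracket ?L a b \<in> secL P" by (rule b1[OF h])
    show "bracket ?L a b = - bracket ?L b a" by (rule b2[OF h])
    assume c: "c \<in> secL P"
    have "bracket ?L b (bracket ?L c a) = - bracket ?L b (bracket ?L a c)"
      unfolding b2[OF c h(1)] by (rule b7[OF b1[OF h(1) c] h(2)])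
    moreover have "bracket ?L c (bracket ?L a b) = - bracket ?L (bracket ?L a b) c"
      by (rule b2[OF c b1[OF h]])
    ultimately show "bracket ?L a (bracket ?L b c) = bracket ?L (bracket ?L a b) c + bracket ?L b (bracket ?L a c)"
      using b4[OF h c] by (simp add: algebra_simps)
    assume f: "f \<in> Cinf ?M"
    show "bracket ?L a (smul f b + c) = smul f (bracket ?L a b) + smul (anchor_der ?L a f) b + bracket ?L a c"
      using b6[OF LL.S_smul[OF f h(2)] c h(1), of 1] b5[OF h f] by simp
  next
    fix a f assume "a \<in> secL P" "f \<in> Cinf ?M"
    then show "anchor_der ?L a f \<in> Cinf ?M" using anchor_Cinf[OF L] by (simp add: secL_def)
  next
    fix a s t and c :: real assume h: "a \<in> secL P" "s \<in> secB P"
    show "nabla a s \<in> secB P" by (rule n1[OF h])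
    assume t: "t \<in> secB P"
    show "nabla a (c *\<^sub>R s + t) = c *\<^sub>R nabla a s + nabla a t" by (rule n3[OF h t])
    fix f assume f: "f \<in> Cinf ?M"
    show "nabla a (smul f s + t) = smul f (nabla a s) + smul (anchor_der ?L a f) s + nabla a t"
      using n3[OF h(1) BB.S_smul[OF f h(2)] t, of 1] n4[OF h f] by simp
  next
    fix a b s f assume "a \<in> secL P" "b \<in> secL P" "s \<in> secB P" "f \<in> Cinf ?M"
    then show "nabla (smul f a + b) s = smul f (nabla a s) + nabla b s" by (intro n2)
  qed
qed

lemma lie_pair_lie_pair_alg:
  fixes P :: "('m::{t2_space,second_countable_topology}, 'v::real_vector, 'w::real_vector) lie_pair_data"
  assumes P: "lie_pair P" and j: "splitting P j" and nab: "connection P nabla" and ext: "extends_bott P nabla"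
  shows "lie_pair_alg (Cinf (base_mfd P)) (secL P) (secB P) (bracket (alg_L P)) (anchor_der (alg_L P)) nabla (secA P)
    (on_sections (pr_B P)) (on_sections j) (bott P) (kap_R P j nabla)"
proof -
  let ?M = "base_mfd P" and ?L = "alg_L P" and ?pr = "on_sections (pr_B P)"
  have M: "smooth_manifold ?M" and L: "lie_algebroid ?M ?L" and B: "vector_bundle ?M (quot_B P)"
    and pr: "bundle_map ?M ?L (quot_B P) (pr_B P)"
    and ker: "\<And>x. {v \<in> fib ?L x. pr_B P x v = 0} = sub_A P x"
    and brA: "\<And>a a'. a \<in> secA P \<Longrightarrow> a' \<in> secA P \<Longrightarrow> bracket ?L a a' \<in> secA P"
    using P by (auto simp: lie_pair_def)
  have VL: "vector_bundle ?M ?L" using L by (simp add: lie_algebroid_def)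
  have jb: "bundle_map ?M (quot_B P) ?L j" and prj: "\<And>x b. b \<in> fib (quot_B P) x \<Longrightarrow> pr_B P x (j x b) = b"
    using j by (auto simp: splitting_def)
  interpret smooth_mfd ?M by unfold_locales (rule M)
  interpret L: lr_mod "Cinf ?M" "secL P" "secB P" "bracket ?L" "anchor_der ?L" nabla
    by (rule lie_pair_lr_mod[OF P nab])
  have pr_B: "?pr l \<in> secB P" if "l \<in> secL P" for l
    using on_sections_section[OF VL B pr] that by (simp add: secL_def secB_def)
  have pr_lin: "?pr (smul f l + l') = smul f (?pr l) + ?pr l'" if "l \<in> secL P" "l' \<in> secL P" for f l l'
    using on_sections_lin[OF pr] that by (simp add: secL_def)
  have A_iff: "l \<in> secA P \<longleftrightarrow> ?pr l = 0" if "l \<in> secL P" for l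
  proof -
    have "l x \<in> fib ?L x" for x using section_fib that by (simp add: secL_def)
    then have "l x \<in> sub_A P x \<longleftrightarrow> pr_B P x (l x) = 0" for x unfolding ker[symmetric] by simp
    then show ?thesis using that by (simp add: secA_def on_sections_def fun_eq_iff zero_fun_apply)
  qed
  have A_L: "a \<in> secL P" if "a \<in> secA P" for a using that by (simp add: secA_def)
  have CA: "Cmod (Cinf ?M) (secA P)"
    unfolding Cmod_def
  proof (intro conjI ballI)
    have "?pr 0 = 0" using pr_lin[of 0 0 "\<lambda>_. 1"] by simp
    then show "0 \<in> secA P" using A_iff[OF L.N.S_zero] by simp
    fix f s s' assume h: "f \<in> Cinf ?M" "s \<in> secA P" "s' \<in> secA P"
    have "?pr s = 0" "?pr s' = 0" using A_iff A_L h by blast+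
    then show "smul f s + s' \<in> secA P"
      using A_iff[OF L.N.S_lin[OF h(1) A_L[OF h(2)] A_L[OF h(3)]]] pr_lin[OF A_L[OF h(2)] A_L[OF h(3)]] by simp
  qed
  have rho: "anchor ?L x (c *\<^sub>R v + w) f = c * anchor ?L x v f + anchor ?L x w f"
    if "v \<in> fib ?L x" "w \<in> fib ?L x" "f \<in> Cinf ?M" for x v w c f
    using L that unfolding lie_algebroid_def by blast
  have jL: "on_sections j b \<in> secL P" if "b \<in> secB P" for b
    using on_sections_section[OF B VL jb] that by (simp add: secL_def secB_def)
  have prj': "?pr (on_sections j b) = b" if "b \<in> secB P" for b
  proof
    fix x show "?pr (on_sections j b) x = b x"
      using prj[OF section_fib[OF that[unfolded secB_def]]] by (simp add: on_sections_def)
  qed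
  have R_step: "kap_R P j nabla (Suc k) (b # bs) [a] = (\<Sum>i<k. kap_R P j nabla k (bs[i := nabla (on_sections j b) (bs ! i)]) [a])
     - (nabla (on_sections j b) (kap_R P j nabla k bs [a])
        - kap_R P j nabla k bs [bracket ?L (on_sections j b) a - on_sections j (?pr (bracket ?L (on_sections j b) a))])"
    if aA: "a \<in> secA P" and k2: "2 \<le> k" for a b bs k
  proof -
    obtain n where n: "k = Suc (Suc n)" using k2 by (metis add_2_eq_Suc le_Suc_ex)
    show ?thesis using aA
      by (simp add: n form_apply sum_form_apply nabla_one_form_def one_form_def prA_def
          del: sum.lessThan_Suc)
  qed
  show ?thesis
  proof (unfold_locales)
    show "Cmod (Cinf ?M) (secA P)" by (rule CA)
    show "a \<in> secL P" if "a \<in> secA P" for a using A_L that .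
    show "bracket ?L a a' \<in> secA P" if "a \<in> secA P" "a' \<in> secA P" for a a' using brA that .
    show "anchor_der ?L (bracket ?L x y) f = anchor_der ?L x (anchor_der ?L y f) - anchor_der ?L y (anchor_der ?L x f)"
      if "x \<in> secL P" "y \<in> secL P" "f \<in> Cinf ?M" for x y f
      using L that unfolding lie_algebroid_def secL_def by blast
    show "anchor_der ?L (x + y) f = anchor_der ?L x f + anchor_der ?L y f"
      if "x \<in> secL P" "y \<in> secL P" "f \<in> Cinf ?M" for x y f
    proof
      fix m
      have "x m \<in> fib ?L m" "y m \<in> fib ?L m" using section_fib that by (simp_all add: secL_def)
      from rho[OF this that(3), of 1] show "anchor_der ?L (x + y) f m = (anchor_der ?L x f + anchor_der ?L y f) m"
        by (simp add: anchor_der_def plus_fun_apply)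
    qed
    show "?pr l \<in> secB P" if "l \<in> secL P" for l using pr_B that .
    show "?pr (smul f l + l') = smul f (?pr l) + ?pr l'" if "l \<in> secL P" "l' \<in> secL P" "f \<in> Cinf ?M" for l l' f
      using pr_lin that by blast
    show "l \<in> secA P \<longleftrightarrow> ?pr l = 0" if "l \<in> secL P" for l using A_iff that .
    show "on_sections j b \<in> secL P" if "b \<in> secB P" for b using jL that .
    show "on_sections j (smul f b + b') = smul f (on_sections j b) + on_sections j b'"
      if "b \<in> secB P" "b' \<in> secB P" "f \<in> Cinf ?M" for b b' f
      using on_sections_lin[OF jb] that by (simp add: secB_def)
    show "?pr (on_sections j b) = b" if "b \<in> secB P" for b using prj' that .
    \<comment> \<open>The lift chosen in the definition differs from \<open>l\<close> by a section
      of A. Its bracket with \<open>a\<close> lies in A again and is removed by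
      \<open>pr\<close>.\<close>
    show "bott P a (?pr l) = ?pr (bracket ?L a l)" if a: "a \<in> secA P" and l: "l \<in> secL P" for a l
    proof -
      let ?l = "SOME l'. l' \<in> secL P \<and> ?pr l' = ?pr l"
      have l': "?l \<in> secL P" "?pr ?l = ?pr l" using someI[of "\<lambda>l'. l' \<in> secL P \<and> ?pr l' = ?pr l" l] l by auto
      have d: "?l - l \<in> secL P" using L.N.S_diff l' l by blast
      have "?pr ?l = ?pr (?l - l) + ?pr l" using pr_lin[OF d l, of "\<lambda>_. 1"] by simp
      then have dA: "?l - l \<in> secA P" using A_iff[OF d] l'(2) by simp
      \<comment> \<open>The anchor applied to the constant 1 is left unevaluated: it multiplies a
        section of A, which \<open>pr\<close> removes as well.\<close>
      have "bracket ?L a (smul (\<lambda>_. 1) (?l - l) + l) = smul (\<lambda>_. 1) (bracket ?L a (?l - l)) + smul (anchor_der ?L a (\<lambda>_. 1)) (?l - l) + bracket ?L a l"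
        by (rule L.br_lin[OF A_L[OF a] d l]) simp
      then have e: "bracket ?L a ?l = smul (anchor_der ?L a (\<lambda>_. 1)) (?l - l) + (bracket ?L a (?l - l) + bracket ?L a l)" by simp
      have r: "anchor_der ?L a (\<lambda>_. 1) \<in> Cinf ?M" using L.rho_C[OF A_L[OF a]] by simp
      have z: "?pr (?l - l) = 0" "?pr (bracket ?L a (?l - l)) = 0"
        using A_iff[OF d] dA A_iff[OF L.br_G[OF A_L[OF a] d]] brA[OF a dA] by auto
      have m: "bracket ?L a (?l - l) \<in> secL P" "bracket ?L a l \<in> secL P" using L.br_G A_L a d l by blast+
      have "?pr (bracket ?L a ?l) = ?pr (bracket ?L a l)"
        unfolding e using pr_lin[OF d L.N.S_add[OF m], of "anchor_der ?L a (\<lambda>_. 1)"] pr_lin[OF m, of "\<lambda>_. 1"] z by simp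
      then show ?thesis by (simp add: bott_def)
    qed
    show "bott P a b = nabla a b" if "a \<in> secA P" "b \<in> secB P" for a b
      using ext that by (simp add: extends_bott_def)
    show "kap_R P j nabla k bs as = 0" if "\<And>a. a \<in> secA P \<Longrightarrow> as \<noteq> [a]" for as k bs
      by (rule kap_R_out) (rule that)
    show "kap_R P j nabla 0 bs = 0" "kap_R P j nabla (Suc 0) bs = 0" for bs by simp_all
    show "kap_R P j nabla 2 [b, e] [a] = nabla a (nabla (on_sections j b) e) - nabla (on_sections j b) (nabla a e)
        - nabla (bracket ?L a (on_sections j b)) e" if "a \<in> secA P" for a b e
      using that by (simp add: numeral_2_eq_2 one_form_def atiyah_def)
    show "kap_R P j nabla (Suc k) (b # bs) [a] = (\<Sum>i<k. kap_R P j nabla k (bs[i := nabla (on_sections j b) (bs ! i)]) [a])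
     - (nabla (on_sections j b) (kap_R P j nabla k bs [a])
        - kap_R P j nabla k bs [bracket ?L (on_sections j b) a - on_sections j (?pr (bracket ?L (on_sections j b) a))])"
      if "a \<in> secA P" "2 \<le> k" "length bs = k" for a k bs b by (rule R_step[OF that(1,2)])
  qed
qed

text \<open>Functions form a module with connection over the sections of A because the anchor takes
  values in tangent vectors: linearity and the product rule hold pointwise.\<close>

lemma lie_pair_lie_pair_dg:
  fixes P :: "('m::{t2_space,second_countable_topology}, 'v::real_vector, 'w::real_vector) lie_pair_data"
  assumes P: "lie_pair P" and "splitting P j" "connection P nabla" "extends_bott P nabla"
  shows "lie_pair_dg (Cinf (base_mfd P)) (secL P) (secB P) (bracket (alg_L P)) (anchor_der (alg_L P)) nabla (secA P)
    (on_sections (pr_B P)) (on_sections j) (bott P) (kap_R P j nabla)"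
proof -
  let ?M = "base_mfd P" and ?L = "alg_L P"
  interpret lie_pair_alg "Cinf ?M" "secL P" "secB P" "bracket ?L" "anchor_der ?L" nabla "secA P"
    "on_sections (pr_B P)" "on_sections j" "bott P" "kap_R P j nabla"
    by (rule lie_pair_lie_pair_alg[OF assms])
  have M: "smooth_manifold ?M" and L: "lie_algebroid ?M ?L" using P by (auto simp: lie_pair_def)
  interpret smooth_mfd ?M by unfold_locales (rule M)
  interpret CC: cmodule "Cinf ?M" "Cinf ?M" by unfold_locales (rule cring.Cmod_C[OF cring_Cinf])
  have fib: "a x \<in> fib ?L x" if "a \<in> secA P" for a x
    using section_fib A_L[OF that] by (simp add: secL_def)
  have tv: "tangent_vector ?M x (anchor ?L x (a x))" if "a \<in> secA P" for a x
    using L fib[OF that] unfolding lie_algebroid_def by blast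
  have rho: "anchor ?L x (c *\<^sub>R v + w) f = c * anchor ?L x v f + anchor ?L x w f"
    if "v \<in> fib ?L x" "w \<in> fib ?L x" "f \<in> Cinf ?M" for x v w c f
    using L that unfolding lie_algebroid_def by blast
  have lin: "anchor_der ?L a (c *\<^sub>R s + t) = c *\<^sub>R anchor_der ?L a s + anchor_der ?L a t"
    if "a \<in> secA P" "s \<in> Cinf ?M" "t \<in> Cinf ?M" for a s t c
  proof
    fix x
    have r: "(c *\<^sub>R g) y = c * g y" for g :: "'m \<Rightarrow> real" and y by (simp add: scaleR_fun_def)
    have e: "(\<lambda>y. c * s y + t y) = c *\<^sub>R s + t" by (rule ext) (simp add: plus_fun_apply r)
    have "anchor ?L x (a x) (\<lambda>y. c * s y + t y) = c * anchor ?L x (a x) s + anchor ?L x (a x) t"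
      using tv[OF that(1), of x] that(2,3) unfolding tangent_vector_def by blast
    then show "anchor_der ?L a (c *\<^sub>R s + t) x = (c *\<^sub>R anchor_der ?L a s + anchor_der ?L a t) x"
      unfolding e by (simp add: anchor_der_def plus_fun_apply r)
  qed
  have mult: "anchor_der ?L a (smul f s) = smul f (anchor_der ?L a s) + smul (anchor_der ?L a f) s"
    if "a \<in> secA P" "f \<in> Cinf ?M" "s \<in> Cinf ?M" for a f s
  proof
    fix x
    show "anchor_der ?L a (smul f s) x = (smul f (anchor_der ?L a s) + smul (anchor_der ?L a f) s) x"
      using tv[OF that(1), of x] that(2,3) unfolding tangent_vector_def
      by (simp add: anchor_der_def plus_fun_apply smul_real mult.commute)
  qed
  have "lr_mod (Cinf ?M) (secA P) (Cinf ?M) (bracket ?L) (anchor_der ?L) (anchor_der ?L)"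
  proof unfold_locales
    fix a s assume h: "a \<in> secA P" "s \<in> Cinf ?M"
    show "anchor_der ?L a s \<in> Cinf ?M" by (rule AA.rho_C[OF h])
    fix t assume t: "t \<in> Cinf ?M"
    show "anchor_der ?L a (c *\<^sub>R s + t) = c *\<^sub>R anchor_der ?L a s + anchor_der ?L a t" for c by (rule lin[OF h t])
    fix f assume f: "f \<in> Cinf ?M"
    show "anchor_der ?L a (smul f s + t) = smul f (anchor_der ?L a s) + smul (anchor_der ?L a f) s + anchor_der ?L a t"
      using lin[OF h(1) CC.S_smul[OF f h(2)] t, of 1] mult[OF h(1) f h(2)] by simp
  next
    fix a b s f assume h: "a \<in> secA P" "b \<in> secA P" "s \<in> Cinf ?M"
    show "anchor_der ?L (smul f a + b) s = smul f (anchor_der ?L a s) + anchor_der ?L b s"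
    proof
      fix x show "anchor_der ?L (smul f a + b) s x = (smul f (anchor_der ?L a s) + anchor_der ?L b s) x"
        using rho[OF fib[OF h(1)] fib[OF h(2)] h(3)] by (simp add: anchor_der_def plus_fun_apply smul_def)
    qed
  qed
  then show ?thesis
    by (intro lie_pair_dg.intro lie_pair_lie_pair_alg[OF assms])
qed

theorem theorem1p3:
  fixes P :: "('m::{t2_space,second_countable_topology}, 'v::real_vector, 'w::real_vector) lie_pair_data"
    and j j' :: "'m \<Rightarrow> 'w \<Rightarrow> 'v"
    and nabla nabla' :: "('m \<Rightarrow> 'v) \<Rightarrow> ('m \<Rightarrow> 'w) \<Rightarrow> ('m \<Rightarrow> 'w)"
  assumes "lie_pair P"
    and "splitting P j" and "connection P nabla" and "extends_bott P nabla"
    and "splitting P j'" and "connection P nabla'" and "extends_bott P nabla'"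
  shows "leibniz_inf_isomorphic (Omega_A P)
    (Omega_A_B P) (kapranov P j nabla)
    (Omega_A_B P) (kapranov P j' nabla')"
proof -
  interpret lie_pair_dg2 "Cinf (base_mfd P)" "secL P" "secB P" "bracket (alg_L P)" "anchor_der (alg_L P)" nabla nabla' "secA P"
    "on_sections (pr_B P)" "on_sections j" "on_sections j'" "bott P" "kap_R P j nabla" "kap_R P j' nabla'"
    by (intro lie_pair_dg2.intro lie_pair_lie_pair_dg assms)
  have "scalar_forms P = AF (Cinf (base_mfd P)) (secA P) (Cinf (base_mfd P))"
    by (rule ext) (simp add: scalar_forms_def P.K.alt_forms_eq)
  moreover have "B_forms P = AF (Cinf (base_mfd P)) (secA P) (secB P)"
    by (rule ext) (simp add: B_forms_def P.AA.alt_forms_eq)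
  moreover have "kapranov P j nabla = P.kap" "kapranov P j' nabla' = Q.kap"
    by (simp_all add: fun_eq_iff kapranov_def P.kap_def Q.kap_def)
  ultimately show ?thesis
    using isomorphic by (simp add: Omega_A_def Omega_A_B_def)
qed

end
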